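(* Let $H$ be a Hilbert space, and let $A$ be a self-adjoint nonnegative operator on $H$ with dense domain $D(A)$. Let $R>0$, let $B_{R}:=\{u\in D(A^{1/2}):|u|_{D(A^{1/2})}<R\}$, and let $f:B_{R}\to H$ be a function. Assume that (i) $\ker(A)\neq\{0\}$, and there exists a constant $\nu>0$ such that $|Au|^{2}\geq\nu|A^{1/2}u|^{2}$ for every $u\in D(A)$; (ii) there exists a constant $L$ such that $|f(u)-f(v)|\leq L|u-v|_{D(A^{1/2})}$ for all $u,v\in B_{R}$; (iii) there exist $p>0$, $q>0$ and $K_{0}\geq 0$ such that $$|f(u)|\leq K_{0}\left(|u|^{1+p}+|A^{1/2}u|^{1+q}\right)\qquad\forall u\in B_{R},$$ and in addition $\langle u,f(u)\rangle\leq 0$ for every $u\in B_{R}$. Then there exists a nonempty set $\mathcal{S}\subseteq B_{R}$, open with respect to the norm of $D(A^{1/2})$, with the following property: for every $u_{0}\in\mathcal{S}$, the unique maximal solution $u$ of $u'(t)+Au(t)=f(u(t))$, $u(0)=u_{0}$, is global (defined for all $t\geq 0$), and there exists a constant $M_{1}>0$ such that $$|u(t)|\geq\frac{M_{1}}{(1+t)^{1/p}}\qquad\forall t\geq 0.$$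
   Context: $|x|$ and $\langle x,y\rangle$ denote the norm and scalar product of $H$. Nonnegative means $\langle Au,u\rangle\geq 0$ for all $u\in D(A)$; $A^{1/2}$ is defined by spectral calculus, and $|u|_{D(A^{1/2})}=(|u|^{2}+|A^{1/2}u|^{2})^{1/2}$. A solution of $u'+Au=f(u)$, $u(0)=u_0$, on an interval $[0,T_* )$ is a function with values in $B_R$ such that for every $T<T_*$: $u\in C^{0}([0,T],D(A^{1/2}))\cap W^{1,2}((0,T),H)\cap L^{2}((0,T),D(A))$, $t\mapsto|A^{1/2}u(t)|^{2}$ is absolutely continuous on $[0,T]$, $u(0)=u_0$, and the equation holds for almost every $t$. It is classical that, under the Lipschitz condition (ii), for every $u_{0}\in B_{R}$ there is a unique such solution on a maximal interval $[0,T_{*})$, where either $T_{*}=+\infty$ or $\lim_{t\to T_{*}^{-}}|u(t)|_{D(A^{1/2})}=R$. *)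

theory Defs
  imports "HOL-Analysis.Analysis"
begin

text \<open>
  The Hilbert space is a type of class \<open>real_inner\<close> and \<open>complete_space\<close>; it is not assumed to be
  separable. An unbounded operator is a pair \<open>(D, A)\<close> of a domain \<open>D\<close> and a total function \<open>A\<close>
  whose values outside \<open>D\<close> are irrelevant.
\<close>

section \<open>Self-adjoint operators\<close>

definition linear_operator :: "'a::real_inner set \<Rightarrow> ('a \<Rightarrow> 'a) \<Rightarrow> bool" where
  "linear_operator D A \<longleftrightarrow> subspace D
     \<and> (\<forall>u\<in>D. \<forall>v\<in>D. A (u + v) = A u + A v) \<and> (\<forall>c. \<forall>u\<in>D. A (c *\<^sub>R u) = c *\<^sub>R A u)"

definition adjoint_graph :: "'a::real_inner set \<Rightarrow> ('a \<Rightarrow> 'a) \<Rightarrow> ('a \<times> 'a) set" where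
  "adjoint_graph D A = {(v, w). \<forall>u\<in>D. inner (A u) v = inner u w}"

text \<open>Equality of the graphs of the operator and of its adjoint includes equality of the domains.\<close>

definition self_adjoint :: "'a::real_inner set \<Rightarrow> ('a \<Rightarrow> 'a) \<Rightarrow> bool" where
  "self_adjoint D A \<longleftrightarrow> linear_operator D A \<and> closure D = UNIV
     \<and> adjoint_graph D A = {(v, A v) | v. v \<in> D}"

definition nonneg_operator :: "'a::real_inner set \<Rightarrow> ('a \<Rightarrow> 'a) \<Rightarrow> bool" where
  "nonneg_operator D A \<longleftrightarrow> (\<forall>u\<in>D. 0 \<le> inner (A u) u)"

definition operator_kernel :: "'a::real_inner set \<Rightarrow> ('a \<Rightarrow> 'a) \<Rightarrow> 'a set" where
  "operator_kernel D A = {u \<in> D. A u = 0}"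

section \<open>Spectral calculus\<close>

definition orthogonal_projection :: "('a::real_inner \<Rightarrow> 'a) \<Rightarrow> bool" where
  "orthogonal_projection P \<longleftrightarrow>
     bounded_linear P \<and> P \<circ> P = P \<and> (\<forall>u v. inner (P u) v = inner u (P v))"

text \<open>Projection-valued measures on the Borel sets of the line (countably additive for strong
  convergence); the values on non-Borel sets are not constrained.\<close>

definition projection_valued_measure :: "(real set \<Rightarrow> 'a::real_inner \<Rightarrow> 'a) \<Rightarrow> bool" where
  "projection_valued_measure E \<longleftrightarrow>
     (\<forall>B\<in>sets borel. orthogonal_projection (E B))
     \<and> E {} = (\<lambda>u. 0) \<and> E UNIV = id
     \<and> (\<forall>B\<in>sets borel. \<forall>C\<in>sets borel. E (B \<inter> C) = E B \<circ> E C)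
     \<and> (\<forall>B :: nat \<Rightarrow> real set. range B \<subseteq> sets borel \<and> disjoint_family B \<longrightarrow>
          (\<forall>u. (\<lambda>n. E (B n) u) sums E (\<Union>n. B n) u))"

definition spectral_scalar_measure ::
    "(real set \<Rightarrow> 'a::real_inner \<Rightarrow> 'a) \<Rightarrow> 'a \<Rightarrow> real measure" where
  "spectral_scalar_measure E u = measure_of UNIV (sets borel) (\<lambda>B. ennreal (inner (E B u) u))"

definition spectral_domain ::
    "(real set \<Rightarrow> 'a::real_inner \<Rightarrow> 'a) \<Rightarrow> (real \<Rightarrow> real) \<Rightarrow> 'a set" where
  "spectral_domain E g =
     {u. (\<integral>\<^sup>+ x. ennreal ((g x)\<^sup>2) \<partial>spectral_scalar_measure E u) < \<infinity>}"

text \<open>The integral of \<open>g\<close> with respect to \<open>E\<close>. The signed measure \<open>B \<mapsto> inner (E B u) v\<close> is written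
  by polarization; restricting \<open>v\<close> to the domain makes both integrals finite, and the domain being
  dense, this determines the vector \<open>w\<close>.\<close>

definition spectral_integral ::
    "(real set \<Rightarrow> 'a::real_inner \<Rightarrow> 'a) \<Rightarrow> (real \<Rightarrow> real) \<Rightarrow> 'a \<Rightarrow> 'a" where
  "spectral_integral E g u = (THE w. \<forall>v\<in>spectral_domain E g.
     inner w v = (1 / 4) * ((LINT x|spectral_scalar_measure E (u + v). g x)
                          - (LINT x|spectral_scalar_measure E (u - v). g x)))"

definition spectral_resolution_of ::
    "(real set \<Rightarrow> 'a::real_inner \<Rightarrow> 'a) \<Rightarrow> 'a set \<Rightarrow> ('a \<Rightarrow> 'a) \<Rightarrow> bool" where
  "spectral_resolution_of E D A \<longleftrightarrow> projection_valued_measure E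
     \<and> D = spectral_domain E (\<lambda>x. x) \<and> (\<forall>u\<in>D. A u = spectral_integral E (\<lambda>x. x) u)"

text \<open>By the spectral theorem a self-adjoint operator has a spectral resolution, and it is unique on
  the Borel sets; the choice operator only fixes the irrelevant values on the other sets.\<close>

definition spectral_measure_of ::
    "'a::real_inner set \<Rightarrow> ('a \<Rightarrow> 'a) \<Rightarrow> real set \<Rightarrow> 'a \<Rightarrow> 'a" where
  "spectral_measure_of D A = (SOME E. spectral_resolution_of E D A)"

text \<open>\<open>A\<^sup>1\<^sup>/\<^sup>2\<close> and its domain. For nonnegative \<open>A\<close> the spectral measure vanishes on the negative
  half-line, so the values of \<open>sqrt\<close> at negative arguments do not matter.\<close>

definition sqrt_domain :: "'a::real_inner set \<Rightarrow> ('a \<Rightarrow> 'a) \<Rightarrow> 'a set" where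
  "sqrt_domain D A = spectral_domain (spectral_measure_of D A) sqrt"

definition sqrt_operator :: "'a::real_inner set \<Rightarrow> ('a \<Rightarrow> 'a) \<Rightarrow> 'a \<Rightarrow> 'a" where
  "sqrt_operator D A = spectral_integral (spectral_measure_of D A) sqrt"

definition sqrt_norm :: "'a::real_inner set \<Rightarrow> ('a \<Rightarrow> 'a) \<Rightarrow> 'a \<Rightarrow> real" where
  "sqrt_norm D A u = sqrt ((norm u)\<^sup>2 + (norm (sqrt_operator D A u))\<^sup>2)"

definition sqrt_ball :: "'a::real_inner set \<Rightarrow> ('a \<Rightarrow> 'a) \<Rightarrow> real \<Rightarrow> 'a set" where
  "sqrt_ball D A R = {u \<in> sqrt_domain D A. sqrt_norm D A u < R}"

definition sqrt_open :: "'a::real_inner set \<Rightarrow> ('a \<Rightarrow> 'a) \<Rightarrow> 'a set \<Rightarrow> bool" where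
  "sqrt_open D A S \<longleftrightarrow> S \<subseteq> sqrt_domain D A \<and>
     (\<forall>u\<in>S. \<exists>\<epsilon>>0. \<forall>v\<in>sqrt_domain D A. sqrt_norm D A (v - u) < \<epsilon> \<longrightarrow> v \<in> S)"

section \<open>Function spaces on \<open>(0,T)\<close>\<close>

text \<open>The Bochner integral of the library needs a separable target space, so strong measurability
  is spelled out here as almost everywhere approximation by simple functions.\<close>

definition L2_interval :: "real \<Rightarrow> (real \<Rightarrow> 'b::real_normed_vector) \<Rightarrow> bool" where
  "L2_interval T g \<longleftrightarrow>
     (\<exists>s. (\<forall>n::nat. simple_function (lebesgue_on {0<..<T}) (s n))
        \<and> (AE t in lebesgue_on {0<..<T}. (\<lambda>n. s n t) \<longlonglongrightarrow> g t))
     \<and> (\<integral>\<^sup>+ t. ennreal ((norm (g t))\<^sup>2) \<partial>lebesgue_on {0<..<T}) < \<infinity>"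

definition test_function :: "real \<Rightarrow> (real \<Rightarrow> real) \<Rightarrow> bool" where
  "test_function T \<phi> \<longleftrightarrow> (\<forall>k t. (deriv ^^ k) \<phi> differentiable (at t))
     \<and> (\<exists>a b. 0 < a \<and> b < T \<and> (\<forall>t. t \<notin> {a..b} \<longrightarrow> \<phi> t = 0))"

text \<open>\<open>\<integral> \<phi>' u = - \<integral> \<phi> g\<close> for all test functions, the two vectors being compared by their scalar
  products with all \<open>v\<close>.\<close>

definition weak_derivative ::
    "real \<Rightarrow> (real \<Rightarrow> 'a::real_inner) \<Rightarrow> (real \<Rightarrow> 'a) \<Rightarrow> bool" where
  "weak_derivative T u g \<longleftrightarrow> (\<forall>\<phi> v. test_function T \<phi> \<longrightarrow>
     (LINT t|lebesgue_on {0<..<T}. deriv \<phi> t * inner (u t) v)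
       = - (LINT t|lebesgue_on {0<..<T}. \<phi> t * inner (g t) v))"

text \<open>\<open>u \<in> W\<^sup>1\<^sup>,\<^sup>2((0,T),H)\<close> with \<open>u' = g\<close>.\<close>

definition W12_interval ::
    "real \<Rightarrow> (real \<Rightarrow> 'a::real_inner) \<Rightarrow> (real \<Rightarrow> 'a) \<Rightarrow> bool" where
  "W12_interval T u g \<longleftrightarrow> L2_interval T u \<and> L2_interval T g \<and> weak_derivative T u g"

text \<open>Square integrability with values in \<open>D(A)\<close>: the norm of the pair \<open>(u, A u)\<close> is the graph norm.\<close>

definition L2_domain ::
    "'a::real_inner set \<Rightarrow> ('a \<Rightarrow> 'a) \<Rightarrow> real \<Rightarrow> (real \<Rightarrow> 'a) \<Rightarrow> bool" where
  "L2_domain D A T u \<longleftrightarrow> (AE t in lebesgue_on {0<..<T}. u t \<in> D)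
     \<and> L2_interval T (\<lambda>t. (u t, A (u t)))"

definition sqrt_continuous ::
    "'a::real_inner set \<Rightarrow> ('a \<Rightarrow> 'a) \<Rightarrow> real \<Rightarrow> (real \<Rightarrow> 'a) \<Rightarrow> bool" where
  "sqrt_continuous D A T u \<longleftrightarrow> (\<forall>t\<in>{0..T}. u t \<in> sqrt_domain D A)
     \<and> (\<forall>s\<in>{0..T}. ((\<lambda>t. sqrt_norm D A (u t - u s)) \<longlongrightarrow> 0) (at s within {0..T}))"

definition absolutely_continuous_interval :: "real \<Rightarrow> (real \<Rightarrow> real) \<Rightarrow> bool" where
  "absolutely_continuous_interval T F \<longleftrightarrow> (\<forall>\<epsilon>>0. \<exists>\<delta>>0. \<forall>(n::nat) a b.
     (\<forall>i<n. 0 \<le> a i \<and> a i \<le> b i \<and> b i \<le> T) \<and> disjoint_family_on (\<lambda>i. {a i<..<b i}) {..<n}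
       \<and> (\<Sum>i<n. b i - a i) < \<delta>
     \<longrightarrow> (\<Sum>i<n. \<bar>F (b i) - F (a i)\<bar>) < \<epsilon>)"

section \<open>Solutions of \<open>u' + A u = f(u)\<close>\<close>

text \<open>\<open>Tmax\<close> may be infinite; the values of \<open>u\<close> outside \<open>[0,Tmax)\<close> are irrelevant.\<close>

definition solution ::
    "'a::real_inner set \<Rightarrow> ('a \<Rightarrow> 'a) \<Rightarrow> real \<Rightarrow> ('a \<Rightarrow> 'a) \<Rightarrow> 'a \<Rightarrow> ereal \<Rightarrow> (real \<Rightarrow> 'a) \<Rightarrow> bool" where
  "solution D A R f u0 Tmax u \<longleftrightarrow> 0 < Tmax \<and> u 0 = u0
     \<and> (\<forall>t. 0 \<le> t \<and> ereal t < Tmax \<longrightarrow> u t \<in> sqrt_ball D A R)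
     \<and> (\<forall>T. 0 < T \<and> ereal T < Tmax \<longrightarrow>
          sqrt_continuous D A T u
          \<and> L2_domain D A T u
          \<and> absolutely_continuous_interval T (\<lambda>t. (norm (sqrt_operator D A (u t)))\<^sup>2)
          \<and> (\<exists>u'. W12_interval T u u'
                \<and> (AE t in lebesgue_on {0<..<T}. u' t + A (u t) = f (u t))))"

definition maximal_solution ::
    "'a::real_inner set \<Rightarrow> ('a \<Rightarrow> 'a) \<Rightarrow> real \<Rightarrow> ('a \<Rightarrow> 'a) \<Rightarrow> 'a \<Rightarrow> ereal \<Rightarrow> (real \<Rightarrow> 'a) \<Rightarrow> bool" where
  "maximal_solution D A R f u0 Tmax u \<longleftrightarrow> solution D A R f u0 Tmax u
     \<and> (\<forall>T v. solution D A R f u0 T v \<and> Tmax \<le> T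
          \<and> (\<forall>t. 0 \<le> t \<and> ereal t < Tmax \<longrightarrow> v t = u t) \<longrightarrow> T = Tmax)"

end

theory Submission
  imports Defs "HOL-Probability.Helly_Selection"
begin

text \<open>
  The spectral theorem is obtained from the bounded operator \<open>B = (1 + A)\<^sup>-\<^sup>1\<close>: the discrete measures with
  mass \<open>inner (binom n k B\<^sup>k (1 - B)\<^sup>n\<^sup>-\<^sup>k u) u\<close> at \<open>k / n\<close> converge weakly along a subsequence to a measure with
  moments \<open>inner (B\<^sup>j u) u\<close>, and the resulting projection-valued measure is transported by \<open>b \<mapsto> 1 / b - 1\<close>.

  Writing \<open>u = (1 + A)\<^sup>-\<^sup>1\<^sup>/\<^sup>2 z\<close> and truncating the spectrum of \<open>A\<close> to \<open>[0,n]\<close>, all energy estimates become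
  differential inequalities for smooth functions, and they pass to the limit. After composing \<open>f\<close> with the
  radial retraction to a ball of radius \<open>r < R\<close>, the nonlinear equation is solved globally by a contraction
  in an exponentially weighted norm.

  For the decay let \<open>y = |u|\<^sup>2\<close>, \<open>w = |A\<^sup>1\<^sup>/\<^sup>2u|\<^sup>2\<close>. Coercivity and the growth of \<open>f\<close> show that
  \<open>G = w / y\<^sup>1\<^sup>+\<^sup>p\<close> satisfies \<open>G' \<le> - (\<nu>/2) G + 4 K0\<^sup>2\<close> as long as \<open>G \<le> \<Gamma>\<close> and \<open>y\<close> is small, so this
  bound is never lost when it holds strictly at time \<open>0\<close>. It gives \<open>y' \<ge> - C y\<^sup>1\<^sup>+\<^sup>p\<^sup>/\<^sup>2\<close>, hence the lower
  bound for \<open>|u|\<close>. The admissible initial data form an open set, nonempty because it contains the small nonzero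
  elements of the kernel, where \<open>w = 0\<close>.
\<close>

section \<open>Riesz representation and quadratic forms\<close>

text \<open>\<open>sqrt_operator D A\<close> is built from a chosen spectral resolution, so nothing
  can be said about it before a resolution is shown to exist; after that, any resolution carries the
  whole bounded Borel calculus, whatever its origin. The map \<open>K\<close>, which is (1 +
  A)^(-1/2), is an isometry of H onto the domain of the square root, so in the variable z the ball
  \<open>sqrt_ball\<close> becomes a ball of H. The retraction multiplies vectors by factors in
  (0,1]; the growth bound and the sign condition therefore survive it with the same constants. Since
  |z|^2 = y + w stays below r^2, it never acts along the solutions considered. The equilibrium of G'
  = -(\<nu>/2) G + 4 K0^2 is 8 K0^2 / \<nu>; the extra 1 in \<Gamma> leaves room for a strict
  inequality. C0 = 2 \<Gamma> + 4 K0 collects the two terms of y' = -2 w + 2 <u, f(u)>. A solution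
  in the sense of the theorem has only a weak derivative. Uniqueness therefore starts by turning it
  into a classical solution of every truncated equation, which takes smooth test functions.\<close>

lemma closed_subspace_projection:
  fixes M :: "'a::{real_inner,complete_space} set"
  assumes M: "subspace M" "closed M"
  obtains y where "y \<in> M" "\<forall>z\<in>M. inner (x - y) z = 0"
proof -
  define d where "d = (INF y\<in>M. (norm (x - y))\<^sup>2)"
  have ne: "M \<noteq> {}" using subspace_0[OF M(1)] by auto
  have bdd: "bdd_below ((\<lambda>y. (norm (x - y))\<^sup>2) ` M)" by (rule bdd_belowI[of _ 0]) auto
  have dle: "d \<le> (norm (x - y))\<^sup>2" if "y \<in> M" for y
    unfolding d_def by (rule cINF_lower[OF bdd that])
  have "\<exists>y\<in>M. (norm (x - y))\<^sup>2 < d + 1 / Suc n" for n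
  proof -
    have "(INF y\<in>M. (norm (x - y))\<^sup>2) < d + 1 / Suc n" unfolding d_def by simp
    then show ?thesis using cINF_less_iff[OF ne bdd] by blast
  qed
  then obtain Y where Y: "\<And>n. Y n \<in> M" "\<And>n. (norm (x - Y n))\<^sup>2 < d + 1 / Suc n" by metis
  \<comment> \<open>Parallelogram law: the midpoint lies in \<open>M\<close>, so its squared
    distance to \<open>x\<close> is at least \<open>d\<close>, and near-minimizers are close to each
    other.\<close>
  have diff: "(norm (Y n - Y m))\<^sup>2 \<le> 2 / Suc n + 2 / Suc m" for n m
  proof -
    have mid: "(1/2) *\<^sub>R (Y n + Y m) \<in> M" using Y M(1) by (simp add: subspace_add subspace_scale)
    have "(norm (Y n - Y m))\<^sup>2 = 2 * (norm (x - Y n))\<^sup>2 + 2 * (norm (x - Y m))\<^sup>2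
        - 4 * (norm (x - (1/2) *\<^sub>R (Y n + Y m)))\<^sup>2"
      unfolding power2_norm_eq_inner
      by (simp add: inner_diff_left inner_diff_right inner_add_left inner_add_right inner_commute algebra_simps)
    then show ?thesis using dle[OF mid] Y(2)[of n] Y(2)[of m] by linarith
  qed
  have "Cauchy Y"
  proof (rule metric_CauchyI)
    fix e :: real assume e: "e > 0"
    obtain N :: nat where N: "4 / e\<^sup>2 < N" using reals_Archimedean2 by blast
    have pos: "0 < real N" using N e by (meson less_trans zero_less_divide_iff zero_less_numeral zero_less_power)
    have "dist (Y m) (Y n) < e" if "m \<ge> N" "n \<ge> N" for m n
    proof -
      have "2 / Suc m \<le> 2 / N" "2 / Suc n \<le> 2 / N" using that pos by (auto intro!: divide_left_mono)
      then have "(norm (Y m - Y n))\<^sup>2 \<le> 4 / N" using diff[of m n] by simp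
      also have "\<dots> < e\<^sup>2" using N e pos by (simp add: field_simps)
      finally show ?thesis using e by (simp add: dist_norm power2_less_imp_less)
    qed
    then show "\<exists>N. \<forall>m\<ge>N. \<forall>n\<ge>N. dist (Y m) (Y n) < e" by blast
  qed
  then obtain y where y: "Y \<longlonglongrightarrow> y" using Cauchy_convergent_iff convergent_def by blast
  have yM: "y \<in> M" using closed_sequentially[OF M(2)] Y(1) y by blast
  have nle: "(norm (x - y))\<^sup>2 \<le> d"
  proof (rule LIMSEQ_le)
    show "(\<lambda>n. (norm (x - Y n))\<^sup>2) \<longlonglongrightarrow> (norm (x - y))\<^sup>2" by (intro tendsto_intros y)
    show "(\<lambda>n. d + 1 / Suc n) \<longlonglongrightarrow> d"
      using tendsto_add[OF tendsto_const LIMSEQ_inverse_real_of_nat, of d] by (simp add: inverse_eq_divide)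
    show "\<exists>N. \<forall>n\<ge>N. (norm (x - Y n))\<^sup>2 \<le> d + 1 / Suc n" using Y(2) less_imp_le by blast
  qed
  have "inner (x - y) z = 0" if z: "z \<in> M" for z
  proof -
    define c where "c = inner (x - y) z"
    \<comment> \<open>Comparison of the minimizer \<open>y\<close> with \<open>y + t z\<close>. The
      choice t = c / |z|^2 below turns this into c^2 <= 0.\<close>
    have q: "2 * t * c \<le> t\<^sup>2 * (norm z)\<^sup>2" for t
    proof -
      have "y + t *\<^sub>R z \<in> M" using yM z M(1) by (simp add: subspace_add subspace_scale)
      then have "(norm (x - y))\<^sup>2 \<le> (norm (x - y - t *\<^sub>R z))\<^sup>2"
        using dle nle by (metis diff_diff_eq order_trans)
      then show ?thesis unfolding c_def power2_norm_eq_inner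
        by (simp add: inner_diff_left inner_diff_right inner_commute power2_eq_square algebra_simps)
    qed
    show ?thesis
    proof (cases "z = 0")
      case False
      have "2 * (c / (norm z)\<^sup>2) * c \<le> (c / (norm z)\<^sup>2)\<^sup>2 * (norm z)\<^sup>2" by (rule q)
      then have "c * c / (norm z)\<^sup>2 \<le> 0" using False by (simp add: field_simps power2_eq_square)
      then have "c * c \<le> 0" using False by (simp add: divide_le_0_iff)
      then show ?thesis unfolding c_def by (metis mult_eq_0_iff order_antisym zero_le_square)
    qed simp
  qed
  then show thesis using that yM by blast
qed

text \<open>A vector \<open>e\<close> orthogonal to the kernel suffices: subtracting a suitable
  multiple of \<open>e\<close> puts every \<open>v\<close> into the kernel.\<close>

lemma Riesz_representation:
  fixes \<phi> :: "'a::{real_inner,complete_space} \<Rightarrow> real"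
  assumes "bounded_linear \<phi>"
  obtains w where "\<forall>v. \<phi> v = inner w v"
proof (cases "\<forall>v. \<phi> v = 0")
  case True then show ?thesis using that[of 0] by simp
next
  case False
  interpret bounded_linear \<phi> by fact
  obtain x where x: "\<phi> x \<noteq> 0" using False by auto
  have sub: "subspace {v. \<phi> v = 0}" by (auto simp: subspace_def add scaleR)
  have cl: "closed {v. \<phi> v = 0}"
    by (intro closed_Collect_eq continuous_intros linear_continuous_on assms)
  obtain y where y: "\<phi> y = 0" "\<forall>z. \<phi> z = 0 \<longrightarrow> inner (x - y) z = 0"
    using closed_subspace_projection[OF sub cl, of x] by auto
  define e where "e = x - y"
  have fe: "\<phi> e \<noteq> 0" using x y by (simp add: e_def diff)
  then have e0: "e \<noteq> 0" by (metis zero)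
  have "\<phi> v = inner ((\<phi> e / (norm e)\<^sup>2) *\<^sub>R e) v" for v
  proof -
    have "\<phi> (v - (\<phi> v / \<phi> e) *\<^sub>R e) = 0" using fe by (simp add: diff scaleR)
    then have "inner e (v - (\<phi> v / \<phi> e) *\<^sub>R e) = 0" using y(2) e_def by auto
    then have "inner e v = \<phi> v / \<phi> e * (norm e)\<^sup>2" by (simp add: inner_diff_right power2_norm_eq_inner)
    then show ?thesis using fe e0 by (simp add: field_simps)
  qed
  then show ?thesis using that by blast
qed

section \<open>Symmetric operators and bounded quadratic forms\<close>

definition symmetric_op :: "('a::real_inner \<Rightarrow> 'a) \<Rightarrow> bool" where
  "symmetric_op T \<longleftrightarrow> bounded_linear T \<and> (\<forall>u v. inner (T u) v = inner u (T v))"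

definition polar_form :: "('a::real_vector \<Rightarrow> real) \<Rightarrow> 'a \<Rightarrow> 'a \<Rightarrow> real" where
  "polar_form Q u v = (Q (u + v) - Q (u - v)) / 4"

text \<open>Everything is phrased by linear identities between finitely many values of
  \<open>Q\<close>, so the property passes to linear combinations and to pointwise limits. In this
  way it is carried from powers of an operator to Borel functions.\<close>

definition quad_form :: "('a::real_vector \<Rightarrow> real) \<Rightarrow> bool" where
  "quad_form Q \<longleftrightarrow> (\<forall>u. polar_form Q u u = Q u) \<and> (\<forall>u v. polar_form Q u v = polar_form Q v u)
    \<and> (\<forall>u w v. polar_form Q (u + w) v = polar_form Q u v + polar_form Q w v)
    \<and> (\<forall>c u v. polar_form Q (c *\<^sub>R u) v = c * polar_form Q u v)"

lemma symmetric_op_polar: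
  assumes "symmetric_op T"
  shows "polar_form (\<lambda>u. inner (T u) u) u v = inner (T u) v"
proof -
  interpret bounded_linear T using assms by (simp add: symmetric_op_def)
  have "inner (T v) u = inner (T u) v" using assms by (metis symmetric_op_def inner_commute)
  then show ?thesis unfolding polar_form_def
    by (simp add: add diff inner_add_left inner_add_right inner_diff_left inner_diff_right)
qed

lemma symmetric_op_quad_form: "symmetric_op T \<Longrightarrow> quad_form (\<lambda>u. inner (T u) u)"
  unfolding quad_form_def symmetric_op_polar
  by (auto simp: symmetric_op_def inner_commute bounded_linear.linear linear_add linear_scale
      inner_add_left inner_add_right)

lemma symmetric_op_eq:
  assumes "symmetric_op S" "symmetric_op T" "\<And>u. inner (S u) u = inner (T u) u"
  shows "S = T"
proof
  fix u
  have "inner (S u) v = inner (T u) v" for v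
    using symmetric_op_polar[OF assms(1), of u v] symmetric_op_polar[OF assms(2), of u v] assms(3)
    by simp
  then show "S u = T u" by (metis vector_eq_rdot)
qed

lemma symmetric_op_compose:
  assumes "symmetric_op S" "symmetric_op T" "\<And>u. S (T u) = T (S u)"
  shows "symmetric_op (\<lambda>u. S (T u))"
  using assms by (auto simp: symmetric_op_def intro: bounded_linear_compose)

lemma quad_form_lincomb:
  assumes "quad_form Q" "quad_form Q'"
  shows "quad_form (\<lambda>u. a * Q u + Q' u)"
proof -
  have e: "polar_form (\<lambda>u. a * Q u + Q' u) u v = a * polar_form Q u v + polar_form Q' u v" for u v
    by (simp add: polar_form_def field_simps)
  show ?thesis using assms unfolding quad_form_def e by (auto simp: algebra_simps)
qed

lemma quad_form_limit:
  assumes "\<And>n::nat. quad_form (Q n)" "\<And>u. (\<lambda>n. Q n u) \<longlonglongrightarrow> q u"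
  shows "quad_form q"
proof -
  have p: "(\<lambda>n. polar_form (Q n) u v) \<longlonglongrightarrow> polar_form q u v" for u v
    unfolding polar_form_def by (intro tendsto_intros assms) simp
  have a: "polar_form (Q n) u u = Q n u" "polar_form (Q n) u v = polar_form (Q n) v u"
    "polar_form (Q n) (u + w) v = polar_form (Q n) u v + polar_form (Q n) w v"
    "polar_form (Q n) (c *\<^sub>R u) v = c * polar_form (Q n) u v" for n u v w c
    using assms(1)[unfolded quad_form_def] by blast+
  show ?thesis unfolding quad_form_def
  proof (intro conjI allI)
    show "polar_form q u u = q u" for u
      using p[of u u] assms(2)[of u] unfolding a(1) by (rule LIMSEQ_unique)
    show "polar_form q u v = polar_form q v u" for u v
      using p[of u v] p[of v u] by (simp add: a(2)[of _ u v] LIMSEQ_unique)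
    show "polar_form q (u + w) v = polar_form q u v + polar_form q w v" for u w v
      using p[of "u + w" v] tendsto_add[OF p[of u v] p[of w v]] unfolding a(3) by (rule LIMSEQ_unique)
    show "polar_form q (c *\<^sub>R u) v = c * polar_form q u v" for c u v
      using p[of "c *\<^sub>R u" v] tendsto_mult_left[OF p[of u v], of c] unfolding a(4) by (rule LIMSEQ_unique)
  qed
qed

lemma norm_le_by_inner:
  fixes w :: "'a::real_inner"
  assumes "inner w w \<le> C * norm w" "0 \<le> C"
  shows "norm w \<le> C"
proof (cases "w = 0")
  case False
  have "norm w * norm w \<le> C * norm w" using assms(1) by (simp add: power2_norm_eq_inner[symmetric] power2_eq_square)
  then show ?thesis using False by simp
qed (use assms in simp)

text \<open>The parallelogram law gives the bound C/2 (|u|^2 + |v|^2); applied to normalized vectors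
  it becomes the product of the norms with the same constant.\<close>

lemma polar_form_bound:
  fixes Q :: "'a::real_inner \<Rightarrow> real"
  assumes Q: "quad_form Q" and C: "\<And>u. \<bar>Q u\<bar> \<le> C * (norm u)\<^sup>2" "0 \<le> C"
  shows "\<bar>polar_form Q u v\<bar> \<le> C * norm u * norm v"
proof -
  note q = Q[unfolded quad_form_def]
  have s: "polar_form Q u (c *\<^sub>R v) = c * polar_form Q u v" for c u v using q by metis
  have pl: "\<bar>polar_form Q u v\<bar> \<le> C / 2 * ((norm u)\<^sup>2 + (norm v)\<^sup>2)" for u v
  proof -
    have "\<bar>4 * polar_form Q u v\<bar> \<le> \<bar>Q (u + v)\<bar> + \<bar>Q (u - v)\<bar>" by (simp add: polar_form_def)
    also have "\<dots> \<le> C * ((norm (u + v))\<^sup>2 + (norm (u - v))\<^sup>2)"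
      using C(1)[of "u + v"] C(1)[of "u - v"] by (simp add: algebra_simps)
    also have "(norm (u + v))\<^sup>2 + (norm (u - v))\<^sup>2 = 2 * ((norm u)\<^sup>2 + (norm v)\<^sup>2)"
      unfolding power2_norm_eq_inner by (simp add: inner_simps)
    finally have "\<bar>4 * polar_form Q u v\<bar> \<le> C * (2 * ((norm u)\<^sup>2 + (norm v)\<^sup>2))" .
    moreover have "\<bar>4 * polar_form Q u v\<bar> = 4 * \<bar>polar_form Q u v\<bar>" by (simp add: abs_mult)
    ultimately show ?thesis by linarith
  qed
  show ?thesis
  proof (cases "u = 0 \<or> v = 0")
    case True
    have "polar_form Q 0 v = 0" for v using q by (metis add_cancel_right_right)
    moreover have "polar_form Q u 0 = 0" for u using q calculation by metis
    ultimately show ?thesis using True by auto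
  next
    case False
    have e: "polar_form Q (inverse (norm u) *\<^sub>R u) (inverse (norm v) *\<^sub>R v)
        = inverse (norm u) * (inverse (norm v) * polar_form Q u v)"
      using q s by metis
    have "norm (inverse (norm u) *\<^sub>R u) = 1" "norm (inverse (norm v) *\<^sub>R v) = 1" using False by auto
    then have "\<bar>inverse (norm u) * (inverse (norm v) * polar_form Q u v)\<bar> \<le> C"
      using pl[of "inverse (norm u) *\<^sub>R u" "inverse (norm v) *\<^sub>R v"] unfolding e by simp
    then have "inverse (norm u) * (inverse (norm v) * \<bar>polar_form Q u v\<bar>) \<le> C"
      by (simp add: abs_mult)
    then show ?thesis using False by (simp add: field_simps)
  qed
qed

lemma symmetric_op_bound:
  assumes T: "symmetric_op T" and C: "\<And>u. \<bar>inner (T u) u\<bar> \<le> C * (norm u)\<^sup>2" "0 \<le> C"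
  shows "norm (T u) \<le> C * norm u"
  by (rule norm_le_by_inner)
    (use polar_form_bound[OF symmetric_op_quad_form[OF T] C, of u "T u"] symmetric_op_polar[OF T, of u "T u"] C
     in auto)

text \<open>Riesz representation of \<open>polar_form Q u\<close> for each \<open>u\<close>. A form
  obtained as a limit of forms thus yields an operator without a limit of operators being
  taken.\<close>

lemma quad_form_op:
  fixes Q :: "'a::{real_inner,complete_space} \<Rightarrow> real"
  assumes Q: "quad_form Q" and C: "\<And>u. \<bar>Q u\<bar> \<le> C * (norm u)\<^sup>2" "0 \<le> C"
  shows "\<exists>T. symmetric_op T \<and> (\<forall>u. inner (T u) u = Q u)"
proof -
  note q = Q[unfolded quad_form_def]
  have bl: "bounded_linear (polar_form Q u)" for u
  proof (rule bounded_linear_intro[where K = "C * norm u"])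
    show "polar_form Q u (x + y) = polar_form Q u x + polar_form Q u y" for x y using q by metis
    show "polar_form Q u (r *\<^sub>R x) = r *\<^sub>R polar_form Q u x" for r x using q by (metis real_scaleR_def)
    show "norm (polar_form Q u x) \<le> norm x * (C * norm u)" for x
      using polar_form_bound[OF Q C, of u x] by (simp add: mult.commute)
  qed
  have "\<exists>w. \<forall>v. polar_form Q u v = inner w v" for u using Riesz_representation[OF bl] by metis
  then obtain T where T: "\<And>u v. polar_form Q u v = inner (T u) v" by metis
  have sym: "inner (T u) v = inner u (T v)" for u v using T q by (metis inner_commute)
  have "bounded_linear T"
  proof (rule bounded_linear_intro[where K = C])
    have "inner (T (x + y)) v = inner (T x + T y) v" for x y v
    proof -
      have "polar_form Q (x + y) v = polar_form Q x v + polar_form Q y v" using q by blast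
      then show ?thesis unfolding T by (simp add: inner_add_left)
    qed
    then show "T (x + y) = T x + T y" for x y by (metis vector_eq_rdot)
    have "inner (T (r *\<^sub>R x)) v = inner (r *\<^sub>R T x) v" for r x v
      using q T by (metis inner_scaleR_left)
    then show "T (r *\<^sub>R x) = r *\<^sub>R T x" for r x by (metis vector_eq_rdot)
    show "norm (T x) \<le> norm x * C" for x
      by (rule norm_le_by_inner) (use polar_form_bound[OF Q C, of x "T x"] C in \<open>auto simp: T mult.commute\<close>)
  qed
  moreover have "inner (T u) u = Q u" for u using T q by metis
  ultimately show ?thesis using sym by (auto simp: symmetric_op_def)
qed

section \<open>Induction over bounded Borel functions\<close>

definition bounded_borel :: "(real \<Rightarrow> real) \<Rightarrow> bool" where
  "bounded_borel g \<longleftrightarrow> g \<in> borel_measurable borel \<and> (\<exists>C. \<forall>x. \<bar>g x\<bar> \<le> C)"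

lemma bounded_borelI: "g \<in> borel_measurable borel \<Longrightarrow> (\<And>x. \<bar>g x\<bar> \<le> C) \<Longrightarrow> bounded_borel g"
  by (auto simp: bounded_borel_def)

lemma bounded_borel_bound:
  assumes "bounded_borel g" obtains C where "0 \<le> C" "\<And>x. \<bar>g x\<bar> \<le> C"
  using assms unfolding bounded_borel_def by (metis abs_ge_zero order_trans)

lemma bounded_borel_measurable [measurable_dest]: "bounded_borel g \<Longrightarrow> g \<in> borel_measurable borel"
  by (simp add: bounded_borel_def)

lemma bounded_borel_indicator: "S \<in> sets borel \<Longrightarrow> bounded_borel (indicat_real S)"
  by (rule bounded_borelI[of _ 1]) (auto simp: indicator_def)

lemma bounded_borel_const: "bounded_borel (\<lambda>x. c)"
  by (rule bounded_borelI[of _ "\<bar>c\<bar>"]) auto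

lemma bounded_borel_lincomb:
  assumes "bounded_borel g" "bounded_borel h" shows "bounded_borel (\<lambda>x. a * g x + h x)"
proof -
  obtain C where C: "\<And>x. \<bar>g x\<bar> \<le> C" using bounded_borel_bound[OF assms(1)] by metis
  obtain C' where C': "\<And>x. \<bar>h x\<bar> \<le> C'" using bounded_borel_bound[OF assms(2)] by metis
  show ?thesis
  proof (rule bounded_borelI)
    show "(\<lambda>x. a * g x + h x) \<in> borel_measurable borel" using assms by measurable
    show "\<bar>a * g x + h x\<bar> \<le> \<bar>a\<bar> * C + C'" for x
      using C[of x] C'[of x] mult_left_mono[OF C[of x], of "\<bar>a\<bar>"]
      by (simp add: abs_mult[symmetric])
  qed
qed

lemma bounded_borel_mult:
  assumes "bounded_borel g" "bounded_borel h" shows "bounded_borel (\<lambda>x. g x * h x)"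
proof -
  obtain C where C: "\<And>x. \<bar>g x\<bar> \<le> C" using bounded_borel_bound[OF assms(1)] by metis
  obtain C' where C': "\<And>x. \<bar>h x\<bar> \<le> C'" using bounded_borel_bound[OF assms(2)] by metis
  have C0: "0 \<le> C" using C[of 0] by linarith
  show ?thesis
  proof (rule bounded_borelI)
    show "(\<lambda>x. g x * h x) \<in> borel_measurable borel" using assms by measurable
    show "\<bar>g x * h x\<bar> \<le> C * C'" for x
      unfolding abs_mult by (intro mult_mono C C' C0) auto
  qed
qed

lemma bounded_borel_diff: "bounded_borel g \<Longrightarrow> bounded_borel h \<Longrightarrow> bounded_borel (\<lambda>x. g x - h x)"
  using bounded_borel_lincomb[of h g "-1"] by simp

lemma bounded_borel_add: "bounded_borel g \<Longrightarrow> bounded_borel h \<Longrightarrow> bounded_borel (\<lambda>x. g x + h x)"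
  using bounded_borel_lincomb[of g h 1] by simp

lemma bounded_borel_limit:
  assumes "\<And>n::nat. bounded_borel (g n)" "\<And>n x. \<bar>g n x\<bar> \<le> C" "\<And>x. (\<lambda>n. g n x) \<longlonglongrightarrow> G x"
  shows "bounded_borel G"
proof (rule bounded_borelI)
  show "G \<in> borel_measurable borel"
    by (rule borel_measurable_LIMSEQ_real[of _ g]) (use assms in \<open>auto simp: bounded_borel_def\<close>)
  show "\<bar>G x\<bar> \<le> C" for x
    by (rule LIMSEQ_le_const2[OF tendsto_rabs[OF assms(3)]]) (use assms(2) in auto)
qed

text \<open>For nonnegative functions this is monotone approximation: a bound of the limit bounds
  all approximants, so bounded pointwise limits suffice. A general \<open>g\<close> is the
  difference of \<open>g + C\<close> and the constant \<open>C\<close>.\<close>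

lemma bounded_borel_induct [consumes 1, case_names indicator lincomb limit]:
  assumes g: "bounded_borel g"
    and ind: "\<And>S. S \<in> sets borel \<Longrightarrow> P (indicat_real S)"
    and lin: "\<And>a g h. bounded_borel g \<Longrightarrow> bounded_borel h \<Longrightarrow> P g \<Longrightarrow> P h \<Longrightarrow> P (\<lambda>x. a * g x + h x)"
    and lim: "\<And>g C G. (\<And>n::nat. bounded_borel (g n)) \<Longrightarrow> (\<And>n x. \<bar>g n x\<bar> \<le> C) \<Longrightarrow> (\<And>n. P (g n))
       \<Longrightarrow> (\<And>x. (\<lambda>n. g n x) \<longlonglongrightarrow> G x) \<Longrightarrow> bounded_borel G \<Longrightarrow> P G"
  shows "P g"
proof -
  have z: "P (\<lambda>x. 0)" using ind[of "{}"] by (simp add: indicator_def[abs_def])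
  have nn: "bounded_borel u \<longrightarrow> P u" if "u \<in> borel_measurable borel" "\<And>x. 0 \<le> u x" for u
    using that
  proof (induction rule: borel_measurable_induct_real)
    case (set A) then show ?case using ind by simp
  next
    case (mult u c)
    show ?case
    proof (cases "c = 0")
      case False
      show ?thesis
      proof
        assume "bounded_borel (\<lambda>x. c * u x)"
        then have "bounded_borel u"
          using bounded_borel_lincomb[of "\<lambda>x. c * u x" "\<lambda>x. 0" "inverse c"] False
          by (simp add: bounded_borel_const mult.assoc[symmetric])
        then show "P (\<lambda>x. c * u x)"
          using lin[of u "\<lambda>x. 0" c] mult z by (simp add: bounded_borel_const)
      qed
    qed (use z in simp)
  next
    case (add u v)
    show ?case
    proof
      assume "bounded_borel (\<lambda>x. v x + u x)"
      then obtain C where C: "\<And>x. \<bar>v x + u x\<bar> \<le> C" using bounded_borel_bound by metis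
      have le: "u x \<le> C" "v x \<le> C" for x using C[of x] add.hyps(2,4)[of x] by auto
      have "bounded_borel u" "bounded_borel v"
        by (rule bounded_borelI[of _ C]; use add.hyps le in simp)+
      then show "P (\<lambda>x. v x + u x)" using lin[of v u 1] add.IH by simp
    qed
  next
    case (seq U)
    show ?case
    proof
      assume b: "bounded_borel u"
      then obtain C where C: "\<And>x. \<bar>u x\<bar> \<le> C" using bounded_borel_bound by metis
      have le: "\<bar>U n x\<bar> \<le> C" for n x
      proof -
        have "U n x \<le> u x" using seq by (intro incseq_le) (auto simp: incseq_def le_fun_def)
        then show ?thesis using seq(2)[of n x] C[of x] by simp
      qed
      have bU: "bounded_borel (U n)" for n by (rule bounded_borelI[OF seq(1) le])
      show "P u" by (rule lim[of U C u]) (use seq b bU le in auto)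
    qed
  qed
  obtain C where C: "\<And>x. \<bar>g x\<bar> \<le> C" "0 \<le> C" using bounded_borel_bound[OF g] by metis
  have b: "bounded_borel (\<lambda>x. g x + C)" by (rule bounded_borel_add[OF g bounded_borel_const])
  have "0 \<le> g x + C" for x using C(1)[of x] by linarith
  then have "P (\<lambda>x. g x + C)"
    using nn[of "\<lambda>x. g x + C"] b bounded_borel_measurable[OF b] by blast
  moreover have "P (\<lambda>x. C)" using nn[of "\<lambda>x. C"] C by (auto simp: bounded_borel_const)
  ultimately have "P (\<lambda>x. - 1 * C + (g x + C))"
    by (intro lin) (auto simp: bounded_borel_const b)
  then show ?thesis by simp
qed

text \<open>Identities of the calculus are first known for powers of the operator. They spread to
  polynomials, to continuous functions by uniform approximation on [0,1], to half-lines by ramps, to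
  Borel sets by a Dynkin argument, and from there to bounded Borel functions.\<close>

lemma unit_interval_induct [consumes 1, case_names power lincomb limit]:
  fixes P :: "(real \<Rightarrow> real) \<Rightarrow> bool"
  defines "u \<equiv> indicat_real {0..1}"
  assumes g: "bounded_borel g"
    and pow: "\<And>n. P (\<lambda>x. u x * x ^ n)"
    and lin: "\<And>a g h. bounded_borel g \<Longrightarrow> bounded_borel h \<Longrightarrow> P g \<Longrightarrow> P h \<Longrightarrow> P (\<lambda>x. a * g x + h x)"
    and lim: "\<And>g C G. (\<And>n::nat. bounded_borel (g n)) \<Longrightarrow> (\<And>n x. \<bar>g n x\<bar> \<le> C) \<Longrightarrow> (\<And>n. P (g n))
       \<Longrightarrow> (\<And>x. (\<lambda>n. g n x) \<longlonglongrightarrow> G x) \<Longrightarrow> bounded_borel G \<Longrightarrow> P G"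
  shows "P (\<lambda>x. u x * g x)"
proof -
  have um[measurable]: "u \<in> borel_measurable borel" unfolding u_def by simp
  have bu: "bounded_borel (\<lambda>x. u x * h x)" if "continuous_on UNIV h" for h
  proof -
    have "compact (h ` {0..1})" using that by (intro compact_continuous_image) (auto intro: continuous_on_subset)
    then obtain C where "\<forall>x\<in>{0..1}. \<bar>h x\<bar> \<le> C" by (metis (no_types) bounded_iff compact_imp_bounded image_eqI real_norm_def)
    then have "\<bar>u x * h x\<bar> \<le> max 0 C" for x
      by (cases "x \<in> {0..1}") (auto simp: u_def max.coboundedI2)
    moreover have [measurable]: "h \<in> borel_measurable borel" using that by (rule borel_measurable_continuous_onI)
    ultimately show ?thesis by (intro bounded_borelI) auto
  qed
  have z: "P (\<lambda>x. 0)"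
    using lin[of "\<lambda>x. u x * x ^ 0" "\<lambda>x. u x * x ^ 0" "-1"] pow[of 0] bu[of "\<lambda>x. x^0"] by simp
  have poly: "P (\<lambda>x. u x * (\<Sum>i\<le>n. a i * x ^ i))" for a and n :: nat
  proof (induction n)
    case 0
    then show ?case using lin[of "\<lambda>x. u x * x ^ 0" "\<lambda>x. 0" "a 0"] pow[of 0] bu[of "\<lambda>x. x^0"] z
      by (simp add: bounded_borel_const mult.commute)
  next
    case (Suc n)
    have "P (\<lambda>x. a (Suc n) * (u x * x ^ Suc n) + u x * (\<Sum>i\<le>n. a i * x ^ i))"
      by (rule lin[OF _ _ pow Suc]) (intro bu continuous_intros)+
    then show ?case by (simp add: algebra_simps)
  qed
  have cont: "P (\<lambda>x. u x * h x)" if h: "continuous_on UNIV h" for h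
  proof -
    have "\<exists>a n. \<forall>x\<in>{0..1}. \<bar>h x - (\<Sum>i\<le>n. a i * x ^ i)\<bar> < 1 / Suc k" for k
    proof -
      obtain q where q: "real_polynomial_function q" "\<And>x. x \<in> {0..1} \<Longrightarrow> \<bar>h x - q x\<bar> < 1 / Suc k"
        using Stone_Weierstrass_real_polynomial_function[of "{0..1}" h "1 / Suc k"] h
        by (auto intro: continuous_on_subset)
      then show ?thesis unfolding real_polynomial_function_iff_sum by blast
    qed
    then obtain a n where an: "\<And>k. \<forall>x\<in>{0..1}. \<bar>h x - (\<Sum>i\<le>n k. a k i * x ^ i)\<bar> < 1 / Suc k" by metis
    obtain C where C: "\<And>x. \<bar>u x * h x\<bar> \<le> C" using bounded_borel_bound[OF bu[OF h]] by metis
    have d: "\<bar>u x * (\<Sum>i\<le>n k. a k i * x ^ i) - u x * h x\<bar> \<le> 1 / Suc k" for x k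
      using an[of k] by (cases "x \<in> {0..1}") (auto simp: u_def abs_minus_commute order.strict_implies_order)
    show ?thesis
    proof (rule lim[of "\<lambda>k x. u x * (\<Sum>i\<le>n k. a k i * x ^ i)" "C + 1"])
      show "bounded_borel (\<lambda>x. u x * (\<Sum>i\<le>n k. a k i * x ^ i))" for k by (intro bu continuous_intros)
      show "\<bar>u x * (\<Sum>i\<le>n k. a k i * x ^ i)\<bar> \<le> C + 1" for k x
      proof -
        have "(1::real) / Suc k \<le> 1" by simp
        then show ?thesis using d[of x k] C[of x] by linarith
      qed
      show "P (\<lambda>x. u x * (\<Sum>i\<le>n k. a k i * x ^ i))" for k by (rule poly)
      show "(\<lambda>k. u x * (\<Sum>i\<le>n k. a k i * x ^ i)) \<longlonglongrightarrow> u x * h x" for x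
      proof (rule Lim_transform_bound[OF _ LIMSEQ_inverse_real_of_nat, THEN LIM_zero_cancel])
        show "\<forall>\<^sub>F k in sequentially. norm (u x * (\<Sum>i\<le>n k. a k i * x ^ i) - u x * h x) \<le> norm (inverse (real (Suc k)))"
          using d by (simp add: inverse_eq_divide)
      qed
    qed (rule bu[OF h])
  qed
  have bi: "bounded_borel (\<lambda>x. u x * indicat_real S x)" if "S \<in> sets borel" for S
    by (rule bounded_borel_mult) (auto simp: u_def that intro: bounded_borel_indicator)
  \<comment> \<open>For n > 0 the ramp equals 1 on \<open>{..a}\<close> and falls to 0 within
    distance 1/n to the right of \<open>a\<close>.\<close>
  have basic: "P (\<lambda>x. u x * indicat_real {..a} x)" for a
  proof (rule lim[of "\<lambda>n x. u x * max 0 (min 1 (1 - real n * (x - a)))" 1])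
    show "bounded_borel (\<lambda>x. u x * max 0 (min 1 (1 - real n * (x - a))))" for n
      by (intro bu continuous_intros)
    show "P (\<lambda>x. u x * max 0 (min 1 (1 - real n * (x - a))))" for n
      by (intro cont continuous_intros)
    show "\<bar>u x * max 0 (min 1 (1 - real n * (x - a)))\<bar> \<le> 1" for n x
      by (auto simp: u_def indicator_def)
    show "(\<lambda>n. u x * max 0 (min 1 (1 - real n * (x - a)))) \<longlonglongrightarrow> u x * indicat_real {..a} x" for x
    proof (intro tendsto_mult tendsto_const)
      show "(\<lambda>n. max 0 (min 1 (1 - real n * (x - a)))) \<longlonglongrightarrow> indicat_real {..a} x"
      proof (cases "x \<le> a")
        case True
        then have "max 0 (min 1 (1 - real n * (x - a))) = 1" for n
          by (simp add: mult_nonneg_nonpos min_def)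
        then show ?thesis using True by simp
      next
        case False
        obtain N :: nat where N: "1 / (x - a) < N" using reals_Archimedean2 by blast
        have "max 0 (min 1 (1 - real n * (x - a))) = 0" if "n \<ge> N" for n
        proof -
          have "1 / (x - a) < n" using N that by simp
          then have "1 < n * (x - a)" using False by (simp add: field_simps)
          then show ?thesis by simp
        qed
        then have "\<forall>\<^sub>F n in sequentially. max 0 (min 1 (1 - real n * (x - a))) = 0"
          by (auto simp: eventually_sequentially)
        then show ?thesis using False by (simp add: tendsto_eventually)
      qed
    qed
  qed (simp add: bi)
  have sets: "P (\<lambda>x. u x * indicat_real S x)" if "S \<in> sets borel" for S
  proof -
    have "Int_stable (range (\<lambda>a::real. {..a}))" "range (\<lambda>a::real. {..a}) \<subseteq> Pow UNIV"
      by (auto simp: Int_stable_def intro!: image_eqI[of _ _ "min _ _"])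
    moreover have "S \<in> sigma_sets UNIV (range (\<lambda>a::real. {..a}))" using that by (simp add: borel_eq_atMost)
    ultimately show ?thesis
    proof (induction rule: sigma_sets_induct_disjoint)
      case (basic A) then show ?case using \<open>\<And>a. P (\<lambda>x. u x * indicat_real {..a} x)\<close> by auto
    next
      case empty then show ?case using z by simp
    next
      case (compl A)
      have A: "A \<in> sets borel" using compl by (simp add: borel_eq_atMost)
      have "P (\<lambda>x. -1 * (u x * indicat_real A x) + u x * indicat_real UNIV x)"
      proof (rule lin)
        show "P (\<lambda>x. u x * indicat_real UNIV x)" using cont[of "\<lambda>x. 1"] by simp
        show "bounded_borel (\<lambda>x. u x * indicat_real UNIV x)" by (rule bi) simp
      qed (use compl A bi in auto)
      moreover have "(\<lambda>x. -1 * (u x * indicat_real A x) + u x * indicat_real UNIV x) = (\<lambda>x. u x * indicat_real (UNIV - A) x)"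
        by (auto simp: indicator_def)
      ultimately show ?case by simp
    next
      case (union A)
      have A: "A i \<in> sets borel" for i using union by (auto simp: borel_eq_atMost)
      have fin: "P (\<lambda>x. u x * indicat_real (\<Union>i<n. A i) x)" for n :: nat
      proof (induction n)
        case (Suc n)
        have "P (\<lambda>x. 1 * (u x * indicat_real (A n) x) + u x * indicat_real (\<Union>i<n. A i) x)"
          by (rule lin) (use Suc union A bi in auto)
        moreover have "1 * (u x * indicat_real (A n) x) + u x * indicat_real (\<Union>i<n. A i) x
            = u x * indicat_real (\<Union>i<Suc n. A i) x" for x
        proof -
          have "A n \<inter> A i = {}" if "i < n" for i
            using union(1) that by (intro disjoint_family_onD[of A UNIV]) auto
          then have "A n \<inter> (\<Union>i<n. A i) = {}" by auto
          moreover have "(\<Union>i<Suc n. A i) = A n \<union> (\<Union>i<n. A i)" by (auto simp: lessThan_Suc)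
          ultimately show ?thesis by (auto simp: indicator_def split: if_splits)
        qed
        ultimately show ?case by simp
      qed (use z in simp)
      show ?case
      proof (rule lim[of "\<lambda>n x. u x * indicat_real (\<Union>i<n. A i) x" 1])
        show "bounded_borel (\<lambda>x. u x * indicat_real (\<Union>i<n. A i) x)" for n using A by (intro bi) auto
        show "\<bar>u x * indicat_real (\<Union>i<n. A i) x\<bar> \<le> 1" for n x by (auto simp: u_def indicator_def)
        show "(\<lambda>n. u x * indicat_real (\<Union>i<n. A i) x) \<longlonglongrightarrow> u x * indicat_real (\<Union>i. A i) x" for x
          by (intro tendsto_intros LIMSEQ_indicator_UN)
      qed (use fin A bi in auto)
    qed
  qed
  have "P (\<lambda>x. u x * g x) \<and> bounded_borel (\<lambda>x. u x * g x)" using g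
  proof (induction rule: bounded_borel_induct)
    case (indicator S) then show ?case using sets bi by simp
  next
    case (lincomb a g h)
    have e: "(\<lambda>x. u x * (a * g x + h x)) = (\<lambda>x. a * (u x * g x) + u x * h x)" by (auto simp: algebra_simps)
    show ?case unfolding e using lincomb by (auto intro: lin bounded_borel_lincomb)
  next
    case (limit g C G)
    have b: "bounded_borel (\<lambda>x. u x * G x)"
      by (rule bounded_borel_mult) (auto simp: u_def limit intro: bounded_borel_indicator)
    have C0: "0 \<le> C" using limit(2)[of 0 0] by linarith
    have "P (\<lambda>x. u x * G x)"
    proof (rule lim[of "\<lambda>n x. u x * g n x" C])
      show "\<bar>u x * g n x\<bar> \<le> C" for n x
        using limit(2)[of n x] C0 by (cases "x \<in> {0..1}") (simp_all add: u_def)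
      show "(\<lambda>n. u x * g n x) \<longlonglongrightarrow> u x * G x" for x by (intro tendsto_intros limit)
    qed (use limit b in auto)
    with b show ?case by simp
  qed
  then show ?thesis ..
qed

section \<open>Calculus for families of scalar spectral measures\<close>

text \<open>The measure of index \<open>u\<close> is meant to be B -> <E(B) u, u>. The structure
  comes in three stages (finite mass, quadratic dependence on \<open>u\<close>, multiplicativity),
  because the existence proof establishes it in this order, each stage using the calculus of the
  previous one.\<close>

locale finite_family =
  fixes \<mu> :: "'a::{real_inner,complete_space} \<Rightarrow> real measure"
  assumes sets_mu [simp, measurable_cong]: "sets (\<mu> u) = sets borel"
    and mass: "emeasure (\<mu> u) UNIV = ennreal ((norm u)\<^sup>2)"
begin

lemma space_mu [simp]: "space (\<mu> u) = UNIV"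
  using sets_eq_imp_space_eq[OF sets_mu] by simp

lemma measurable_mu: "g \<in> measurable borel N \<Longrightarrow> g \<in> measurable (\<mu> u) N"
  using measurable_cong_sets[OF sets_mu refl] by blast

lemma finite_mu: "finite_measure (\<mu> u)"
  by (rule finite_measureI) (simp add: mass)

lemma integrable_mu: "bounded_borel g \<Longrightarrow> integrable (\<mu> u) g"
  by (rule bounded_borel_bound[of g], assumption,
      rule finite_measure.integrable_const_bound[OF finite_mu])
    (auto simp: bounded_borel_def)

lemma integral_const_mu: "(LINT x|\<mu> u. c) = c * (norm u)\<^sup>2"
  by (simp add: measure_def mass)

lemma integral_mu_bound:
  assumes "bounded_borel g" "\<And>x. \<bar>g x\<bar> \<le> C"
  shows "\<bar>LINT x|\<mu> u. g x\<bar> \<le> C * (norm u)\<^sup>2"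
proof -
  have "\<bar>LINT x|\<mu> u. g x\<bar> \<le> (LINT x|\<mu> u. \<bar>g x\<bar>)" by (rule integral_abs_bound)
  also have "\<dots> \<le> (LINT x|\<mu> u. C)"
    using assms by (intro integral_mono integrable_abs integrable_mu bounded_borel_const) auto
  also have "\<dots> = C * (norm u)\<^sup>2" by (rule integral_const_mu)
  finally show ?thesis .
qed

lemma integral_mu_limit:
  assumes "\<And>n::nat. bounded_borel (g n)" "\<And>n x. \<bar>g n x\<bar> \<le> C" "\<And>x. (\<lambda>n. g n x) \<longlonglongrightarrow> G x"
  shows "(\<lambda>n. LINT x|\<mu> u. g n x) \<longlonglongrightarrow> (LINT x|\<mu> u. G x)"
proof (rule integral_dominated_convergence[where w = "\<lambda>x. C"])
  show "G \<in> borel_measurable (\<mu> u)"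
    by (rule measurable_mu[OF bounded_borel_measurable[OF bounded_borel_limit[OF assms]]])
  show "g n \<in> borel_measurable (\<mu> u)" for n
    by (rule measurable_mu[OF bounded_borel_measurable[OF assms(1)]])
qed (use assms bounded_borel_const integrable_mu in auto)

end

locale measure_family = finite_family +
  assumes quad_measure: "S \<in> sets borel \<Longrightarrow> quad_form (\<lambda>u. measure (\<mu> u) S)"
begin

lemma quad_integral: "bounded_borel g \<Longrightarrow> quad_form (\<lambda>u. LINT x|\<mu> u. g x)"
proof (induction rule: bounded_borel_induct)
  case (indicator S)
  then show ?case using quad_measure by simp
next
  case (lincomb a g h)
  then show ?case using quad_form_lincomb by (simp add: integrable_mu)
next
  case (limit g C G)
  show ?case by (rule quad_form_limit[OF limit(5)]) (rule integral_mu_limit[OF limit(1-3)])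
qed

text \<open>The integral of \<open>g\<close> against the projections. It is pinned down by its
  quadratic form, so that through \<open>Phi_unique\<close> equalities of operators reduce to
  equalities of integrals.\<close>

definition Phi :: "(real \<Rightarrow> real) \<Rightarrow> 'a \<Rightarrow> 'a" where
  "Phi g = (THE T. symmetric_op T \<and> (\<forall>u. inner (T u) u = (LINT x|\<mu> u. g x)))"

lemma Phi:
  assumes "bounded_borel g"
  shows Phi_symmetric: "symmetric_op (Phi g)" and Phi_quad: "inner (Phi g u) u = (LINT x|\<mu> u. g x)"
proof -
  obtain C where C: "0 \<le> C" "\<And>x. \<bar>g x\<bar> \<le> C" using bounded_borel_bound[OF assms] by metis
  have "\<exists>!T. symmetric_op T \<and> (\<forall>u. inner (T u) u = (LINT x|\<mu> u. g x))"
    using quad_form_op[OF quad_integral[OF assms] integral_mu_bound[OF assms C(2)] C(1)]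
      symmetric_op_eq by metis
  from theI'[OF this] show "symmetric_op (Phi g)" "inner (Phi g u) u = (LINT x|\<mu> u. g x)"
    unfolding Phi_def by blast+
qed

lemma Phi_linear: "bounded_borel g \<Longrightarrow> bounded_linear (Phi g)"
  using Phi_symmetric by (auto simp: symmetric_op_def)

lemma Phi_inner: "bounded_borel g \<Longrightarrow> inner (Phi g u) v = inner u (Phi g v)"
  using Phi_symmetric by (auto simp: symmetric_op_def)

lemma Phi_polar: "bounded_borel g \<Longrightarrow> inner (Phi g u) v = polar_form (\<lambda>u. LINT x|\<mu> u. g x) u v"
  using symmetric_op_polar[OF Phi_symmetric, of g u v] by (simp add: Phi_quad)

lemma Phi_unique:
  assumes "bounded_borel g" "symmetric_op T" "\<And>u. inner (T u) u = (LINT x|\<mu> u. g x)"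
  shows "Phi g = T"
  using symmetric_op_eq[OF Phi_symmetric[OF assms(1)] assms(2)] assms(3) Phi_quad[OF assms(1)] by auto

lemma Phi_bound:
  assumes "bounded_borel g" "\<And>x. \<bar>g x\<bar> \<le> C"
  shows "norm (Phi g u) \<le> C * norm u"
proof (rule symmetric_op_bound[OF Phi_symmetric[OF assms(1)]])
  show "\<bar>inner (Phi g u) u\<bar> \<le> C * (norm u)\<^sup>2" for u
    unfolding Phi_quad[OF assms(1)] by (rule integral_mu_bound[OF assms])
  show "0 \<le> C" using assms(2)[of 0] by linarith
qed

lemma Phi_lincomb:
  assumes "bounded_borel g" "bounded_borel h"
  shows "Phi (\<lambda>x. a * g x + h x) u = a *\<^sub>R Phi g u + Phi h u"
proof -
  have "Phi (\<lambda>x. a * g x + h x) = (\<lambda>u. a *\<^sub>R Phi g u + Phi h u)"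
  proof (rule Phi_unique[OF bounded_borel_lincomb[OF assms]])
    show "symmetric_op (\<lambda>u. a *\<^sub>R Phi g u + Phi h u)"
      using Phi_inner assms unfolding symmetric_op_def
      by (auto intro!: bounded_linear_add bounded_linear_compose[OF bounded_linear_scaleR_right] Phi_linear
          simp: inner_add_left inner_add_right)
    show "inner (a *\<^sub>R Phi g u + Phi h u) u = (LINT x|\<mu> u. a * g x + h x)" for u
      using assms by (simp add: inner_add_left Phi_quad integrable_mu)
  qed
  then show ?thesis by simp
qed

lemma Phi_add: "bounded_borel g \<Longrightarrow> bounded_borel h \<Longrightarrow> Phi (\<lambda>x. g x + h x) u = Phi g u + Phi h u"
  using Phi_lincomb[of g h 1 u] by simp

lemma Phi_zero: "Phi (\<lambda>x. 0) u = 0"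
proof -
  have "Phi (\<lambda>x. 0) = (\<lambda>u. 0)"
    by (rule Phi_unique) (auto simp: bounded_borel_const symmetric_op_def bounded_linear_zero)
  then show ?thesis by simp
qed

lemma Phi_scale: "bounded_borel g \<Longrightarrow> Phi (\<lambda>x. a * g x) u = a *\<^sub>R Phi g u"
  using Phi_lincomb[of g "\<lambda>x. 0" a u] by (simp add: bounded_borel_const Phi_zero)

lemma Phi_diff: "bounded_borel g \<Longrightarrow> bounded_borel h \<Longrightarrow> Phi (\<lambda>x. g x - h x) u = Phi g u - Phi h u"
  using Phi_lincomb[of h g "-1" u] by simp

lemma Phi_one: "Phi (\<lambda>x. 1) u = u"
proof -
  have "Phi (\<lambda>x. 1) = (\<lambda>u. u)"
    by (rule Phi_unique) (auto simp: bounded_borel_const symmetric_op_def bounded_linear_ident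
        integral_const_mu power2_norm_eq_inner simp del: lebesgue_integral_const)
  then show ?thesis by simp
qed

text \<open>Polarization expresses the scalar product by two integrals, and dominated convergence
  applies to each. Strong convergence has to wait for multiplicativity.\<close>

lemma Phi_weak_limit:
  assumes "\<And>n::nat. bounded_borel (g n)" "\<And>n x. \<bar>g n x\<bar> \<le> C" "\<And>x. (\<lambda>n. g n x) \<longlonglongrightarrow> G x"
  shows "(\<lambda>n. inner (Phi (g n) u) v) \<longlonglongrightarrow> inner (Phi G u) v"
  unfolding Phi_polar[OF assms(1)] Phi_polar[OF bounded_borel_limit[OF assms]] polar_form_def
  by (intro tendsto_intros integral_mu_limit[OF assms]) auto

end

locale spectral_family = measure_family +
  assumes Phi_indicator_mult: "S \<in> sets borel \<Longrightarrow> T \<in> sets borel \<Longrightarrow>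
    Phi (indicator S) (Phi (indicator T) u) = Phi (indicator (S \<inter> T)) u"
begin

lemma Phi_mult_indicator:
  assumes S: "S \<in> sets borel" and g: "bounded_borel g"
  shows "Phi g (Phi (indicator S) u) = Phi (\<lambda>x. g x * indicator S x) u"
  using g
proof (induction rule: bounded_borel_induct)
  case (indicator T)
  have "indicat_real (T \<inter> S) = (\<lambda>x. indicator T x * indicator S x)" by (auto simp: indicator_def)
  then show ?case using Phi_indicator_mult[OF indicator S, of u] by simp
next
  case (lincomb a g h)
  have "(\<lambda>x. (a * g x + h x) * indicator S x) = (\<lambda>x. a * (g x * indicator S x) + h x * indicator S x)"
    by (auto simp: algebra_simps)
  then show ?case using lincomb bounded_borel_indicator[OF S]
    by (simp add: Phi_lincomb bounded_borel_mult)
next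
  case (limit g C G)
  have C0: "0 \<le> C" using limit(2)[of 0 0] by linarith
  have "inner (Phi G (Phi (indicator S) u)) v = inner (Phi (\<lambda>x. G x * indicator S x) u) v" for v
  proof (rule LIMSEQ_unique)
    show "(\<lambda>n. inner (Phi (g n) (Phi (indicator S) u)) v) \<longlonglongrightarrow> inner (Phi G (Phi (indicator S) u)) v"
      by (rule Phi_weak_limit[OF limit(1-3)])
    show "(\<lambda>n. inner (Phi (g n) (Phi (indicator S) u)) v) \<longlonglongrightarrow> inner (Phi (\<lambda>x. G x * indicator S x) u) v"
      unfolding limit(5)
    proof (rule Phi_weak_limit[of _ C])
      show "\<bar>g n x * indicat_real S x\<bar> \<le> C" for n x
        using limit(2)[of n x] C0 by (cases "x \<in> S") simp_all
    qed (auto intro!: tendsto_intros bounded_borel_mult limit bounded_borel_indicator S)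
  qed
  then show ?case by (metis vector_eq_rdot)
qed

text \<open>Second half of a double induction: \<open>Phi_mult_indicator\<close> varies the left
  factor against a fixed set, here the right factor varies. In the limit case \<open>Phi g\<close>
  is moved across the scalar product, so that weak limits suffice.\<close>

lemma Phi_mult:
  assumes g: "bounded_borel g" and h: "bounded_borel h"
  shows "Phi g (Phi h u) = Phi (\<lambda>x. g x * h x) u"
  using h
proof (induction rule: bounded_borel_induct)
  case (indicator S)
  then show ?case by (rule Phi_mult_indicator[OF _ g])
next
  case (lincomb a h k)
  interpret bounded_linear "Phi g" using g by (rule Phi_linear)
  have "(\<lambda>x. g x * (a * h x + k x)) = (\<lambda>x. a * (g x * h x) + g x * k x)" by (auto simp: algebra_simps)
  then show ?case using lincomb g by (simp add: Phi_lincomb bounded_borel_mult add scaleR)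
next
  case (limit h C H)
  obtain B where B: "0 \<le> B" "\<And>x. \<bar>g x\<bar> \<le> B" using bounded_borel_bound[OF g] by metis
  have "inner (Phi g (Phi H u)) v = inner (Phi (\<lambda>x. g x * H x) u) v" for v
  proof (rule LIMSEQ_unique)
    show "(\<lambda>n. inner (Phi g (Phi (h n) u)) v) \<longlonglongrightarrow> inner (Phi g (Phi H u)) v"
      unfolding Phi_inner[OF g] by (rule Phi_weak_limit[OF limit(1-3)])
    show "(\<lambda>n. inner (Phi g (Phi (h n) u)) v) \<longlonglongrightarrow> inner (Phi (\<lambda>x. g x * H x) u) v"
      unfolding limit(5)
    proof (rule Phi_weak_limit[of _ "B * C"])
      show "\<bar>g x * h n x\<bar> \<le> B * C" for n x unfolding abs_mult by (intro mult_mono B limit) auto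
    qed (auto intro!: tendsto_intros bounded_borel_mult limit g)
  qed
  then show ?case by (metis vector_eq_rdot)
qed

lemma Phi_inner_mult:
  "bounded_borel g \<Longrightarrow> bounded_borel h \<Longrightarrow> inner (Phi g u) (Phi h v) = inner (Phi (\<lambda>x. g x * h x) u) v"
  using Phi_inner[of h "Phi g u" v] Phi_mult[of h g u] by (simp add: mult.commute)

lemma Phi_norm2: "bounded_borel g \<Longrightarrow> (norm (Phi g u))\<^sup>2 = (LINT x|\<mu> u. (g x)\<^sup>2)"
  unfolding power2_norm_eq_inner
  by (simp add: Phi_inner_mult Phi_quad bounded_borel_mult power2_eq_square)

text \<open>Multiplicativity identifies the squared norm of \<open>Phi (g n) u - Phi G u\<close>
  with the integral of (g n - G)^2, which tends to 0 by dominated convergence.\<close>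

lemma Phi_limit:
  assumes "\<And>n::nat. bounded_borel (g n)" "\<And>n x. \<bar>g n x\<bar> \<le> C" "\<And>x. (\<lambda>n. g n x) \<longlonglongrightarrow> G x"
  shows "(\<lambda>n. Phi (g n) u) \<longlonglongrightarrow> Phi G u"
proof -
  have G: "bounded_borel G" by (rule bounded_borel_limit[OF assms])
  have GC: "\<bar>G x\<bar> \<le> C" for x
    by (rule LIMSEQ_le_const2[OF tendsto_rabs[OF assms(3)]]) (use assms(2) in auto)
  have bd: "bounded_borel (\<lambda>x. (g n x - G x)\<^sup>2)" for n
    unfolding power2_eq_square by (intro bounded_borel_mult bounded_borel_diff assms G)
  have "(\<lambda>n. LINT x|\<mu> u. (g n x - G x)\<^sup>2) \<longlonglongrightarrow> (LINT x|\<mu> u. 0)"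
  proof (rule integral_mu_limit[OF bd])
    show "\<bar>(g n x - G x)\<^sup>2\<bar> \<le> (2 * C)\<^sup>2" for n x
    proof -
      have "\<bar>g n x - G x\<bar> \<le> \<bar>2 * C\<bar>" using assms(2)[of n x] GC[of x] by linarith
      then show ?thesis by (simp add: abs_le_square_iff)
    qed
    show "(\<lambda>n. (g n x - G x)\<^sup>2) \<longlonglongrightarrow> 0" for x
      using tendsto_power[OF tendsto_diff[OF assms(3) tendsto_const], of x "G x" 2] by simp
  qed
  then have "(\<lambda>n. (norm (Phi (g n) u - Phi G u))\<^sup>2) \<longlonglongrightarrow> 0"
    using assms G by (simp add: Phi_norm2[symmetric] bounded_borel_diff Phi_diff)
  then have "(\<lambda>n. norm (Phi (g n) u - Phi G u)) \<longlonglongrightarrow> 0"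
    using tendsto_real_sqrt[of "\<lambda>n. (norm (Phi (g n) u - Phi G u))\<^sup>2" 0] by simp
  then show ?thesis using Lim_null tendsto_norm_zero_iff by blast
qed

text \<open>The new mass of \<open>S\<close> is <Phi(1_S h^2) u, u>, both copies of \<open>h\<close>
  being moved to the left. This is the change of variable used later for the resolvent and for
  \<open>K\<close>.\<close>

lemma mu_Phi:
  assumes h: "bounded_borel h"
  shows "\<mu> (Phi h u) = density (\<mu> u) (\<lambda>x. ennreal ((h x)\<^sup>2))"
proof (rule measure_eqI)
  fix S assume "S \<in> sets (\<mu> (Phi h u))"
  then have S: "S \<in> sets borel" by simp
  interpret finite_measure "\<mu> v" for v by (rule finite_mu)
  note [measurable] = bounded_borel_measurable[OF h]
  note i = bounded_borel_indicator[OF S]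
  have "emeasure (\<mu> (Phi h u)) S = ennreal (LINT x|\<mu> (Phi h u). indicator S x)"
    using S by (simp add: emeasure_eq_measure)
  also have "(LINT x|\<mu> (Phi h u). indicator S x) = inner (Phi (indicator S) (Phi h u)) (Phi h u)"
    by (simp only: Phi_quad[OF i])
  also have "\<dots> = (LINT x|\<mu> u. indicator S x * h x * h x)"
    by (simp add: Phi_mult i h Phi_inner_mult bounded_borel_mult Phi_quad)
  also have "ennreal \<dots> = (\<integral>\<^sup>+x. ennreal (indicator S x * h x * h x) \<partial>\<mu> u)"
    by (rule nn_integral_eq_integral[symmetric])
      (auto intro!: integrable_mu bounded_borel_mult i h simp: mult.assoc)
  also have "\<dots> = (\<integral>\<^sup>+x. ennreal ((h x)\<^sup>2) * indicator S x \<partial>\<mu> u)"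
    by (intro nn_integral_cong) (auto simp: indicator_def power2_eq_square)
  also have "\<dots> = emeasure (density (\<mu> u) (\<lambda>x. ennreal ((h x)\<^sup>2))) S"
    using S by (subst emeasure_density) auto
  finally show "emeasure (\<mu> (Phi h u)) S = emeasure (density (\<mu> u) (\<lambda>x. ennreal ((h x)\<^sup>2))) S" .
qed simp

lemma nn_integral_mu_Phi:
  assumes "bounded_borel h" "k \<in> borel_measurable borel"
  shows "(\<integral>\<^sup>+x. k x \<partial>\<mu> (Phi h u)) = (\<integral>\<^sup>+x. ennreal ((h x)\<^sup>2) * k x \<partial>\<mu> u)"
  unfolding mu_Phi[OF assms(1)] using assms by (subst nn_integral_density) auto

end


section \<open>Passage between families of scalar measures and projection-valued measures\<close>

lemma (in spectral_family) pvm_of_spectral_family: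
  assumes [measurable]: "\<phi> \<in> borel_measurable borel"
  defines "E \<equiv> \<lambda>S. Phi (\<lambda>x. indicator S (\<phi> x))"
  shows "projection_valued_measure E"
    and "spectral_scalar_measure E u = distr (\<mu> u) borel \<phi>"
proof -
  have b: "bounded_borel (\<lambda>x. indicat_real S (\<phi> x))" if [measurable]: "S \<in> sets borel" for S
    by (rule bounded_borelI[of _ 1]) (auto simp: indicator_def)
  show "projection_valued_measure E"
    unfolding projection_valued_measure_def
  proof (intro conjI ballI allI impI)
    fix S :: "real set" assume S: "S \<in> sets borel"
    have "Phi (\<lambda>x. indicator S (\<phi> x)) (Phi (\<lambda>x. indicator S (\<phi> x)) u) = Phi (\<lambda>x. indicator S (\<phi> x)) u" for u
      by (simp add: Phi_mult b S flip: indicator_inter_arith)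
    then show "orthogonal_projection (E S)"
      using b[OF S] by (auto simp: orthogonal_projection_def E_def Phi_linear Phi_inner fun_eq_iff)
  next
    show "E {} = (\<lambda>u. 0)" by (simp add: E_def Phi_zero fun_eq_iff)
    show "E UNIV = id" by (simp add: E_def Phi_one fun_eq_iff)
  next
    fix S T :: "real set" assume ST: "S \<in> sets borel" "T \<in> sets borel"
    show "E (S \<inter> T) = E S \<circ> E T"
      using ST by (simp add: E_def fun_eq_iff Phi_mult b flip: indicator_inter_arith)
  next
    fix B :: "nat \<Rightarrow> real set" and u assume B: "range B \<subseteq> sets borel \<and> disjoint_family B"
    then have Bm: "B n \<in> sets borel" for n by auto
    have fin: "(\<Sum>i<n. E (B i) u) = Phi (\<lambda>x. indicator (\<Union>i<n. B i) (\<phi> x)) u" for n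
    proof (induction n)
      case (Suc n)
      have "B n \<inter> B i = {}" if "i < n" for i
        using B that by (intro disjoint_family_onD[of B UNIV]) auto
      then have "indicator (\<Union>i<Suc n. B i) (\<phi> x) = indicat_real (\<Union>i<n. B i) (\<phi> x) + indicator (B n) (\<phi> x)" for x
        by (auto simp: indicator_def lessThan_Suc)
      then show ?case using Suc Bm by (simp add: E_def Phi_add b del: indicator_UN_disjoint)
    qed (simp add: Phi_zero)
    \<comment> \<open>Countable additivity in the strong sense: finite sums are the calculus of
      finite unions, whose indicators converge boundedly.\<close>
    show "(\<lambda>n. E (B n) u) sums E (\<Union>n. B n) u"
      unfolding sums_def fin unfolding E_def
    proof (rule Phi_limit[of _ 1])
      show "bounded_borel (\<lambda>x. indicat_real (\<Union>i<n. B i) (\<phi> x))" for n using Bm by (intro b) auto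
      show "(\<lambda>n. indicat_real (\<Union>i<n. B i) (\<phi> x)) \<longlonglongrightarrow> indicat_real (\<Union>n. B n) (\<phi> x)" for x
        by (rule LIMSEQ_indicator_UN)
    qed (auto simp: indicator_def)
  qed
  have "spectral_scalar_measure E u = measure_of UNIV (sets borel) (emeasure (distr (\<mu> u) borel \<phi>))"
    unfolding spectral_scalar_measure_def
  proof (rule measure_of_eq)
    fix S :: "real set" assume "S \<in> sigma_sets UNIV (sets borel)"
    then have S[measurable]: "S \<in> sets borel" by (metis sets.sigma_sets_eq space_borel)
    interpret finite_measure "\<mu> u" by (rule finite_mu)
    have "inner (E S u) u = (LINT x|\<mu> u. indicator (\<phi> -` S) x)"
      unfolding E_def using S by (simp add: Phi_quad b indicator_vimage[abs_def])
    also have "\<dots> = measure (\<mu> u) (\<phi> -` S)"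
      using measurable_sets[OF assms(1) S] by simp
    also have "ennreal \<dots> = emeasure (distr (\<mu> u) borel \<phi>) S"
      by (subst emeasure_distr) (auto simp: emeasure_eq_measure measurable_mu)
    finally show "ennreal (inner (E S u) u) = emeasure (distr (\<mu> u) borel \<phi>) S" .
  qed simp
  also have "\<dots> = distr (\<mu> u) borel \<phi>"
    using measure_of_of_measure[of "distr (\<mu> u) borel \<phi>"] by simp
  finally show "spectral_scalar_measure E u = distr (\<mu> u) borel \<phi>" .
qed

text \<open>\<open>measure_of\<close> returns the intended set function only if it is positive and
  countably additive. Positivity holds because E(S) is a symmetric idempotent, additivity because
  strong convergence implies convergence of <E(S) u, u>.\<close>

lemma
  fixes E :: "real set \<Rightarrow> 'a::{real_inner,complete_space} \<Rightarrow> 'a"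
  assumes E: "projection_valued_measure E"
  shows pvm_symmetric: "S \<in> sets borel \<Longrightarrow> symmetric_op (E S)"
    and pvm_measure: "S \<in> sets borel \<Longrightarrow> emeasure (spectral_scalar_measure E u) S = ennreal (inner (E S u) u)"
    and pvm_nonneg: "S \<in> sets borel \<Longrightarrow> 0 \<le> inner (E S u) u"
proof -
  note e = E[unfolded projection_valued_measure_def orthogonal_projection_def]
  show sy: "symmetric_op (E S)" if "S \<in> sets borel" for S
    using e that by (auto simp: symmetric_op_def)
  show nn: "0 \<le> inner (E S u) u" if "S \<in> sets borel" for S u
  proof -
    have "E S (E S u) = E S u" using e that by (metis comp_apply)
    then have "inner (E S u) u = inner (E S u) (E S u)" using sy[OF that] by (metis symmetric_op_def)
    then show ?thesis by simp
  qed
  show "emeasure (spectral_scalar_measure E u) S = ennreal (inner (E S u) u)" if "S \<in> sets borel"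
  proof (rule emeasure_measure_of[OF spectral_scalar_measure_def])
    show "S \<in> sets (spectral_scalar_measure E u)"
      using that by (simp add: spectral_scalar_measure_def sets.sigma_sets_eq[of borel, simplified])
    show "positive (sets (spectral_scalar_measure E u)) (\<lambda>B. ennreal (inner (E B u) u))"
      using e by (auto simp: positive_def)
    show "countably_additive (sets (spectral_scalar_measure E u)) (\<lambda>B. ennreal (inner (E B u) u))"
    proof (rule countably_additiveI)
      fix A :: "nat \<Rightarrow> real set"
      assume A: "range A \<subseteq> sets (spectral_scalar_measure E u)" "disjoint_family A"
      then have A': "range A \<subseteq> sets borel"
        by (simp add: spectral_scalar_measure_def sets.sigma_sets_eq[of borel, simplified])
      then have "(\<lambda>n. E (A n) u) sums E (\<Union>n. A n) u" using e A(2) by blast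
      then have "(\<lambda>n. inner (E (A n) u) u) sums inner (E (\<Union>n. A n) u) u"
        by (rule bounded_linear.sums[OF bounded_linear_inner_left])
      then show "(\<Sum>i. ennreal (inner (E (A i) u) u)) = ennreal (inner (E (\<Union>i. A i) u) u)"
        using A' nn by (intro suminf_ennreal_eq) auto
    qed
  qed simp
qed

text \<open>Applied to the spectral measure chosen for \<open>A\<close>, this makes the whole
  calculus available however the choice was made.\<close>

lemma spectral_family_of_pvm:
  fixes E :: "real set \<Rightarrow> 'a::{real_inner,complete_space} \<Rightarrow> 'a"
  assumes E: "projection_valued_measure E"
  shows "spectral_family (spectral_scalar_measure E)"
proof -
  note e = E[unfolded projection_valued_measure_def]
  have m: "measure (spectral_scalar_measure E u) S = inner (E S u) u" if "S \<in> sets borel" for S u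
    using that by (simp add: measure_def pvm_measure[OF E] pvm_nonneg[OF E])
  interpret measure_family "spectral_scalar_measure E"
  proof
    show "sets (spectral_scalar_measure E u) = sets borel" for u
      by (simp add: spectral_scalar_measure_def sets.sigma_sets_eq[of borel, simplified])
    show "emeasure (spectral_scalar_measure E u) UNIV = ennreal ((norm u)\<^sup>2)" for u
      using pvm_measure[OF E, of UNIV u] e by (simp add: power2_norm_eq_inner)
    show "quad_form (\<lambda>u. measure (spectral_scalar_measure E u) S)" if "S \<in> sets borel" for S
      unfolding m[OF that] by (rule symmetric_op_quad_form[OF pvm_symmetric[OF E that]])
  qed
  have P: "Phi (indicator S) = E S" if "S \<in> sets borel" for S
    by (rule Phi_unique[OF bounded_borel_indicator[OF that] pvm_symmetric[OF E that]])
      (use that m in simp)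
  show ?thesis
  proof
    show "Phi (indicator S) (Phi (indicator T) u) = Phi (indicator (S \<inter> T)) u"
      if "S \<in> sets borel" "T \<in> sets borel" for S T u
      using that e by (simp add: P)
  qed
qed

section \<open>Integrals of unbounded functions\<close>

text \<open>The cut is by the size of \<open>g\<close>, not of \<open>x\<close>. The product of two
  truncations is the square of the one with the smaller index, hence their increments act
  orthogonally and Pythagoras applies.\<close>

definition cut :: "(real \<Rightarrow> real) \<Rightarrow> nat \<Rightarrow> real \<Rightarrow> real" where
  "cut g n x = (if \<bar>g x\<bar> \<le> real n then g x else 0)"

lemma bounded_borel_cut:
  assumes [measurable]: "g \<in> borel_measurable borel" shows "bounded_borel (cut g n)"
  by (rule bounded_borelI[of _ "real n"]) (auto simp: cut_def[abs_def])

lemma cut_tendsto: "(\<lambda>n. cut g n x) \<longlonglongrightarrow> g x"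
proof -
  obtain N :: nat where "\<bar>g x\<bar> \<le> N" using real_arch_simple by blast
  then have "\<forall>\<^sub>F n in sequentially. cut g n x = g x"
    unfolding eventually_sequentially cut_def by (intro exI[of _ N]) auto
  then show ?thesis by (rule tendsto_eventually)
qed

context spectral_family
begin

definition dom :: "(real \<Rightarrow> real) \<Rightarrow> 'a set" where
  "dom g = {u. (\<integral>\<^sup>+x. ennreal ((g x)\<^sup>2) \<partial>\<mu> u) < \<infinity>}"

lemma nn_integral_cut:
  assumes g[measurable]: "g \<in> borel_measurable borel"
  shows "(\<integral>\<^sup>+x. ennreal ((cut g n x)\<^sup>2) \<partial>\<mu> u) = ennreal ((norm (Phi (cut g n) u))\<^sup>2)"
proof -
  note b = bounded_borel_cut[OF g]
  have "integrable (\<mu> u) (\<lambda>x. (cut g n x)\<^sup>2)"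
    unfolding power2_eq_square by (intro integrable_mu bounded_borel_mult b)
  then show ?thesis unfolding Phi_norm2[OF b] by (intro nn_integral_eq_integral) auto
qed

lemma norm_Phi_cut_mono:
  assumes g[measurable]: "g \<in> borel_measurable borel" and "m \<le> n"
  shows "(norm (Phi (cut g n) u - Phi (cut g m) u))\<^sup>2
    = (norm (Phi (cut g n) u))\<^sup>2 - (norm (Phi (cut g m) u))\<^sup>2"
proof -
  note b = bounded_borel_cut[OF g]
  have "(\<lambda>x. cut g n x * cut g m x) = (\<lambda>x. cut g m x * cut g m x)"
    using assms(2) by (auto simp: cut_def)
  then have "inner (Phi (cut g n) u) (Phi (cut g m) u) = inner (Phi (cut g m) u) (Phi (cut g m) u)"
    by (simp add: Phi_inner_mult b)
  then show ?thesis by (simp add: power2_norm_eq_inner inner_simps inner_commute)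
qed

lemma nn_integral_SUP_cut:
  assumes g[measurable]: "g \<in> borel_measurable borel"
  shows "(\<integral>\<^sup>+x. ennreal ((g x)\<^sup>2) \<partial>\<mu> u) = (SUP n. ennreal ((norm (Phi (cut g n) u))\<^sup>2))"
proof -
  have le: "(cut g m x)\<^sup>2 \<le> (cut g n x)\<^sup>2" if "m \<le> n" for m n x using that by (auto simp: cut_def)
  have inc: "incseq (\<lambda>n x. ennreal ((cut g n x)\<^sup>2))"
    using le by (auto simp: incseq_def le_fun_def ennreal_leI)
  have "ennreal ((g x)\<^sup>2) = (SUP n. ennreal ((cut g n x)\<^sup>2))" for x
  proof (rule LIMSEQ_unique)
    show "(\<lambda>n. ennreal ((cut g n x)\<^sup>2)) \<longlonglongrightarrow> ennreal ((g x)\<^sup>2)"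
      by (intro tendsto_ennrealI tendsto_power cut_tendsto)
    show "(\<lambda>n. ennreal ((cut g n x)\<^sup>2)) \<longlonglongrightarrow> (SUP n. ennreal ((cut g n x)\<^sup>2))"
      using inc by (intro LIMSEQ_SUP) (auto simp: incseq_def le_fun_def)
  qed
  then have "(\<integral>\<^sup>+x. ennreal ((g x)\<^sup>2) \<partial>\<mu> u) = (\<integral>\<^sup>+x. (SUP n. ennreal ((cut g n x)\<^sup>2)) \<partial>\<mu> u)" by simp
  also have "\<dots> = (SUP n. \<integral>\<^sup>+x. ennreal ((cut g n x)\<^sup>2) \<partial>\<mu> u)"
    using bounded_borel_measurable[OF bounded_borel_cut[OF g]]
    by (intro nn_integral_monotone_convergence_SUP inc measurable_mu) simp
  finally show ?thesis by (simp add: nn_integral_cut)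
qed

lemma Phi_cut_mono:
  assumes g[measurable]: "g \<in> borel_measurable borel" and "m \<le> n"
  shows "norm (Phi (cut g m) u) \<le> norm (Phi (cut g n) u)"
  using norm_Phi_cut_mono[OF assms, of u] zero_le_power2 by (metis diff_ge_0_iff_ge norm_ge_zero power2_le_imp_le)

text \<open>By monotone convergence the integral of g^2 is the supremum of the squared norms of
  \<open>Phi (cut g n) u\<close>. In this form the domain is visibly a subspace.\<close>

lemma dom_iff:
  assumes g[measurable]: "g \<in> borel_measurable borel"
  shows "u \<in> dom g \<longleftrightarrow> (\<exists>C. \<forall>n. norm (Phi (cut g n) u) \<le> C)"
proof
  assume "u \<in> dom g"
  then have "(SUP n. ennreal ((norm (Phi (cut g n) u))\<^sup>2)) < \<infinity>"
    by (simp add: dom_def nn_integral_SUP_cut)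
  then obtain C where C: "0 \<le> C" "(SUP n. ennreal ((norm (Phi (cut g n) u))\<^sup>2)) = ennreal C"
    by (auto simp: less_top_ennreal)
  have "norm (Phi (cut g n) u) \<le> sqrt C" for n
  proof (rule real_le_rsqrt)
    have "ennreal ((norm (Phi (cut g n) u))\<^sup>2) \<le> ennreal C"
      unfolding C(2)[symmetric] by (rule SUP_upper) simp
    then show "(norm (Phi (cut g n) u))\<^sup>2 \<le> C" using C(1) by (simp add: ennreal_le_iff)
  qed
  then show "\<exists>C. \<forall>n. norm (Phi (cut g n) u) \<le> C" by blast
next
  assume "\<exists>C. \<forall>n. norm (Phi (cut g n) u) \<le> C"
  then obtain C where C: "\<And>n. norm (Phi (cut g n) u) \<le> C" by blast
  have "(SUP n. ennreal ((norm (Phi (cut g n) u))\<^sup>2)) \<le> ennreal (C\<^sup>2)"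
    by (intro SUP_least ennreal_leI power_mono C) auto
  also have "\<dots> < \<infinity>" by simp
  finally show "u \<in> dom g" by (simp add: dom_def nn_integral_SUP_cut)
qed

lemma dom_lincomb:
  assumes g: "g \<in> borel_measurable borel" and "u \<in> dom g" "v \<in> dom g"
  shows "a *\<^sub>R u + v \<in> dom g"
proof -
  note b = bounded_borel_cut[OF g]
  obtain C where C: "\<And>n. norm (Phi (cut g n) u) \<le> C" using assms dom_iff[OF g] by metis
  obtain C' where C': "\<And>n. norm (Phi (cut g n) v) \<le> C'" using assms dom_iff[OF g] by metis
  have "norm (Phi (cut g n) (a *\<^sub>R u + v)) \<le> \<bar>a\<bar> * C + C'" for n
  proof -
    interpret bounded_linear "Phi (cut g n)" using b by (rule Phi_linear)
    have "norm (Phi (cut g n) (a *\<^sub>R u + v)) \<le> \<bar>a\<bar> * norm (Phi (cut g n) u) + norm (Phi (cut g n) v)"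
      unfolding add scaleR using norm_triangle_ineq by (metis norm_scaleR)
    also have "\<dots> \<le> \<bar>a\<bar> * C + C'" by (intro add_mono mult_left_mono C C') auto
    finally show ?thesis .
  qed
  then show ?thesis unfolding dom_iff[OF g] by blast
qed

text \<open>The norms increase and are bounded, and \<open>norm_Phi_cut_mono\<close> turns
  differences of squared norms into squared norms of differences; so the vectors form a Cauchy
  sequence.\<close>

lemma Phi_cut_convergent:
  assumes g: "g \<in> borel_measurable borel" and u: "u \<in> dom g"
  obtains w where "(\<lambda>n. Phi (cut g n) u) \<longlonglongrightarrow> w" "ennreal ((norm w)\<^sup>2) = (\<integral>\<^sup>+x. ennreal ((g x)\<^sup>2) \<partial>\<mu> u)"
proof -
  define a where "a n = (norm (Phi (cut g n) u))\<^sup>2" for n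
  obtain C where C: "\<And>n. norm (Phi (cut g n) u) \<le> C" using u dom_iff[OF g] by metis
  have inc: "incseq a" unfolding a_def incseq_def by (auto intro!: power_mono Phi_cut_mono g)
  have "Bseq a"
  proof (rule BseqI')
    show "norm (a n) \<le> C\<^sup>2" for n unfolding a_def using power_mono[OF C, of n 2] by simp
  qed
  then have "Cauchy a" using inc Bseq_mono_convergent[of a] by (auto simp: incseq_def convergent_Cauchy)
  have "Cauchy (\<lambda>n. Phi (cut g n) u)"
  proof (rule metric_CauchyI)
    fix e :: real assume e: "e > 0"
    obtain N where N: "\<And>m n. m \<ge> N \<Longrightarrow> n \<ge> N \<Longrightarrow> \<bar>a m - a n\<bar> < e\<^sup>2"
      using metric_CauchyD[OF \<open>Cauchy a\<close>, of "e\<^sup>2"] e by (auto simp: dist_real_def)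
    have *: "dist (Phi (cut g n) u) (Phi (cut g m) u) < e" if "m \<le> n" "m \<ge> N" for m n
    proof -
      have "(norm (Phi (cut g n) u - Phi (cut g m) u))\<^sup>2 < e\<^sup>2"
        unfolding norm_Phi_cut_mono[OF g that(1)] using N[of n m] that by (simp add: a_def)
      then show ?thesis using e by (simp add: dist_norm power2_less_imp_less)
    qed
    have "dist (Phi (cut g n) u) (Phi (cut g m) u) < e" if "n \<ge> N" "m \<ge> N" for m n
      using *[of m n] *[of n m] that by (metis dist_commute nle_le)
    then show "\<exists>N. \<forall>m\<ge>N. \<forall>n\<ge>N. dist (Phi (cut g m) u) (Phi (cut g n) u) < e" by blast
  qed
  then obtain w where w: "(\<lambda>n. Phi (cut g n) u) \<longlonglongrightarrow> w" using Cauchy_convergent_iff convergent_def by blast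
  have "ennreal ((norm w)\<^sup>2) = (\<integral>\<^sup>+x. ennreal ((g x)\<^sup>2) \<partial>\<mu> u)"
    unfolding nn_integral_SUP_cut[OF g]
  proof (rule LIMSEQ_unique)
    show "(\<lambda>n. ennreal ((norm (Phi (cut g n) u))\<^sup>2)) \<longlonglongrightarrow> ennreal ((norm w)\<^sup>2)"
      by (intro tendsto_intros w)
    show "(\<lambda>n. ennreal ((norm (Phi (cut g n) u))\<^sup>2)) \<longlonglongrightarrow> (SUP n. ennreal ((norm (Phi (cut g n) u))\<^sup>2))"
      using inc by (intro LIMSEQ_SUP) (auto simp: incseq_def a_def ennreal_leI)
  qed
  then show thesis using that w by blast
qed

lemma integral_dom:
  assumes g[measurable]: "g \<in> borel_measurable borel" and u: "u \<in> dom g"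
  shows "(\<lambda>n. LINT x|\<mu> u. cut g n x) \<longlonglongrightarrow> (LINT x|\<mu> u. g x)" and "integrable (\<mu> u) g"
proof -
  interpret finite_measure "\<mu> u" by (rule finite_mu)
  have "integrable (\<mu> u) (\<lambda>x. (g x)\<^sup>2)"
    using u by (intro integrableI_bounded) (auto simp: dom_def measurable_mu)
  then have i: "integrable (\<mu> u) (\<lambda>x. 1 + (g x)\<^sup>2)" by simp
  have le: "\<bar>c\<bar> \<le> 1 + c\<^sup>2" for c :: real
  proof -
    have "0 \<le> (\<bar>c\<bar> - 1)\<^sup>2 + \<bar>c\<bar>" by simp
    then show ?thesis by (simp add: power2_eq_square algebra_simps)
  qed
  show "integrable (\<mu> u) g"
    by (rule Bochner_Integration.integrable_bound[OF i]) (auto simp: measurable_mu le intro: order_trans[OF le])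
  show "(\<lambda>n. LINT x|\<mu> u. cut g n x) \<longlonglongrightarrow> (LINT x|\<mu> u. g x)"
  proof (rule integral_dominated_convergence[OF _ _ i])
    show "AE x in \<mu> u. norm (cut g n x) \<le> 1 + (g x)\<^sup>2" for n
      using le by (auto simp: cut_def)
  qed (auto simp: measurable_mu cut_tendsto bounded_borel_measurable bounded_borel_cut)
qed

text \<open>Restricting \<open>u\<close> spectrally to the set where |g| <= n gives a vector of the
  domain, and these vectors converge to \<open>u\<close>.\<close>

lemma dom_dense:
  assumes g[measurable]: "g \<in> borel_measurable borel"
  shows "closure (dom g) = UNIV"
proof -
  define i where "i n = indicat_real {x. \<bar>g x\<bar> \<le> real n}" for n :: nat
  have ib: "bounded_borel (i n)" for n unfolding i_def by (rule bounded_borel_indicator) simp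
  have "u \<in> closure (dom g)" for u
    unfolding closure_sequential
  proof (intro exI conjI allI)
    fix n
    have "norm (Phi (cut g m) (Phi (i n) u)) \<le> real n * norm u" for m
      unfolding Phi_mult[OF bounded_borel_cut[OF g] ib]
      by (rule Phi_bound[OF bounded_borel_mult[OF bounded_borel_cut[OF g] ib]])
        (auto simp: cut_def i_def indicator_def)
    then show "Phi (i n) u \<in> dom g" unfolding dom_iff[OF g] by blast
  next
    have "(\<lambda>n. Phi (i n) u) \<longlonglongrightarrow> Phi (\<lambda>x. 1) u"
    proof (rule Phi_limit[OF ib])
      show "\<bar>i n x\<bar> \<le> 1" for n x by (simp add: i_def)
      show "(\<lambda>n. i n x) \<longlonglongrightarrow> 1" for x
      proof -
        obtain N :: nat where "\<bar>g x\<bar> \<le> N" using real_arch_simple by blast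
        then have "\<forall>\<^sub>F n in sequentially. i n x = 1"
          unfolding eventually_sequentially i_def by (intro exI[of _ N]) auto
        then show ?thesis by (rule tendsto_eventually)
      qed
    qed
    then show "(\<lambda>n. Phi (i n) u) \<longlonglongrightarrow> u" by (simp add: Phi_one)
  qed
  then show ?thesis by auto
qed

end

section \<open>Spectral integrals as limits of truncated ones\<close>

lemma vector_eq_dense:
  fixes w :: "'a::real_inner"
  assumes "closure V = UNIV" "\<And>v. v \<in> V \<Longrightarrow> inner w v = inner w' v"
  shows "w = w'"
proof -
  obtain V' where V': "\<And>n. V' n \<in> V" "V' \<longlonglongrightarrow> w - w'"
    using assms(1) closure_sequential[of "w - w'" V] by auto
  have "(\<lambda>n. inner (w - w') (V' n)) \<longlonglongrightarrow> inner (w - w') (w - w')" by (intro tendsto_intros V')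
  moreover have "inner (w - w') (V' n) = 0" for n using assms(2)[OF V'(1)] by (simp add: inner_diff_left)
  ultimately have "inner (w - w') (w - w') = 0" by (simp add: LIMSEQ_const_iff)
  then show ?thesis by simp
qed

locale pvm =
  fixes E :: "real set \<Rightarrow> 'a::{real_inner,complete_space} \<Rightarrow> 'a"
  assumes pvm: "projection_valued_measure E"

sublocale pvm \<subseteq> spectral_family "spectral_scalar_measure E"
  by (rule spectral_family_of_pvm[OF pvm])

context pvm
begin

lemma spectral_domain_eq: "spectral_domain E g = dom g"
  by (simp add: spectral_domain_def dom_def)

text \<open>The test vectors in the description are dense, so at most one vector passes the test;
  exhibiting one evaluates the description operator.\<close>

lemma spectral_integral_unique:
  assumes g: "g \<in> borel_measurable borel"
    and w: "\<And>v. v \<in> dom g \<Longrightarrow> inner w v = (1 / 4) * ((LINT x|spectral_scalar_measure E (u + v). g x)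
                          - (LINT x|spectral_scalar_measure E (u - v). g x))"
  shows "spectral_integral E g u = w"
  unfolding spectral_integral_def spectral_domain_eq
proof (rule the_equality)
  show "w' = w" if "\<forall>v\<in>dom g. inner w' v = (1 / 4) * ((LINT x|spectral_scalar_measure E (u + v). g x)
                          - (LINT x|spectral_scalar_measure E (u - v). g x))" for w'
    by (rule vector_eq_dense[OF dom_dense[OF g]]) (use that w in metis)
qed (use w in blast)

lemma spectral_integral:
  assumes g: "g \<in> borel_measurable borel" and u: "u \<in> dom g"
  shows spectral_integral_limit: "(\<lambda>n. Phi (cut g n) u) \<longlonglongrightarrow> spectral_integral E g u"
    and spectral_integral_norm: "ennreal ((norm (spectral_integral E g u))\<^sup>2)
      = (\<integral>\<^sup>+x. ennreal ((g x)\<^sup>2) \<partial>spectral_scalar_measure E u)"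
proof -
  obtain w where w: "(\<lambda>n. Phi (cut g n) u) \<longlonglongrightarrow> w"
    "ennreal ((norm w)\<^sup>2) = (\<integral>\<^sup>+x. ennreal ((g x)\<^sup>2) \<partial>spectral_scalar_measure E u)"
    using Phi_cut_convergent[OF assms] by metis
  have "spectral_integral E g u = w"
  proof (rule spectral_integral_unique[OF g])
    fix v assume v: "v \<in> dom g"
    have d: "u + v \<in> dom g" "u - v \<in> dom g"
      using dom_lincomb[OF g u v, of 1] dom_lincomb[OF g v u, of "-1"] by auto
    show "inner w v = (1 / 4) * ((LINT x|spectral_scalar_measure E (u + v). g x)
                          - (LINT x|spectral_scalar_measure E (u - v). g x))"
    proof (rule LIMSEQ_unique)
      show "(\<lambda>n. inner (Phi (cut g n) u) v) \<longlonglongrightarrow> inner w v" by (intro tendsto_intros w)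
      show "(\<lambda>n. inner (Phi (cut g n) u) v) \<longlonglongrightarrow> (1 / 4) * ((LINT x|spectral_scalar_measure E (u + v). g x)
                          - (LINT x|spectral_scalar_measure E (u - v). g x))"
        unfolding Phi_polar[OF bounded_borel_cut[OF g]] polar_form_def
        using tendsto_mult_left[OF tendsto_diff[OF integral_dom(1)[OF g d(1)] integral_dom(1)[OF g d(2)]], of "1/4"]
        by simp
    qed
  qed
  then show "(\<lambda>n. Phi (cut g n) u) \<longlonglongrightarrow> spectral_integral E g u"
    and "ennreal ((norm (spectral_integral E g u))\<^sup>2) = (\<integral>\<^sup>+x. ennreal ((g x)\<^sup>2) \<partial>spectral_scalar_measure E u)"
    using w by simp_all
qed

end

section \<open>The spectral theorem for nonnegative self-adjoint operators\<close>

lemma symmetric_op_funpow: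
  assumes "symmetric_op T" shows "symmetric_op (T ^^ k)"
proof (induction k)
  case 0 show ?case by (auto simp: symmetric_op_def id_def bounded_linear_ident)
next
  case (Suc k)
  have "symmetric_op (\<lambda>u. T ((T ^^ k) u))"
    by (rule symmetric_op_compose[OF assms Suc]) (simp add: funpow_swap1)
  then show ?case by (simp add: comp_def)
qed

locale unit_operator =
  fixes B :: "'a::{real_inner,complete_space} \<Rightarrow> 'a"
  assumes symmetric: "symmetric_op B"
    and nonneg: "0 \<le> inner (B u) u" and le_one: "inner (B u) u \<le> (norm u)\<^sup>2"
begin

definition C :: "'a \<Rightarrow> 'a" where "C u = u - B u"

lemma linear_B: "linear B"
  using symmetric by (auto simp: symmetric_op_def bounded_linear.linear)

lemma symmetric_C: "symmetric_op C"
  using symmetric unfolding symmetric_op_def C_def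
  by (auto intro!: bounded_linear_sub bounded_linear_ident simp: inner_diff_left inner_diff_right)

lemma B_C: "B (C u) = C (B u)"
  by (simp add: C_def linear_diff[OF linear_B])

lemma B_Ck: "B ((C ^^ k) u) = (C ^^ k) (B u)"
  by (induction k) (simp_all add: B_C)

lemma C_Bk: "C ((B ^^ k) u) = (B ^^ k) (C u)"
  by (induction k) (simp_all add: B_C[symmetric])

definition T :: "nat \<Rightarrow> nat \<Rightarrow> 'a \<Rightarrow> 'a" where "T k m u = (B ^^ k) ((C ^^ m) u)"

lemma T_Suc: "T (Suc k) m u = B (T k m u)" "T k (Suc m) u = C (T k m u)"
    "T (Suc k) m u = T k m (B u)" "T k (Suc m) u = T k m (C u)"
proof -
  show "T (Suc k) m u = B (T k m u)" by (simp add: T_def)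
  show "T k (Suc m) u = C (T k m u)" by (simp add: T_def C_Bk)
  show "T (Suc k) m u = T k m (B u)" by (simp add: T_def funpow_swap1 B_Ck)
  show "T k (Suc m) u = T k m (C u)" by (simp add: T_def funpow_swap1)
qed

text \<open>Pairs of equal factors are moved to the other side of the scalar product, which leaves exponents
  at most one; for \<open>B C\<close> use \<open>B C = B C\<^sup>2 + C B\<^sup>2\<close>.\<close>

lemma T_nonneg: "0 \<le> inner (T k m u) u"
proof (induction "k + m" arbitrary: k m u rule: less_induct)
  case less
  have C0: "0 \<le> inner (C u) u" for u
    using le_one[of u] by (simp add: C_def inner_diff_left power2_norm_eq_inner)
  consider k' where "k = Suc (Suc k')" | m' where "m = Suc (Suc m')" | "k \<le> 1" "m \<le> 1"
    by (metis One_nat_def Suc_eq_plus1 less_eq_Suc_le not_less_eq_eq old.nat.exhaust zero_less_Suc le_simps(2) not0_implies_Suc le0)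
  then show ?case
  proof cases
    case 1
    have "inner (T k m u) u = inner (T k' m (B u)) (B u)"
      using symmetric by (simp add: 1 T_Suc(1)[of "Suc k'"] T_Suc(3)[of k'] symmetric_op_def)
    then show ?thesis using less[of k' m "B u"] 1 by simp
  next
    case 2
    have "inner (T k m u) u = inner (T k m' (C u)) (C u)"
      using symmetric_C by (simp add: 2 T_Suc(2)[of k "Suc m'"] T_Suc(4)[of k m'] symmetric_op_def)
    then show ?thesis using less[of k m' "C u"] 2 by simp
  next
    case 3
    have BC: "0 \<le> inner (B (C u)) u"
    proof -
      have "B (C u) = B (C (C u)) + C (B (B u))"
        by (simp add: C_def linear_diff[OF linear_B])
      moreover have "inner (B (C (C u))) u = inner (B (C u)) (C u)"
        using symmetric_C by (simp add: B_C symmetric_op_def)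
      moreover have "inner (C (B (B u))) u = inner (C (B u)) (B u)"
        using symmetric by (simp add: B_C[symmetric] symmetric_op_def)
      ultimately show ?thesis using nonneg[of "C u"] C0[of "B u"] by (simp add: inner_add_left)
    qed
    have "k = 0 \<or> k = 1" "m = 0 \<or> m = 1" using 3 by auto
    then show ?thesis using nonneg[of u] C0[of u] BC by (auto simp: T_def)
  qed
qed

text \<open>The expansion of (B + C)^n where B + C = 1. The expansions of \<open>B u\<close> and
  \<open>C u\<close> come from applying the operator to that of \<open>u\<close>, and Pascal's rule
  adds them.\<close>

lemma T_binomial: "(\<Sum>k\<le>n. real (n choose k) *\<^sub>R T k (n - k) u) = u"
proof (induction n)
  case 0 show ?case by (simp add: T_def)
next
  case (Suc n)
  let ?a = "\<lambda>k. real (n choose k)"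
  have lc: "linear C" using symmetric_C by (auto simp: symmetric_op_def bounded_linear.linear)
  have "C u = (\<Sum>k\<le>n. ?a k *\<^sub>R T k (Suc n - k) u)"
  proof -
    have "C u = C (\<Sum>k\<le>n. ?a k *\<^sub>R T k (n - k) u)" by (simp only: Suc)
    also have "\<dots> = (\<Sum>k\<le>n. ?a k *\<^sub>R C (T k (n - k) u))" by (simp add: linear_sum[OF lc] linear_scale[OF lc])
    also have "\<dots> = (\<Sum>k\<le>n. ?a k *\<^sub>R T k (Suc n - k) u)"
      by (rule sum.cong) (auto simp: T_Suc(2)[symmetric] Suc_diff_le)
    finally show ?thesis .
  qed
  also have "\<dots> = (\<Sum>k\<le>Suc n. ?a k *\<^sub>R T k (Suc n - k) u)" by simp
  also have "\<dots> = T 0 (Suc n) u + (\<Sum>k\<le>n. ?a (Suc k) *\<^sub>R T (Suc k) (n - k) u)"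
    by (subst sum.atMost_Suc_shift) simp
  finally have c: "C u = T 0 (Suc n) u + (\<Sum>k\<le>n. ?a (Suc k) *\<^sub>R T (Suc k) (n - k) u)" .
  have "B u = B (\<Sum>k\<le>n. ?a k *\<^sub>R T k (n - k) u)" by (simp only: Suc)
  also have "\<dots> = (\<Sum>k\<le>n. ?a k *\<^sub>R T (Suc k) (n - k) u)"
    by (simp add: linear_sum[OF linear_B] linear_scale[OF linear_B] T_Suc(1))
  finally have b: "B u = (\<Sum>k\<le>n. ?a k *\<^sub>R T (Suc k) (n - k) u)" .
  have "(\<Sum>k\<le>Suc n. real (Suc n choose k) *\<^sub>R T k (Suc n - k) u)
      = T 0 (Suc n) u + (\<Sum>k\<le>n. real (Suc n choose Suc k) *\<^sub>R T (Suc k) (n - k) u)"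
    by (subst sum.atMost_Suc_shift) simp
  also have "\<dots> = C u + B u"
    unfolding b c by (simp add: scaleR_add_left sum.distrib)
  finally show ?case by (simp add: C_def)
qed

text \<open>Factorial moments are exact, so that the moments of the Bernstein measures converge without any
  functional calculus for \<open>B\<close>.\<close>

lemma T_factorial_moment:
  assumes "j \<le> n"
  shows "(\<Sum>k\<le>n. (real (k choose j) / real (n choose j) * real (n choose k)) *\<^sub>R T k (n - k) u) = (B ^^ j) u"
proof -
  have lin: "linear (B ^^ j)" using symmetric_op_funpow[OF symmetric]
    by (auto simp: symmetric_op_def bounded_linear.linear)
  have TT: "(B ^^ j) (T k m u) = T (j + k) m u" for k m by (simp add: T_def funpow_add)
  \<comment> \<open>The binomial expansion of order n - j, shifted by j factors of \<open>B\<close>;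
    \<open>choose_mult\<close> converts the coefficients.\<close>
  have "(B ^^ j) u = (B ^^ j) (\<Sum>i\<le>n-j. real (n - j choose i) *\<^sub>R T i (n - j - i) u)"
    by (simp only: T_binomial)
  also have "\<dots> = (\<Sum>i\<le>n-j. real (n - j choose i) *\<^sub>R T (j + i) (n - (j + i)) u)"
    by (simp add: linear_sum[OF lin] linear_scale[OF lin] TT diff_diff_eq)
  also have "\<dots> = (\<Sum>k=j..n. real (n - j choose (k - j)) *\<^sub>R T k (n - k) u)"
    by (rule sum.reindex_bij_witness[of _ "\<lambda>k. k - j" "\<lambda>i. j + i"]) (use assms in auto)
  also have "\<dots> = (\<Sum>k=j..n. (real (k choose j) / real (n choose j) * real (n choose k)) *\<^sub>R T k (n - k) u)"
  proof (rule sum.cong)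
    fix k assume k: "k \<in> {j..n}"
    have "real (n choose k) * real (k choose j) = real (n choose j) * real (n - j choose (k - j))"
      using choose_mult[of j k n] k by (metis atLeastAtMost_iff of_nat_mult)
    moreover have "real (n choose j) \<noteq> 0" using assms by simp
    ultimately have "real (n - j choose (k - j)) = real (k choose j) / real (n choose j) * real (n choose k)"
      by (simp add: field_simps)
    then show "real (n - j choose (k - j)) *\<^sub>R T k (n - k) u
      = (real (k choose j) / real (n choose j) * real (n choose k)) *\<^sub>R T k (n - k) u" by simp
  qed simp
  also have "\<dots> = (\<Sum>k\<le>n. (real (k choose j) / real (n choose j) * real (n choose k)) *\<^sub>R T k (n - k) u)"
    by (rule sum.mono_neutral_left) auto
  finally show ?thesis ..
qed

end

lemma nat_fraction_le_one: "k \<le> n \<Longrightarrow> real k / real n \<le> 1"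
  by (cases "n = 0") (auto simp: divide_le_eq_1)

text \<open>Both quantities are products of j factors of absolute value at most 1, the first with
  factors (k - i) / (n - i). The difference of two such products is at most the sum of the
  differences of the factors.\<close>

lemma choose_quotient_approx:
  assumes k: "k \<le> n" and n: "2 * j < n"
  shows "\<bar>real (k choose j) / real (n choose j) - (real k / real n) ^ j\<bar> \<le> real j * (real j / real (n - j))"
proof -
  let ?a = "\<lambda>i. (real k - real i) / (real n - real i)"
  have "real (k choose j) / real (n choose j) = (\<Prod>i<j. ?a i)"
  proof -
    have ch: "real (m choose j) = (\<Prod>i<j. real m - real i) / fact j" for m
      unfolding binomial_gbinomial gbinomial_prod_rev by (simp add: lessThan_atLeast0)
    show ?thesis unfolding ch by (simp add: prod_dividef)
  qed
  moreover have "(real k / real n) ^ j = (\<Prod>i<j. real k / real n)" by simp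
  moreover have "norm ((\<Prod>i\<in>{..<j}. ?a i) - (\<Prod>i\<in>{..<j}. real k / real n)) \<le> (\<Sum>i<j. norm (?a i - real k / real n))"
  proof (rule norm_prod_diff)
    \<comment> \<open>A factor is negative when k < i; then 2 j < n still gives i - k <= n -
      i.\<close>
    show "norm (?a i) \<le> 1" if "i \<in> {..<j}" for i
    proof -
      have "\<bar>real k - real i\<bar> \<le> real n - real i" using that n k by auto
      then show ?thesis using that n by (simp add: divide_le_eq_1)
    qed
    show "norm (real k / real n) \<le> 1" using nat_fraction_le_one[OF k] by simp
  qed
  moreover have "(\<Sum>i<j. norm (?a i - real k / real n)) \<le> (\<Sum>i<j. real j / real (n - j))"
  proof (rule sum_mono)
    fix i assume i: "i \<in> {..<j}"
    have n0: "0 < real n" "0 < real n - real i" "0 < real (n - j)" using i n by auto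
    have "?a i - real k / real n = - (real i / (real n - real i)) * ((real n - real k) / real n)"
      using n0 by (simp add: field_simps)
    then have "norm (?a i - real k / real n) = (real i / (real n - real i)) * ((real n - real k) / real n)"
      using n0 k by (simp add: abs_mult)
    also have "\<dots> \<le> (real i / (real n - real i)) * 1"
      using n0 k by (intro mult_left_mono) (auto simp: divide_le_eq_1)
    also have "\<dots> \<le> real j / real (n - j)"
      using i n by (simp, intro frac_le) auto
    finally show "norm (?a i - real k / real n) \<le> real j / real (n - j)" .
  qed
  ultimately show ?thesis by simp
qed

section \<open>Bernstein measures and their weak limit\<close>

context unit_operator
begin

text \<open>A Bernstein basis polynomial with x replaced by \<open>B\<close> and 1 - x by
  \<open>C\<close>; \<open>T_nonneg\<close> turns the values into masses.\<close>

definition weight :: "nat \<Rightarrow> 'a \<Rightarrow> nat \<Rightarrow> real" where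
  "weight n u k = real (n choose k) * inner (T k (n - k) u) u"

definition bernstein_measure :: "nat \<Rightarrow> 'a \<Rightarrow> real measure" where
  "bernstein_measure n u = distr (point_measure {..n} (\<lambda>k. ennreal (weight n u k))) borel (\<lambda>k. real k / real n)"

lemma weight_nonneg: "0 \<le> weight n u k"
  by (simp add: weight_def T_nonneg)

lemma sum_weight: "(\<Sum>k\<le>n. weight n u k) = (norm u)\<^sup>2"
proof -
  have "(\<Sum>k\<le>n. weight n u k) = inner (\<Sum>k\<le>n. real (n choose k) *\<^sub>R T k (n - k) u) u"
    by (simp add: weight_def inner_sum_left)
  then show ?thesis by (simp only: T_binomial power2_norm_eq_inner)
qed

lemma integral_bernstein_measure:
  assumes [measurable]: "h \<in> borel_measurable borel"
  shows "(LINT x|bernstein_measure n u. h x) = (\<Sum>k\<le>n. weight n u k * h (real k / real n))"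
proof -
  have "(LINT x|bernstein_measure n u. h x) = (LINT k|point_measure {..n} (\<lambda>k. ennreal (weight n u k)). h (real k / real n))"
    unfolding bernstein_measure_def
    by (rule integral_distr[OF _ assms]) (auto simp: measurable_def sets_point_measure space_point_measure)
  also have "\<dots> = (\<Sum>k\<le>n. weight n u k * h (real k / real n))"
    by (subst lebesgue_integral_point_measure_finite) (auto simp: weight_nonneg)
  finally show ?thesis .
qed

lemma emeasure_bernstein_measure:
  assumes [measurable]: "S \<in> sets borel" and S: "{0..1} \<subseteq> S"
  shows "emeasure (bernstein_measure n u) S = ennreal ((norm u)\<^sup>2)"
proof -
  have "(\<lambda>k. real k / real n) -` S \<inter> {..n} = {..n}"
    using S nat_fraction_le_one by (auto intro!: subsetD[OF S])
  then have "emeasure (bernstein_measure n u) S = emeasure (point_measure {..n} (\<lambda>k. ennreal (weight n u k))) {..n}"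
    unfolding bernstein_measure_def
    by (subst emeasure_distr) (auto simp: measurable_def sets_point_measure space_point_measure)
  also have "\<dots> = ennreal ((norm u)\<^sup>2)"
    by (simp add: emeasure_point_measure_finite sum_ennreal weight_nonneg sum_weight)
  finally show ?thesis .
qed

text \<open>The factorial moments equal <B^j u, u> as soon as n >= j; replacing the quotient of
  binomial coefficients by (k/n)^j costs O(1/n), uniformly in k.\<close>

lemma bernstein_moment:
  "(\<lambda>n. \<Sum>k\<le>n. weight n u k * (real k / real n) ^ j) \<longlonglongrightarrow> inner ((B ^^ j) u) u"
proof (rule Lim_transform)
  have e: "(\<Sum>k\<le>n. weight n u k * (real (k choose j) / real (n choose j))) = inner ((B ^^ j) u) u"
    if "j \<le> n" for n
    unfolding T_factorial_moment[OF that, symmetric, of u]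
    by (simp add: weight_def inner_sum_left algebra_simps)
  show "(\<lambda>n. \<Sum>k\<le>n. weight n u k * (real (k choose j) / real (n choose j))) \<longlonglongrightarrow> inner ((B ^^ j) u) u"
    by (rule tendsto_eventually) (use e in \<open>auto simp: eventually_sequentially\<close>)
  show "(\<lambda>n. (\<Sum>k\<le>n. weight n u k * (real k / real n) ^ j)
      - (\<Sum>k\<le>n. weight n u k * (real (k choose j) / real (n choose j)))) \<longlonglongrightarrow> 0"
  proof (rule Lim_null_comparison)
    show "\<forall>\<^sub>F n in sequentially. norm ((\<Sum>k\<le>n. weight n u k * (real k / real n) ^ j)
      - (\<Sum>k\<le>n. weight n u k * (real (k choose j) / real (n choose j))))
       \<le> (norm u)\<^sup>2 * (real j * (real j / real (n - j)))"
    proof (rule eventually_sequentiallyI[of "Suc (2 * j)"])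
      fix n assume n: "Suc (2 * j) \<le> n"
      have "norm ((\<Sum>k\<le>n. weight n u k * (real k / real n) ^ j)
          - (\<Sum>k\<le>n. weight n u k * (real (k choose j) / real (n choose j))))
        = \<bar>\<Sum>k\<le>n. weight n u k * ((real k / real n) ^ j - real (k choose j) / real (n choose j))\<bar>"
        by (simp add: sum_subtractf right_diff_distrib)
      also have "\<dots> \<le> (\<Sum>k\<le>n. weight n u k * (real j * (real j / real (n - j))))"
      proof (rule order_trans[OF sum_abs], rule sum_mono)
        fix k assume "k \<in> {..n}"
        then have "\<bar>(real k / real n) ^ j - real (k choose j) / real (n choose j)\<bar> \<le> real j * (real j / real (n - j))"
          using choose_quotient_approx[of k n j] n by (simp add: abs_minus_commute)
        then show "\<bar>weight n u k * ((real k / real n) ^ j - real (k choose j) / real (n choose j))\<bar>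
          \<le> weight n u k * (real j * (real j / real (n - j)))"
          unfolding abs_mult using weight_nonneg by (intro mult_mono) auto
      qed
      also have "\<dots> = (norm u)\<^sup>2 * (real j * (real j / real (n - j)))"
        by (simp only: sum_distrib_right[symmetric] sum_weight)
      finally show "norm ((\<Sum>k\<le>n. weight n u k * (real k / real n) ^ j)
          - (\<Sum>k\<le>n. weight n u k * (real (k choose j) / real (n choose j))))
        \<le> (norm u)\<^sup>2 * (real j * (real j / real (n - j)))" .
    qed
    have "(\<lambda>n. real j / real n) \<longlonglongrightarrow> 0" by (rule lim_const_over_n)
    then have "(\<lambda>n. real j / real (n - j)) \<longlonglongrightarrow> 0" by (subst LIMSEQ_offset[of _ j]; simp)
    then show "(\<lambda>n. (norm u)\<^sup>2 * (real j * (real j / real (n - j)))) \<longlonglongrightarrow> 0"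
      by (intro tendsto_mult_right_zero)
  qed
qed

definition clamp01 :: "real \<Rightarrow> real" where "clamp01 x = max 0 (min 1 x)"

lemma unit_measure_exists:
  assumes u: "norm u = 1"
  shows "\<exists>M. sets M = sets borel \<and> emeasure M UNIV = 1 \<and> (AE x in M. x \<in> {0..1})
    \<and> (\<forall>j. (LINT x|M. indicat_real {0..1} x * x ^ j) = inner ((B ^^ j) u) u)"
proof -
  have rd: "real_distribution (bernstein_measure n u)" for n
  proof -
    have "emeasure (bernstein_measure n u) (space (bernstein_measure n u)) = 1"
      using emeasure_bernstein_measure[of UNIV n u] u by (simp add: bernstein_measure_def)
    then show ?thesis
      by (auto simp: real_distribution_def real_distribution_axioms_def bernstein_measure_def intro: prob_spaceI)
  qed
  have "tight (\<lambda>n. bernstein_measure n u)"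
    unfolding tight_def
  proof (intro conjI allI impI)
    fix e :: real assume e: "e > 0"
    \<comment> \<open>The interval of tightness is open on the left; it starts at -1 so as to
      contain a possible atom at 0.\<close>
    have "measure (bernstein_measure n u) {-1<..1} = 1" for n
      using emeasure_bernstein_measure[of "{-1<..1}" n u] u by (simp add: measure_def subset_eq)
    then have "\<forall>n. 1 - e < measure (bernstein_measure n u) {-1<..1}" using e by simp
    then show "\<exists>a b. a < b \<and> (\<forall>n. 1 - e < measure (bernstein_measure n u) {a<..b})"
      by (intro exI[of _ "-1"] exI[of _ 1]) simp
  qed (rule rd)
  then obtain r M where r: "strict_mono r" and M: "real_distribution M"
    and wc: "weak_conv_m ((\<lambda>n. bernstein_measure n u) \<circ> id \<circ> r) M"
    using tight_imp_convergent_subsubsequence[of _ id] strict_mono_id by (metis id_def)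
  interpret M: real_distribution M by fact
  have conv: "(\<lambda>n. LINT x|bernstein_measure (r n) u. h x) \<longlonglongrightarrow> (LINT x|M. h x)"
    if h: "continuous_on UNIV h" "\<And>x. \<bar>h x\<bar> \<le> K" for h :: "real \<Rightarrow> real" and K
  proof -
    have "isCont h x" for x using h(1) by (simp add: continuous_on_eq_continuous_at)
    then show ?thesis
      using weak_conv_imp_integral_bdd_continuous_conv[OF _ M wc, of h K] rd h(2) by (simp add: comp_def)
  qed
  \<comment> \<open>A bounded continuous function that vanishes exactly on [0,1]. Its integrals pass
    to the weak limit, which confines the limit measure to [0,1].\<close>
  have "(LINT x|M. min 1 \<bar>x - clamp01 x\<bar>) = 0"
  proof (rule LIMSEQ_unique[OF conv[of _ 1]])
    have ci: "continuous_on UNIV (\<lambda>x. min 1 \<bar>x - clamp01 x\<bar>)"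
      unfolding clamp01_def by (intro continuous_intros)
    then show "continuous_on UNIV (\<lambda>x. min 1 \<bar>x - clamp01 x\<bar>)" .
    have "clamp01 (real k / real n) = real k / real n" if "k \<le> n" for k n
      using nat_fraction_le_one[OF that] by (simp add: clamp01_def)
    then have "(LINT x|bernstein_measure n u. min 1 \<bar>x - clamp01 x\<bar>) = 0" for n
      by (subst integral_bernstein_measure) (auto intro!: borel_measurable_continuous_onI ci sum.neutral)
    then show "(\<lambda>n. LINT x|bernstein_measure (r n) u. min 1 \<bar>x - clamp01 x\<bar>) \<longlonglongrightarrow> 0" by simp
  qed auto
  moreover have "integrable M (\<lambda>x. min 1 \<bar>x - clamp01 x\<bar>)"
    by (rule M.integrable_const_bound[of _ 1]) (auto simp: clamp01_def)
  ultimately have "AE x in M. min 1 \<bar>x - clamp01 x\<bar> = 0"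
    by (subst (asm) integral_nonneg_eq_0_iff_AE) auto
  then have AE: "AE x in M. x \<in> {0..1}"
    by eventually_elim (auto simp: clamp01_def min_def max_def abs_if split: if_splits)
  have "(LINT x|M. indicat_real {0..1} x * x ^ j) = inner ((B ^^ j) u) u" for j
  proof -
    \<comment> \<open>The power is replaced by a bounded continuous function that agrees with it on
      [0,1], so that weak convergence applies.\<close>
    have ci: "continuous_on UNIV (\<lambda>x. clamp01 x ^ j)"
      unfolding clamp01_def by (intro continuous_intros)
    have "(LINT x|M. indicat_real {0..1} x * x ^ j) = (LINT x|M. clamp01 x ^ j)"
    proof (rule integral_cong_AE)
      show "AE x in M. indicat_real {0..1} x * x ^ j = clamp01 x ^ j"
        using AE by eventually_elim (auto simp: clamp01_def)
      show "(\<lambda>x. clamp01 x ^ j) \<in> borel_measurable M"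
        using borel_measurable_continuous_onI[OF ci] by simp
    qed simp
    also have "\<dots> = inner ((B ^^ j) u) u"
    proof (rule LIMSEQ_unique[OF conv[OF ci, of 1]])
      show "\<bar>clamp01 x ^ j\<bar> \<le> 1" for x
        unfolding power_abs by (rule power_le_one) (auto simp: clamp01_def)
      have "clamp01 (real k / real n) = real k / real n" if "k \<le> n" for k n
        using nat_fraction_le_one[OF that] by (simp add: clamp01_def)
      then have "(LINT x|bernstein_measure n u. clamp01 x ^ j) = (\<Sum>k\<le>n. weight n u k * (real k / real n) ^ j)" for n
        by (subst integral_bernstein_measure) (auto intro!: borel_measurable_continuous_onI ci sum.cong)
      then show "(\<lambda>n. LINT x|bernstein_measure (r n) u. clamp01 x ^ j) \<longlonglongrightarrow> inner ((B ^^ j) u) u"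
        using LIMSEQ_subseq_LIMSEQ[OF bernstein_moment r] by (simp add: comp_def)
    qed
    finally show ?thesis .
  qed
  then show ?thesis using AE M.emeasure_space_1 by (intro exI[of _ M]) simp
qed

text \<open>The weak compactness used is that of probability measures. A nonzero vector is
  normalized and the measure rescaled by |u|^2; the zero vector receives the null measure.\<close>

lemma moment_measure_exists:
  "\<exists>M. sets M = sets borel \<and> emeasure M UNIV = ennreal ((norm u)\<^sup>2) \<and> (AE x in M. x \<in> {0..1})
    \<and> (\<forall>j. (LINT x|M. indicat_real {0..1} x * x ^ j) = inner ((B ^^ j) u) u)"
proof (cases "u = 0")
  case True
  have "(B ^^ j) 0 = 0" for j
    using symmetric_op_funpow[OF symmetric] by (auto simp: symmetric_op_def bounded_linear.linear linear_0)
  then show ?thesis using True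
    by (intro exI[of _ "null_measure borel"]) (auto simp: eventually_ae_filter null_sets_def intro!: exI[of _ "UNIV"])
next
  case False
  define v where "v = inverse (norm u) *\<^sub>R u"
  have v: "norm v = 1" "u = norm u *\<^sub>R v" using False by (auto simp: v_def)
  obtain M where M: "sets M = sets borel" "emeasure M UNIV = 1" "AE x in M. x \<in> {0..1}"
    "\<And>j. (LINT x|M. indicat_real {0..1} x * x ^ j) = inner ((B ^^ j) v) v"
    using unit_measure_exists[OF v(1)] by metis
  define N where "N = density M (\<lambda>x. ennreal ((norm u)\<^sup>2))"
  have "sets N = sets borel" by (simp add: N_def M)
  moreover have "emeasure N UNIV = ennreal ((norm u)\<^sup>2)"
    unfolding N_def using M by (subst emeasure_density_const) auto
  moreover have "AE x in N. x \<in> {0..1}"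
    unfolding N_def by (subst AE_density) (use M(3) in auto)
  moreover have "(LINT x|N. indicat_real {0..1} x * x ^ j) = inner ((B ^^ j) u) u" for j
  proof -
    have [measurable]: "(\<lambda>x. indicat_real {0..1} x * x ^ j) \<in> borel_measurable M"
      using M(1) by (simp cong: measurable_cong_sets)
    have "(LINT x|N. indicat_real {0..1} x * x ^ j) = (norm u)\<^sup>2 * inner ((B ^^ j) v) v"
      unfolding N_def by (subst integral_density) (auto simp: M(4)[symmetric] mult.assoc[symmetric] integral_mult_right_zero[symmetric] simp del: integral_mult_right_zero)
    also have "\<dots> = inner ((B ^^ j) u) u"
    proof -
      have "(B ^^ j) u = norm u *\<^sub>R (B ^^ j) v"
        using symmetric_op_funpow[OF symmetric, of j] v(2)
        by (metis symmetric_op_def bounded_linear.linear linear_scale)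
      then have "inner ((B ^^ j) u) u = norm u * (inner ((B ^^ j) v) (norm u *\<^sub>R v))"
        using v(2) by (metis inner_scaleR_left)
      then show ?thesis by (simp add: power2_eq_square)
    qed
    finally show ?thesis .
  qed
  ultimately show ?thesis by blast
qed

text \<open>The measures are chosen separately for each vector. That they fit together is deduced
  from their moments, which are quadratic forms in the vector and multiplicative in the
  exponent.\<close>

lemma spectral_family_exists:
  obtains \<mu> where "spectral_family \<mu>" "\<And>u. AE x in \<mu> u. x \<in> {0..1}"
    "\<And>j u. (LINT x|\<mu> u. indicat_real {0..1} x * x ^ j) = inner ((B ^^ j) u) u"
proof -
  obtain \<mu> where \<mu>: "\<And>u. sets (\<mu> u) = sets borel" "\<And>u. emeasure (\<mu> u) UNIV = ennreal ((norm u)\<^sup>2)"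
    "\<And>u. AE x in \<mu> u. x \<in> {0..1}"
    "\<And>j u. (LINT x|\<mu> u. indicat_real {0..1} x * x ^ j) = inner ((B ^^ j) u) u"
    using moment_measure_exists by metis
  interpret finite_family \<mu> by standard (use \<mu> in auto)
  let ?u = "indicat_real {0..1}"
  have pb: "bounded_borel (\<lambda>x. ?u x * x ^ j)" for j
    by (rule bounded_borelI[of _ 1]) (auto simp: indicator_def power_le_one)
  have ub: "bounded_borel ?u" by (rule bounded_borel_indicator) simp
  \<comment> \<open>Since the measures live on [0,1], its indicator can be inserted freely; it makes
    the powers bounded on the whole line.\<close>
  have AEu: "(LINT x|\<mu> u. ?u x * g x) = (LINT x|\<mu> u. g x)" if "bounded_borel g" for g u
    by (rule integral_cong_AE)
      (use that ub \<mu>(3)[of u] in \<open>auto intro!: measurable_mu bounded_borel_measurable bounded_borel_mult elim: eventually_mono\<close>)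
  have quad: "quad_form (\<lambda>u. LINT x|\<mu> u. ?u x * g x)" if "bounded_borel g" for g
    using that
  proof (induction rule: unit_interval_induct)
    case (power n)
    show ?case unfolding \<mu>(4) by (rule symmetric_op_quad_form[OF symmetric_op_funpow[OF symmetric]])
  next
    case (lincomb a g h)
    then show ?case using quad_form_lincomb by (simp add: integrable_mu)
  next
    case (limit g C G)
    show ?case by (rule quad_form_limit[OF limit(5)]) (rule integral_mu_limit[OF limit(1-3)])
  qed
  interpret measure_family \<mu>
  proof
    fix S :: "real set" assume S: "S \<in> sets borel"
    show "quad_form (\<lambda>u. measure (\<mu> u) S)"
      using quad[OF bounded_borel_indicator[OF S]] S by (simp add: AEu bounded_borel_indicator)
  qed
  have Phi_u: "Phi (\<lambda>x. ?u x * g x) = Phi g" if "bounded_borel g" for g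
    by (rule Phi_unique[OF bounded_borel_mult[OF ub that] Phi_symmetric[OF that]])
      (simp add: AEu that Phi_quad)
  have Phi_pow: "Phi (\<lambda>x. ?u x * x ^ j) = B ^^ j" for j
    by (rule Phi_unique[OF pb symmetric_op_funpow[OF symmetric]]) (simp add: \<mu>(4))
  \<comment> \<open>With a power on the left, multiplicativity is carried from B^j B^n = B^(j+n) to
    all right factors; \<open>m2\<close> then varies the left factor.\<close>
  have m1: "Phi (\<lambda>x. ?u x * x ^ j) (Phi (\<lambda>x. ?u x * g x) v) = Phi (\<lambda>x. (?u x * x ^ j) * (?u x * g x)) v"
    if "bounded_borel g" for g j v
    using that
  proof (induction rule: unit_interval_induct)
    case (power n)
    have "(\<lambda>x. (?u x * x ^ j) * (?u x * x ^ n)) = (\<lambda>x. ?u x * x ^ (j + n))"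
      by (auto simp: indicator_def power_add)
    then show ?case by (simp only: Phi_pow funpow_add comp_apply)
  next
    case (lincomb a g h)
    interpret bounded_linear "Phi (\<lambda>x. ?u x * x ^ j)" using pb by (rule Phi_linear)
    have "(\<lambda>x. (?u x * x ^ j) * (a * g x + h x)) = (\<lambda>x. a * ((?u x * x ^ j) * g x) + (?u x * x ^ j) * h x)"
      by (auto simp: algebra_simps)
    then show ?case using lincomb pb by (simp add: Phi_lincomb bounded_borel_mult add scaleR)
  next
    case (limit g C G)
    have "inner (Phi (\<lambda>x. ?u x * x ^ j) (Phi G v)) w = inner (Phi (\<lambda>x. (?u x * x ^ j) * G x) v) w" for w
    proof (rule LIMSEQ_unique)
      show "(\<lambda>n. inner (Phi (\<lambda>x. ?u x * x ^ j) (Phi (g n) v)) w) \<longlonglongrightarrow> inner (Phi (\<lambda>x. ?u x * x ^ j) (Phi G v)) w"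
        unfolding Phi_inner[OF pb] by (rule Phi_weak_limit[OF limit(1-3)])
      show "(\<lambda>n. inner (Phi (\<lambda>x. ?u x * x ^ j) (Phi (g n) v)) w) \<longlonglongrightarrow> inner (Phi (\<lambda>x. (?u x * x ^ j) * G x) v) w"
        unfolding limit(5)
      proof (rule Phi_weak_limit[of _ "1 * C"])
        show "\<bar>(?u x * x ^ j) * g n x\<bar> \<le> 1 * C" for n x
          unfolding abs_mult[of "?u x * x ^ j"]
          by (intro mult_mono limit) (auto simp: indicator_def power_le_one)
      qed (auto intro!: tendsto_intros bounded_borel_mult limit pb)
    qed
    then show ?case by (metis vector_eq_rdot)
  qed
  have m2: "Phi (\<lambda>x. ?u x * h x) (Phi (\<lambda>x. ?u x * g x) v) = Phi (\<lambda>x. (?u x * h x) * (?u x * g x)) v"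
    if g: "bounded_borel g" and "bounded_borel h" for g h v
    using that(2)
  proof (induction rule: unit_interval_induct)
    case (power n) show ?case by (rule m1[OF g])
  next
    case (lincomb a h k)
    have "(\<lambda>x. (a * h x + k x) * (?u x * g x)) = (\<lambda>x. a * (h x * (?u x * g x)) + k x * (?u x * g x))"
      by (auto simp: algebra_simps)
    then show ?case using lincomb ub g by (simp add: Phi_lincomb bounded_borel_mult)
  next
    case (limit h C H)
    obtain K where K: "0 \<le> K" "\<And>x. \<bar>?u x * g x\<bar> \<le> K" using bounded_borel_bound[OF bounded_borel_mult[OF ub g]] by metis
    have C0: "0 \<le> C" using limit(2)[of 0 0] by linarith
    have "inner (Phi H (Phi (\<lambda>x. ?u x * g x) v)) w = inner (Phi (\<lambda>x. H x * (?u x * g x)) v) w" for w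
    proof (rule LIMSEQ_unique)
      show "(\<lambda>n. inner (Phi (h n) (Phi (\<lambda>x. ?u x * g x) v)) w) \<longlonglongrightarrow> inner (Phi H (Phi (\<lambda>x. ?u x * g x) v)) w"
        by (rule Phi_weak_limit[OF limit(1-3)])
      show "(\<lambda>n. inner (Phi (h n) (Phi (\<lambda>x. ?u x * g x) v)) w) \<longlonglongrightarrow> inner (Phi (\<lambda>x. H x * (?u x * g x)) v) w"
        unfolding limit(5)
      proof (rule Phi_weak_limit[of _ "C * K"])
        show "\<bar>h n x * (?u x * g x)\<bar> \<le> C * K" for n x
          unfolding abs_mult[of "h n x"] by (intro mult_mono limit K C0) auto
      qed (auto intro!: tendsto_intros bounded_borel_mult limit ub g)
    qed
    then show ?case by (metis vector_eq_rdot)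
  qed
  have "spectral_family \<mu>"
  proof
    fix S T' :: "real set" and v assume S: "S \<in> sets borel" and T': "T' \<in> sets borel"
    note b = bounded_borel_indicator
    have e: "(\<lambda>x. (?u x * indicat_real S x) * (?u x * indicat_real T' x)) = (\<lambda>x. ?u x * indicat_real (S \<inter> T') x)"
      by (auto simp: indicator_def)
    show "Phi (indicator S) (Phi (indicator T') v) = Phi (indicator (S \<inter> T')) v"
      using m2[OF b[OF T'] b[OF S], of v] S T' unfolding e by (simp add: Phi_u b)
  qed
  then show thesis using that \<mu> by blast
qed

end

section \<open>The resolvent of a nonnegative self-adjoint operator\<close>

locale nonneg_self_adjoint =
  fixes D :: "'a::{real_inner,complete_space} set" and A :: "'a \<Rightarrow> 'a"
  assumes self_adjoint: "self_adjoint D A" and nonneg: "nonneg_operator D A"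
begin

lemma subspace_D: "subspace D"
  and A_add: "u \<in> D \<Longrightarrow> v \<in> D \<Longrightarrow> A (u + v) = A u + A v"
  and A_scale: "u \<in> D \<Longrightarrow> A (c *\<^sub>R u) = c *\<^sub>R A u"
  using self_adjoint by (auto simp: self_adjoint_def linear_operator_def)

lemma A_diff: "u \<in> D \<Longrightarrow> v \<in> D \<Longrightarrow> A (u - v) = A u - A v"
  using A_add[of u "-1 *\<^sub>R v"] A_scale[of v "-1"] subspace_scale[OF subspace_D, of v "-1"] by simp

lemma A_symmetric: assumes "u \<in> D" "v \<in> D" shows "inner (A u) v = inner u (A v)"
proof -
  have "(v, A v) \<in> adjoint_graph D A" using self_adjoint assms(2) by (auto simp: self_adjoint_def)
  then show ?thesis using assms(1) by (auto simp: adjoint_graph_def)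
qed

text \<open>The half of self-adjointness that produces elements of the domain: a vector that
  satisfies the equation weakly lies in \<open>D\<close>.\<close>

lemma A_adjoint: "(\<And>u. u \<in> D \<Longrightarrow> inner (A u) v = inner u w) \<Longrightarrow> v \<in> D \<and> w = A v"
proof -
  assume "\<And>u. u \<in> D \<Longrightarrow> inner (A u) v = inner u w"
  then have "(v, w) \<in> adjoint_graph D A" by (auto simp: adjoint_graph_def)
  then show ?thesis using self_adjoint by (auto simp: self_adjoint_def)
qed

lemma A_nonneg: "u \<in> D \<Longrightarrow> 0 \<le> inner (A u) u"
  using nonneg by (auto simp: nonneg_operator_def)

lemma shift_norm: assumes "u \<in> D" shows "norm u \<le> norm (u + A u)"
proof (rule norm_le_by_inner)
  have "inner u u \<le> inner u (u + A u)" using A_nonneg[OF assms] by (simp add: inner_add_right inner_commute)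
  also have "\<dots> \<le> norm (u + A u) * norm u" using norm_cauchy_schwarz[of u "u + A u"] by (simp add: mult.commute)
  finally show "inner u u \<le> norm (u + A u) * norm u" .
qed simp

text \<open>By \<open>shift_norm\<close> the range of 1 + A is closed. A vector v orthogonal to it
  satisfies A v = -v, which nonnegativity permits only for v = 0.\<close>

lemma shift_surjective: "\<exists>u\<in>D. u + A u = w"
proof -
  define M where "M = (\<lambda>u. u + A u) ` D"
  have "subspace M"
    unfolding subspace_def
  proof (intro conjI ballI allI)
    show "0 \<in> M" using subspace_0[OF subspace_D] A_scale[of 0 0] by (auto simp: M_def intro!: image_eqI[of _ _ 0])
    show "x + y \<in> M" if "x \<in> M" "y \<in> M" for x y
    proof -
      obtain u v where "u \<in> D" "x = u + A u" "v \<in> D" "y = v + A v" using \<open>x \<in> M\<close> \<open>y \<in> M\<close> by (auto simp: M_def)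
      then show ?thesis unfolding M_def
        by (intro image_eqI[of _ _ "u + v"]) (auto simp: A_add subspace_add[OF subspace_D])
    qed
    show "c *\<^sub>R x \<in> M" if "x \<in> M" for c x
    proof -
      obtain u where "u \<in> D" "x = u + A u" using \<open>x \<in> M\<close> by (auto simp: M_def)
      then show ?thesis unfolding M_def
        by (intro image_eqI[of _ _ "c *\<^sub>R u"]) (auto simp: A_scale subspace_scale[OF subspace_D] scaleR_add_right)
    qed
  qed
  moreover have "closed M"
    unfolding closed_sequential_limits
  proof (intro allI impI, elim conjE)
    fix y l assume "\<forall>n. y n \<in> M" and l: "y \<longlonglongrightarrow> l"
    then have "\<forall>n. \<exists>v. v \<in> D \<and> y n = v + A v" by (auto simp: M_def)
    then obtain u where u: "\<And>n. u n \<in> D" "\<And>n. y n = u n + A (u n)" by metis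
    have "Cauchy u"
    proof (rule metric_CauchyI)
      fix e :: real assume "e > 0"
      then obtain N where N: "\<And>m n. m \<ge> N \<Longrightarrow> n \<ge> N \<Longrightarrow> dist (y m) (y n) < e"
        using metric_CauchyD[OF LIMSEQ_imp_Cauchy[OF l]] by metis
      have "dist (u m) (u n) \<le> dist (y m) (y n)" for m n
        using shift_norm[OF subspace_diff[OF subspace_D u(1) u(1)], of m n]
        by (simp add: dist_norm u A_diff algebra_simps)
      then show "\<exists>N. \<forall>m\<ge>N. \<forall>n\<ge>N. dist (u m) (u n) < e" using N by (meson le_less_trans)
    qed
    then obtain v where v: "u \<longlonglongrightarrow> v" using Cauchy_convergent_iff convergent_def by blast
    have Av: "(\<lambda>n. A (u n)) \<longlonglongrightarrow> l - v" using tendsto_diff[OF l v] u by simp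
    have "v \<in> D \<and> l - v = A v"
    proof (rule A_adjoint)
      fix x assume x: "x \<in> D"
      have "(\<lambda>n. inner (A x) (u n)) \<longlonglongrightarrow> inner (A x) v" by (intro tendsto_intros v)
      moreover have "(\<lambda>n. inner (A x) (u n)) \<longlonglongrightarrow> inner x (l - v)"
        unfolding A_symmetric[OF x u(1)] by (intro tendsto_intros Av)
      ultimately show "inner (A x) v = inner x (l - v)" by (rule LIMSEQ_unique)
    qed
    then show "l \<in> M" unfolding M_def by (intro image_eqI[of _ _ v]) (auto simp: algebra_simps)
  qed
  ultimately obtain y where y: "y \<in> M" "\<forall>z\<in>M. inner (w - y) z = 0"
    using closed_subspace_projection by metis
  have "w - y \<in> D \<and> - (w - y) = A (w - y)"
  proof (rule A_adjoint)
    fix u assume "u \<in> D"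
    then have "inner (w - y) (u + A u) = 0" using y(2) by (auto simp: M_def)
    then show "inner (A u) (w - y) = inner u (- (w - y))"
      unfolding inner_minus_right by (simp add: inner_add_right inner_commute[of "w - y"])
  qed
  then have "inner (A (w - y)) (w - y) = - inner (w - y) (w - y)" by (metis inner_minus_left)
  moreover have "0 \<le> inner (A (w - y)) (w - y)" using A_nonneg \<open>w - y \<in> D \<and> _\<close> by blast
  ultimately have "inner (w - y) (w - y) = 0" using inner_ge_zero[of "w - y"] by linarith
  then have wy: "w = y" by simp
  have "w \<in> M" by (subst wy) (rule y(1))
  then obtain u where "w = u + A u" "u \<in> D" unfolding M_def by (rule imageE)
  then show ?thesis by blast
qed

definition resolvent :: "'a \<Rightarrow> 'a" where "resolvent w = (SOME u. u \<in> D \<and> u + A u = w)"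

lemma resolvent: "resolvent w \<in> D" "resolvent w + A (resolvent w) = w"
  using someI_ex[of "\<lambda>u. u \<in> D \<and> u + A u = w"] shift_surjective unfolding resolvent_def by blast+

lemma resolvent_eq: assumes "u \<in> D" shows "resolvent (u + A u) = u"
proof -
  define v where "v = resolvent (u + A u) - u"
  have v: "v \<in> D" "v + A v = 0"
    using assms resolvent[of "u + A u"]
    by (auto simp: v_def A_diff algebra_simps intro: subspace_diff[OF subspace_D])
  then show ?thesis using shift_norm[OF v(1)] by (simp add: v_def)
qed

lemma unit_operator_resolvent: "unit_operator resolvent"
proof
  have nr: "norm (resolvent w) \<le> norm w" for w
    using shift_norm[OF resolvent(1)[of w]] by (simp add: resolvent(2))
  show "symmetric_op resolvent"
    unfolding symmetric_op_def
  proof (intro conjI allI)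
    show "bounded_linear resolvent"
    proof (rule bounded_linear_intro[where K = 1])
      show "resolvent (x + y) = resolvent x + resolvent y" for x y
      proof -
        have "resolvent ((resolvent x + resolvent y) + A (resolvent x + resolvent y)) = resolvent x + resolvent y"
          by (rule resolvent_eq) (intro subspace_add[OF subspace_D] resolvent)
        moreover have "(resolvent x + resolvent y) + A (resolvent x + resolvent y)
            = (resolvent x + A (resolvent x)) + (resolvent y + A (resolvent y))"
          by (simp add: A_add resolvent(1))
        ultimately show ?thesis unfolding resolvent(2) by simp
      qed
      show "resolvent (c *\<^sub>R x) = c *\<^sub>R resolvent x" for c x
      proof -
        have "resolvent (c *\<^sub>R resolvent x + A (c *\<^sub>R resolvent x)) = c *\<^sub>R resolvent x"
          by (rule resolvent_eq) (intro subspace_scale[OF subspace_D] resolvent)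
        moreover have "c *\<^sub>R resolvent x + A (c *\<^sub>R resolvent x) = c *\<^sub>R (resolvent x + A (resolvent x))"
          by (simp add: A_scale resolvent(1) scaleR_add_right)
        ultimately show ?thesis unfolding resolvent(2) by simp
      qed
      show "norm (resolvent x) \<le> norm x * 1" for x using nr by simp
    qed
    fix w z
    have "inner (resolvent w) (resolvent z + A (resolvent z)) = inner (resolvent w + A (resolvent w)) (resolvent z)"
      using A_symmetric[OF resolvent(1) resolvent(1)] by (simp add: inner_add_left inner_add_right)
    then show "inner (resolvent w) z = inner w (resolvent z)" by (simp only: resolvent(2))
  qed
  fix w
  have "inner (resolvent w) (resolvent w + A (resolvent w)) = inner (resolvent w) w" by (simp only: resolvent(2))
  then show "0 \<le> inner (resolvent w) w"
    using A_nonneg[OF resolvent(1)[of w]] by (simp add: inner_add_right inner_commute)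
       (metis add_nonneg_nonneg inner_ge_zero)
  have "inner (resolvent w) w \<le> norm (resolvent w) * norm w" by (rule norm_cauchy_schwarz)
  also have "\<dots> \<le> (norm w)\<^sup>2" using nr by (simp add: power2_eq_square mult_right_mono)
  finally show "inner (resolvent w) w \<le> (norm w)\<^sup>2" .
qed

end

sublocale nonneg_self_adjoint \<subseteq> R: unit_operator resolvent
  by (rule unit_operator_resolvent)

context nonneg_self_adjoint
begin

text \<open>The measures of the resolvent are pushed forward by \<open>\<phi>\<close>. The point is
  that the resulting domain is exactly \<open>D\<close>, neither larger nor smaller, and that the
  integral of the identity is \<open>A\<close> on it.\<close>

lemma spectral_resolution_exists: "\<exists>E. spectral_resolution_of E D A"
proof -
  obtain \<mu> where sf: "spectral_family \<mu>" and AE: "\<And>u. AE x in \<mu> u. x \<in> {0..1}"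
    and pow: "\<And>j u. (LINT x|\<mu> u. indicat_real {0..1} x * x ^ j) = inner ((resolvent ^^ j) u) u"
    using R.spectral_family_exists by metis
  interpret spectral_family \<mu> by (rule sf)
  define \<iota> where "\<iota> x = indicat_real {0..1} x * x" for x :: real
  \<comment> \<open>At 0 the division convention gives the value -1. No spectral mass sits there, as
    the vector \<open>z\<close> below shows.\<close>
  define \<phi> where "\<phi> x = 1 / x - 1" for x :: real
  have \<phi>[measurable]: "\<phi> \<in> borel_measurable borel" unfolding \<phi>_def[abs_def] by measurable
  have \<iota>b: "bounded_borel \<iota>"
    unfolding \<iota>_def[abs_def] by (rule bounded_borelI[of _ 1]) (auto simp: indicator_def)
  have Phi_\<iota>: "Phi \<iota> = resolvent"
    by (rule Phi_unique[OF \<iota>b R.symmetric]) (use pow[of _ 1] in \<open>simp add: \<iota>_def[abs_def]\<close>)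
  define E where "E S = Phi (\<lambda>x. indicator S (\<phi> x))" for S
  have E: "projection_valued_measure E" and Em: "spectral_scalar_measure E u = distr (\<mu> u) borel \<phi>" for u
    using pvm_of_spectral_family[OF \<phi>] unfolding E_def[abs_def] by blast+
  interpret E: pvm E by standard (rule E)
  have dom_E: "E.dom (\<lambda>x. x) = dom \<phi>"
    unfolding E.dom_def dom_def Em by (subst nn_integral_distr) (auto intro: measurable_mu)
  have \<iota>\<phi>: "\<iota> x * \<phi> x = indicat_real {0<..1} x * (1 - x)" for x
    by (auto simp: \<iota>_def \<phi>_def indicator_def field_simps)
  have \<iota>\<phi>b: "bounded_borel (\<lambda>x. \<iota> x * \<phi> x)"
    unfolding \<iota>\<phi> by (rule bounded_borelI[of _ 1]) (auto simp: indicator_def)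
  \<comment> \<open>An element of \<open>D\<close> lies in the range of the resolvent, and the
    factor \<open>\<iota>\<close> so gained makes the integrand bounded by 1.\<close>
  have D1: "u \<in> dom \<phi>" if "u \<in> D" for u
  proof -
    have u: "u = Phi \<iota> (u + A u)" unfolding Phi_\<iota> using resolvent_eq[OF that] by simp
    have "(\<integral>\<^sup>+x. ennreal ((\<phi> x)\<^sup>2) \<partial>\<mu> u) = (\<integral>\<^sup>+x. ennreal ((\<iota> x * \<phi> x)\<^sup>2) \<partial>\<mu> (u + A u))"
      by (subst u, subst nn_integral_mu_Phi[OF \<iota>b]) (auto simp: ennreal_mult[symmetric] power_mult_distrib)
    also have "\<dots> \<le> (\<integral>\<^sup>+x. 1 \<partial>\<mu> (u + A u))"
      unfolding \<iota>\<phi> by (intro nn_integral_mono) (auto simp: indicator_def power_le_one)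
    also have "\<dots> < \<infinity>" by (simp add: mass)
    finally show ?thesis by (simp add: dom_def)
  qed
  have D2: "u \<in> D" if u: "u \<in> dom \<phi>" for u
  proof -
    obtain w where w: "(\<lambda>n. Phi (cut \<phi> n) u) \<longlonglongrightarrow> w" using Phi_cut_convergent[OF \<phi> u] by metis
    note cb = bounded_borel_cut[OF \<phi>]
    have l1: "(\<lambda>n. Phi \<iota> (Phi (cut \<phi> n) u)) \<longlonglongrightarrow> Phi \<iota> w"
      by (rule bounded_linear.tendsto[OF Phi_linear[OF \<iota>b] w])
    have "(\<lambda>n. Phi \<iota> (Phi (cut \<phi> n) u)) \<longlonglongrightarrow> Phi (\<lambda>x. \<iota> x * \<phi> x) u"
      unfolding Phi_mult[OF \<iota>b cb]
    proof (rule Phi_limit[of _ 1])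
      show "bounded_borel (\<lambda>x. \<iota> x * cut \<phi> n x)" for n by (intro bounded_borel_mult \<iota>b cb)
      show "\<bar>\<iota> x * cut \<phi> n x\<bar> \<le> 1" for n x
      proof -
        have "\<bar>\<iota> x * cut \<phi> n x\<bar> \<le> \<bar>\<iota> x * \<phi> x\<bar>" by (auto simp: cut_def)
        also have "\<dots> \<le> 1" unfolding \<iota>\<phi> by (auto simp: indicator_def)
        finally show ?thesis .
      qed
      show "(\<lambda>n. \<iota> x * cut \<phi> n x) \<longlonglongrightarrow> \<iota> x * \<phi> x" for x by (intro tendsto_intros cut_tendsto)
    qed
    then have e1: "Phi \<iota> w = Phi (\<lambda>x. \<iota> x * \<phi> x) u" using l1 LIMSEQ_unique by blast
    \<comment> \<open>On (0,1] the sum \<open>\<iota> x * \<phi> x + \<iota> x\<close> equals 1, so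
      \<open>z\<close> is the part of \<open>u\<close> carried by the complement of (0,1]. The
      resolvent annihilates it and is injective.\<close>
    define z where "z = Phi (\<lambda>x. 1 - (\<iota> x * \<phi> x + \<iota> x)) u"
    have zb: "bounded_borel (\<lambda>x. \<iota> x * \<phi> x + \<iota> x)" by (intro bounded_borel_add \<iota>\<phi>b \<iota>b)
    have "Phi \<iota> z = Phi (\<lambda>x. 0) u"
    proof -
      have "(\<lambda>x. \<iota> x * (1 - (\<iota> x * \<phi> x + \<iota> x))) = (\<lambda>x. 0)"
        unfolding \<iota>\<phi> by (auto simp: \<iota>_def indicator_def)
      then show ?thesis unfolding z_def
        by (simp add: Phi_mult \<iota>b bounded_borel_diff bounded_borel_const zb)
    qed
    then have "resolvent z = 0" by (simp add: Phi_\<iota> Phi_zero)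
    then have "z = 0" using resolvent(2)[of z] A_scale[of 0 0] subspace_0[OF subspace_D] by simp
    then have "u = Phi (\<lambda>x. \<iota> x * \<phi> x + \<iota> x) u"
      using Phi_diff[OF bounded_borel_const[of 1] zb, of u] by (simp add: z_def Phi_one)
    also have "\<dots> = Phi \<iota> (w + u)"
      using e1 Phi_linear[OF \<iota>b] by (simp add: Phi_add \<iota>\<phi>b \<iota>b bounded_linear.linear linear_add)
    finally show ?thesis using resolvent(1)[of "w + u"] by (simp add: Phi_\<iota>)
  qed
  have D: "D = dom \<phi>" using D1 D2 by auto
  \<comment> \<open>Writing s as the resolvent of s + A s brings in the density \<iota>^2, which
    turns \<open>\<phi>\<close> into the bounded function \<iota> - \<iota>^2.\<close>
  have quad: "(LINT x|spectral_scalar_measure E s. x) = inner (A s) s" if "s \<in> D" for s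
  proof -
    have s: "s = Phi \<iota> (s + A s)" unfolding Phi_\<iota> using resolvent_eq[OF that] by simp
    have e: "(\<iota> x)\<^sup>2 * \<phi> x = \<iota> x - \<iota> x * \<iota> x" for x
      by (auto simp: \<iota>_def \<phi>_def indicator_def field_simps power2_eq_square)
    have "(LINT x|spectral_scalar_measure E s. x) = (LINT x|\<mu> s. \<phi> x)"
      unfolding Em by (subst integral_distr) (auto intro: measurable_mu)
    also have "\<dots> = (LINT x|\<mu> (s + A s). (\<iota> x)\<^sup>2 * \<phi> x)"
      by (subst s, subst mu_Phi[OF \<iota>b], subst integral_density)
        (auto intro!: measurable_mu borel_measurable_power bounded_borel_measurable \<iota>b)
    also have "\<dots> = inner (Phi (\<lambda>x. \<iota> x - \<iota> x * \<iota> x) (s + A s)) (s + A s)"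
      unfolding e by (simp add: Phi_quad \<iota>b bounded_borel_diff bounded_borel_mult)
    also have "Phi (\<lambda>x. \<iota> x - \<iota> x * \<iota> x) (s + A s) = s - resolvent s"
      using resolvent_eq[OF that]
      by (simp add: Phi_diff \<iota>b bounded_borel_mult Phi_mult[symmetric] Phi_\<iota>)
    also have "inner (s - resolvent s) (s + A s) = inner (s + A s) s - inner (resolvent s) (s + A s)"
      unfolding inner_diff_left by (simp only: inner_commute[of s "s + A s"])
    also have "inner (resolvent s) (s + A s) = inner s (resolvent (s + A s))"
      using R.symmetric by (simp add: symmetric_op_def)
    also have "\<dots> = inner s s" by (simp add: resolvent_eq[OF that])
    finally show ?thesis by (simp add: inner_add_left)
  qed
  have "A u = spectral_integral E (\<lambda>x. x) u" if u: "u \<in> D" for u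
  proof (rule E.spectral_integral_unique[symmetric])
    fix v assume "v \<in> E.dom (\<lambda>x. x)"
    then have v: "v \<in> D" by (simp add: dom_E D)
    have "(LINT x|spectral_scalar_measure E (u + v). x) = inner (A (u + v)) (u + v)"
      "(LINT x|spectral_scalar_measure E (u - v). x) = inner (A (u - v)) (u - v)"
      by (rule quad; intro subspace_add subspace_diff subspace_D u v)+
    moreover have "inner (A v) u = inner (A u) v" using A_symmetric[OF u v] by (simp add: inner_commute)
    ultimately show "inner (A u) v = (1 / 4) * ((LINT x|spectral_scalar_measure E (u + v). x)
                          - (LINT x|spectral_scalar_measure E (u - v). x))"
      by (simp add: A_add A_diff u v inner_simps)
  qed simp
  then show ?thesis
    using E by (auto simp: spectral_resolution_of_def E.spectral_domain_eq dom_E D[symmetric])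
qed

lemma spectral_measure_of: "spectral_resolution_of (spectral_measure_of D A) D A"
  unfolding spectral_measure_of_def by (rule someI_ex[OF spectral_resolution_exists])

end

section \<open>Truncations of a nonnegative self-adjoint operator\<close>

lemma (in measure_family) Phi_cong_AE:
  assumes "bounded_borel g" "bounded_borel h" "\<And>u. AE x in \<mu> u. g x = h x"
  shows "Phi g = Phi h"
proof (rule Phi_unique[OF assms(1) Phi_symmetric[OF assms(2)]])
  show "inner (Phi h u) u = (LINT x|\<mu> u. g x)" for u
    unfolding Phi_quad[OF assms(2)]
    by (rule integral_cong_AE)
      (use assms(3)[of u] in \<open>auto intro!: measurable_mu bounded_borel_measurable assms elim: eventually_mono\<close>)
qed

sublocale nonneg_self_adjoint \<subseteq> S: pvm "spectral_measure_of D A"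
  using spectral_measure_of by unfold_locales (simp add: spectral_resolution_of_def)

text \<open>The symbols use |x| in place of x, which changes nothing almost everywhere once the
  negative half-line is known to be null (\<open>AE_nonneg\<close>), and makes product rules such as
  \<open>funs_mult\<close> hold at every point. They represent the spectral cutoff, the truncated A,
  the truncated (1 + A)^(1/2) and the full (1 + A)^(-1/2).\<close>

definition pf :: "nat \<Rightarrow> real \<Rightarrow> real" where "pf n x = (if \<bar>x\<bar> \<le> real n then 1 else 0)"
definition af :: "nat \<Rightarrow> real \<Rightarrow> real" where "af n x = (if \<bar>x\<bar> \<le> real n then \<bar>x\<bar> else 0)"
definition bf :: "nat \<Rightarrow> real \<Rightarrow> real" where "bf n x = (if \<bar>x\<bar> \<le> real n then sqrt (1 + \<bar>x\<bar>) else 0)"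
definition kf :: "real \<Rightarrow> real" where "kf x = 1 / sqrt (1 + \<bar>x\<bar>)"

text \<open>\<open>sqrt\<close> is an odd function on the real line, hence the absolute value also
  for negative x.\<close>

lemma sqrt_square_abs: "(sqrt x)\<^sup>2 = \<bar>x\<bar>"
  by (simp add: power2_eq_square)

lemma kf_bounds: "0 < kf x" "kf x \<le> 1"
  by (auto simp: kf_def divide_le_eq_1 add_pos_nonneg)

lemma kf_square: "kf x * kf x = 1 / (1 + \<bar>x\<bar>)" "kf x * (kf x * y) = y / (1 + \<bar>x\<bar>)"
  by (simp_all add: kf_def)

lemma bounded_borel_pf: "bounded_borel (pf n)"
  unfolding pf_def[abs_def] by (rule bounded_borelI[of _ 1]) auto

lemma bounded_borel_af: "bounded_borel (af n)"
  unfolding af_def[abs_def] by (rule bounded_borelI[of _ "real n"]) auto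

lemma bf_bound: "\<bar>bf n x\<bar> \<le> sqrt (1 + real n)"
  by (auto simp: bf_def)

lemma bounded_borel_bf: "bounded_borel (bf n)"
  by (rule bounded_borelI[OF _ bf_bound]) (auto simp: bf_def[abs_def])

lemma bounded_borel_kf: "bounded_borel kf"
proof (rule bounded_borelI[of _ 1])
  show "kf \<in> borel_measurable borel" unfolding kf_def[abs_def] by measurable
  show "\<bar>kf x\<bar> \<le> 1" for x using kf_bounds[of x] by simp
qed

lemmas bounded_borel_funs = bounded_borel_pf bounded_borel_af bounded_borel_bf bounded_borel_kf
  bounded_borel_mult bounded_borel_add bounded_borel_diff bounded_borel_const

context nonneg_self_adjoint
begin

abbreviation "\<mu> \<equiv> spectral_scalar_measure (spectral_measure_of D A)"

definition P :: "nat \<Rightarrow> 'a \<Rightarrow> 'a" where "P n = S.Phi (pf n)"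
definition An :: "nat \<Rightarrow> 'a \<Rightarrow> 'a" where "An n = S.Phi (af n)"
definition Bn :: "nat \<Rightarrow> 'a \<Rightarrow> 'a" where "Bn n = S.Phi (bf n)"
definition K :: "'a \<Rightarrow> 'a" where "K = S.Phi kf"

lemma D_eq: "u \<in> D \<longleftrightarrow> u \<in> S.dom (\<lambda>x. x)" and A_eq: "u \<in> D \<Longrightarrow> A u = spectral_integral (spectral_measure_of D A) (\<lambda>x. x) u"
  using spectral_measure_of by (auto simp: spectral_resolution_of_def S.spectral_domain_eq)

lemma A_limit: "u \<in> D \<Longrightarrow> (\<lambda>n. S.Phi (cut (\<lambda>x. x) n) u) \<longlonglongrightarrow> A u"
  using S.spectral_integral_limit[of "\<lambda>x. x" u] by (simp add: D_eq[symmetric] A_eq)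

text \<open>The part w of \<open>u\<close> carried by [-n,0) lies in \<open>D\<close>, and <A w, w>
  is the integral of x over [-n,0). It is nonnegative by hypothesis on \<open>A\<close>, so that set
  is null; n is then sent to infinity.\<close>

lemma AE_nonneg: "AE x in \<mu> u. 0 \<le> x"
proof -
  have "AE x in \<mu> u. \<not> (- real n \<le> x \<and> x < 0)" for n
  proof -
    define g where "g x = (if - real n \<le> x \<and> x < 0 then x else 0)" for x
    define i where "i = indicat_real {x. - real n \<le> x \<and> x < 0}"
    have gb: "bounded_borel g" unfolding g_def[abs_def] by (rule bounded_borelI[of _ "real n"]) auto
    have ib: "bounded_borel i" unfolding i_def by (rule bounded_borel_indicator) simp
    have cb: "bounded_borel (cut (\<lambda>x. x) m)" for m by (rule bounded_borel_cut) simp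
    define w where "w = S.Phi i u"
    have e: "S.Phi (cut (\<lambda>x. x) m) w = S.Phi g u" if "m \<ge> n" for m
    proof -
      have "(\<lambda>x. cut (\<lambda>x. x) m x * i x) = g" using that by (auto simp: cut_def i_def g_def indicator_def)
      then show ?thesis unfolding w_def by (simp add: S.Phi_mult cb ib)
    qed
    have wD: "w \<in> D"
    proof -
      have "norm (S.Phi (cut (\<lambda>x. x) m) w) \<le> real n * norm u" for m
        unfolding w_def S.Phi_mult[OF cb ib]
        by (rule S.Phi_bound[OF bounded_borel_mult[OF cb ib]]) (auto simp: cut_def i_def indicator_def)
      then show ?thesis unfolding D_eq by (subst S.dom_iff) auto
    qed
    have "(\<lambda>m. S.Phi (cut (\<lambda>x. x) m) w) \<longlonglongrightarrow> S.Phi g u"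
      by (rule tendsto_eventually) (use e in \<open>auto simp: eventually_sequentially\<close>)
    then have "A w = S.Phi g u" using A_limit[OF wD] LIMSEQ_unique by blast
    then have "0 \<le> inner (S.Phi g u) (S.Phi i u)" using A_nonneg[OF wD] by (simp add: w_def)
    also have "\<dots> = (LINT x|\<mu> u. g x)"
    proof -
      have "(\<lambda>x. g x * i x) = g" by (auto simp: i_def g_def indicator_def)
      then show ?thesis by (simp add: S.Phi_inner_mult gb ib S.Phi_quad)
    qed
    finally have le: "0 \<le> (LINT x|\<mu> u. g x)" .
    have int: "integrable (\<mu> u) g" by (rule S.integrable_mu[OF gb])
    have "(LINT x|\<mu> u. g x) \<le> (LINT x|\<mu> u. 0)" by (rule integral_mono[OF int]) (auto simp: g_def)
    then have "(LINT x|\<mu> u. - g x) = 0" using le int by simp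
    moreover have "integrable (\<mu> u) (\<lambda>x. - g x)" using int by simp
    moreover have "AE x in \<mu> u. 0 \<le> - g x" by (simp add: g_def)
    ultimately have "AE x in \<mu> u. - g x = 0"
      using integral_nonneg_eq_0_iff_AE[of "\<mu> u" "\<lambda>x. - g x"] by blast
    then show ?thesis by eventually_elim (auto simp: g_def split: if_splits)
  qed
  then have "AE x in \<mu> u. \<forall>n. \<not> (- real n \<le> x \<and> x < 0)" by (subst AE_all_countable) (rule allI)
  then show ?thesis
  proof eventually_elim
    case (elim x)
    obtain n :: nat where "- x \<le> real n" using real_arch_simple by blast
    then have "- real n \<le> x" by simp
    then show ?case using spec[OF elim, of n] by linarith
  qed
qed

lemma Phi_cut_id: "S.Phi (cut (\<lambda>x. x) n) = An n"
  unfolding An_def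
proof (rule S.Phi_cong_AE)
  show "AE x in \<mu> u. cut (\<lambda>x. x) n x = af n x" for u
    using AE_nonneg[of u] by eventually_elim (auto simp: cut_def af_def)
qed (auto intro: bounded_borel_cut bounded_borel_af)

lemma D_iff: "u \<in> D \<longleftrightarrow> (\<exists>C. \<forall>n. norm (An n u) \<le> C)"
  unfolding D_eq by (subst S.dom_iff) (auto simp: Phi_cut_id)

lemma An_tendsto: "u \<in> D \<Longrightarrow> (\<lambda>n. An n u) \<longlonglongrightarrow> A u"
  using A_limit by (simp add: Phi_cut_id)

lemma linear_ops: "bounded_linear (P n)" "bounded_linear (An n)" "bounded_linear (Bn n)" "bounded_linear K"
  by (simp_all add: P_def An_def Bn_def K_def S.Phi_linear bounded_borel_funs)

lemmas ops_diff = linear_ops[THEN bounded_linear.linear, THEN linear_diff]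
lemmas ops_scale = linear_ops[THEN bounded_linear.linear, THEN linear_scale]
lemmas ops_zero = linear_ops[THEN bounded_linear.linear, THEN linear_0]

lemma ops_inner: "inner (P n u) v = inner u (P n v)" "inner (An n u) v = inner u (An n v)"
    "inner (Bn n u) v = inner u (Bn n v)" "inner (K u) v = inner u (K v)"
  by (simp_all add: P_def An_def Bn_def K_def S.Phi_inner bounded_borel_funs)

lemma ops_norm: "norm (P n u) \<le> norm u" "norm (An n u) \<le> real n * norm u"
    "norm (Bn n u) \<le> sqrt (1 + real n) * norm u" "norm (K u) \<le> norm u"
proof -
  show "norm (P n u) \<le> norm u" using S.Phi_bound[OF bounded_borel_pf, of n 1] by (simp add: P_def pf_def)
  show "norm (An n u) \<le> real n * norm u" unfolding An_def by (rule S.Phi_bound[OF bounded_borel_af]) (simp add: af_def)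
  show "norm (Bn n u) \<le> sqrt (1 + real n) * norm u" unfolding Bn_def by (rule S.Phi_bound[OF bounded_borel_bf bf_bound])
  show "norm (K u) \<le> norm u" using S.Phi_bound[OF bounded_borel_kf, of 1] kf_bounds by (simp add: K_def abs_of_pos)
qed

lemma funs_mult: "(\<lambda>x. pf n x * pf m x) = pf (min n m)" "(\<lambda>x. af n x * pf m x) = af (min n m)"
    "(\<lambda>x. pf n x * af m x) = af (min n m)" "(\<lambda>x. bf n x * pf m x) = bf (min n m)"
    "(\<lambda>x. pf n x * bf m x) = bf (min n m)" "(\<lambda>x. kf x * bf n x) = pf n" "(\<lambda>x. bf n x * kf x) = pf n"
    "(\<lambda>x. bf n x * bf n x) = (\<lambda>x. pf n x + af n x)"
  by (auto simp: pf_def af_def bf_def kf_def fun_eq_iff add_nonneg_eq_0_iff)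

lemma ops_mult: "P n (P m u) = P (min n m) u" "An n (P m u) = An (min n m) u" "P n (An m u) = An (min n m) u"
    "Bn n (P m u) = Bn (min n m) u" "P n (Bn m u) = Bn (min n m) u"
    "K (Bn n u) = P n u" "Bn n (K u) = P n u" "K (P n u) = P n (K u)" "K (An n u) = An n (K u)"
  by (simp_all add: P_def An_def Bn_def K_def S.Phi_mult bounded_borel_funs funs_mult mult.commute min.commute)

lemma P_tendsto: "(\<lambda>n. P n u) \<longlonglongrightarrow> u"
proof -
  have "(\<lambda>n. S.Phi (pf n) u) \<longlonglongrightarrow> S.Phi (\<lambda>x. 1) u"
  proof (rule S.Phi_limit[OF bounded_borel_pf])
    show "\<bar>pf n x\<bar> \<le> 1" for n x by (simp add: pf_def)
    show "(\<lambda>n. pf n x) \<longlonglongrightarrow> 1" for x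
    proof -
      obtain N :: nat where "\<bar>x\<bar> \<le> N" using real_arch_simple by blast
      then have "\<forall>\<^sub>F n in sequentially. pf n x = 1"
        unfolding eventually_sequentially pf_def by (intro exI[of _ N]) auto
      then show ?thesis by (rule tendsto_eventually)
    qed
  qed
  then show ?thesis by (simp add: P_def S.Phi_one)
qed

lemma norm_Bn: "(norm (Bn n u))\<^sup>2 = (norm (P n u))\<^sup>2 + inner (An n u) u"
proof -
  have "(norm (Bn n u))\<^sup>2 = inner (S.Phi (\<lambda>x. pf n x + af n x) u) u"
    by (simp add: power2_norm_eq_inner Bn_def S.Phi_inner_mult bounded_borel_funs funs_mult)
  also have "\<dots> = inner (P n u) u + inner (An n u) u"
    by (simp add: S.Phi_add bounded_borel_funs P_def An_def inner_add_left)
  also have "inner (P n u) u = (norm (P n u))\<^sup>2"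
    by (simp add: power2_norm_eq_inner ops_inner(1)[of n u "P n u"] ops_mult inner_commute)
  finally show ?thesis .
qed

lemma An_nonneg: "0 \<le> inner (An n u) u"
  unfolding An_def S.Phi_quad[OF bounded_borel_af] by (rule integral_nonneg_AE) (simp add: af_def)

lemma An_quad_K: "inner (An n (K z)) (K z) = (norm (P n z))\<^sup>2 - (norm (P n (K z)))\<^sup>2"
proof -
  have "P n (K z) = K (P n z)" "P n z = Bn n (K z)" by (simp_all add: ops_mult)
  then show ?thesis using norm_Bn[of n "K z"] by simp
qed

lemma An_mono: "m \<le> n \<Longrightarrow> norm (An m u) \<le> norm (An n u)"
  using ops_norm(1)[of m "An n u"] by (simp add: ops_mult min_absorb1)

text \<open>Under \<open>P n\<close> the approximations \<open>An m u\<close> of \<open>A u\<close>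
  are constant once m >= n.\<close>

lemma P_A: assumes "u \<in> D" shows "P n (A u) = An n u"
proof (rule LIMSEQ_unique)
  show "(\<lambda>m. P n (An m u)) \<longlonglongrightarrow> P n (A u)" by (rule bounded_linear.tendsto[OF linear_ops(1) An_tendsto[OF assms]])
  show "(\<lambda>m. P n (An m u)) \<longlonglongrightarrow> An n u"
    by (rule tendsto_eventually) (auto simp: eventually_sequentially ops_mult intro!: exI[of _ n])
qed

lemma P_in_D: "P n u \<in> D" and A_P: "A (P n u) = An n u"
proof -
  have "norm (An m (P n u)) \<le> norm (An n u)" for m using An_mono[of "min m n" n u] by (simp add: ops_mult)
  then show D: "P n u \<in> D" unfolding D_iff by blast
  have "(\<lambda>m. An m (P n u)) \<longlonglongrightarrow> An n u"
    by (rule tendsto_eventually) (auto simp: eventually_sequentially ops_mult intro!: exI[of _ n])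
  then show "A (P n u) = An n u" using An_tendsto[OF D] LIMSEQ_unique by blast
qed

section \<open>The isometry \<open>K\<close> onto the domain of the square root\<close>

lemma sqrt_domain_eq_dom: "sqrt_domain D A = S.dom sqrt"
  by (simp add: sqrt_domain_def S.spectral_domain_eq)

text \<open>The measure of \<open>K z\<close> has density 1/(1 + |x|) with respect to that of
  \<open>z\<close>, and |x|/(1 + |x|) + 1/(1 + |x|) = 1.\<close>

lemma K_nn_integral: "(\<integral>\<^sup>+x. ennreal ((sqrt x)\<^sup>2) \<partial>\<mu> (K z)) + ennreal ((norm (K z))\<^sup>2) = ennreal ((norm z)\<^sup>2)"
proof -
  have a: "(\<integral>\<^sup>+x. ennreal ((sqrt x)\<^sup>2) \<partial>\<mu> (K z)) = (\<integral>\<^sup>+x. ennreal (\<bar>x\<bar> / (1 + \<bar>x\<bar>)) \<partial>\<mu> z)"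
    unfolding K_def
    by (subst S.nn_integral_mu_Phi[OF bounded_borel_kf])
      (auto simp: ennreal_mult[symmetric] power2_eq_square kf_square mult.assoc intro!: nn_integral_cong)
  have b: "ennreal ((norm (K z))\<^sup>2) = (\<integral>\<^sup>+x. ennreal (1 / (1 + \<bar>x\<bar>)) \<partial>\<mu> z)"
    unfolding K_def S.Phi_norm2[OF bounded_borel_kf] unfolding power2_eq_square
    by (subst nn_integral_eq_integral[symmetric])
      (use S.integrable_mu[OF bounded_borel_mult[OF bounded_borel_kf bounded_borel_kf], of z] in \<open>auto simp: kf_square\<close>)
  have "(\<integral>\<^sup>+x. ennreal (\<bar>x\<bar> / (1 + \<bar>x\<bar>)) \<partial>\<mu> z) + (\<integral>\<^sup>+x. ennreal (1 / (1 + \<bar>x\<bar>)) \<partial>\<mu> z)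
      = (\<integral>\<^sup>+x. ennreal (\<bar>x\<bar> / (1 + \<bar>x\<bar>)) + ennreal (1 / (1 + \<bar>x\<bar>)) \<partial>\<mu> z)"
    by (rule nn_integral_add[symmetric]; rule S.measurable_mu; measurable)
  also have "\<dots> = (\<integral>\<^sup>+x. 1 \<partial>\<mu> z)"
  proof (rule nn_integral_cong)
    fix x :: real
    have "\<bar>x\<bar> / (1 + \<bar>x\<bar>) + 1 / (1 + \<bar>x\<bar>) = 1" by (simp add: add_divide_distrib[symmetric] add.commute add_nonneg_eq_0_iff)
    then show "ennreal (\<bar>x\<bar> / (1 + \<bar>x\<bar>)) + ennreal (1 / (1 + \<bar>x\<bar>)) = 1"
      by (simp add: ennreal_plus[symmetric] del: ennreal_plus)
  qed
  finally show ?thesis unfolding a b by (simp add: S.mass)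
qed

lemma sqrt_domain_eq: "sqrt_domain D A = range K"
proof (intro equalityI subsetI)
  fix u assume "u \<in> range K"
  then obtain z where z: "u = K z" by auto
  have "(\<integral>\<^sup>+x. ennreal ((sqrt x)\<^sup>2) \<partial>\<mu> (K z))
      \<le> (\<integral>\<^sup>+x. ennreal ((sqrt x)\<^sup>2) \<partial>\<mu> (K z)) + ennreal ((norm (K z))\<^sup>2)"
    by (rule add_increasing2) auto
  also have "\<dots> = ennreal ((norm z)\<^sup>2)" by (rule K_nn_integral)
  also have "\<dots> < \<infinity>" by simp
  finally have "K z \<in> S.dom sqrt" by (simp add: S.dom_def)
  then show "u \<in> sqrt_domain D A" by (simp only: sqrt_domain_eq_dom z)
next
  fix u assume "u \<in> sqrt_domain D A"
  then have u: "(\<integral>\<^sup>+x. ennreal \<bar>x\<bar> \<partial>\<mu> u) < \<infinity>"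
    unfolding sqrt_domain_eq_dom S.dom_def by (simp add: sqrt_square_abs)
  \<comment> \<open>The reciprocal of \<open>kf\<close>. Integrability of |x| puts \<open>u\<close>
    into its domain, and the limit \<open>w\<close> of the truncations satisfies
    \<open>K w = u\<close>.\<close>
  define g where "g x = sqrt (1 + \<bar>x\<bar>)" for x :: real
  have g[measurable]: "g \<in> borel_measurable borel" unfolding g_def[abs_def] by measurable
  have "(\<integral>\<^sup>+x. ennreal ((g x)\<^sup>2) \<partial>\<mu> u) = (\<integral>\<^sup>+x. 1 + ennreal \<bar>x\<bar> \<partial>\<mu> u)"
    by (intro nn_integral_cong) (simp add: g_def)
  also have "\<dots> = (\<integral>\<^sup>+x. 1 \<partial>\<mu> u) + (\<integral>\<^sup>+x. ennreal \<bar>x\<bar> \<partial>\<mu> u)"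
    by (rule nn_integral_add; rule S.measurable_mu; measurable)
  also have "\<dots> < \<infinity>" using u by (simp add: S.mass)
  finally have "u \<in> S.dom g" by (simp add: S.dom_def)
  then obtain w where w: "(\<lambda>n. S.Phi (cut g n) u) \<longlonglongrightarrow> w" using S.Phi_cut_convergent[OF g] by metis
  note cb = bounded_borel_cut[OF g]
  have "(\<lambda>n. K (S.Phi (cut g n) u)) \<longlonglongrightarrow> S.Phi (\<lambda>x. 1) u"
    unfolding K_def S.Phi_mult[OF bounded_borel_kf cb]
  proof (rule S.Phi_limit[of _ 1])
    have 1: "kf x * g x = 1" for x by (simp add: kf_def g_def add_nonneg_eq_0_iff)
    show "bounded_borel (\<lambda>x. kf x * cut g n x)" for n by (intro bounded_borel_funs cb)
    show "\<bar>kf x * cut g n x\<bar> \<le> 1" for n x using 1[of x] by (simp add: cut_def)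
    show "(\<lambda>n. kf x * cut g n x) \<longlonglongrightarrow> 1" for x
      unfolding 1[symmetric, of x] by (intro tendsto_intros cut_tendsto)
  qed
  moreover have "(\<lambda>n. K (S.Phi (cut g n) u)) \<longlonglongrightarrow> K w" by (rule bounded_linear.tendsto[OF linear_ops(4) w])
  ultimately have "K w = u" using LIMSEQ_unique S.Phi_one by metis
  then show "u \<in> range K" by auto
qed

lemma sqrt_operator_K: "(norm (sqrt_operator D A (K z)))\<^sup>2 = (norm z)\<^sup>2 - (norm (K z))\<^sup>2"
proof -
  have "K z \<in> S.dom sqrt" using sqrt_domain_eq sqrt_domain_eq_dom by auto
  then have "ennreal ((norm (sqrt_operator D A (K z)))\<^sup>2) + ennreal ((norm (K z))\<^sup>2) = ennreal ((norm z)\<^sup>2)"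
    unfolding sqrt_operator_def by (subst S.spectral_integral_norm) (auto simp: K_nn_integral[simplified])
  then have "(norm (sqrt_operator D A (K z)))\<^sup>2 + (norm (K z))\<^sup>2 = (norm z)\<^sup>2"
    by (simp add: ennreal_plus[symmetric] del: ennreal_plus)
  then show ?thesis by simp
qed

text \<open>With \<open>sqrt_domain_eq\<close> this lets all statements about the domain of the
  square root be made in H itself, and it identifies the energy of \<open>K z\<close> with |z|^2 -
  |K z|^2.\<close>

lemma sqrt_norm_K: "sqrt_norm D A (K z) = norm z"
  by (simp add: sqrt_norm_def sqrt_operator_K)

lemma K_inject: "K z = K w \<longleftrightarrow> z = w"
proof
  assume "K z = K w"
  then have "K (z - w) = K 0" by (simp add: ops_diff ops_zero)
  then show "z = w" using sqrt_norm_K[of "z - w"] sqrt_norm_K[of 0] by simp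
qed simp

lemma D_subset: "D \<subseteq> sqrt_domain D A"
proof
  fix u assume "u \<in> D"
  then have "(\<integral>\<^sup>+x. ennreal (x\<^sup>2) \<partial>\<mu> u) < \<infinity>" by (simp add: D_eq S.dom_def)
  moreover have "(\<integral>\<^sup>+x. ennreal ((sqrt x)\<^sup>2) \<partial>\<mu> u) \<le> (\<integral>\<^sup>+x. 1 + ennreal (x\<^sup>2) \<partial>\<mu> u)"
  proof (rule nn_integral_mono)
    fix x :: real
    have "\<bar>x\<bar> \<le> 1 + x\<^sup>2"
    proof -
      have "0 \<le> (\<bar>x\<bar> - 1)\<^sup>2 + \<bar>x\<bar>" by simp
      then show ?thesis by (simp add: power2_eq_square algebra_simps)
    qed
    then have "ennreal ((sqrt x)\<^sup>2) \<le> ennreal (1 + x\<^sup>2)" by (intro ennreal_leI) (simp add: sqrt_square_abs)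
    also have "ennreal (1 + x\<^sup>2) = 1 + ennreal (x\<^sup>2)" by simp
    finally show "ennreal ((sqrt x)\<^sup>2) \<le> 1 + ennreal (x\<^sup>2)" .
  qed
  moreover have "(\<integral>\<^sup>+x. 1 + ennreal (x\<^sup>2) \<partial>\<mu> u) = (\<integral>\<^sup>+x. 1 \<partial>\<mu> u) + (\<integral>\<^sup>+x. ennreal (x\<^sup>2) \<partial>\<mu> u)"
    by (rule nn_integral_add; rule S.measurable_mu; measurable)
  moreover have "(\<integral>\<^sup>+x. 1 \<partial>\<mu> u) < \<infinity>" by (simp add: S.mass)
  ultimately show "u \<in> sqrt_domain D A"
    unfolding sqrt_domain_eq_dom S.dom_def
    by (metis (no_types, lifting) ennreal_add_less_top infinity_ennreal_def mem_Collect_eq order_le_less_trans)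
qed

text \<open>The vector \<open>P n u\<close> lies in \<open>D\<close> and equals
  \<open>K (Bn n u)\<close>, so the hypothesis at that vector reads off in terms of
  \<open>An n\<close>.\<close>

lemma coercive:
  assumes "\<forall>u\<in>D. (norm (A u))\<^sup>2 \<ge> \<nu> * (norm (sqrt_operator D A u))\<^sup>2"
  shows "\<nu> * inner (An n u) u \<le> (norm (An n u))\<^sup>2"
proof -
  have "(norm (sqrt_operator D A (P n u)))\<^sup>2 = inner (An n u) u"
    using sqrt_operator_K[of "Bn n u"] norm_Bn[of n u] by (simp add: ops_mult)
  then show ?thesis using assms P_in_D[of n u] by (metis A_P)
qed

end

section \<open>Antiderivatives of vector-valued functions\<close>

text \<open>The library integrates vector-valued functions only over types of class \<open>banach\<close>,
  hence the detour through scalar integrals and the Riesz representation.\<close>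

lemma antiderivative_exists:
  fixes g :: "real \<Rightarrow> 'a::{real_inner,complete_space}"
  assumes g: "continuous_on UNIV g"
  obtains G where "G 0 = 0" "\<And>t. t > -1 \<Longrightarrow> (G has_vector_derivative g t) (at t)"
proof -
  have ci: "continuous_on S (\<lambda>s. inner (g s) x)" for x S
    by (intro continuous_intros continuous_on_subset[OF g]) auto
  \<comment> \<open>Integration starts at -1, which makes the derivative at 0 two-sided; the value
    at 0 is subtracted at the end.\<close>
  have ii: "(\<lambda>s. inner (g s) x) integrable_on {-1..t}" for x t
    by (rule integrable_continuous_real[OF ci])
  have "bounded_linear (\<lambda>x. integral {-1..t} (\<lambda>s. inner (g s) x))" for t
  proof -
    have "compact (g ` {-1..t})" by (intro compact_continuous_image continuous_on_subset[OF g]) auto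
    then obtain C where C: "0 < C" "\<And>s. s \<in> {-1..t} \<Longrightarrow> norm (g s) \<le> C"
      using compact_imp_bounded bounded_pos by (metis image_eqI)
    show ?thesis
    proof (rule bounded_linear_intro[where K = "C * measure lborel {-1..t}"])
      show "norm (integral {-1..t} (\<lambda>s. inner (g s) x)) \<le> norm x * (C * measure lborel {-1..t})" for x
      proof -
        have "norm (integral (cbox (-1) t) (\<lambda>s. inner (g s) x)) \<le> (C * norm x) * measure lborel (cbox (-1) t)"
        proof (rule has_integral_bound)
          show "0 \<le> C * norm x" using C by simp
          show "((\<lambda>s. inner (g s) x) has_integral integral (cbox (-1) t) (\<lambda>s. inner (g s) x)) (cbox (-1) t)"
            using ii[of x t] by (simp add: integrable_integral)
          show "norm (inner (g s) x) \<le> C * norm x" if "s \<in> cbox (-1) t" for s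
            using order_trans[OF Cauchy_Schwarz_ineq2 mult_right_mono[OF C(2), of s "norm x"]] that by simp
        qed
        then show ?thesis by (simp add: algebra_simps)
      qed
    qed (simp_all add: inner_add_right integral_add[OF ii ii])
  qed
  then have "\<exists>w. \<forall>x. integral {-1..t} (\<lambda>s. inner (g s) x) = inner w x" for t
    using Riesz_representation by metis
  then obtain H where H: "\<And>t x. integral {-1..t} (\<lambda>s. inner (g s) x) = inner (H t) x" by metis
  have dH: "((\<lambda>s. inner (H s) x) has_real_derivative inner (g t) x) (at t)" if "t > -1" for t x
  proof -
    have "((\<lambda>s. integral {-1..s} (\<lambda>r. inner (g r) x)) has_real_derivative inner (g t) x) (at t within {-1..t+1})"
      by (rule integral_has_real_derivative[OF ci]) (use that in auto)
    then show ?thesis unfolding H using that by (subst (asm) at_within_Icc_at) auto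
  qed
  \<comment> \<open>Scalar derivatives alone do not give differentiability in norm. Testing the
    remainder against itself (the vector \<open>x\<close> below) yields a mean value bound that is
    uniform in the direction.\<close>
  have "(H has_vector_derivative g t) (at t)" if t: "t > -1" for t
    unfolding has_vector_derivative_def has_derivative_at_alt
  proof (intro conjI allI impI)
    show "bounded_linear (\<lambda>x. x *\<^sub>R g t)" by (rule bounded_linear_scaleR_left)
    fix e :: real assume e: "e > 0"
    have "isCont g t" using g by (simp add: continuous_on_eq_continuous_at)
    then obtain d where d: "d > 0" "\<And>s. \<bar>s - t\<bar> < d \<Longrightarrow> norm (g s - g t) < e"
      using e unfolding continuous_at_eps_delta dist_norm real_norm_def by blast
    show "\<exists>d>0. \<forall>s. norm (s - t) < d \<longrightarrow> norm (H s - H t - (s - t) *\<^sub>R g t) \<le> e * norm (s - t)"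
    proof (intro exI[of _ "min d (t + 1)"] conjI allI impI)
      show "min d (t + 1) > 0" using d t by simp
      fix s assume s: "norm (s - t) < min d (t + 1)"
      define x where "x = H s - H t - (s - t) *\<^sub>R g t"
      have "norm ((inner (H s) x - s * inner (g t) x) - (inner (H t) x - t * inner (g t) x)) \<le> (e * norm x) * norm (s - t)"
      proof (rule field_differentiable_bound[of "closed_segment s t"])
        fix r assume r: "r \<in> closed_segment s t"
        then have rt: "\<bar>r - t\<bar> \<le> \<bar>s - t\<bar>" using segment_bound1[of r s t]
          by (auto simp: closed_segment_eq_real_ivl split: if_splits)
        then have r1: "r > -1" using s t by (auto simp: abs_if split: if_splits)
        show "((\<lambda>r. inner (H r) x - r * inner (g t) x) has_field_derivative (inner (g r) x - inner (g t) x)) (at r within closed_segment s t)"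
          by (rule DERIV_subset[of _ _ _ UNIV])
            (auto intro!: derivative_eq_intros dH[OF r1])
        have "\<bar>inner (g r - g t) x\<bar> \<le> norm (g r - g t) * norm x" by (rule Cauchy_Schwarz_ineq2)
        also have "\<dots> \<le> e * norm x" using d(2)[of r] rt s by (intro mult_right_mono) auto
        finally show "norm (inner (g r) x - inner (g t) x) \<le> e * norm x" by (simp add: inner_diff_left)
      qed auto
      then have "inner x x \<le> (e * norm (s - t)) * norm x"
        by (simp add: x_def inner_diff_left algebra_simps)
      then show "norm (H s - H t - (s - t) *\<^sub>R g t) \<le> e * norm (s - t)"
        unfolding x_def[symmetric] by (rule norm_le_by_inner) (use e in simp)
    qed
  qed
  then show thesis
    by (intro that[of "\<lambda>t. H t - H 0"])
      (auto intro!: has_vector_derivative_eq_rhs[OF has_vector_derivative_diff[OF _ has_vector_derivative_const]])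
qed

section \<open>The linear evolution equation\<close>

context nonneg_self_adjoint
begin

text \<open>With \<open>u = K z\<close> and \<open>K = (1 + A)\<^sup>-\<^sup>1\<^sup>/\<^sup>2\<close> the equation \<open>u' + A u = g\<close> becomes
  \<open>z' + A z = (1 + A)\<^sup>1\<^sup>/\<^sup>2 g\<close>, and the norm of \<open>D(A\<^sup>1\<^sup>/\<^sup>2)\<close> becomes the norm of \<open>H\<close>. The equation is
  required for every spectral truncation, where all operators are bounded.\<close>

definition evol :: "real \<Rightarrow> (real \<Rightarrow> 'a) \<Rightarrow> (real \<Rightarrow> 'a) \<Rightarrow> bool" where
  "evol \<tau> z g \<longleftrightarrow> continuous_on {0..\<tau>} z \<and> (\<forall>n. \<forall>t\<in>{0<..<\<tau>}.
     ((\<lambda>s. P n (z s)) has_vector_derivative (Bn n (g t) - An n (z t))) (at t))"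

lemma evol_diff:
  assumes "evol \<tau> z g" "evol \<tau> y h"
  shows "evol \<tau> (\<lambda>t. z t - y t) (\<lambda>t. g t - h t)"
  unfolding evol_def
proof (intro conjI allI ballI)
  show "continuous_on {0..\<tau>} (\<lambda>t. z t - y t)" using assms by (intro continuous_intros) (auto simp: evol_def)
  fix n t assume "t \<in> {0<..<\<tau>}"
  then have "((\<lambda>s. P n (z s) - P n (y s)) has_vector_derivative
      (Bn n (g t) - An n (z t)) - (Bn n (h t) - An n (y t))) (at t)"
    using assms by (intro has_vector_derivative_diff) (auto simp: evol_def)
  then show "((\<lambda>s. P n (z s - y s)) has_vector_derivative (Bn n (g t - h t) - An n (z t - y t))) (at t)"
    by (simp add: ops_diff algebra_simps)
qed

lemma ops_comm: "P m (P n u) = P n (P m u)" "P m (An n u) = An n (P m u)" "P m (Bn n u) = Bn n (P m u)"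
  by (simp_all add: ops_mult min.commute)

lemma evol_P:
  assumes "evol \<tau> z g"
  shows "evol \<tau> (\<lambda>t. P m (z t)) (\<lambda>t. P m (g t))"
  unfolding evol_def
proof (intro conjI allI ballI)
  show "continuous_on {0..\<tau>} (\<lambda>t. P m (z t))"
    using assms by (intro bounded_linear.continuous_on[OF linear_ops(1)]) (auto simp: evol_def)
  fix n t assume "t \<in> {0<..<\<tau>}"
  then have "((\<lambda>s. P m (P n (z s))) has_vector_derivative P m (Bn n (g t) - An n (z t))) (at t)"
    using assms by (intro bounded_linear.has_vector_derivative[OF linear_ops(1)]) (auto simp: evol_def)
  then show "((\<lambda>s. P n (P m (z s))) has_vector_derivative (Bn n (P m (g t)) - An n (P m (z t)))) (at t)"
    by (simp add: ops_diff ops_comm(2,3) ops_comm(1)[of m n])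
qed

lemma evol_cong:
  assumes "evol \<tau> z g" "\<And>t. t \<in> {0<..<\<tau>} \<Longrightarrow> g t = h t" shows "evol \<tau> z h"
  using assms by (simp add: evol_def)

lemma inner_An_P: "inner (An n z) (P n z) = inner (An n z) z"
  using ops_inner(1)[of n "An n z" z] by (simp add: ops_mult inner_commute)

lemma norm_derivative:
  fixes f :: "real \<Rightarrow> 'b::real_inner"
  assumes "(f has_vector_derivative f') (at t within S)"
  shows "((\<lambda>s. (norm (f s))\<^sup>2) has_real_derivative 2 * inner (f t) f') (at t within S)"
proof -
  have f: "(f has_derivative (\<lambda>h. h *\<^sub>R f')) (at t within S)"
    using assms by (simp add: has_vector_derivative_def)
  show ?thesis
    unfolding power2_norm_eq_inner has_field_derivative_def
    by (rule has_derivative_eq_rhs[OF has_derivative_inner[OF f f]]) (auto simp: inner_commute fun_eq_iff)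
qed

text \<open>Moved onto z, the unbounded forcing \<open>Bn n (g t)\<close> costs at most |Bn z|^2 +
  |g|^2 = |P z|^2 + <An z, z> + |g|^2. Half of the dissipation pays for the middle term, the weight
  exp(-s) for |P z|^2.\<close>

lemma evol_energy:
  assumes e: "evol \<tau> z g" and t: "t \<in> {0<..<\<tau>}"
  obtains d where "((\<lambda>s. exp (- s) * (norm (P n (z s)))\<^sup>2) has_real_derivative d) (at t)"
    "d \<le> exp (- t) * ((norm (g t))\<^sup>2 - inner (An n (z t)) (z t))"
proof -
  let ?z = "P n (z t)"
  have "((\<lambda>s. P n (z s)) has_vector_derivative (Bn n (g t) - An n (z t))) (at t)"
    using e t by (auto simp: evol_def)
  note d1 = norm_derivative[OF this]
  have d2: "((\<lambda>s. exp (- s) * (norm (P n (z s)))\<^sup>2) has_real_derivative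
      exp (- t) * (2 * inner ?z (Bn n (g t) - An n (z t)) - (norm ?z)\<^sup>2)) (at t)"
  proof -
    have "((\<lambda>s. exp (- s)) has_real_derivative - exp (- t)) (at t)"
      by (auto intro!: derivative_eq_intros)
    from DERIV_mult[OF this d1] show ?thesis
      by (rule DERIV_cong) (simp add: algebra_simps)
  qed
  have "inner ?z (Bn n (g t)) = inner (Bn n (z t)) (g t)"
    using ops_inner(3)[of n "P n (z t)" "g t"] by (simp add: ops_mult)
  also have "\<dots> \<le> norm (Bn n (z t)) * norm (g t)" by (rule norm_cauchy_schwarz)
  finally have "2 * inner ?z (Bn n (g t)) \<le> 2 * (norm (Bn n (z t)) * norm (g t))" by simp
  also have "\<dots> \<le> (norm (Bn n (z t)))\<^sup>2 + (norm (g t))\<^sup>2"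
    using sum_squares_bound[of "norm (Bn n (z t))" "norm (g t)"] by (simp add: mult.assoc)
  finally have "2 * inner ?z (Bn n (g t)) \<le> (norm ?z)\<^sup>2 + inner (An n (z t)) (z t) + (norm (g t))\<^sup>2"
    by (simp add: norm_Bn)
  then have "2 * inner ?z (Bn n (g t) - An n (z t)) - (norm ?z)\<^sup>2 \<le> (norm (g t))\<^sup>2 - inner (An n (z t)) (z t)"
    using inner_An_P[of n "z t"] by (simp add: inner_diff_right inner_commute)
  then have "exp (- t) * (2 * inner ?z (Bn n (g t) - An n (z t)) - (norm ?z)\<^sup>2)
      \<le> exp (- t) * ((norm (g t))\<^sup>2 - inner (An n (z t)) (z t))"
    by (rule mult_left_mono) simp
  then show thesis using that d2 by blast
qed

lemma continuous_on_P: "continuous_on S z \<Longrightarrow> continuous_on S (\<lambda>s. P n (z s))"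
  by (rule bounded_linear.continuous_on[OF linear_ops(1)])

lemma evol_est:
  assumes e: "evol \<tau> z g" and g: "\<And>t. t \<in> {0<..<\<tau>} \<Longrightarrow> (norm (g t))\<^sup>2 \<le> M * exp (c * t)"
    and c: "c > 1" and M: "M \<ge> 0" and t: "t \<in> {0..\<tau>}"
  shows "(norm (z t))\<^sup>2 \<le> exp t * (norm (z 0))\<^sup>2 + M / (c - 1) * exp (c * t)"
proof -
  have n: "(norm (P n (z t)))\<^sup>2 \<le> exp t * (norm (z 0))\<^sup>2 + M / (c - 1) * exp (c * t)" for n
  proof -
    define \<eta> where "\<eta> s = exp (- s) * (norm (P n (z s)))\<^sup>2 - M / (c - 1) * exp ((c - 1) * s)" for s
    have "\<eta> t \<le> \<eta> 0"
    proof (rule DERIV_nonpos_imp_decreasing_open[where f = \<eta> and a = 0 and b = t])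
      show "0 \<le> t" using t by simp
      have cz: "continuous_on {0..t} z" using e t by (auto simp: evol_def intro: continuous_on_subset)
      show "continuous_on {0..t} \<eta>"
        unfolding \<eta>_def by (intro continuous_intros continuous_on_P cz)
      fix s assume s: "0 < s" "s < t"
      then have s': "s \<in> {0<..<\<tau>}" using t by auto
      obtain d where d: "((\<lambda>s. exp (- s) * (norm (P n (z s)))\<^sup>2) has_real_derivative d) (at s)"
        "d \<le> exp (- s) * ((norm (g s))\<^sup>2 - inner (An n (z s)) (z s))" using evol_energy[OF e s'] by metis
      have "(\<eta> has_real_derivative d - M * exp ((c - 1) * s)) (at s)"
      proof -
        have "((\<lambda>s. M / (c - 1) * exp ((c - 1) * s)) has_real_derivative M * exp ((c - 1) * s)) (at s)"
          using c by (auto intro!: derivative_eq_intros)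
        from DERIV_diff[OF d(1) this] show ?thesis unfolding \<eta>_def[abs_def] .
      qed
      moreover have "d \<le> M * exp ((c - 1) * s)"
      proof -
        have "d \<le> exp (- s) * (norm (g s))\<^sup>2" using d(2) An_nonneg[of n "z s"] by (smt (verit) exp_gt_zero mult_left_mono)
        also have "\<dots> \<le> exp (- s) * (M * exp (c * s))" by (intro mult_left_mono g[OF s']) simp
        also have "\<dots> = M * exp ((c - 1) * s)" by (simp add: exp_add[symmetric] algebra_simps)
        finally show ?thesis .
      qed
      ultimately show "\<exists>y. (\<eta> has_real_derivative y) (at s) \<and> y \<le> 0" by (intro exI conjI) auto
    qed
    then have "exp (- t) * (norm (P n (z t)))\<^sup>2 \<le> (norm (P n (z 0)))\<^sup>2 - M / (c - 1) + M / (c - 1) * exp ((c - 1) * t)"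
      by (simp add: \<eta>_def)
    also have "\<dots> \<le> (norm (z 0))\<^sup>2 + M / (c - 1) * exp ((c - 1) * t)"
    proof -
      have "(norm (P n (z 0)))\<^sup>2 \<le> (norm (z 0))\<^sup>2" by (intro power_mono ops_norm) auto
      moreover have "0 \<le> M / (c - 1)" using c M by simp
      ultimately show ?thesis by linarith
    qed
    finally have "exp t * (exp (- t) * (norm (P n (z t)))\<^sup>2) \<le> exp t * ((norm (z 0))\<^sup>2 + M / (c - 1) * exp ((c - 1) * t))"
      by (intro mult_left_mono) auto
    also have "exp t * ((norm (z 0))\<^sup>2 + M / (c - 1) * exp ((c - 1) * t))
        = exp t * (norm (z 0))\<^sup>2 + M / (c - 1) * (exp t * exp ((c - 1) * t))"
      by (simp only: distrib_left mult.left_commute)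
    also have "exp t * exp ((c - 1) * t) = exp (c * t)"
      by (simp add: exp_add[symmetric] algebra_simps)
    also have "exp t * (exp (- t) * (norm (P n (z t)))\<^sup>2) = (norm (P n (z t)))\<^sup>2"
      by (simp add: mult.assoc[symmetric] exp_minus_inverse)
    finally show ?thesis .
  qed
  show ?thesis
    by (rule LIMSEQ_le_const2[of "\<lambda>n. (norm (P n (z t)))\<^sup>2"])
      (use n in \<open>auto intro!: tendsto_intros P_tendsto\<close>)
qed

lemma evol_unique:
  assumes "evol \<tau> z g" "evol \<tau> y g" "z 0 = y 0" "t \<in> {0..\<tau>}"
  shows "z t = y t"
  using evol_est[OF evol_diff[OF assms(1,2)], of 0 2 t] assms by simp

section \<open>The truncated semigroup and variation of constants\<close>

definition ef :: "nat \<Rightarrow> real \<Rightarrow> real \<Rightarrow> real" where "ef n t x = exp (- t * \<bar>x\<bar>) * pf n x"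
text \<open>On a bounded part of the spectrum the semigroup of -A makes sense for all real times.
  Negative times enter the variation of constants formula.\<close>

definition Sg :: "nat \<Rightarrow> real \<Rightarrow> 'a \<Rightarrow> 'a" where "Sg n t = S.Phi (ef n t)"

lemma bounded_ef: "\<bar>ef n t x\<bar> \<le> exp (\<bar>t\<bar> * real n)"
proof -
  have "- t * \<bar>x\<bar> \<le> \<bar>t\<bar> * real n" if "\<bar>x\<bar> \<le> real n"
  proof -
    have "- t * \<bar>x\<bar> \<le> \<bar>t\<bar> * \<bar>x\<bar>" by (intro mult_right_mono) auto
    also have "\<dots> \<le> \<bar>t\<bar> * real n" by (intro mult_left_mono that) auto
    finally show ?thesis .
  qed
  then show ?thesis by (auto simp: ef_def pf_def)
qed

lemma bounded_borel_ef: "bounded_borel (ef n t)"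
proof (rule bounded_borelI[OF _ bounded_ef])
  have [measurable]: "pf n \<in> borel_measurable borel" using bounded_borel_pf by (simp add: bounded_borel_def)
  show "ef n t \<in> borel_measurable borel" unfolding ef_def[abs_def] by measurable
qed

lemma linear_Sg: "bounded_linear (Sg n t)"
  unfolding Sg_def by (rule S.Phi_linear[OF bounded_borel_ef])

lemma norm_Sg: "norm (Sg n t u) \<le> exp (\<bar>t\<bar> * real n) * norm u"
  unfolding Sg_def by (rule S.Phi_bound[OF bounded_borel_ef bounded_ef])

lemma Sg_mult: "Sg n t (Sg n s u) = Sg n (t + s) u" "P n (Sg n t u) = Sg n t u" "Sg n 0 u = P n u"
proof -
  have "(\<lambda>x. ef n t x * ef n s x) = ef n (t + s)"
    by (auto simp: ef_def pf_def exp_add[symmetric] algebra_simps)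
  then show "Sg n t (Sg n s u) = Sg n (t + s) u" by (simp add: Sg_def S.Phi_mult bounded_borel_ef)
  have "(\<lambda>x. pf n x * ef n t x) = ef n t" by (auto simp: ef_def pf_def)
  then show "P n (Sg n t u) = Sg n t u" by (simp add: Sg_def P_def S.Phi_mult bounded_borel_ef bounded_borel_pf)
  show "Sg n 0 u = P n u" by (simp add: Sg_def P_def ef_def[abs_def])
qed

lemma exp_second_order: "\<bar>exp w - 1 - w\<bar> \<le> w\<^sup>2 * exp \<bar>w\<bar>" for w :: real
proof -
  have l: "0 \<le> exp w - 1 - w" using exp_ge_add_one_self[of w] by linarith
  have "exp w * (1 - w) \<le> exp w * exp (- w)" using exp_ge_add_one_self[of "- w"] by (intro mult_left_mono) auto
  then have u: "exp w - 1 - w \<le> w * (exp w - 1)" by (simp add: exp_minus algebra_simps)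
  have "w * (exp w - 1) \<le> w\<^sup>2 * exp \<bar>w\<bar>"
  proof (cases "w \<ge> 0")
    case True
    have "exp w - 1 \<le> w * exp w" using \<open>exp w * (1 - w) \<le> exp w * exp (- w)\<close> by (simp add: exp_minus algebra_simps)
    then have "w * (exp w - 1) \<le> w * (w * exp w)" using True by (intro mult_left_mono)
    then show ?thesis using True by (simp add: power2_eq_square algebra_simps)
  next
    case False
    have "w * (exp w - 1) \<le> w * w"
    proof (rule mult_left_mono_neg)
      show "w \<le> exp w - 1" using exp_ge_add_one_self[of w] by linarith
    qed (use False in simp)
    also have "\<dots> \<le> w\<^sup>2 * exp \<bar>w\<bar>" by (simp add: power2_eq_square mult_left_le)
       (metis abs_ge_zero mult.right_neutral mult_left_mono one_le_exp_iff zero_le_square)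
    finally show ?thesis .
  qed
  then show ?thesis using l u by linarith
qed

lemma Sg_second_order:
  "norm (Sg n s v - Sg n t v + (s - t) *\<^sub>R An n (Sg n t v))
    \<le> ((s - t)\<^sup>2 * (real n)\<^sup>2 * exp (\<bar>s - t\<bar> * real n)) * (exp (\<bar>t\<bar> * real n) * norm v)"
proof -
  define r where "r x = ef n (s - t) x - pf n x + (s - t) * af n x" for x
  have b: "bounded_borel (\<lambda>x. (s - t) * af n x)" by (intro bounded_borel_funs)
  have rb: "bounded_borel r" unfolding r_def[abs_def] by (intro bounded_borel_funs bounded_borel_ef)
  have "Sg n s v - Sg n t v + (s - t) *\<^sub>R An n (Sg n t v) = S.Phi r (Sg n t v)"
  proof -
    have "S.Phi r (Sg n t v) = Sg n (s - t) (Sg n t v) - P n (Sg n t v) + (s - t) *\<^sub>R An n (Sg n t v)"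
      unfolding r_def[abs_def]
      by (simp add: S.Phi_add S.Phi_diff S.Phi_scale bounded_borel_funs bounded_borel_ef b flip: Sg_def P_def An_def)
    then show ?thesis by (simp add: Sg_mult)
  qed
  moreover have "norm (S.Phi r (Sg n t v)) \<le> ((s - t)\<^sup>2 * (real n)\<^sup>2 * exp (\<bar>s - t\<bar> * real n)) * norm (Sg n t v)"
  proof (rule S.Phi_bound[OF rb])
    fix x
    show "\<bar>r x\<bar> \<le> (s - t)\<^sup>2 * (real n)\<^sup>2 * exp (\<bar>s - t\<bar> * real n)"
    proof (cases "\<bar>x\<bar> \<le> real n")
      case True
      have "\<bar>r x\<bar> = \<bar>exp (- (s - t) * \<bar>x\<bar>) - 1 - (- (s - t) * \<bar>x\<bar>)\<bar>"
        using True by (simp add: r_def ef_def pf_def af_def algebra_simps)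
      also have "\<dots> \<le> (- (s - t) * \<bar>x\<bar>)\<^sup>2 * exp \<bar>- (s - t) * \<bar>x\<bar>\<bar>" by (rule exp_second_order)
      also have "\<dots> = (s - t)\<^sup>2 * x\<^sup>2 * exp (\<bar>s - t\<bar> * \<bar>x\<bar>)" by (simp add: power_mult_distrib abs_mult power2_commute abs_minus_commute)
      also have "\<dots> \<le> (s - t)\<^sup>2 * (real n)\<^sup>2 * exp (\<bar>s - t\<bar> * real n)"
        using True by (intro mult_mono mult_left_mono) (auto simp: abs_le_square_iff[symmetric] mult_left_mono)
      finally show ?thesis .
    qed (simp add: r_def ef_def pf_def af_def)
  qed
  moreover have "\<dots> \<le> ((s - t)\<^sup>2 * (real n)\<^sup>2 * exp (\<bar>s - t\<bar> * real n)) * (exp (\<bar>t\<bar> * real n) * norm v)"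
    by (intro mult_left_mono norm_Sg) auto
  ultimately show ?thesis by simp
qed

lemma Sg_derivative_const: "((\<lambda>s. Sg n s v) has_vector_derivative - An n (Sg n t v)) (at t)"
  unfolding has_vector_derivative_def has_derivative_at_alt
proof (intro conjI allI impI)
  show "bounded_linear (\<lambda>x. x *\<^sub>R - An n (Sg n t v))" by (rule bounded_linear_scaleR_left)
  fix e :: real assume e: "e > 0"
  define C where "C = (real n)\<^sup>2 * exp (real n) * (exp (\<bar>t\<bar> * real n) * norm v)"
  have C: "C \<ge> 0" by (simp add: C_def)
  show "\<exists>d>0. \<forall>s. norm (s - t) < d \<longrightarrow> norm (Sg n s v - Sg n t v - (s - t) *\<^sub>R - An n (Sg n t v)) \<le> e * norm (s - t)"
  proof (intro exI[of _ "min 1 (e / (C + 1))"] conjI allI impI)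
    show "min 1 (e / (C + 1)) > 0" using e C by simp
    fix s assume s: "norm (s - t) < min 1 (e / (C + 1))"
    have "norm (Sg n s v - Sg n t v + (s - t) *\<^sub>R An n (Sg n t v))
        \<le> ((s - t)\<^sup>2 * (real n)\<^sup>2 * exp (\<bar>s - t\<bar> * real n)) * (exp (\<bar>t\<bar> * real n) * norm v)"
      by (rule Sg_second_order)
    also have "\<dots> \<le> ((s - t)\<^sup>2 * (real n)\<^sup>2 * exp (1 * real n)) * (exp (\<bar>t\<bar> * real n) * norm v)"
      using s by (intro mult_right_mono mult_left_mono) (auto intro!: mult_left_le_one_le)
    also have "\<dots> = (C * \<bar>s - t\<bar>) * \<bar>s - t\<bar>"
    proof -
      have sq: "(s - t)\<^sup>2 = \<bar>s - t\<bar> * \<bar>s - t\<bar>" by (simp add: power2_eq_square)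
      show ?thesis unfolding sq C_def by (simp only: mult_1 mult.assoc mult.commute mult.left_commute)
    qed
    also have "\<dots> \<le> e * \<bar>s - t\<bar>"
    proof (rule mult_right_mono)
      have "C * \<bar>s - t\<bar> \<le> (C + 1) * (e / (C + 1))" using s C by (intro mult_mono) auto
      then show "C * \<bar>s - t\<bar> \<le> e" using C by simp
    qed simp
    finally show "norm (Sg n s v - Sg n t v - (s - t) *\<^sub>R - An n (Sg n t v)) \<le> e * norm (s - t)" by simp
  qed
qed

lemma Sg_tendsto:
  assumes v: "(v \<longlongrightarrow> w) (at t)"
  shows "((\<lambda>s. Sg n s (v s)) \<longlongrightarrow> Sg n t w) (at t)"
proof -
  have "((\<lambda>s. Sg n s w) \<longlongrightarrow> Sg n t w) (at t)"
    using has_vector_derivative_continuous[OF Sg_derivative_const[of n w t]] by (simp add: continuous_at)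
  moreover have "((\<lambda>s. Sg n s (v s - w)) \<longlongrightarrow> 0) (at t)"
  proof (rule Lim_null_comparison)
    show "\<forall>\<^sub>F s in at t. norm (Sg n s (v s - w)) \<le> exp (\<bar>s\<bar> * real n) * norm (v s - w)" by (simp add: norm_Sg)
    have "((\<lambda>s. exp (\<bar>s\<bar> * real n) * norm (v s - w)) \<longlongrightarrow> exp (\<bar>t\<bar> * real n) * norm (w - w)) (at t)"
      by (intro tendsto_intros v)
    then show "((\<lambda>s. exp (\<bar>s\<bar> * real n) * norm (v s - w)) \<longlongrightarrow> 0) (at t)" by simp
  qed
  ultimately have "((\<lambda>s. Sg n s w + Sg n s (v s - w)) \<longlongrightarrow> Sg n t w + 0) (at t)" by (rule tendsto_add)
  then show ?thesis by (simp add: linear_diff[OF bounded_linear.linear[OF linear_Sg]])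
qed

lemma Sg_continuous: assumes "continuous_on UNIV v" shows "continuous_on UNIV (\<lambda>s. Sg n s (v s))"
  using assms Sg_tendsto by (simp add: continuous_on_def)

lemma has_vector_derivative_quotient:
  "(f has_vector_derivative d) (at t) \<longleftrightarrow> ((\<lambda>s. (f s - f t) /\<^sub>R (s - t)) \<longlongrightarrow> d) (at t)"
proof -
  have "norm ((f s - f t) - (s - t) *\<^sub>R d) / norm (s - t) = norm ((f s - f t) /\<^sub>R (s - t) - d)"
    if "s \<noteq> t" for s
  proof -
    have "(f s - f t) /\<^sub>R (s - t) - d = ((f s - f t) - (s - t) *\<^sub>R d) /\<^sub>R (s - t)"
      using that by (simp add: scaleR_diff_right)
    then show ?thesis by (simp add: divide_inverse mult.commute)
  qed
  then have "((\<lambda>s. norm ((f s - f t) - (s - t) *\<^sub>R d) / norm (s - t)) \<longlongrightarrow> 0) (at t)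
      \<longleftrightarrow> ((\<lambda>s. norm ((f s - f t) /\<^sub>R (s - t) - d)) \<longlongrightarrow> 0) (at t)"
    by (intro tendsto_cong) (auto simp: eventually_at_filter)
  then show ?thesis
    unfolding has_vector_derivative_def has_derivative_iff_norm
    by (simp add: bounded_linear_scaleR_left tendsto_norm_zero_iff LIM_zero_iff)
qed

lemma Sg_derivative:
  assumes y: "(y has_vector_derivative y') (at t)"
  shows "((\<lambda>s. Sg n s (y s)) has_vector_derivative Sg n t y' - An n (Sg n t (y t))) (at t)"
proof -
  have "((\<lambda>s. Sg n s ((y s - y t) /\<^sub>R (s - t))) \<longlongrightarrow> Sg n t y') (at t)"
    by (rule Sg_tendsto) (use y has_vector_derivative_quotient in blast)
  then have "((\<lambda>s. Sg n s (y s - y t)) has_vector_derivative Sg n t y') (at t)"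
    unfolding has_vector_derivative_quotient
    by (simp add: linear_scale[OF bounded_linear.linear[OF linear_Sg]] linear_0[OF bounded_linear.linear[OF linear_Sg]])
  from has_vector_derivative_add[OF this Sg_derivative_const[of n "y t" t]]
  show ?thesis by (simp add: linear_diff[OF bounded_linear.linear[OF linear_Sg]])
qed

lemma truncated_evolution:
  assumes g: "continuous_on UNIV g"
  obtains y where "y 0 = P n z0" "\<And>\<tau>. evol \<tau> y (\<lambda>t. P n (g t))"
proof -
  \<comment> \<open>\<open>Sg_continuous\<close> concerns forward time; reflecting s to -s gives
    continuity for the backward time needed under the integral.\<close>
  have "continuous_on UNIV (\<lambda>s. Sg n (- (- s)) (Bn n (g (- s))))"
    by (simp, intro Sg_continuous bounded_linear.continuous_on[OF linear_ops(3)] continuous_on_compose2[OF g] continuous_intros) auto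
  then have "continuous_on UNIV ((\<lambda>s. Sg n (- (- s)) (Bn n (g (- s)))) \<circ> uminus)"
    by (intro continuous_on_compose continuous_intros) (auto intro: continuous_on_subset)
  then have c: "continuous_on UNIV (\<lambda>s. Sg n (- s) (Bn n (g s)))" by (simp add: comp_def)
  obtain G where G: "G 0 = 0" "\<And>t. t > -1 \<Longrightarrow> (G has_vector_derivative Sg n (- t) (Bn n (g t))) (at t)"
    using antiderivative_exists[OF c] by metis
  \<comment> \<open>Variation of constants, \<open>G\<close> being the integral of
    \<open>Sg n (- s) (Bn n (g s))\<close>.\<close>
  define y where "y t = Sg n t (P n z0 + G t)" for t
  have Py: "P n (y t) = y t" for t by (simp add: y_def Sg_mult)
  have dy: "(y has_vector_derivative Bn n (g t) - An n (y t)) (at t)" if "t > -1" for t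
  proof -
    have "((\<lambda>t. P n z0 + G t) has_vector_derivative Sg n (- t) (Bn n (g t))) (at t)"
      using has_vector_derivative_add[OF has_vector_derivative_const G(2)[OF that]] by simp
    from Sg_derivative[OF this, of n] show ?thesis
      unfolding y_def[symmetric] Sg_mult by (simp add: Sg_mult ops_mult)
  qed
  have "evol \<tau> y (\<lambda>t. P n (g t))" for \<tau>
    unfolding evol_def
  proof (intro conjI allI ballI)
    show "continuous_on {0..\<tau>} y"
      by (rule continuous_on_vector_derivative[of _ _ "\<lambda>t. Bn n (g t) - An n (y t)"])
        (rule has_vector_derivative_at_within, rule dy, simp)
    fix m t assume t: "t \<in> {0<..<\<tau>}"
    have "((\<lambda>s. P m (y s)) has_vector_derivative P m (Bn n (g t) - An n (y t))) (at t)"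
      by (rule bounded_linear.has_vector_derivative[OF linear_ops(1) dy]) (use t in auto)
    moreover have "P m (An n (y t)) = An m (y t)"
      using arg_cong[OF Py[of t], of "An m"] by (simp add: ops_mult)
    ultimately show "((\<lambda>s. P m (y s)) has_vector_derivative Bn m (P n (g t)) - An m (y t)) (at t)"
      by (simp add: ops_diff ops_mult)
  qed
  moreover have "y 0 = P n z0" by (simp add: y_def G Sg_mult ops_mult)
  ultimately show thesis using that by blast
qed

text \<open>Strong convergence of contractions is uniform on compact sets, by a finite net.\<close>

lemma P_uniform:
  fixes \<tau> :: real
  assumes g: "continuous_on {0..\<tau>} g" and e: "e > 0"
  obtains N where "\<And>n t. n \<ge> N \<Longrightarrow> t \<in> {0..\<tau>} \<Longrightarrow> norm (P n (g t) - g t) < e"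
proof -
  have "compact (g ` {0..\<tau>})" by (intro compact_continuous_image g compact_Icc)
  then obtain F where F: "finite F" "g ` {0..\<tau>} \<subseteq> (\<Union>x\<in>F. ball x (e / 4))"
    using e unfolding compact_eq_totally_bounded by (metis zero_less_divide_iff zero_less_numeral)
  have "\<forall>\<^sub>F n in sequentially. \<forall>x\<in>F. dist (P n x) x < e / 4"
    using F(1) e by (intro eventually_ball_finite ballI tendstoD[OF P_tendsto]) auto
  then obtain N where N: "\<And>n x. n \<ge> N \<Longrightarrow> x \<in> F \<Longrightarrow> norm (P n x - x) < e / 4"
    unfolding eventually_sequentially dist_norm by blast
  have "norm (P n (g t) - g t) < e" if n: "n \<ge> N" and t: "t \<in> {0..\<tau>}" for n t
  proof -
    obtain x where x: "x \<in> F" "norm (x - g t) < e / 4" using F(2) t by (force simp: dist_norm)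
    have "P n (g t) - g t = P n (g t - x) + (P n x - x) + (x - g t)" by (simp add: ops_diff)
    then have "norm (P n (g t) - g t) \<le> norm (P n (g t - x)) + norm (P n x - x) + norm (x - g t)"
      by (metis norm_triangle_ineq norm_triangle_le add_right_mono)
    also have "\<dots> < e / 4 + e / 4 + e / 4"
      using N[OF n x(1)] x(2) ops_norm(1)[of n "g t - x"] by (simp add: norm_minus_commute)
    also have "\<dots> < e" using e by simp
    finally show ?thesis .
  qed
  then show thesis using that by blast
qed

text \<open>Solutions with truncated data and forcing form a Cauchy sequence, as the constants of
  \<open>evol_est\<close> do not involve the truncation. The limit solves the equation at level j
  exactly: by uniqueness \<open>P j (y n t)\<close> equals \<open>P j (y j t)\<close> for all n >=
  j.\<close>

lemma linear_evolution:
  assumes g: "continuous_on UNIV g"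
  obtains z where "continuous_on {0..} z" "z 0 = z0" "\<And>\<tau>. evol \<tau> z g"
proof -
  have "\<exists>y. y 0 = P n z0 \<and> (\<forall>\<tau>. evol \<tau> y (\<lambda>t. P n (g t)))" for n
    using truncated_evolution[OF g, of n z0] by metis
  then obtain y where y: "\<And>n. y n 0 = P n z0" "\<And>n \<tau>. evol \<tau> (y n) (\<lambda>t. P n (g t))" by metis
  have uc: "uniformly_convergent_on {0..\<tau>} y" for \<tau>
  proof (rule Cauchy_uniformly_convergent, rule uniformly_Cauchy_onI)
    fix e :: real assume e: "e > 0"
    define C where "C = exp \<tau> + exp (2 * \<tau>)"
    have C: "C > 0" by (simp add: C_def add_pos_pos)
    define d where "d = e / (2 * sqrt C + 1)"
    have d: "d > 0" "2 * d * sqrt C < e" using e C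
      by (auto simp: d_def field_simps add_pos_nonneg)
    obtain N1 where N1: "\<And>n t. n \<ge> N1 \<Longrightarrow> t \<in> {0..\<tau>} \<Longrightarrow> norm (P n (g t) - g t) < d"
      using P_uniform[OF continuous_on_subset[OF g] d(1)] by (metis UNIV_I subsetI)
    obtain N2 where N2: "\<And>n. n \<ge> N2 \<Longrightarrow> norm (P n z0 - z0) < d"
      using LIMSEQ_D[OF P_tendsto d(1)] by metis
    have tri: "norm (a - b) \<le> 2 * d" if "norm (a - c) < d" "norm (b - c) < d" for a b c :: 'a
      using norm_triangle_ineq4[of "a - c" "b - c"] that by simp
    show "\<exists>N. \<forall>t\<in>{0..\<tau>}. \<forall>m\<ge>N. \<forall>n\<ge>N. dist (y m t) (y n t) < e"
    proof (intro exI[of _ "max N1 N2"] ballI allI impI)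
      fix t m n assume t: "t \<in> {0..\<tau>}" and mn: "max N1 N2 \<le> m" "max N1 N2 \<le> n"
      have "(norm (y m t - y n t))\<^sup>2 \<le> exp t * (norm (y m 0 - y n 0))\<^sup>2 + (2 * d)\<^sup>2 / (2 - 1) * exp (2 * t)"
      proof (rule evol_est[OF evol_diff[OF y(2) y(2)]])
        fix s assume s: "s \<in> {0<..<\<tau>}"
        have "(norm (P m (g s) - P n (g s)))\<^sup>2 \<le> (2 * d)\<^sup>2"
          using mn s by (intro power_mono tri[OF N1 N1]) auto
        also have "\<dots> \<le> (2 * d)\<^sup>2 * exp (2 * s)" using s by (simp add: mult_le_cancel_left1)
        finally show "(norm (P m (g s) - P n (g s)))\<^sup>2 \<le> (2 * d)\<^sup>2 * exp (2 * s)" .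
      qed (use t in auto)
      also have "\<dots> \<le> exp \<tau> * (2 * d)\<^sup>2 + (2 * d)\<^sup>2 * exp (2 * \<tau>)"
        using t mn unfolding y by (intro add_mono mult_mono power_mono tri[OF N2 N2]) auto
      also have "\<dots> = (2 * d * sqrt C)\<^sup>2" using C by (simp add: C_def power_mult_distrib algebra_simps)
      also have "\<dots> < e\<^sup>2" using d C by (intro power_strict_mono) auto
      finally show "dist (y m t) (y n t) < e" using e by (simp add: dist_norm power2_less_imp_less)
    qed
  qed
  define z where "z t = lim (\<lambda>n. y n t)" for t
  have ul: "uniform_limit {0..\<tau>} y z sequentially" for \<tau>
    unfolding z_def using uc[of \<tau>] by (simp add: uniformly_convergent_uniform_limit_iff)
  have zt: "(\<lambda>n. y n t) \<longlonglongrightarrow> z t" if "t \<ge> 0" for t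
    using tendsto_uniform_limitI[OF ul[of t], of t] that by simp
  have cz: "continuous_on {0..\<tau>} z" for \<tau>
    by (rule uniform_limit_theorem[OF _ ul]) (use y(2) in \<open>auto simp: evol_def\<close>)
  have "isCont z t" if "t > 0" for t
  proof -
    have "continuous_on {0<..<t+1} z" by (rule continuous_on_subset[OF cz[of "t+1"]]) auto
    then show ?thesis using that by (simp add: continuous_on_eq_continuous_at)
  qed
  moreover have "continuous (at 0 within {0..}) z"
  proof -
    have "continuous (at 0 within {0..1}) z" using cz[of 1] by (simp add: continuous_on_eq_continuous_within)
    then show ?thesis by (simp add: continuous_within at_within_Icc_at_right at_within_Ici_at_right)
  qed
  ultimately have cont: "continuous_on {0..} z"
    unfolding continuous_on_eq_continuous_within
    by (metis atLeast_iff continuous_at_imp_continuous_at_within le_less)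
  have Pz: "P j (z t) = P j (y j t)" if "t \<ge> 0" for j t
  proof (rule LIMSEQ_unique)
    show "(\<lambda>n. P j (y n t)) \<longlonglongrightarrow> P j (z t)" by (rule bounded_linear.tendsto[OF linear_ops(1) zt[OF that]])
    have "P j (y n t) = P j (y j t)" if n: "n \<ge> j" for n
    proof (rule evol_unique[of t])
      show "evol t (\<lambda>t. P j (y j t)) (\<lambda>t. P j (P j (g t)))" by (rule evol_P[OF y(2)])
      show "evol t (\<lambda>t. P j (y n t)) (\<lambda>t. P j (P j (g t)))"
        using evol_P[OF y(2), of t j n] n by (simp add: ops_mult min_absorb1)
      show "P j (y n 0) = P j (y j 0)" using n by (simp add: y ops_mult min_absorb1)
    qed (use \<open>t \<ge> 0\<close> in auto)
    then show "(\<lambda>n. P j (y n t)) \<longlonglongrightarrow> P j (y j t)"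
      by (intro tendsto_eventually eventually_sequentiallyI[of j])
  qed
  have "evol \<tau> z g" for \<tau>
    unfolding evol_def
  proof (intro conjI allI ballI cz)
    fix j t assume t: "t \<in> {0<..<\<tau>}"
    have "((\<lambda>s. P j (y j s)) has_vector_derivative Bn j (P j (g t)) - An j (y j t)) (at t)"
      using y(2)[of \<tau> j] t by (auto simp: evol_def)
    then have "((\<lambda>s. P j (z s)) has_vector_derivative Bn j (P j (g t)) - An j (y j t)) (at t)"
      by (rule has_vector_derivative_transform_within_open[of _ _ _ "{0<..<\<tau>}"]) (use t Pz in auto)
    moreover have "An j (y j t) = An j (z t)" using arg_cong[OF Pz[of t j], of "An j"] t by (simp add: ops_mult)
    ultimately show "((\<lambda>s. P j (z s)) has_vector_derivative Bn j (g t) - An j (z t)) (at t)"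
      by (simp add: ops_mult)
  qed
  moreover have "z 0 = z0"
    using zt[of 0] P_tendsto[of z0] LIMSEQ_unique by (simp add: y) blast
  ultimately show thesis using that cont by blast
qed

section \<open>The semilinear evolution equation with a Lipschitz nonlinearity\<close>

lemma semilinear_evolution:
  assumes lip: "\<And>x y. norm (F x - F y) \<le> L * norm (x - y)" and F0: "F 0 = 0" and l: "L \<ge> 0"
  obtains z where "continuous_on {0..} z" "z 0 = z0" "\<And>\<tau>. evol \<tau> z (\<lambda>t. F (z t))"
proof -
  \<comment> \<open>Makes L^2 / (c - 1) at most 1/4, so that the estimate of squared norms contracts
    distances by 1/2.\<close>
  define c where "c = 4 * L\<^sup>2 + 2"
  have "0 < 1 + 4 * L\<^sup>2" by (simp add: add_pos_nonneg)
  then have c: "c > 1" "L\<^sup>2 / (c - 1) \<le> 1 / 4" by (auto simp: c_def field_simps)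
  have cF: "continuous_on UNIV F"
    by (rule lipschitz_on_continuous_on[of L]) (use lip l in \<open>auto simp: lipschitz_on_def dist_norm\<close>)
  \<comment> \<open>The unknown is a bounded continuous function times exp(c t / 2); this encodes
    the exponentially weighted norm.\<close>
  define Z where "Z \<phi> t = exp (c / 2 * t) *\<^sub>R apply_bcontfun \<phi> t" for \<phi> :: "real \<Rightarrow>\<^sub>C 'a" and t
  have sq: "(exp (c / 2 * t) * a)\<^sup>2 = a\<^sup>2 * exp (c * t)" for a t :: real
    by (simp add: power_mult_distrib exp_double[symmetric])
  have cZ: "continuous_on UNIV (\<lambda>t. F (Z \<phi> t))" for \<phi>
    unfolding Z_def by (intro continuous_on_compose2[OF cF] continuous_intros) auto
  have "\<exists>z. continuous_on {0..} z \<and> z 0 = z0 \<and> (\<forall>\<tau>. evol \<tau> z (\<lambda>t. F (Z \<phi> t)))" for \<phi>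
    using linear_evolution[OF cZ, of z0 \<phi>] by metis
  then obtain sol where sol: "\<And>\<phi>. continuous_on {0..} (sol \<phi>)" "\<And>\<phi>. sol \<phi> 0 = z0"
    "\<And>\<phi> \<tau>. evol \<tau> (sol \<phi>) (\<lambda>t. F (Z \<phi> t))" by metis
  \<comment> \<open>\<open>max 0 t\<close> freezes the function at its initial value for negative
    times, which gives a bounded continuous function on the whole line.\<close>
  define \<psi> where "\<psi> \<phi> t = exp (- (c / 2) * max 0 t) *\<^sub>R sol \<phi> (max 0 t)" for \<phi> t
  have \<psi>b: "\<psi> \<phi> \<in> bcontfun" for \<phi>
  proof -
    obtain B where B: "B > 0" "\<And>t. norm (apply_bcontfun \<phi> t) \<le> B"
      using bounded_apply_bcontfun[of \<phi>] by (metis bounded_pos UNIV_I image_eqI)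
    have "norm (\<psi> \<phi> t) \<le> sqrt ((norm z0)\<^sup>2 + (L * B)\<^sup>2 / (c - 1))" for t
    proof (rule real_le_rsqrt)
      let ?t = "max 0 t"
      have "(norm (sol \<phi> ?t))\<^sup>2 \<le> exp ?t * (norm (sol \<phi> 0))\<^sup>2 + (L * B)\<^sup>2 / (c - 1) * exp (c * ?t)"
      proof (rule evol_est[OF sol(3)[of ?t]])
        fix s
        have "norm (F (Z \<phi> s)) \<le> L * norm (Z \<phi> s)" using lip[of "Z \<phi> s" 0] F0 by simp
        also have "\<dots> \<le> L * (exp (c / 2 * s) * B)" by (intro mult_left_mono l) (simp add: Z_def B)
        finally have "(norm (F (Z \<phi> s)))\<^sup>2 \<le> (exp (c / 2 * s) * (L * B))\<^sup>2"
          by (intro power_mono) (simp_all add: mult.left_commute)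
        then show "(norm (F (Z \<phi> s)))\<^sup>2 \<le> (L * B)\<^sup>2 * exp (c * s)" unfolding sq .
      qed (use c in auto)
      also have "\<dots> \<le> exp (c * ?t) * (norm z0)\<^sup>2 + (L * B)\<^sup>2 / (c - 1) * exp (c * ?t)"
      proof -
        have "?t \<le> c * ?t" using c mult_right_mono[of 1 c ?t] by simp
        then show ?thesis unfolding sol(2) by (intro add_right_mono mult_right_mono) auto
      qed
      finally have le: "(norm (sol \<phi> ?t))\<^sup>2 \<le> exp (c * ?t) * ((norm z0)\<^sup>2 + (L * B)\<^sup>2 / (c - 1))"
        by (simp add: algebra_simps)
      have "(norm (\<psi> \<phi> t))\<^sup>2 = exp (- (c * ?t)) * (norm (sol \<phi> ?t))\<^sup>2"
        by (simp add: \<psi>_def power_mult_distrib exp_double[symmetric])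
      also have "\<dots> \<le> exp (- (c * ?t)) * (exp (c * ?t) * ((norm z0)\<^sup>2 + (L * B)\<^sup>2 / (c - 1)))"
        by (intro mult_left_mono le) simp
      also have "\<dots> = (norm z0)\<^sup>2 + (L * B)\<^sup>2 / (c - 1)"
        by (simp only: mult.assoc[symmetric] exp_add[symmetric]) simp
      finally show "(norm (\<psi> \<phi> t))\<^sup>2 \<le> (norm z0)\<^sup>2 + (L * B)\<^sup>2 / (c - 1)" .
    qed
    then have "bounded (range (\<psi> \<phi>))" by (auto simp: bounded_iff)
    moreover have "continuous_on UNIV (\<psi> \<phi>)"
      unfolding \<psi>_def by (intro continuous_intros continuous_on_compose2[OF sol(1)]) auto
    ultimately show ?thesis by (simp add: bcontfun_def)
  qed
  define \<Psi> where "\<Psi> \<phi> = Bcontfun (\<psi> \<phi>)" for \<phi>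
  have a\<Psi>: "apply_bcontfun (\<Psi> \<phi>) = \<psi> \<phi>" for \<phi>
    unfolding \<Psi>_def by (rule Bcontfun_inverse[OF \<psi>b])
  have contr: "dist (\<Psi> \<phi>) (\<Psi> \<phi>') \<le> 1 / 2 * dist \<phi> \<phi>'" for \<phi> \<phi>'
  proof (rule dist_bound)
    fix t :: real
    let ?t = "max 0 t" and ?d = "dist \<phi> \<phi>'"
    have "(norm (sol \<phi> ?t - sol \<phi>' ?t))\<^sup>2 \<le> exp ?t * (norm (sol \<phi> 0 - sol \<phi>' 0))\<^sup>2 + (L * ?d)\<^sup>2 / (c - 1) * exp (c * ?t)"
    proof (rule evol_est[OF evol_diff[OF sol(3) sol(3), of ?t]])
      fix s
      have "norm (F (Z \<phi> s) - F (Z \<phi>' s)) \<le> L * norm (Z \<phi> s - Z \<phi>' s)" by (rule lip)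
      also have "Z \<phi> s - Z \<phi>' s = exp (c / 2 * s) *\<^sub>R (apply_bcontfun \<phi> s - apply_bcontfun \<phi>' s)"
        by (simp add: Z_def scaleR_diff_right)
      also have "L * norm \<dots> \<le> L * (exp (c / 2 * s) * ?d)"
        using dist_bounded[of \<phi> s \<phi>'] by (intro mult_left_mono l) (simp add: dist_norm)
      finally have "(norm (F (Z \<phi> s) - F (Z \<phi>' s)))\<^sup>2 \<le> (exp (c / 2 * s) * (L * ?d))\<^sup>2"
        by (intro power_mono) (simp_all add: mult.left_commute)
      then show "(norm (F (Z \<phi> s) - F (Z \<phi>' s)))\<^sup>2 \<le> (L * ?d)\<^sup>2 * exp (c * s)" unfolding sq .
    qed (use c in auto)
    also have "\<dots> = (L\<^sup>2 / (c - 1)) * ?d\<^sup>2 * exp (c * ?t)" by (simp add: sol(2) power_mult_distrib)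
    also have "\<dots> \<le> 1 / 4 * ?d\<^sup>2 * exp (c * ?t)" using c by (intro mult_right_mono) auto
    also have "\<dots> = (exp (c / 2 * ?t) * (?d / 2))\<^sup>2" unfolding sq by (simp add: power_divide)
    finally have le: "norm (sol \<phi> ?t - sol \<phi>' ?t) \<le> exp (c / 2 * ?t) * (?d / 2)"
      by (rule power2_le_imp_le) simp
    have "dist (\<psi> \<phi> t) (\<psi> \<phi>' t) = exp (- (c / 2 * ?t)) * norm (sol \<phi> ?t - sol \<phi>' ?t)"
      by (simp add: \<psi>_def dist_norm scaleR_diff_right[symmetric])
    also have "\<dots> \<le> exp (- (c / 2 * ?t)) * (exp (c / 2 * ?t) * (?d / 2))" by (intro mult_left_mono le) simp
    also have "\<dots> = 1 / 2 * ?d" by (simp only: mult.assoc[symmetric] exp_add[symmetric]) simp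
    finally show "dist (apply_bcontfun (\<Psi> \<phi>) t) (apply_bcontfun (\<Psi> \<phi>') t) \<le> 1 / 2 * ?d"
      unfolding a\<Psi> .
  qed
  have "\<exists>!\<phi>. \<Psi> \<phi> = \<phi>" by (rule banach_fix_type[of "1/2"]) (use contr in auto)
  then obtain \<phi> where \<phi>: "\<Psi> \<phi> = \<phi>" by blast
  have Zs: "Z \<phi> t = sol \<phi> t" if "t \<ge> 0" for t
  proof -
    have "apply_bcontfun \<phi> t = \<psi> \<phi> t" using a\<Psi>[of \<phi>] \<phi> by simp
    then show ?thesis using that by (simp add: Z_def \<psi>_def exp_add[symmetric])
  qed
  have "evol \<tau> (sol \<phi>) (\<lambda>t. F (sol \<phi> t))" for \<tau>
    by (rule evol_cong[OF sol(3)]) (simp add: Zs)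
  then show thesis using that sol(1,2) by blast
qed

end

section \<open>The slow decay estimate\<close>

text \<open>Every left-hand side tends to 0 with \<epsilon>. The third condition makes w^(1+q) at
  most y^(1+p), the fourth lets half of \<nu> absorb the drift of y^(1+p), and the last keeps |z|
  below the retraction radius.\<close>

lemma small_parameter_exists:
  fixes p q \<nu> \<Gamma> r C0 :: real
  assumes "p > 0" "q > 0" "\<nu> > 0" "\<Gamma> > 0" "r > 0" "C0 > 0"
  obtains \<epsilon> where "0 < \<epsilon>" "\<epsilon> \<le> 1" "(\<Gamma> * \<epsilon> powr (1 + p)) powr q * \<Gamma> \<le> 1"
    "(1 + p) * C0 * \<epsilon> powr (p / 2) \<le> \<nu> / 2" "\<epsilon> + \<Gamma> * \<epsilon> powr (1 + p) < r\<^sup>2"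
proof -
  have t: "((\<lambda>\<epsilon>::real. \<epsilon> powr a) \<longlongrightarrow> 0) (at_right 0)" if "a > 0" for a
  proof -
    have "\<forall>\<^sub>F \<epsilon> in at_right 0. 0 \<le> (\<epsilon>::real)"
      by (rule eventually_mono[OF eventually_at_right_less[of 0]]) simp
    then show ?thesis
      using tendsto_powr'[of "\<lambda>\<epsilon>::real. \<epsilon>" 0 "at_right 0" "\<lambda>_. a" a] that by simp
  qed
  have 1: "((\<lambda>\<epsilon>. (\<Gamma> * \<epsilon> powr (1 + p)) powr q * \<Gamma>) \<longlongrightarrow> 0) (at_right 0)"
  proof -
    have "((\<lambda>\<epsilon>. (\<Gamma> * \<epsilon> powr (1 + p)) powr q * \<Gamma>) \<longlongrightarrow> (\<Gamma> * 0) powr q * \<Gamma>) (at_right 0)"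
      using assms by (intro tendsto_mult tendsto_const tendsto_powr' t) auto
    then show ?thesis by simp
  qed
  have 2: "((\<lambda>\<epsilon>. (1 + p) * C0 * \<epsilon> powr (p / 2)) \<longlongrightarrow> 0) (at_right 0)"
    using tendsto_mult_right_zero[OF t[of "p/2"]] assms by simp
  have 3: "((\<lambda>\<epsilon>. \<epsilon> + \<Gamma> * \<epsilon> powr (1 + p)) \<longlongrightarrow> 0) (at_right 0)"
    using tendsto_add[OF tendsto_ident_at[of 0 "{0<..}"] tendsto_mult_right_zero[OF t[of "1+p"]]] assms by simp
  have "\<forall>\<^sub>F \<epsilon> in at_right 0. 0 < \<epsilon> \<and> \<epsilon> \<le> 1 \<and> (\<Gamma> * \<epsilon> powr (1 + p)) powr q * \<Gamma> < 1
      \<and> (1 + p) * C0 * \<epsilon> powr (p / 2) < \<nu> / 2 \<and> \<epsilon> + \<Gamma> * \<epsilon> powr (1 + p) < r\<^sup>2"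
    using assms
    by (intro eventually_conj order_tendstoD(2)[OF 1] order_tendstoD(2)[OF 2] order_tendstoD(2)[OF 3]
        eventually_at_right_less) (auto simp: eventually_at_right[of 0 1] intro!: exI[of _ 1])
  then obtain \<epsilon> where "0 < \<epsilon> \<and> \<epsilon> \<le> 1 \<and> (\<Gamma> * \<epsilon> powr (1 + p)) powr q * \<Gamma> < 1
      \<and> (1 + p) * C0 * \<epsilon> powr (p / 2) < \<nu> / 2 \<and> \<epsilon> + \<Gamma> * \<epsilon> powr (1 + p) < r\<^sup>2"
    using eventually_happens'[OF trivial_limit_at_right_real] by blast
  then show thesis using that[of \<epsilon>] by auto
qed

text \<open>Here \<open>N\<close> stands for \<open>|f(u)|\<close> and \<open>wn\<close> for the truncations of \<open>w\<close>, which are differentiable while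
  \<open>w\<close> is only absolutely continuous.\<close>

locale slow_decay =
  fixes y w N y' :: "real \<Rightarrow> real" and wn wn' :: "nat \<Rightarrow> real \<Rightarrow> real"
    and p q K0 \<nu> \<Gamma> C0 \<epsilon> :: real
  assumes pq: "p > 0" "q > 0" "K0 \<ge> 0" "\<nu> > 0"
    and \<Gamma>_def: "\<Gamma> = 8 * K0\<^sup>2 / \<nu> + 1" and C0_def: "C0 = 2 * \<Gamma> + 4 * K0"
    and \<epsilon>: "0 < \<epsilon>" "\<epsilon> \<le> 1" "(\<Gamma> * \<epsilon> powr (1 + p)) powr q * \<Gamma> \<le> 1" "(1 + p) * C0 * \<epsilon> powr (p / 2) \<le> \<nu> / 2"
    and y_cont: "continuous_on {0..} y" and w_cont: "continuous_on {0..} w"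
    and y_nonneg: "\<And>t. t \<ge> 0 \<Longrightarrow> 0 \<le> y t" and w_nonneg: "\<And>t. t \<ge> 0 \<Longrightarrow> 0 \<le> w t"
    and N: "\<And>t. t \<ge> 0 \<Longrightarrow> 0 \<le> N t \<and> (N t)\<^sup>2 \<le> 2 * K0\<^sup>2 * (y t powr (1 + p) + w t powr (1 + q))"
    and dy: "\<And>t. t > 0 \<Longrightarrow> (y has_real_derivative y' t) (at t)"
    and y': "\<And>t. t > 0 \<Longrightarrow> y' t \<le> 0" "\<And>t. t > 0 \<Longrightarrow> - y' t \<le> 2 * w t + 2 * sqrt (y t) * N t"
    and wn_cont: "\<And>n. continuous_on {0..} (wn n)" and wn_nonneg: "\<And>n t. t \<ge> 0 \<Longrightarrow> 0 \<le> wn n t"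
    and wn_lim: "\<And>t. t \<ge> 0 \<Longrightarrow> (\<lambda>n. wn n t) \<longlonglongrightarrow> w t"
    and dwn: "\<And>n t. t > 0 \<Longrightarrow> (wn n has_real_derivative wn' n t) (at t)"
    and wn': "\<And>n t. t > 0 \<Longrightarrow> wn' n t \<le> - \<nu> * wn n t + (N t)\<^sup>2"
    and init: "0 < y 0" "y 0 < \<epsilon>" "w 0 < \<Gamma> * y 0 powr (1 + p)"
begin

lemma \<Gamma>_pos: "\<Gamma> \<ge> 1" and C0_pos: "C0 > 0"
proof -
  have "0 \<le> 8 * K0\<^sup>2 / \<nu>" using pq by simp
  then show "\<Gamma> \<ge> 1" unfolding \<Gamma>_def by linarith
  then show "C0 > 0" using pq unfolding C0_def by linarith
qed

lemma y_le: assumes "t \<ge> 0" shows "y t \<le> y 0" "y t < \<epsilon>"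
proof -
  show "y t \<le> y 0"
    by (rule DERIV_nonpos_imp_decreasing_open[where f = y and a = 0 and b = t])
      (use assms dy y'(1) in \<open>auto intro: continuous_on_subset[OF y_cont]\<close>)
  then show "y t < \<epsilon>" using init by simp
qed

text \<open>Consequences of G <= \<Gamma> at a single time. Since w^(1+q) = w^q w is then at most
  y^(1+p), both terms of the growth bound have the size of the first, and the exponent q
  disappears.\<close>

lemma bounds:
  assumes t: "t > 0" and good: "w t \<le> \<Gamma> * y t powr (1 + p)"
  shows N_bound: "(N t)\<^sup>2 \<le> 4 * K0\<^sup>2 * y t powr (1 + p)"
    and y'_bound: "- y' t \<le> C0 * y t powr (1 + p / 2)"
    and y'_linear: "- (1 + p) * y' t \<le> \<nu> / 2 * y t"
proof -
  have y0: "0 \<le> y t" "y t \<le> \<epsilon>" "y t \<le> 1" and w0: "0 \<le> w t" using y_nonneg[of t] y_le[of t] t \<epsilon> w_nonneg[of t] by auto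
  have "w t powr (1 + q) = w t powr q * w t" using w0 by (cases "w t = 0") (auto simp: powr_add)
  also have "\<dots> \<le> (\<Gamma> * \<epsilon> powr (1 + p)) powr q * (\<Gamma> * y t powr (1 + p))"
  proof (intro mult_mono good powr_mono2)
    have "w t \<le> \<Gamma> * y t powr (1 + p)" by (rule good)
    also have "\<dots> \<le> \<Gamma> * \<epsilon> powr (1 + p)" using \<Gamma>_pos y0 pq by (intro mult_left_mono powr_mono2) auto
    finally show "w t \<le> \<Gamma> * \<epsilon> powr (1 + p)" .
  qed (use pq w0 in auto)
  also have "\<dots> = ((\<Gamma> * \<epsilon> powr (1 + p)) powr q * \<Gamma>) * y t powr (1 + p)" by simp
  also have "\<dots> \<le> 1 * y t powr (1 + p)" by (intro mult_right_mono \<epsilon>) auto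
  finally have "w t powr (1 + q) \<le> y t powr (1 + p)" by simp
  then have "2 * K0\<^sup>2 * (y t powr (1 + p) + w t powr (1 + q)) \<le> 2 * K0\<^sup>2 * (y t powr (1 + p) + y t powr (1 + p))"
    by (intro mult_left_mono) auto
  then show Nb: "(N t)\<^sup>2 \<le> 4 * K0\<^sup>2 * y t powr (1 + p)" using N[of t] t by simp
  have "(2 * K0 * y t powr ((1 + p) / 2))\<^sup>2 = 4 * K0\<^sup>2 * y t powr (1 + p)"
    by (simp add: power_mult_distrib power2_eq_square powr_add[symmetric])
  then have "(N t)\<^sup>2 \<le> (2 * K0 * y t powr ((1 + p) / 2))\<^sup>2" using Nb by simp
  then have Nt: "N t \<le> 2 * K0 * y t powr ((1 + p) / 2)" by (rule power2_le_imp_le) (use pq in simp)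
  have "sqrt (y t) * N t \<le> y t powr (1 / 2) * (2 * K0 * y t powr ((1 + p) / 2))"
    using Nt y0 by (intro mult_mono) (auto simp: powr_half_sqrt N t less_imp_le)
  also have "\<dots> = 2 * K0 * y t powr (1 + p / 2)"
    by (simp add: powr_add[symmetric] add_divide_distrib[symmetric] mult.left_commute) (simp add: add_divide_distrib)
  finally have a: "sqrt (y t) * N t \<le> 2 * K0 * y t powr (1 + p / 2)" .
  \<comment> \<open>Because y <= 1, the term 2 w is also of order y^(1+p/2); adding the two
    contributions produces C0 = 2 \<Gamma> + 4 K0.\<close>
  have "y t powr (1 + p) \<le> y t powr (1 + p / 2)" using y0 pq by (intro powr_mono') auto
  then have "\<Gamma> * y t powr (1 + p) \<le> \<Gamma> * y t powr (1 + p / 2)" using \<Gamma>_pos by simp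
  then show yb: "- y' t \<le> C0 * y t powr (1 + p / 2)"
    using y'(2)[OF t] good a by (simp add: C0_def distrib_right)
  have "(1 + p) * (- y' t) \<le> (1 + p) * (C0 * y t powr (1 + p / 2))"
    using pq by (intro mult_left_mono yb) auto
  also have "\<dots> = ((1 + p) * C0 * y t powr (p / 2)) * y t"
    using y0 by (cases "y t = 0") (auto simp: powr_add)
  also have "\<dots> \<le> ((1 + p) * C0 * \<epsilon> powr (p / 2)) * y t"
    using y0 pq C0_pos by (intro mult_right_mono mult_left_mono powr_mono2) auto
  also have "\<dots> \<le> \<nu> / 2 * y t" by (intro mult_right_mono \<epsilon> y0)
  finally show "- (1 + p) * y' t \<le> \<nu> / 2 * y t" by (simp add: algebra_simps)
qed

text \<open>The strict bound at all earlier times yields the strict bound at \<open>t1\<close>.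
  First y is kept away from 0 up to and including \<open>t1\<close>, since G divides by a power of
  y; then the differential inequality for G is integrated.\<close>

lemma improve:
  assumes t1: "t1 > 0" and good: "\<And>t. 0 \<le> t \<Longrightarrow> t < t1 \<Longrightarrow> w t < \<Gamma> * y t powr (1 + p)"
  shows "w t1 < \<Gamma> * y t1 powr (1 + p)"
proof -
  have lin: "- (1 + p) * y' t \<le> \<nu> / 2 * y t" if "0 < t" "t < t1" for t
    by (rule y'_linear) (use that good[of t] in auto)
  \<comment> \<open>\<open>lin\<close> says y' >= -\<kappa> y, so exp(\<kappa> t) y is
    nondecreasing.\<close>
  define \<kappa> where "\<kappa> = \<nu> / (2 * (1 + p))"
  have \<kappa>: "\<nu> = 2 * (1 + p) * \<kappa>" using pq by (simp add: \<kappa>_def)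
  have ypos: "0 < y t" if t: "0 \<le> t" "t \<le> t1" for t
  proof -
    have "exp (\<kappa> * 0) * y 0 \<le> exp (\<kappa> * t) * y t"
    proof (rule DERIV_nonneg_imp_increasing_open[OF t(1)])
      show "continuous_on {0..t} (\<lambda>s. exp (\<kappa> * s) * y s)"
        by (intro continuous_intros continuous_on_subset[OF y_cont]) auto
      fix s assume s: "0 < s" "s < t"
      have "((\<lambda>s. exp (\<kappa> * s) * y s) has_real_derivative
          exp (\<kappa> * s) * (\<kappa> * y s + y' s)) (at s)"
        by (auto intro!: derivative_eq_intros dy s simp: algebra_simps)
      moreover have "0 \<le> \<kappa> * y s + y' s"

      proof -
        have "(1 + p) * (\<kappa> * y s + y' s) \<ge> 0" using lin[of s] s t unfolding \<kappa> by (simp add: algebra_simps)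
        then show ?thesis using pq by (simp add: zero_le_mult_iff)
      qed
      ultimately show "\<exists>d. ((\<lambda>s. exp (\<kappa> * s) * y s) has_real_derivative d) (at s) \<and> 0 \<le> d"
        by (meson mult_nonneg_nonneg exp_ge_zero)
    qed
    then have "0 < exp (\<kappa> * t) * y t" using init(1) by simp
    then show ?thesis by (simp add: zero_less_mult_iff)
  qed
  \<comment> \<open>The equilibrium of the inequality for G; \<open>G\<close> below measures the
    deviation from it with the integrating factor exp(\<nu> t / 2).\<close>
  define c where "c = 8 * K0\<^sup>2 / \<nu>"
  define G where "G n t = exp (\<nu> / 2 * t) * (wn n t * y t powr (- (1 + p)) - c)" for n t
  have G_le: "G n t1 \<le> G n 0" for n
  proof (rule DERIV_nonpos_imp_decreasing_open[where f = "G n" and a = 0 and b = t1])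
    show "0 \<le> t1" using t1 by simp
    show "continuous_on {0..t1} (G n)"
      unfolding G_def using ypos
      by (intro continuous_intros continuous_on_subset[OF y_cont] continuous_on_subset[OF wn_cont]) (auto simp: less_le)
    fix s assume s: "0 < s" "s < t1"
    have ys: "0 < y s" using ypos s by simp
    have d: "(G n has_real_derivative exp (\<nu> / 2 * s) * (\<nu> / 2 * (wn n s * y s powr (- (1 + p)) - c)
       + wn' n s * y s powr (- (1 + p)) + wn n s * (- (1 + p) * y s powr (- (1 + p) - 1) * y' s))) (at s)"
      unfolding G_def[abs_def]
      by (rule derivative_eq_intros dwn dy s DERIV_fun_powr ys refl | simp add: ys)+ (simp add: algebra_simps)
    have "wn n s * (- (1 + p) * y s powr (- (1 + p) - 1) * y' s)
        = (wn n s * y s powr (- (1 + p) - 1)) * (- (1 + p) * y' s)" by (simp add: algebra_simps)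
    also have "\<dots> \<le> (wn n s * y s powr (- (1 + p) - 1)) * (\<nu> / 2 * y s)"
      using s by (intro mult_left_mono lin mult_nonneg_nonneg wn_nonneg) auto
    also have "\<dots> = \<nu> / 2 * (wn n s * (y s powr (- (1 + p) - 1) * y s))" by (simp add: algebra_simps)
    also have "y s powr (- (1 + p) - 1) * y s = y s powr (- (1 + p))"
    proof -
      have "1 + (- (1 + p) - 1) = - (1 + p)" by simp
      then show ?thesis using powr_mult_base[of "y s" "- (1 + p) - 1"] ys by (metis mult.commute less_imp_le)
    qed
    finally have a: "wn n s * (- (1 + p) * y s powr (- (1 + p) - 1) * y' s) \<le> \<nu> / 2 * (wn n s * y s powr (- (1 + p)))" .
    have "wn' n s \<le> - \<nu> * wn n s + 4 * K0\<^sup>2 * y s powr (1 + p)"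
      using wn'[OF s(1), of n] N_bound[OF s(1)] good[of s] s by simp
    then have "wn' n s * y s powr (- (1 + p)) \<le> (- \<nu> * wn n s + 4 * K0\<^sup>2 * y s powr (1 + p)) * y s powr (- (1 + p))"
      by (rule mult_right_mono) simp
    also have "\<dots> = - \<nu> * (wn n s * y s powr (- (1 + p))) + 4 * K0\<^sup>2 * (y s powr (1 + p) * y s powr (- (1 + p)))"
      by (simp add: algebra_simps)
    also have "y s powr (1 + p) * y s powr (- (1 + p)) = 1" using ys by (simp add: powr_add[symmetric])
    finally have b: "wn' n s * y s powr (- (1 + p)) \<le> - \<nu> * (wn n s * y s powr (- (1 + p))) + 4 * K0\<^sup>2" by simp
    have "\<nu> / 2 * c = 4 * K0\<^sup>2" using pq by (simp add: c_def)
    then have "\<nu> / 2 * (wn n s * y s powr (- (1 + p)) - c)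
       + wn' n s * y s powr (- (1 + p)) + wn n s * (- (1 + p) * y s powr (- (1 + p) - 1) * y' s) \<le> 0"
      using a b by (simp add: algebra_simps)
    with d show "\<exists>d. (G n has_real_derivative d) (at s) \<and> d \<le> 0"
      by (meson mult_nonneg_nonpos exp_ge_zero)
  qed
  \<comment> \<open>Monotonicity was shown for the differentiable truncations of w; the inequality
    between the endpoints passes to w.\<close>
  have lim: "(\<lambda>n. G n t) \<longlonglongrightarrow> exp (\<nu> / 2 * t) * (w t * y t powr (- (1 + p)) - c)" if "t \<ge> 0" for t
    unfolding G_def by (intro tendsto_intros wn_lim that)
  have "exp (\<nu> / 2 * t1) * (w t1 * y t1 powr (- (1 + p)) - c) \<le> exp (\<nu> / 2 * 0) * (w 0 * y 0 powr (- (1 + p)) - c)"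
    by (rule LIMSEQ_le[OF lim lim]) (use t1 G_le in auto)
  moreover have "w 0 * y 0 powr (- (1 + p)) < \<Gamma>"
  proof -
    have "w 0 * y 0 powr (- (1 + p)) < (\<Gamma> * y 0 powr (1 + p)) * y 0 powr (- (1 + p))"
      using init by (intro mult_strict_right_mono) auto
    then show ?thesis using init(1) by (simp add: mult.assoc powr_add[symmetric])
  qed
  \<comment> \<open>At time 0 the deviation from c is less than \<Gamma> - c = 1.\<close>
  ultimately have "exp (\<nu> / 2 * t1) * (w t1 * y t1 powr (- (1 + p)) - c) < 1" by (simp add: \<Gamma>_def c_def)
  moreover have "1 \<le> exp (\<nu> / 2 * t1)" using pq t1 by simp
  ultimately have "w t1 * y t1 powr (- (1 + p)) - c < 1"
    by (smt (verit) mult_less_cancel_right2 mult_right_mono)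
  then have "(w t1 * y t1 powr (- (1 + p))) * y t1 powr (1 + p) < \<Gamma> * y t1 powr (1 + p)"
    using ypos[of t1] t1 by (intro mult_strict_right_mono) (auto simp: \<Gamma>_def c_def)
  then show ?thesis using ypos[of t1] t1 by (simp add: mult.assoc powr_add[symmetric])
qed

text \<open>A first time of failure exists by continuity and is positive because the initial
  inequality is strict; \<open>improve\<close> contradicts failure there.\<close>

lemma good: assumes "t \<ge> 0" shows "w t < \<Gamma> * y t powr (1 + p)"
proof (rule ccontr)
  assume bad: "\<not> w t < \<Gamma> * y t powr (1 + p)"
  define S where "S = {s \<in> {0..t}. \<Gamma> * y s powr (1 + p) \<le> w s}"
  have "closed S"
    unfolding S_def
  proof (rule continuous_on_closed_Collect_le)
    show "continuous_on {0..t} (\<lambda>s. \<Gamma> * y s powr (1 + p))"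
      by (intro continuous_on_mult continuous_on_const continuous_on_powr' continuous_on_subset[OF y_cont])
        (use y_nonneg pq in auto)
    show "continuous_on {0..t} w" by (rule continuous_on_subset[OF w_cont]) auto
  qed simp
  moreover have ne: "S \<noteq> {}" using bad assms by (auto simp: S_def)
  moreover have bdd: "bdd_below S" by (auto simp: S_def intro: bdd_belowI[of _ 0])
  ultimately have "Inf S \<in> S" by (simp add: closed_contains_Inf)
  then obtain m where m: "m = Inf S" "m \<in> S" by blast
  then have m': "0 \<le> m" "m \<le> t" "\<Gamma> * y m powr (1 + p) \<le> w m" by (simp_all add: S_def)
  have lt: "w s < \<Gamma> * y s powr (1 + p)" if "0 \<le> s" "s < m" for s
  proof (rule ccontr)
    assume "\<not> ?thesis"
    then have "s \<in> S" using that m' by (simp add: S_def)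
    then show False using cInf_lower[OF _ bdd, of s] that m(1) by simp
  qed
  have "m \<noteq> 0" using m' init by auto
  have "w m < \<Gamma> * y m powr (1 + p)"
  proof (rule improve)
    show "m > 0" using \<open>m \<noteq> 0\<close> m'(1) by simp
  qed (rule lt)
  then show False using m' by simp
qed

text \<open>If y vanished, the strict inequality of \<open>good\<close> would make w
  negative.\<close>

lemma y_pos: assumes "t \<ge> 0" shows "0 < y t"
  using good[OF assms] w_nonneg[OF assms] y_nonneg[OF assms] \<Gamma>_pos
  by (cases "y t = 0") (auto simp: less_le)

lemma sum_bound: "t \<ge> 0 \<Longrightarrow> y t + w t < \<epsilon> + \<Gamma> * \<epsilon> powr (1 + p)"
proof -
  assume t: "t \<ge> 0"
  have "\<Gamma> * y t powr (1 + p) \<le> \<Gamma> * \<epsilon> powr (1 + p)"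
    using y_le[OF t] y_pos[OF t] \<Gamma>_pos pq by (intro mult_left_mono powr_mono2) auto
  then show ?thesis using good[OF t] y_le(2)[OF t] by simp
qed

text \<open>The bound -y' <= C0 y^(1+p/2) says that y^(-p/2) grows at most linearly; inverting gives
  sqrt y >= M (1 + t)^(-1/p).\<close>

lemma slow: "\<exists>M>0. \<forall>t\<ge>0. M / (1 + t) powr (1 / p) \<le> sqrt (y t)"
proof -
  define B where "B = y 0 powr (- (p / 2)) + p / 2 * C0"
  have B: "B > 0" using init C0_pos pq by (auto simp: B_def intro!: add_pos_pos)
  have le: "y t powr (- (p / 2)) \<le> B * (1 + t)" if t: "t \<ge> 0" for t
  proof -
    have "y t powr (- (p / 2)) - p / 2 * C0 * t \<le> y 0 powr (- (p / 2)) - p / 2 * C0 * 0"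
    proof (rule DERIV_nonpos_imp_decreasing_open[where f = "\<lambda>t. y t powr (- (p / 2)) - p / 2 * C0 * t" and a = 0 and b = t])
      show "continuous_on {0..t} (\<lambda>t. y t powr (- (p / 2)) - p / 2 * C0 * t)"
        by (intro continuous_intros continuous_on_subset[OF y_cont]) (use y_pos in \<open>auto simp: less_le\<close>)
      fix s assume s: "0 < s" "s < t"
      have ys: "0 < y s" using y_pos s by simp
      have d: "((\<lambda>t. y t powr (- (p / 2)) - p / 2 * C0 * t) has_real_derivative
          (- (p / 2) * y s powr (- (p / 2) - 1) * y' s - p / 2 * C0)) (at s)"
        by (rule derivative_eq_intros dy s DERIV_fun_powr ys refl | simp add: ys)+
      have "y s powr (- (p / 2) - 1) * (- y' s) \<le> y s powr (- (p / 2) - 1) * (C0 * y s powr (1 + p / 2))"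
        using good[of s] s by (intro mult_left_mono y'_bound) auto
      also have "\<dots> = C0 * (y s powr (- (p / 2) - 1) * y s powr (1 + p / 2))" by simp
      also have "y s powr (- (p / 2) - 1) * y s powr (1 + p / 2) = 1" using ys by (simp add: powr_add[symmetric])
      finally have "p / 2 * (y s powr (- (p / 2) - 1) * (- y' s)) \<le> p / 2 * C0"
        using pq by (intro mult_left_mono) auto
      then have "- (p / 2) * y s powr (- (p / 2) - 1) * y' s - p / 2 * C0 \<le> 0" by simp
      with d show "\<exists>d. ((\<lambda>t. y t powr (- (p / 2)) - p / 2 * C0 * t) has_real_derivative d) (at s) \<and> d \<le> 0" by blast
    qed (use t in simp)
    then have "y t powr (- (p / 2)) \<le> y 0 powr (- (p / 2)) + p / 2 * C0 * t" by simp
    also have "\<dots> \<le> B * (1 + t)" using t pq C0_pos by (simp add: B_def distrib_left distrib_right)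
    finally show ?thesis .
  qed
  have "B powr (- (1 / p)) / (1 + t) powr (1 / p) \<le> sqrt (y t)" if t: "t \<ge> 0" for t
  proof -
    have yt: "0 < y t" by (rule y_pos[OF t])
    have "B powr (- (1 / p)) / (1 + t) powr (1 / p) = (B * (1 + t)) powr (- (1 / p))"
      using B t by (simp add: powr_mult powr_minus divide_inverse)
    also have "\<dots> \<le> (y t powr (- (p / 2))) powr (- (1 / p))"
      using yt pq by (intro powr_mono2' le t) auto
    also have "\<dots> = sqrt (y t)" using yt pq by (simp add: powr_powr powr_half_sqrt)
    finally show ?thesis .
  qed
  then show ?thesis using B by (intro exI[of _ "B powr (- (1 / p))"]) auto
qed

end

section \<open>Truncated energies along a solution\<close>

text \<open>Convergence of the derivatives need not be uniform: dominated convergence identifies the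
  integrated form, and continuity of the limit \<open>G\<close> recovers the pointwise
  derivative.\<close>

lemma limit_derivative:
  fixes Y :: "nat \<Rightarrow> real \<Rightarrow> real"
  assumes cont: "\<And>n. continuous_on {0..\<tau>} (Y n)"
    and der: "\<And>n t. t \<in> {0<..<\<tau>} \<Longrightarrow> (Y n has_real_derivative g n t) (at t)"
    and bound: "\<And>n t. t \<in> {0..\<tau>} \<Longrightarrow> \<bar>g n t\<bar> \<le> C"
    and lim: "\<And>t. t \<in> {0..\<tau>} \<Longrightarrow> (\<lambda>n. g n t) \<longlonglongrightarrow> G t" "\<And>t. t \<in> {0..\<tau>} \<Longrightarrow> (\<lambda>n. Y n t) \<longlonglongrightarrow> y t"
    and G: "continuous_on {0..\<tau>} G" and t: "t \<in> {0<..<\<tau>}"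
  shows "(y has_real_derivative G t) (at t)"
proof -
  have int: "integral {0..s} G = y s - y 0" if s: "s \<in> {0..\<tau>}" for s
  proof -
    have hi: "(g n has_integral (Y n s - Y n 0)) {0..s}" for n
      using s by (intro fundamental_theorem_of_calculus_interior continuous_on_subset[OF cont])
        (auto simp: has_real_derivative_iff_has_vector_derivative[symmetric] intro: der)
    have "(\<lambda>n. integral {0..s} (g n)) \<longlonglongrightarrow> integral {0..s} G"
    proof (rule dominated_convergence(2))
      show "g n integrable_on {0..s}" for n using hi by blast
      show "(\<lambda>_. C) integrable_on {0..s}" by (rule integrable_const_ivl)
      show "norm (g n x) \<le> C" if "x \<in> {0..s}" for n x using bound[of x n] that s by simp
      show "(\<lambda>n. g n x) \<longlonglongrightarrow> G x" if "x \<in> {0..s}" for x using lim(1)[of x] that s by simp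
    qed
    moreover have "(\<lambda>n. integral {0..s} (g n)) \<longlonglongrightarrow> y s - y 0"
      unfolding integral_unique[OF hi] using s by (intro tendsto_diff lim) auto
    ultimately show ?thesis by (rule LIMSEQ_unique)
  qed
  have "((\<lambda>s. integral {0..s} G) has_real_derivative G t) (at t within {0..\<tau>})"
    by (rule integral_has_real_derivative[OF G]) (use t in auto)
  then have d: "((\<lambda>s. integral {0..s} G) has_real_derivative G t) (at t)"
    using t by (subst (asm) at_within_Icc_at) auto
  have "((\<lambda>s. integral {0..s} G + y 0) has_real_derivative G t) (at t)"
    using DERIV_add[OF d DERIV_const[of "y 0"]] by simp
  then show ?thesis
    by (rule has_field_derivative_transform_within_open[where S = "{0<..<\<tau>}"]) (use t int in auto)
qed

context nonneg_self_adjoint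
begin

lemma evol_u:
  assumes e: "evol \<tau> z g" and t: "t \<in> {0<..<\<tau>}"
  shows "((\<lambda>s. P n (K (z s))) has_vector_derivative P n (g t) - An n (K (z t))) (at t)"
proof -
  have "((\<lambda>s. K (P n (z s))) has_vector_derivative K (Bn n (g t) - An n (z t))) (at t)"
    by (rule bounded_linear.has_vector_derivative[OF linear_ops(4)]) (use e t in \<open>auto simp: evol_def\<close>)
  then show ?thesis by (simp add: ops_diff ops_mult)
qed

lemma evol_u_norm:
  assumes e: "evol \<tau> z g" and t: "t \<in> {0<..<\<tau>}"
  shows "((\<lambda>s. (norm (P n (K (z s))))\<^sup>2) has_real_derivative
    2 * inner (P n (K (z t))) (g t) - 2 * inner (An n (K (z t))) (K (z t))) (at t)"
proof (rule DERIV_cong[OF norm_derivative[OF evol_u[OF e t]]])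
  have "inner (P n (K (z t))) (P n (g t)) = inner (P n (K (z t))) (g t)"
    using ops_inner(1)[of n "P n (K (z t))" "g t"] by (simp add: ops_mult)
  then show "2 * inner (P n (K (z t))) (P n (g t) - An n (K (z t)))
      = 2 * inner (P n (K (z t))) (g t) - 2 * inner (An n (K (z t))) (K (z t))"
    using inner_An_P[of n "K (z t)"] by (simp add: inner_diff_right inner_commute)
qed

lemma evol_u_energy:
  assumes e: "evol \<tau> z g" and t: "t \<in> {0<..<\<tau>}"
  shows "((\<lambda>s. inner (An n (K (z s))) (K (z s))) has_real_derivative
    2 * inner (An n (K (z t))) (g t) - 2 * (norm (An n (K (z t))))\<^sup>2) (at t)"
proof -
  let ?v = "\<lambda>s. P n (K (z s))" and ?v' = "P n (g t) - An n (K (z t))"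
  have Av: "An n (?v s) = An n (K (z s))" for s by (simp add: ops_mult)
  have d1: "(?v has_derivative (\<lambda>h. h *\<^sub>R ?v')) (at t)"
    using evol_u[OF e t] by (simp add: has_vector_derivative_def)
  have d2: "((\<lambda>s. An n (?v s)) has_derivative (\<lambda>h. h *\<^sub>R An n ?v')) (at t)"
    using bounded_linear.has_vector_derivative[OF linear_ops(2) evol_u[OF e t]]
    by (simp add: has_vector_derivative_def)
  have a: "inner (An n (K (z t))) ?v' = inner (An n (K (z t))) (g t) - (norm (An n (K (z t))))\<^sup>2"
    using ops_inner(1)[of n "An n (K (z t))" "g t"] by (simp add: inner_diff_right ops_mult power2_norm_eq_inner)
  have b: "inner (An n ?v') (?v t) = inner (An n (K (z t))) ?v'"
    using ops_inner(2)[of n ?v' "?v t"] by (simp add: Av inner_commute)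
  have "((\<lambda>s. inner (An n (?v s)) (?v s)) has_derivative
      (\<lambda>h. inner (An n (?v t)) (h *\<^sub>R ?v') + inner (h *\<^sub>R An n ?v') (?v t))) (at t)"
    by (rule has_derivative_inner[OF d2 d1])
  then have "((\<lambda>s. inner (An n (?v s)) (?v s)) has_real_derivative 2 * inner (An n (K (z t))) ?v') (at t)"
    unfolding has_field_derivative_def
    by (rule has_derivative_eq_rhs) (auto simp: fun_eq_iff Av b algebra_simps)
  moreover have "inner (An n (?v s)) (?v s) = inner (An n (K (z s))) (K (z s))" for s
    unfolding Av by (rule inner_An_P)
  ultimately show ?thesis unfolding a by (simp add: algebra_simps)
qed

lemma continuous_on_K: "continuous_on S z \<Longrightarrow> continuous_on S (\<lambda>s. K (z s))"
  by (rule bounded_linear.continuous_on[OF linear_ops(4)])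

lemma continuous_on_An: "continuous_on S z \<Longrightarrow> continuous_on S (\<lambda>s. An n (z s))"
  by (rule bounded_linear.continuous_on[OF linear_ops(2)])

lemma An_K_tendsto: "(\<lambda>n. inner (An n (K z)) (K z)) \<longlonglongrightarrow> (norm z)\<^sup>2 - (norm (K z))\<^sup>2"
  unfolding An_quad_K by (intro tendsto_intros P_tendsto)

lemma An_K_bound: "\<bar>inner (An n (K z)) (K z)\<bar> \<le> (norm z)\<^sup>2"
proof -
  have "(norm (P n z))\<^sup>2 \<le> (norm z)\<^sup>2" by (intro power_mono ops_norm) auto
  then show ?thesis using An_nonneg[of n "K z"] An_quad_K[of n z] by (smt (verit) zero_le_power2)
qed

text \<open>The truncated derivatives converge boundedly, with <A u, u> entering as |z|^2 - |K z|^2.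
  This expression is continuous in time even where \<open>A (K (z t))\<close> has no
  meaning.\<close>

lemma evol_y_derivative:
  assumes e: "evol \<tau> z g" and g: "continuous_on {0..\<tau>} g" and t: "t \<in> {0<..<\<tau>}"
  shows "((\<lambda>s. (norm (K (z s)))\<^sup>2) has_real_derivative
    2 * inner (K (z t)) (g t) - 2 * ((norm (z t))\<^sup>2 - (norm (K (z t)))\<^sup>2)) (at t)"
proof -
  have cz: "continuous_on {0..\<tau>} z" using e by (auto simp: evol_def)
  have "compact (z ` {0..\<tau>})" "compact (g ` {0..\<tau>})" by (intro compact_continuous_image cz g compact_Icc)+
  then obtain B C where B: "\<And>t. t \<in> {0..\<tau>} \<Longrightarrow> norm (z t) \<le> B" and C: "\<And>t. t \<in> {0..\<tau>} \<Longrightarrow> norm (g t) \<le> C"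
    by (metis bounded_iff compact_imp_bounded image_eqI)
  have "((\<lambda>s. (norm (K (z s)))\<^sup>2) has_real_derivative
    (\<lambda>t. 2 * inner (K (z t)) (g t) - 2 * ((norm (z t))\<^sup>2 - (norm (K (z t)))\<^sup>2)) t) (at t)"
  proof (rule limit_derivative[where \<tau> = \<tau> and C = "2 * (B * C) + 2 * B\<^sup>2" and Y = "\<lambda>n s. (norm (P n (K (z s))))\<^sup>2"
      and g = "\<lambda>n t. 2 * inner (P n (K (z t))) (g t) - 2 * inner (An n (K (z t))) (K (z t))"])
    show "continuous_on {0..\<tau>} (\<lambda>s. (norm (P n (K (z s))))\<^sup>2)" for n
      by (intro continuous_intros continuous_on_P continuous_on_K cz)
    show "\<bar>2 * inner (P n (K (z s))) (g s) - 2 * inner (An n (K (z s))) (K (z s))\<bar> \<le> 2 * (B * C) + 2 * B\<^sup>2"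
      if s: "s \<in> {0..\<tau>}" for n s
    proof -
      have "\<bar>inner (P n (K (z s))) (g s)\<bar> \<le> norm (P n (K (z s))) * norm (g s)" by (rule Cauchy_Schwarz_ineq2)
      also have "\<dots> \<le> B * C"
        using order_trans[OF ops_norm(1) order_trans[OF ops_norm(4) B[OF s]]] C[OF s]
        by (intro mult_mono) (auto intro: order_trans[OF norm_ge_zero B[OF s]])
      finally have 1: "\<bar>inner (P n (K (z s))) (g s)\<bar> \<le> B * C" .
      have "\<bar>inner (An n (K (z s))) (K (z s))\<bar> \<le> (norm (z s))\<^sup>2" by (rule An_K_bound)
      also have "\<dots> \<le> B\<^sup>2" by (intro power_mono B s) auto
      finally show ?thesis using 1 by linarith
    qed
    show "(\<lambda>n. 2 * inner (P n (K (z s))) (g s) - 2 * inner (An n (K (z s))) (K (z s)))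
      \<longlonglongrightarrow> 2 * inner (K (z s)) (g s) - 2 * ((norm (z s))\<^sup>2 - (norm (K (z s)))\<^sup>2)" for s
      by (intro tendsto_intros P_tendsto An_K_tendsto)
    show "(\<lambda>n. (norm (P n (K (z s))))\<^sup>2) \<longlonglongrightarrow> (norm (K (z s)))\<^sup>2" for s by (intro tendsto_intros P_tendsto)
    show "continuous_on {0..\<tau>} (\<lambda>t. 2 * inner (K (z t)) (g t) - 2 * ((norm (z t))\<^sup>2 - (norm (K (z t)))\<^sup>2))"
      by (intro continuous_intros continuous_on_K cz g)
  qed (use evol_u_norm[OF e] t in auto)
  then show ?thesis .
qed

section \<open>Global solutions of the truncated nonlinear equation\<close>

definition retract :: "real \<Rightarrow> 'a \<Rightarrow> 'a" where
  "retract r z = (if norm z \<le> r then z else (r / norm z) *\<^sub>R z)"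

lemma norm_retract: "r \<ge> 0 \<Longrightarrow> norm (retract r z) \<le> r"
  by (auto simp: retract_def)

text \<open>A factor in (0,1] lowers both norms in the growth bound and keeps the sign of <u,
  f(u)>.\<close>

lemma retract_scale: "r > 0 \<Longrightarrow> \<exists>c. 0 < c \<and> c \<le> 1 \<and> retract r z = c *\<^sub>R z"
proof (cases "norm z \<le> r")
  case True
  then show ?thesis by (intro exI[of _ 1]) (simp add: retract_def)
next
  case False
  moreover assume r: "r > 0"
  moreover have "0 < norm z" using False r by linarith
  ultimately show ?thesis by (intro exI[of _ "r / norm z"]) (auto simp: retract_def divide_le_eq_1)
qed

text \<open>Two triangle inequalities suffice; the factor 2 merely enlarges the Lipschitz constant
  of the modified nonlinearity.\<close>

lemma retract_lipschitz:
  assumes r: "r > 0" shows "norm (retract r x - retract r y) \<le> 2 * norm (x - y)"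
proof -
  have one: "norm (a - (r / norm b) *\<^sub>R b) \<le> 2 * norm (a - b)" if "norm a \<le> r" "norm b > r" for a b :: 'a
  proof -
    have "b \<noteq> 0" using that r by auto
    have "b - (r / norm b) *\<^sub>R b = (1 - r / norm b) *\<^sub>R b" by (simp add: scaleR_diff_left)
    then have "norm (b - (r / norm b) *\<^sub>R b) = \<bar>1 - r / norm b\<bar> * norm b" by simp
    also have "\<dots> = norm b - r" using that r \<open>b \<noteq> 0\<close> by (simp add: field_simps abs_of_nonneg divide_le_eq_1)
    also have "\<dots> \<le> norm (a - b)" using that norm_triangle_ineq3[of a b] by linarith
    finally show ?thesis using norm_triangle_ineq[of "a - b" "b - (r / norm b) *\<^sub>R b"] by simp
  qed
  consider "norm x \<le> r" "norm y \<le> r" | "norm x \<le> r" "norm y > r" | "norm x > r" "norm y \<le> r" | "norm x > r" "norm y > r"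
    by linarith
  then show ?thesis
  proof cases
    case 1 then show ?thesis by (simp add: retract_def)
  next
    case 2 then show ?thesis using one[of x y] by (simp add: retract_def)
  next
    case 3 then show ?thesis using one[of y x] by (simp add: retract_def norm_minus_commute)
  next
    case 4
    have x0: "0 < norm x" "0 < norm y" using 4 r by auto
    have "(r / norm x) *\<^sub>R x - (r / norm y) *\<^sub>R y = (r / norm x) *\<^sub>R (x - y) + (r / norm x - r / norm y) *\<^sub>R y"
      by (simp add: scaleR_diff_right scaleR_diff_left)
    then have "norm ((r / norm x) *\<^sub>R x - (r / norm y) *\<^sub>R y)
        \<le> (r / norm x) * norm (x - y) + \<bar>r / norm x - r / norm y\<bar> * norm y"
      using norm_triangle_ineq[of "(r / norm x) *\<^sub>R (x - y)" "(r / norm x - r / norm y) *\<^sub>R y"] r by simp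
    also have "\<bar>r / norm x - r / norm y\<bar> * norm y = (r / norm x) * \<bar>norm y - norm x\<bar>"
    proof -
      have "r / norm x - r / norm y = (r / norm x) * ((norm y - norm x) / norm y)" using x0 by (simp add: field_simps)
      then show ?thesis using x0 r by (simp add: abs_mult)
    qed
    also have "\<dots> \<le> (r / norm x) * norm (x - y)"
      using r x0 norm_triangle_ineq3[of y x] by (intro mult_left_mono) (auto simp: norm_minus_commute)
    finally have "norm ((r / norm x) *\<^sub>R x - (r / norm y) *\<^sub>R y) \<le> (r / norm x) * (2 * norm (x - y))" by (simp add: algebra_simps)
    also have "\<dots> \<le> 1 * (2 * norm (x - y))" using 4 r by (intro mult_right_mono) (auto simp: divide_le_eq_1)
    finally show ?thesis using 4 by (simp add: retract_def)
  qed
qed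

lemma sqrt_ball_iff: "K z \<in> sqrt_ball D A R \<longleftrightarrow> norm z < R"
  by (auto simp: sqrt_ball_def sqrt_norm_K sqrt_domain_eq)

lemma global_decay:
  fixes f :: "'a \<Rightarrow> 'a"
  assumes R: "R > 0" and \<nu>: "\<nu> > 0" "\<forall>u\<in>D. (norm (A u))\<^sup>2 \<ge> \<nu> * (norm (sqrt_operator D A u))\<^sup>2"
    and lip: "\<forall>u\<in>sqrt_ball D A R. \<forall>v\<in>sqrt_ball D A R. norm (f u - f v) \<le> L * sqrt_norm D A (u - v)"
    and pq: "p > 0" "q > 0" "K0 \<ge> 0"
    and growth: "\<forall>u\<in>sqrt_ball D A R.
           norm (f u) \<le> K0 * (norm u powr (1 + p) + norm (sqrt_operator D A u) powr (1 + q))"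
    and dissip: "\<forall>u\<in>sqrt_ball D A R. inner u (f u) \<le> 0"
  obtains \<epsilon> \<Gamma> where "0 < \<epsilon>" "0 < \<Gamma>"
    "\<And>z0. 0 < norm (K z0) \<Longrightarrow> (norm (K z0))\<^sup>2 < \<epsilon> \<Longrightarrow>
       (norm z0)\<^sup>2 - (norm (K z0))\<^sup>2 < \<Gamma> * ((norm (K z0))\<^sup>2) powr (1 + p) \<Longrightarrow>
       \<exists>z. continuous_on {0..} z \<and> z 0 = z0 \<and> (\<forall>\<tau>. evol \<tau> z (\<lambda>t. f (K (z t)))) \<and>
         (\<forall>t\<ge>0. norm (z t) < R) \<and> (\<exists>M>0. \<forall>t\<ge>0. M / (1 + t) powr (1 / p) \<le> norm (K (z t)))"
proof -
  \<comment> \<open>Any radius strictly inside (0,R) works: values of the retraction must stay in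
    the open ball where f is controlled.\<close>
  define r where "r = R / 2"
  have r: "0 < r" "r < R" using R by (auto simp: r_def)
  define F where "F z = f (K (retract r z))" for z
  have ball: "K (retract r z) \<in> sqrt_ball D A R" for z
    unfolding sqrt_ball_iff using norm_retract[of r z] r by linarith
  have Flip: "norm (F x - F y) \<le> (2 * \<bar>L\<bar>) * norm (x - y)" for x y
  proof -
    have "norm (F x - F y) \<le> L * sqrt_norm D A (K (retract r x) - K (retract r y))"
      using lip ball unfolding F_def by blast
    also have "sqrt_norm D A (K (retract r x) - K (retract r y)) = norm (retract r x - retract r y)"
      by (metis ops_diff(4) sqrt_norm_K)
    also have "L * \<dots> \<le> \<bar>L\<bar> * (2 * norm (x - y))"
      by (rule mult_mono) (use retract_lipschitz[OF r(1)] in auto)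
    finally show ?thesis by simp
  qed
  have Fgrowth: "norm (F z) \<le> K0 * (norm (K z) powr (1 + p) + sqrt ((norm z)\<^sup>2 - (norm (K z))\<^sup>2) powr (1 + q))" for z
  proof -
    obtain c where c: "0 < c" "c \<le> 1" "retract r z = c *\<^sub>R z" using retract_scale[OF r(1)] by metis
    have nn: "0 \<le> (norm z)\<^sup>2 - (norm (K z))\<^sup>2" using sqrt_operator_K[of z] by (metis zero_le_power2)
    have "norm (sqrt_operator D A (K (c *\<^sub>R z))) = sqrt ((norm (c *\<^sub>R z))\<^sup>2 - (norm (K (c *\<^sub>R z)))\<^sup>2)"
      using sqrt_operator_K[of "c *\<^sub>R z"] by (metis norm_ge_zero real_sqrt_unique)
    also have "\<dots> = sqrt (c\<^sup>2 * ((norm z)\<^sup>2 - (norm (K z))\<^sup>2))"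
      by (simp add: ops_scale power_mult_distrib algebra_simps)
    also have "\<dots> = c * sqrt ((norm z)\<^sup>2 - (norm (K z))\<^sup>2)" using c by (simp add: real_sqrt_mult)
    finally have T: "norm (sqrt_operator D A (K (c *\<^sub>R z))) = c * sqrt ((norm z)\<^sup>2 - (norm (K z))\<^sup>2)" .
    have "norm (F z) \<le> K0 * (norm (K (c *\<^sub>R z)) powr (1 + p) + norm (sqrt_operator D A (K (c *\<^sub>R z))) powr (1 + q))"
      using growth ball[of z] unfolding F_def c(3) by blast
    also have "\<dots> \<le> K0 * (norm (K z) powr (1 + p) + sqrt ((norm z)\<^sup>2 - (norm (K z))\<^sup>2) powr (1 + q))"
      unfolding T using c pq nn by (intro mult_left_mono add_mono powr_mono2) (auto simp: ops_scale mult_left_le_one_le)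
    finally show ?thesis .
  qed
  have F0: "F 0 = 0" using Fgrowth[of 0] pq by (simp add: ops_zero)
  have Fdis: "inner (K z) (F z) \<le> 0" for z
  proof -
    obtain c where c: "0 < c" "c \<le> 1" "retract r z = c *\<^sub>R z" using retract_scale[OF r(1)] by metis
    have "inner (K (c *\<^sub>R z)) (F z) \<le> 0" using dissip ball[of z] unfolding F_def c(3) by blast
    then show ?thesis using c(1) by (simp add: ops_scale mult_le_0_iff)
  qed
  define \<Gamma> where "\<Gamma> = 8 * K0\<^sup>2 / \<nu> + 1"
  define C0 where "C0 = 2 * \<Gamma> + 4 * K0"
  have \<Gamma>: "\<Gamma> > 0" and C0: "C0 > 0"
  proof -
    have "0 \<le> 8 * K0\<^sup>2 / \<nu>" using \<nu> by simp
    then show "\<Gamma> > 0" unfolding \<Gamma>_def by linarith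
    then show "C0 > 0" using pq unfolding C0_def by linarith
  qed
  obtain \<epsilon> where small: "0 < \<epsilon>" "\<epsilon> \<le> 1" "(\<Gamma> * \<epsilon> powr (1 + p)) powr q * \<Gamma> \<le> 1"
    "(1 + p) * C0 * \<epsilon> powr (p / 2) \<le> \<nu> / 2" "\<epsilon> + \<Gamma> * \<epsilon> powr (1 + p) < r\<^sup>2"
    using small_parameter_exists[OF pq(1,2) \<nu>(1) \<Gamma> r(1) C0] by metis
  show thesis
  proof (rule that[OF small(1) \<Gamma>])
    fix z0 assume z0: "0 < norm (K z0)" "(norm (K z0))\<^sup>2 < \<epsilon>"
      "(norm z0)\<^sup>2 - (norm (K z0))\<^sup>2 < \<Gamma> * ((norm (K z0))\<^sup>2) powr (1 + p)"
    obtain z where z: "continuous_on {0..} z" "z 0 = z0" "\<And>\<tau>. evol \<tau> z (\<lambda>t. F (z t))"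
      using semilinear_evolution[OF Flip F0] by (metis abs_ge_zero mult_nonneg_nonneg zero_le_numeral)
    have cF: "continuous_on UNIV F"
      by (rule lipschitz_on_continuous_on[of "2 * \<bar>L\<bar>"]) (use Flip in \<open>auto simp: lipschitz_on_def dist_norm\<close>)
    have cg: "continuous_on {0..\<tau>} (\<lambda>t. F (z t))" for \<tau>
      by (intro continuous_on_compose2[OF cF] continuous_on_subset[OF z(1)]) auto
    \<comment> \<open>Here y = |u|^2 and w = |A^(1/2) u|^2 with u = K z; the truncations of w are
      <An n u, u>.\<close>
    interpret slow_decay "\<lambda>t. (norm (K (z t)))\<^sup>2" "\<lambda>t. (norm (z t))\<^sup>2 - (norm (K (z t)))\<^sup>2" "\<lambda>t. norm (F (z t))"
      "\<lambda>t. 2 * inner (K (z t)) (F (z t)) - 2 * ((norm (z t))\<^sup>2 - (norm (K (z t)))\<^sup>2)"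
      "\<lambda>n t. inner (An n (K (z t))) (K (z t))"
      "\<lambda>n t. 2 * inner (An n (K (z t))) (F (z t)) - 2 * (norm (An n (K (z t))))\<^sup>2"
      p q K0 \<nu> \<Gamma> C0 \<epsilon>
    proof
      show wnn: "0 \<le> (norm (z t))\<^sup>2 - (norm (K (z t)))\<^sup>2" for t using sqrt_operator_K[of "z t"] by (metis zero_le_power2)
      show "0 \<le> norm (F (z t)) \<and> (norm (F (z t)))\<^sup>2 \<le> 2 * K0\<^sup>2 * (((norm (K (z t)))\<^sup>2) powr (1 + p)
          + ((norm (z t))\<^sup>2 - (norm (K (z t)))\<^sup>2) powr (1 + q))" for t
      proof
        let ?a = "norm (K (z t)) powr (1 + p)" and ?w = "(norm (z t))\<^sup>2 - (norm (K (z t)))\<^sup>2"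
        let ?b = "sqrt ?w powr (1 + q)"
        have a: "?a\<^sup>2 = ((norm (K (z t)))\<^sup>2) powr (1 + p)" by (simp add: power2_eq_square powr_mult)
        have b: "?b\<^sup>2 = ?w powr (1 + q)"
        proof -
          have "?w = sqrt ?w * sqrt ?w" using wnn[of t] by simp
          then show ?thesis using wnn[of t] by (metis power2_eq_square powr_mult real_sqrt_ge_zero)
        qed
        have "(norm (F (z t)))\<^sup>2 \<le> (K0 * (?a + ?b))\<^sup>2" by (intro power_mono Fgrowth) auto
        also have "\<dots> = K0\<^sup>2 * (?a + ?b)\<^sup>2" by (simp add: power_mult_distrib)
        also have "\<dots> \<le> K0\<^sup>2 * (2 * (?a\<^sup>2 + ?b\<^sup>2))"
          using sum_squares_bound[of ?a ?b] by (intro mult_left_mono) (auto simp: power2_sum)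
        finally show "(norm (F (z t)))\<^sup>2 \<le> 2 * K0\<^sup>2 * (((norm (K (z t)))\<^sup>2) powr (1 + p) + ?w powr (1 + q))"
          by (simp add: a b algebra_simps)
      qed simp
      show "((\<lambda>t. (norm (K (z t)))\<^sup>2) has_real_derivative
          2 * inner (K (z t)) (F (z t)) - 2 * ((norm (z t))\<^sup>2 - (norm (K (z t)))\<^sup>2)) (at t)" if "0 < t" for t
        by (rule evol_y_derivative[OF z(3)[of "t + 1"] cg]) (use that in auto)
      show "2 * inner (K (z t)) (F (z t)) - 2 * ((norm (z t))\<^sup>2 - (norm (K (z t)))\<^sup>2) \<le> 0" for t
      proof -
        have "2 * a - 2 * b \<le> 0" if "a \<le> 0" "0 \<le> b" for a b :: real using that by linarith
        then show ?thesis using Fdis wnn by blast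
      qed
      show "- (2 * inner (K (z t)) (F (z t)) - 2 * ((norm (z t))\<^sup>2 - (norm (K (z t)))\<^sup>2))
          \<le> 2 * ((norm (z t))\<^sup>2 - (norm (K (z t)))\<^sup>2) + 2 * sqrt ((norm (K (z t)))\<^sup>2) * norm (F (z t))" for t
      proof -
        have "- (2 * a - 2 * b) \<le> 2 * b + 2 * m" if "\<bar>a\<bar> \<le> m" for a b m :: real using that by linarith
        from this[OF Cauchy_Schwarz_ineq2] show ?thesis by (simp only: real_sqrt_abs abs_norm_cancel mult.assoc)
      qed
      show "((\<lambda>t. inner (An n (K (z t))) (K (z t))) has_real_derivative
          2 * inner (An n (K (z t))) (F (z t)) - 2 * (norm (An n (K (z t))))\<^sup>2) (at t)" if "0 < t" for n t
        by (rule evol_u_energy[OF z(3)[of "t + 1"]]) (use that in auto)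
      show "2 * inner (An n (K (z t))) (F (z t)) - 2 * (norm (An n (K (z t))))\<^sup>2
          \<le> - \<nu> * inner (An n (K (z t))) (K (z t)) + (norm (F (z t)))\<^sup>2" for n t
      proof -
        \<comment> \<open>Half of the dissipation 2 |An u|^2 pays for the forcing; coercivity is
          applied to the other half.\<close>
        have "2 * inner (An n (K (z t))) (F (z t)) \<le> (norm (An n (K (z t))))\<^sup>2 + (norm (F (z t)))\<^sup>2"
          using norm_cauchy_schwarz[of "An n (K (z t))" "F (z t)"]
            sum_squares_bound[of "norm (An n (K (z t)))" "norm (F (z t))"] by linarith
        then show ?thesis using coercive[OF \<nu>(2), of n "K (z t)"] by linarith
      qed
      show "continuous_on {0..} (\<lambda>t. (norm (K (z t)))\<^sup>2)" "continuous_on {0..} (\<lambda>t. (norm (z t))\<^sup>2 - (norm (K (z t)))\<^sup>2)"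
        by (intro continuous_intros continuous_on_K z(1))+
      show "continuous_on {0..} (\<lambda>t. inner (An n (K (z t))) (K (z t)))" for n
        by (intro continuous_intros continuous_on_K continuous_on_An z(1))
      show "0 \<le> inner (An n (K (z t))) (K (z t))" for n t by (rule An_nonneg)
      show "(\<lambda>n. inner (An n (K (z t))) (K (z t))) \<longlonglongrightarrow> (norm (z t))\<^sup>2 - (norm (K (z t)))\<^sup>2" for t by (rule An_K_tendsto)
      show "0 < (norm (K (z 0)))\<^sup>2" "(norm (K (z 0)))\<^sup>2 < \<epsilon>"
        "(norm (z 0))\<^sup>2 - (norm (K (z 0)))\<^sup>2 < \<Gamma> * ((norm (K (z 0)))\<^sup>2) powr (1 + p)"
        using z0 by (simp_all add: z(2))
    qed (fact pq(1) pq(2) pq(3) \<nu>(1) \<Gamma>_def C0_def small(1) small(2) small(3) small(4) | rule zero_le_power2)+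
    \<comment> \<open>|z|^2 = y + w is below r^2 by the choice of \<epsilon>, so the retraction is
      the identity along z and the original equation holds.\<close>
    have small_z: "norm (z t) < r" if "t \<ge> 0" for t
      using sum_bound[OF that] small(5) r by (intro power2_less_imp_less[of "norm (z t)" r]) auto
    have "retract r (z t) = z t" if "t \<ge> 0" for t using small_z[OF that] by (simp add: retract_def)
    then have "evol \<tau> z (\<lambda>t. f (K (z t)))" for \<tau>
      by (intro evol_cong[OF z(3)]) (simp add: F_def)
    moreover have "\<forall>t\<ge>0. norm (z t) < R" using small_z r by (meson less_trans)
    moreover have "\<exists>M>0. \<forall>t\<ge>0. M / (1 + t) powr (1 / p) \<le> norm (K (z t))" using slow by simp
    ultimately show "\<exists>z. continuous_on {0..} z \<and> z 0 = z0 \<and> (\<forall>\<tau>. evol \<tau> z (\<lambda>t. f (K (z t)))) \<and>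
         (\<forall>t\<ge>0. norm (z t) < R) \<and> (\<exists>M>0. \<forall>t\<ge>0. M / (1 + t) powr (1 / p) \<le> norm (K (z t)))"
      using z(1,2) by blast
  qed
qed

end

section \<open>Lebesgue integrals on an interval\<close>

abbreviation leb :: "real \<Rightarrow> real measure" where "leb T \<equiv> lebesgue_on {0<..<T}"

lemma finite_leb: "finite_measure (leb T)"
  by (rule finite_measure_lebesgue_on) (simp add: lmeasurable_interval)

lemma AE_leb_interior: "AE t in leb T. 0 < t \<and> t < T"
  by (rule AE_I2) auto

lemma leb_measurable: "continuous_on {0..T} \<phi> \<Longrightarrow> \<phi> \<in> borel_measurable (leb T)"
  by (rule continuous_imp_measurable_on_sets_lebesgue) (auto intro: continuous_on_subset)

lemma leb_indicator_measurable: "indicat_real {a<..<b} \<in> borel_measurable (leb T)"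
  by (rule measurable_restrict_space1, rule measurable_completion) simp

lemma leb_indicator_integrable:
  fixes Q :: "real \<Rightarrow> real"
  assumes Q: "integrable (leb T) Q"
  shows "integrable (leb T) (\<lambda>t. indicator {a<..<b} t * Q t)"
proof (rule Bochner_Integration.integrable_bound[OF Q])
  show "(\<lambda>t. indicator {a<..<b} t * Q t) \<in> borel_measurable (leb T)"
    by (rule borel_measurable_times[OF leb_indicator_measurable borel_measurable_integrable[OF Q]])
  show "AE t in leb T. norm (indicator {a<..<b} t * Q t) \<le> norm (Q t)"
    by (rule AE_I2) (simp add: indicator_def)
qed

lemma leb_integrable:
  fixes \<phi> :: "real \<Rightarrow> real"
  assumes \<phi>: "continuous_on {0..T} \<phi>" shows "integrable (leb T) \<phi>"
proof -
  interpret finite_measure "leb T" by (rule finite_leb)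
  have "compact (\<phi> ` {0..T})" by (intro compact_continuous_image \<phi> compact_Icc)
  then obtain C where C: "\<And>t. t \<in> {0..T} \<Longrightarrow> norm (\<phi> t) \<le> C"
    by (metis bounded_iff compact_imp_bounded image_eqI)
  show ?thesis
    by (rule integrable_const_bound[of _ C]) (use C \<phi> in \<open>auto intro!: AE_I2 leb_measurable\<close>)
qed

lemma leb_integral_indicator:
  fixes \<phi> :: "real \<Rightarrow> real"
  assumes \<phi>: "continuous_on {0..T} \<phi>" and ab: "0 \<le> a" "a \<le> b" "b \<le> T"
  shows "(LINT t|leb T. indicator {a<..<b} t * \<phi> t) = integral {a..b} \<phi>"
proof -
  have "(LINT t|leb T. indicator {a<..<b} t * \<phi> t)
      = (LINT t|lebesgue. indicator {0<..<T} t *\<^sub>R (indicator {a<..<b} t * \<phi> t))"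
    by (rule integral_restrict_space) simp
  also have "\<dots> = (LINT t|lebesgue. indicator {a<..<b} t *\<^sub>R \<phi> t)"
    by (rule Bochner_Integration.integral_cong) (use ab in \<open>auto simp: indicator_def\<close>)
  also have "\<dots> = (LINT t|lebesgue_on {a<..<b}. \<phi> t)" by (rule integral_restrict_space[symmetric]) simp
  also have "\<dots> = integral {a<..<b} \<phi>"
  proof (rule lebesgue_integral_eq_integral)
    have "integrable (lebesgue_on {a..b}) \<phi>"
      using ab by (intro continuous_imp_integrable_real continuous_on_subset[OF \<phi>]) auto
    then have "set_integrable lebesgue {a..b} \<phi>" by (simp add: integrable_restrict_space set_integrable_def)
    then have "set_integrable lebesgue {a<..<b} \<phi>" by (rule set_integrable_subset) auto
    then show "integrable (lebesgue_on {a<..<b}) \<phi>" by (simp add: integrable_restrict_space set_integrable_def)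
  qed simp
  finally show ?thesis by (simp add: integral_open_interval_real)
qed

lemma leb_integral:
  fixes \<phi> :: "real \<Rightarrow> real"
  assumes \<phi>: "continuous_on {0..T} \<phi>" and T: "0 < T"
  shows "(LINT t|leb T. \<phi> t) = integral {0..T} \<phi>"
proof -
  have "(LINT t|leb T. \<phi> t) = (LINT t|leb T. indicator {0<..<T} t * \<phi> t)"
    by (rule Bochner_Integration.integral_cong) auto
  then show ?thesis using leb_integral_indicator[OF \<phi>, of 0 T] T by simp
qed

text \<open>\<open>Q\<close> is split at a level k: the part above k has small total integral, and
  the part below contributes at most k times the total length of the intervals.\<close>

lemma absolutely_continuous_integral:
  fixes Q F :: "real \<Rightarrow> real"
  assumes Q: "integrable (leb T) Q" "AE t in leb T. 0 \<le> Q t"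
    and F: "\<And>a b. 0 \<le> a \<Longrightarrow> a \<le> b \<Longrightarrow> b \<le> T \<Longrightarrow> \<bar>F b - F a\<bar> \<le> (LINT t|leb T. indicator {a<..<b} t * Q t)"
  shows "absolutely_continuous_interval T F"
  unfolding absolutely_continuous_interval_def
proof (intro allI impI)
  fix \<epsilon> :: real assume \<epsilon>: "\<epsilon> > 0"
  interpret finite_measure "leb T" by (rule finite_leb)
  note [measurable] = borel_measurable_integrable[OF Q(1)]
  have "(\<lambda>k. LINT t|leb T. Q t - min (Q t) (real k)) \<longlonglongrightarrow> (LINT t|leb T. 0)"
  proof (rule integral_dominated_convergence[where w = "\<lambda>t. \<bar>Q t\<bar>"])
    show "AE t in leb T. (\<lambda>k. Q t - min (Q t) (real k)) \<longlonglongrightarrow> 0"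
    proof (rule AE_I2)
      fix t
      obtain N :: nat where "Q t \<le> N" using real_arch_simple by blast
      then have "\<forall>\<^sub>F k in sequentially. Q t - min (Q t) (real k) = 0"
        unfolding eventually_sequentially by (intro exI[of _ N]) auto
      then show "(\<lambda>k. Q t - min (Q t) (real k)) \<longlonglongrightarrow> 0" by (rule tendsto_eventually)
    qed
    show "AE t in leb T. norm (Q t - min (Q t) (real k)) \<le> \<bar>Q t\<bar>" for k by (rule AE_I2) auto
  qed (use Q in auto)
  then have "\<forall>\<^sub>F k in sequentially. (LINT t|leb T. Q t - min (Q t) (real k)) < \<epsilon> / 2"
    using \<epsilon> by (intro order_tendstoD(2)) auto
  then obtain k :: nat where k: "(LINT t|leb T. Q t - min (Q t) (real k)) < \<epsilon> / 2"
    by (meson eventually_happens trivial_limit_sequentially)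
  have ik: "integrable (leb T) (\<lambda>t. min (Q t) (real k))" using Q(1) by auto
  show "\<exists>\<delta>>0. \<forall>(n::nat) a b. (\<forall>i<n. 0 \<le> a i \<and> a i \<le> b i \<and> b i \<le> T) \<and> disjoint_family_on (\<lambda>i. {a i<..<b i}) {..<n}
      \<and> (\<Sum>i<n. b i - a i) < \<delta> \<longrightarrow> (\<Sum>i<n. \<bar>F (b i) - F (a i)\<bar>) < \<epsilon>"
  \<comment> \<open>The bounded part then contributes less than \<epsilon>/2; k + 1 in place of k
    keeps the quotient meaningful for k = 0.\<close>
  proof (intro exI[of _ "\<epsilon> / (2 * (real k + 1))"] conjI allI impI; (elim conjE)?)
    show "0 < \<epsilon> / (2 * (real k + 1))" using \<epsilon> by simp
    fix n :: nat and a b :: "nat \<Rightarrow> real"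
    assume ab: "\<forall>i<n. 0 \<le> a i \<and> a i \<le> b i \<and> b i \<le> T" and disj: "disjoint_family_on (\<lambda>i. {a i<..<b i}) {..<n}"
      and small: "(\<Sum>i<n. b i - a i) < \<epsilon> / (2 * (real k + 1))"
    have mi: "indicat_real {a i<..<b i} \<in> borel_measurable (leb T)" for i
      by (rule leb_indicator_measurable)
    have ii: "integrable (leb T) (\<lambda>t. indicator {a i<..<b i} t * Q t)" for i
      by (rule leb_indicator_integrable[OF Q(1)])
    have ind1: "integrable (leb T) (indicat_real {a i<..<b i})" for i
      by (rule integrable_const_bound[of _ 1]) (use mi in auto)
    have sum_le: "(\<Sum>i<n. indicat_real {a i<..<b i} t) \<le> 1" for t
    proof (cases "\<exists>i<n. t \<in> {a i<..<b i}")
      case True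
      then obtain i where i: "i < n" "t \<in> {a i<..<b i}" by blast
      have "indicat_real {a j<..<b j} t = 0" if "j < n" "j \<noteq> i" for j
        using disjoint_family_onD[OF disj, of i j] i that by (auto simp: indicator_def)
      then have "(\<Sum>j<n. indicat_real {a j<..<b j} t) = (\<Sum>j\<in>{i}. indicat_real {a j<..<b j} t)"
        using i by (intro sum.mono_neutral_right) auto
      then have "(\<Sum>j<n. indicat_real {a j<..<b j} t) = indicat_real {a i<..<b i} t" by simp
      then show ?thesis by (simp only: indicator_le_1)
    next
      case False
      then have "(\<Sum>i<n. indicat_real {a i<..<b i} t) = 0" by (intro sum.neutral) auto
      then show ?thesis by simp
    qed
    have "(\<Sum>i<n. \<bar>F (b i) - F (a i)\<bar>) \<le> (\<Sum>i<n. LINT t|leb T. indicator {a i<..<b i} t * Q t)"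
      using ab by (intro sum_mono F) auto
    also have "\<dots> = (LINT t|leb T. (\<Sum>i<n. indicator {a i<..<b i} t * Q t))"
      by (rule Bochner_Integration.integral_sum[symmetric]) (rule ii)
    also have "\<dots> \<le> (LINT t|leb T. (Q t - min (Q t) (real k)) + real k * (\<Sum>i<n. indicator {a i<..<b i} t))"
    proof (rule integral_mono_AE)
      show "integrable (leb T) (\<lambda>t. (Q t - min (Q t) (real k)) + real k * (\<Sum>i<n. indicator {a i<..<b i} t))"
        using Q(1) ik ind1 by (intro Bochner_Integration.integrable_add Bochner_Integration.integrable_diff
          Bochner_Integration.integrable_mult_right Bochner_Integration.integrable_sum) auto
      show "AE t in leb T. (\<Sum>i<n. indicator {a i<..<b i} t * Q t)
          \<le> (Q t - min (Q t) (real k)) + real k * (\<Sum>i<n. indicator {a i<..<b i} t)"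
        using Q(2)
      proof eventually_elim
        case (elim t)
        let ?s = "\<Sum>i<n. indicat_real {a i<..<b i} t"
        have s: "0 \<le> ?s" "?s \<le> 1" using sum_le by (auto intro: sum_nonneg)
        have "(\<Sum>i<n. indicat_real {a i<..<b i} t * Q t) = ?s * (Q t - min (Q t) (real k)) + ?s * min (Q t) (real k)"
          unfolding sum_distrib_right[symmetric] distrib_left[symmetric] by (simp only: diff_add_cancel)
        also have "\<dots> \<le> 1 * (Q t - min (Q t) (real k)) + ?s * real k"
          using s by (intro add_mono mult_right_mono mult_left_mono) auto
        finally show ?case by (simp add: mult.commute)
      qed
    qed (intro Bochner_Integration.integrable_sum ii)
    also have "\<dots> = (LINT t|leb T. Q t - min (Q t) (real k)) + real k * (\<Sum>i<n. LINT t|leb T. indicator {a i<..<b i} t)"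
      using Q(1) ik ind1 by (simp add: Bochner_Integration.integral_sum)
    also have "(\<Sum>i<n. LINT t|leb T. indicator {a i<..<b i} t) = (\<Sum>i<n. b i - a i)"
    proof (rule sum.cong)
      fix i assume "i \<in> {..<n}"
      then show "(LINT t|leb T. indicator {a i<..<b i} t) = b i - a i"
        using leb_integral_indicator[of T "\<lambda>t. 1" "a i" "b i"] ab by simp
    qed simp
    also have "real k * (\<Sum>i<n. b i - a i) \<le> (real k + 1) * (\<Sum>i<n. b i - a i)"
      using ab by (intro mult_right_mono sum_nonneg) auto
    also have "(real k + 1) * (\<Sum>i<n. b i - a i) < \<epsilon> / 2"
    proof -
      have "(real k + 1) * (\<Sum>i<n. b i - a i) < (real k + 1) * (\<epsilon> / (2 * (real k + 1)))"
        using small by (intro mult_strict_left_mono) auto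
      also have "\<dots> = \<epsilon> / 2"
      proof -
        have *: "k' * (\<epsilon> / (2 * k')) = \<epsilon> / 2" if "k' \<noteq> 0" for k' :: real using that by simp
        show ?thesis by (rule *) simp
      qed
      finally show ?thesis .
    qed
    finally show "(\<Sum>i<n. \<bar>F (b i) - F (a i)\<bar>) < \<epsilon>" using k by linarith
  qed
qed

section \<open>Strong measurability and test functions\<close>

lemma step_approximation:
  fixes h :: "real \<Rightarrow> 'b::real_normed_vector"
  assumes h: "continuous_on {0..T} h" and T: "0 < T" and e: "e > 0"
  obtains s where "simple_function (leb T) s" "\<And>t. t \<in> {0<..<T} \<Longrightarrow> norm (s t - h t) < e"
proof -
  have "uniformly_continuous_on {0..T} h" by (rule compact_uniformly_continuous[OF h compact_Icc])
  then obtain d where d: "d > 0" "\<And>x y. x \<in> {0..T} \<Longrightarrow> y \<in> {0..T} \<Longrightarrow> dist y x < d \<Longrightarrow> dist (h y) (h x) < e"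
    using e unfolding uniformly_continuous_on_def by blast
  obtain m :: nat where m: "T / d < real m" using reals_Archimedean2 by blast
  have "0 < T / d" using T d by simp
  then have m0: "0 < real m" using m by linarith
  define \<kappa> where "\<kappa> t = T * real_of_int \<lfloor>real m * t / T\<rfloor> / real m" for t
  have \<kappa>: "0 \<le> \<kappa> t" "\<kappa> t \<le> t" "t - \<kappa> t < d" "0 \<le> \<lfloor>real m * t / T\<rfloor>" "\<lfloor>real m * t / T\<rfloor> \<le> int m" if t: "t \<in> {0<..<T}" for t
  proof -
    show f0: "0 \<le> \<lfloor>real m * t / T\<rfloor>" using t m0 T by simp
    then show "0 \<le> \<kappa> t" using T by (simp add: \<kappa>_def)
    have "T * real_of_int \<lfloor>real m * t / T\<rfloor> \<le> T * (real m * t / T)" using T by (intro mult_left_mono) auto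
    then show "\<kappa> t \<le> t" using T m0 by (simp add: \<kappa>_def field_simps)
    have "real m * t / T < real_of_int \<lfloor>real m * t / T\<rfloor> + 1" by linarith
    then have "T * (real m * t / T) < T * (real_of_int \<lfloor>real m * t / T\<rfloor> + 1)" using T by (intro mult_strict_left_mono)
    then have "t < \<kappa> t + T / real m" using T m0 by (simp add: \<kappa>_def field_simps)
    moreover have "T / real m < d" using m m0 d by (simp add: field_simps)
    ultimately show "t - \<kappa> t < d" by linarith
    have "real m * t / T \<le> real m" using t T m0 by (simp add: field_simps)
    then show "\<lfloor>real m * t / T\<rfloor> \<le> int m" by linarith
  qed
  have "simple_function (leb T) \<kappa>"
  proof (rule simple_function_borel_measurable)
    have "\<kappa> \<in> borel_measurable borel" unfolding \<kappa>_def by measurable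
    then show "\<kappa> \<in> borel_measurable (leb T)" by (simp add: measurable_completion measurable_restrict_space1)
    have "\<kappa> ` space (leb T) \<subseteq> (\<lambda>i. T * real_of_int i / real m) ` {0..int m}"
      using \<kappa>(4,5) by (auto simp: \<kappa>_def)
    then show "finite (\<kappa> ` space (leb T))" by (rule finite_subset) simp
  qed
  then have "simple_function (leb T) (\<lambda>t. h (\<kappa> t))" by (rule simple_function_compose1)
  moreover have "norm (h (\<kappa> t) - h t) < e" if t: "t \<in> {0<..<T}" for t
    using d(2)[of t "\<kappa> t"] \<kappa>(1-3)[OF t] t by (simp add: dist_norm)
  ultimately show thesis using that by blast
qed

text \<open>Each continuous approximant is replaced by a simple function within 1/(n+1); the simple
  functions then have the same limit.\<close>

lemma L2_interval_limit:
  fixes h :: "nat \<Rightarrow> real \<Rightarrow> 'b::real_normed_vector"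
  assumes T: "0 < T" and h: "\<And>n. continuous_on {0..T} (h n)"
    and lim: "AE t in leb T. (\<lambda>n. h n t) \<longlonglongrightarrow> g t"
    and fin: "(\<integral>\<^sup>+ t. ennreal ((norm (g t))\<^sup>2) \<partial>leb T) < \<infinity>"
  shows "L2_interval T g"
proof -
  have "\<exists>s. simple_function (leb T) s \<and> (\<forall>t\<in>{0<..<T}. norm (s t - h n t) < 1 / real (Suc n))" for n
    using step_approximation[OF h T, of "1 / real (Suc n)" n] by (metis of_nat_0_less_iff zero_less_Suc zero_less_divide_1_iff)
  then obtain s where s: "\<And>n. simple_function (leb T) (s n)"
    "\<And>n t. t \<in> {0<..<T} \<Longrightarrow> norm (s n t - h n t) < 1 / real (Suc n)" by metis
  have "AE t in leb T. (\<lambda>n. s n t) \<longlonglongrightarrow> g t"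
    using lim AE_leb_interior
  proof eventually_elim
    case (elim t)
    have "(\<lambda>n. s n t - h n t) \<longlonglongrightarrow> 0"
      by (rule Lim_transform_bound[OF _ LIMSEQ_inverse_real_of_nat])
        (use s(2)[of t] elim in \<open>auto simp: inverse_eq_divide less_imp_le\<close>)
    from tendsto_add[OF this elim(1)] show ?case by simp
  qed
  then show ?thesis unfolding L2_interval_def using s(1) fin by blast
qed

lemma test_function_continuous:
  assumes "test_function T \<phi>"
  shows "continuous_on UNIV \<phi>" "continuous_on UNIV (deriv \<phi>)" "\<And>t. (\<phi> has_real_derivative deriv \<phi> t) (at t)"
    "\<phi> 0 = 0" "\<phi> T = 0"
proof -
  have d: "(deriv ^^ k) \<phi> differentiable (at t)" for k t using assms by (auto simp: test_function_def)
  show dd: "(\<phi> has_real_derivative deriv \<phi> t) (at t)" for t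
    using d[of 0 t] by (simp add: DERIV_deriv_iff_real_differentiable)
  show "continuous_on UNIV \<phi>"
    by (rule continuous_at_imp_continuous_on) (blast intro: DERIV_isCont[OF dd])
  have "deriv \<phi> differentiable (at t)" for t using d[of 1 t] by simp
  then show "continuous_on UNIV (deriv \<phi>)"
    by (intro continuous_at_imp_continuous_on ballI differentiable_imp_continuous_within)
  obtain a b where "0 < a" "b < T" "\<forall>t. t \<notin> {a..b} \<longrightarrow> \<phi> t = 0" using assms by (auto simp: test_function_def)
  then show "\<phi> 0 = 0" "\<phi> T = 0" by auto
qed

lemma integration_by_parts:
  fixes h h' :: "real \<Rightarrow> real"
  assumes T: "0 < T" and \<phi>: "test_function T \<phi>" and h: "continuous_on {0..T} h" "continuous_on {0..T} h'"
    and d: "\<And>t. t \<in> {0<..<T} \<Longrightarrow> (h has_real_derivative h' t) (at t)"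
  shows "(LINT t|leb T. deriv \<phi> t * h t) = - (LINT t|leb T. \<phi> t * h' t)"
proof -
  note tf = test_function_continuous[OF \<phi>]
  have c: "continuous_on {0..T} \<phi>" "continuous_on {0..T} (deriv \<phi>)" using tf(1,2) continuous_on_subset by blast+
  have ci: "continuous_on {0..T} (\<lambda>t. deriv \<phi> t * h t)" "continuous_on {0..T} (\<lambda>t. \<phi> t * h' t)"
    by (intro continuous_intros c h)+
  have "((\<lambda>t. deriv \<phi> t * h t + \<phi> t * h' t) has_integral (\<phi> T * h T - \<phi> 0 * h 0)) {0..T}"
  proof (rule fundamental_theorem_of_calculus_interior)
    show "0 \<le> T" using T by simp
    show "continuous_on {0..T} (\<lambda>t. \<phi> t * h t)" by (intro continuous_intros c h)
    show "((\<lambda>t. \<phi> t * h t) has_vector_derivative deriv \<phi> t * h t + \<phi> t * h' t) (at t)" if "t \<in> {0<..<T}" for t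
      using DERIV_mult[OF tf(3) d[OF that]]
      by (simp add: has_real_derivative_iff_has_vector_derivative[symmetric] mult.commute add.commute)
  qed
  then have "integral {0..T} (\<lambda>t. deriv \<phi> t * h t + \<phi> t * h' t) = 0" using tf by (simp add: integral_unique)
  then have "integral {0..T} (\<lambda>t. deriv \<phi> t * h t) + integral {0..T} (\<lambda>t. \<phi> t * h' t) = 0"
    by (subst (asm) Henstock_Kurzweil_Integration.integral_add) (auto intro: integrable_continuous_real ci)
  then show ?thesis using leb_integral[OF ci(1) T] leb_integral[OF ci(2) T] by simp
qed

section \<open>Regularity of the constructed solution\<close>

locale evolution = nonneg_self_adjoint +
  fixes z g :: "real \<Rightarrow> 'a" and T :: real
  assumes T: "0 < T" and z_cont: "continuous_on {0..T} z" and g_cont: "continuous_on {0..T} g"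
    and evol: "evol T z g"
begin

definition u :: "real \<Rightarrow> 'a" where "u t = K (z t)"

lemma u_cont: "continuous_on {0..T} u"
  unfolding u_def by (intro continuous_on_K z_cont)

lemma An_u_cont: "continuous_on {0..T} (\<lambda>t. An n (u t))"
  by (intro continuous_on_An u_cont)

lemma bounds_exist: obtains B C where "\<And>t. t \<in> {0..T} \<Longrightarrow> norm (z t) \<le> B" "\<And>t. t \<in> {0..T} \<Longrightarrow> norm (g t) \<le> C"
    "0 \<le> B" "0 \<le> C" "\<And>t. t \<in> {0..T} \<Longrightarrow> norm (u t) \<le> B"
proof -
  have "compact (z ` {0..T})" "compact (g ` {0..T})" by (intro compact_continuous_image z_cont g_cont compact_Icc)+
  then obtain B C where BC: "\<And>t. t \<in> {0..T} \<Longrightarrow> norm (z t) \<le> B" "\<And>t. t \<in> {0..T} \<Longrightarrow> norm (g t) \<le> C"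
    by (metis bounded_iff compact_imp_bounded image_eqI)
  moreover have "0 \<le> B" "0 \<le> C" using order_trans[OF norm_ge_zero] BC[of 0] T by force+
  moreover have "norm (u t) \<le> B" if "t \<in> {0..T}" for t
    using order_trans[OF ops_norm(4) BC(1)[OF that]] by (simp add: u_def)
  ultimately show thesis using that by blast
qed

definition wn :: "nat \<Rightarrow> real \<Rightarrow> real" where "wn n t = inner (An n (u t)) (u t)"
definition wn' :: "nat \<Rightarrow> real \<Rightarrow> real" where
  "wn' n t = 2 * inner (An n (u t)) (g t) - 2 * (norm (An n (u t)))\<^sup>2"

lemma wn'_cont: "continuous_on {0..T} (wn' n)"
  unfolding wn'_def by (intro continuous_intros An_u_cont g_cont)

lemma wn_integral:
  assumes ab: "0 \<le> a" "a \<le> b" "b \<le> T"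
  shows "integral {a..b} (wn' n) = wn n b - wn n a"
proof (rule integral_unique, rule fundamental_theorem_of_calculus_interior[OF ab(2)])
  have "continuous_on {0..T} (wn n)"
    unfolding wn_def by (intro continuous_intros An_u_cont u_cont)
  then show "continuous_on {a..b} (wn n)" by (rule continuous_on_subset) (use ab in auto)
  show "(wn n has_vector_derivative wn' n t) (at t)" if "t \<in> {a<..<b}" for t
    using evol_u_energy[OF evol, of t n] that ab
    by (simp add: wn_def[abs_def] wn'_def u_def has_real_derivative_iff_has_vector_derivative)
qed

lemma wn'_bounds: "(norm (An n (u t)))\<^sup>2 \<le> (norm (g t))\<^sup>2 - wn' n t"
    "\<bar>wn' n t\<bar> \<le> 3 * (norm (An n (u t)))\<^sup>2 + (norm (g t))\<^sup>2"
proof -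
  have "2 * \<bar>inner (An n (u t)) (g t)\<bar> \<le> 2 * (norm (An n (u t)) * norm (g t))"
    using Cauchy_Schwarz_ineq2[of "An n (u t)" "g t"] by simp
  also have "\<dots> \<le> (norm (An n (u t)))\<^sup>2 + (norm (g t))\<^sup>2"
    using sum_squares_bound[of "norm (An n (u t))" "norm (g t)"] by (simp add: mult.assoc)
  finally show "(norm (An n (u t)))\<^sup>2 \<le> (norm (g t))\<^sup>2 - wn' n t"
    "\<bar>wn' n t\<bar> \<le> 3 * (norm (An n (u t)))\<^sup>2 + (norm (g t))\<^sup>2"
    unfolding wn'_def using zero_le_power2[of "norm (An n (u t))"] by linarith+
qed

text \<open>Integrating |An u|^2 <= |g|^2 - wn' leaves only endpoint energies, and those are bounded
  by |z|^2 for every n. This is the maximal regularity estimate.\<close>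

lemma An_square_integral: obtains C where "\<And>n. (\<integral>\<^sup>+ t. ennreal ((norm (An n (u t)))\<^sup>2) \<partial>leb T) \<le> ennreal C"
proof -
  obtain B C where B: "\<And>t. t \<in> {0..T} \<Longrightarrow> norm (z t) \<le> B" and C: "\<And>t. t \<in> {0..T} \<Longrightarrow> norm (g t) \<le> C"
    using bounds_exist by metis
  have "(\<integral>\<^sup>+ t. ennreal ((norm (An n (u t)))\<^sup>2) \<partial>leb T) \<le> ennreal (T * C\<^sup>2 + B\<^sup>2)" for n
  proof -
    have c: "continuous_on {0..T} (\<lambda>t. (norm (An n (u t)))\<^sup>2)" by (intro continuous_intros An_u_cont)
    have "(\<integral>\<^sup>+ t. ennreal ((norm (An n (u t)))\<^sup>2) \<partial>leb T) = ennreal (LINT t|leb T. (norm (An n (u t)))\<^sup>2)"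
      by (rule nn_integral_eq_integral[OF leb_integrable[OF c]]) simp
    also have "(LINT t|leb T. (norm (An n (u t)))\<^sup>2) = integral {0..T} (\<lambda>t. (norm (An n (u t)))\<^sup>2)"
      by (rule leb_integral[OF c T])
    also have "\<dots> \<le> integral {0..T} (\<lambda>t. C\<^sup>2 - wn' n t)"
    proof (rule integral_le)
      show "(\<lambda>t. (norm (An n (u t)))\<^sup>2) integrable_on {0..T}" by (rule integrable_continuous_real[OF c])
      show "(\<lambda>t. C\<^sup>2 - wn' n t) integrable_on {0..T}"
        by (intro integrable_continuous_real continuous_intros wn'_cont)
      show "(norm (An n (u t)))\<^sup>2 \<le> C\<^sup>2 - wn' n t" if "t \<in> {0..T}" for t
        using wn'_bounds(1)[of n t] power_mono[OF C[OF that], of 2] by simp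
    qed
    also have "\<dots> = T * C\<^sup>2 - (wn n T - wn n 0)"
      using wn_integral[of 0 T n] T
      by (subst Henstock_Kurzweil_Integration.integral_diff)
        (auto intro: integrable_continuous_real wn'_cont)
    also have "\<dots> \<le> T * C\<^sup>2 + B\<^sup>2"
    proof -
      have "0 \<le> wn n T" by (simp add: wn_def An_nonneg)
      moreover have "wn n 0 \<le> (norm (z 0))\<^sup>2" using An_K_bound[of n "z 0"] by (simp add: wn_def u_def)
      moreover have "(norm (z 0))\<^sup>2 \<le> B\<^sup>2" using T by (intro power_mono B) auto
      ultimately show ?thesis by linarith
    qed
    finally show ?thesis by (simp add: ennreal_leI)
  qed
  then show thesis using that by blast
qed

text \<open>The extended-valued squared norm of A u: the truncations increase, and finiteness of the
  supremum is membership in \<open>D\<close>. It is measurable everywhere and finite almost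
  everywhere.\<close>

definition Mu :: "real \<Rightarrow> ennreal" where "Mu t = (SUP n. ennreal ((norm (An n (u t)))\<^sup>2))"

lemma Mu_measurable [measurable]: "Mu \<in> borel_measurable (leb T)"
proof -
  have "(\<lambda>t. ennreal ((norm (An n (u t)))\<^sup>2)) \<in> borel_measurable (leb T)" for n
    by (intro measurable_compose[OF _ measurable_ennreal] leb_measurable continuous_intros An_u_cont)
  then show ?thesis unfolding Mu_def by measurable
qed

lemma Mu_finite: "(\<integral>\<^sup>+ t. Mu t \<partial>leb T) < \<infinity>"
proof -
  obtain C where C: "\<And>n. (\<integral>\<^sup>+ t. ennreal ((norm (An n (u t)))\<^sup>2) \<partial>leb T) \<le> ennreal C"
    using An_square_integral by metis
  have "(\<integral>\<^sup>+ t. Mu t \<partial>leb T) = (SUP n. \<integral>\<^sup>+ t. ennreal ((norm (An n (u t)))\<^sup>2) \<partial>leb T)"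
    unfolding Mu_def
  proof (rule nn_integral_monotone_convergence_SUP)
    show "incseq (\<lambda>n t. ennreal ((norm (An n (u t)))\<^sup>2))"
      by (auto simp: incseq_def le_fun_def intro!: ennreal_leI power_mono An_mono)
    show "(\<lambda>t. ennreal ((norm (An n (u t)))\<^sup>2)) \<in> borel_measurable (leb T)" for n
      by (intro measurable_compose[OF _ measurable_ennreal] leb_measurable continuous_intros An_u_cont)
  qed
  also have "\<dots> \<le> ennreal C" by (intro SUP_least C)
  also have "\<dots> < \<infinity>" by simp
  finally show ?thesis .
qed

definition m :: "real \<Rightarrow> real" where "m t = enn2real (Mu t)"

lemma AE_Mu: "AE t in leb T. Mu t < \<infinity>"
  using nn_integral_noteq_infinite[OF Mu_measurable] Mu_finite by (simp add: less_top)

lemma m: assumes "Mu t < \<infinity>" shows "(norm (An n (u t)))\<^sup>2 \<le> m t" and "u t \<in> D" and "(norm (A (u t)))\<^sup>2 \<le> m t"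
proof -
  have a: "(norm (An n (u t)))\<^sup>2 \<le> m t" for n
  proof -
    have "ennreal ((norm (An n (u t)))\<^sup>2) \<le> Mu t" unfolding Mu_def by (rule SUP_upper) simp
    also have "Mu t = ennreal (m t)" unfolding m_def using assms by (simp add: ennreal_enn2real_if)
    finally show ?thesis by (simp add: m_def ennreal_le_iff)
  qed
  then show "(norm (An n (u t)))\<^sup>2 \<le> m t" .
  have "norm (An n (u t)) \<le> sqrt (m t)" for n by (rule real_le_rsqrt[OF a])
  then show D: "u t \<in> D" unfolding D_iff by blast
  show "(norm (A (u t)))\<^sup>2 \<le> m t"
    by (rule LIMSEQ_le_const2[of "\<lambda>n. (norm (An n (u t)))\<^sup>2"]) (use a in \<open>auto intro!: tendsto_intros An_tendsto D\<close>)
qed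

lemma m_integrable: "integrable (leb T) m"
proof (rule integrableI_nonneg)
  show "m \<in> borel_measurable (leb T)" unfolding m_def by measurable
  have "(\<integral>\<^sup>+ t. ennreal (m t) \<partial>leb T) \<le> (\<integral>\<^sup>+ t. Mu t \<partial>leb T)"
    by (intro nn_integral_mono) (simp add: m_def ennreal_enn2real_if)
  then show "(\<integral>\<^sup>+ t. ennreal (m t) \<partial>leb T) < \<infinity>" using Mu_finite by (rule le_less_trans)
qed (simp add: m_def)

text \<open>The derivatives of the truncated energies are dominated by one integrable function, 3 m
  + C^2; the increments of the limit therefore obey the same integral bound.\<close>

lemma energy_abs_continuous: "absolutely_continuous_interval T (\<lambda>t. (norm (z t))\<^sup>2 - (norm (u t))\<^sup>2)"
proof -
  obtain B C where C: "\<And>t. t \<in> {0..T} \<Longrightarrow> norm (g t) \<le> C" using bounds_exist by metis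
  interpret finite_measure "leb T" by (rule finite_leb)
  define Q where "Q t = 3 * m t + C\<^sup>2" for t
  have Qi: "integrable (leb T) Q" unfolding Q_def using m_integrable by simp
  show ?thesis
  proof (rule absolutely_continuous_integral[OF Qi])
    show "AE t in leb T. 0 \<le> Q t" by (rule AE_I2) (simp add: Q_def m_def)
    fix a b assume ab: "0 \<le> a" "a \<le> b" "b \<le> T"
    have "\<bar>wn n b - wn n a\<bar> \<le> (LINT t|leb T. indicator {a<..<b} t * Q t)" for n
    proof -
      have i1: "integrable (leb T) (\<lambda>t. indicator {a<..<b} t * wn' n t)"
        by (rule leb_indicator_integrable[OF leb_integrable[OF wn'_cont]])
      have i2: "integrable (leb T) (\<lambda>t. indicator {a<..<b} t * Q t)"
        by (rule leb_indicator_integrable[OF Qi])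
      have "\<bar>wn n b - wn n a\<bar> = \<bar>LINT t|leb T. indicator {a<..<b} t * wn' n t\<bar>"
        by (simp add: leb_integral_indicator[OF wn'_cont ab] wn_integral[OF ab])
      also have "\<dots> \<le> (LINT t|leb T. \<bar>indicator {a<..<b} t * wn' n t\<bar>)" by (rule integral_abs_bound)
      also have "\<dots> \<le> (LINT t|leb T. indicator {a<..<b} t * Q t)"
      proof (rule integral_mono_AE[OF _ i2])
        show "integrable (leb T) (\<lambda>t. \<bar>indicator {a<..<b} t * wn' n t\<bar>)" using i1 by simp
        show "AE t in leb T. \<bar>indicator {a<..<b} t * wn' n t\<bar> \<le> indicator {a<..<b} t * Q t"
          using AE_Mu AE_leb_interior
        proof eventually_elim
          case (elim t)
          have "(norm (g t))\<^sup>2 \<le> C\<^sup>2" using elim by (intro power_mono C) auto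
          then have "\<bar>wn' n t\<bar> \<le> Q t" using wn'_bounds(2)[of n t] m(1)[OF elim(1), of n] by (simp add: Q_def)
          then show ?case by (simp add: indicator_def)
        qed
      qed
      finally show ?thesis .
    qed
    moreover have "(\<lambda>n. \<bar>wn n b - wn n a\<bar>) \<longlonglongrightarrow> \<bar>((norm (z b))\<^sup>2 - (norm (u b))\<^sup>2) - ((norm (z a))\<^sup>2 - (norm (u a))\<^sup>2)\<bar>"
      unfolding wn_def u_def by (intro tendsto_intros An_K_tendsto)
    ultimately show "\<bar>((norm (z b))\<^sup>2 - (norm (u b))\<^sup>2) - ((norm (z a))\<^sup>2 - (norm (u a))\<^sup>2)\<bar>
        \<le> (LINT t|leb T. indicator {a<..<b} t * Q t)"
      by (intro LIMSEQ_le_const2) auto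
  qed
qed

lemma AE_D: "AE t in leb T. u t \<in> D"
  using AE_Mu by eventually_elim (rule m(2))

lemma nn_integral_bound:
  assumes "\<And>t. t \<in> {0<..<T} \<Longrightarrow> Mu t < \<infinity> \<Longrightarrow> h t \<le> a + b * m t" "0 \<le> a" "0 \<le> b"
  shows "(\<integral>\<^sup>+ t. ennreal (h t) \<partial>leb T) < \<infinity>"
proof -
  interpret finite_measure "leb T" by (rule finite_leb)
  have i: "integrable (leb T) (\<lambda>t. a + b * m t)" using m_integrable by simp
  have "(\<integral>\<^sup>+ t. ennreal (h t) \<partial>leb T) \<le> (\<integral>\<^sup>+ t. ennreal (a + b * m t) \<partial>leb T)"
    using AE_Mu AE_leb_interior
    by (intro nn_integral_mono_AE, eventually_elim) (auto intro!: ennreal_leI assms(1))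
  also have "\<dots> = ennreal (LINT t|leb T. a + b * m t)"
    by (rule nn_integral_eq_integral[OF i]) (use assms in \<open>auto simp: m_def\<close>)
  also have "\<dots> < \<infinity>" by simp
  finally show ?thesis .
qed

lemma L2_domain_u: "L2_domain D A T u"
  unfolding L2_domain_def
proof (intro conjI AE_D)
  obtain B C where B: "\<And>t. t \<in> {0..T} \<Longrightarrow> norm (u t) \<le> B" using bounds_exist by metis
  show "L2_interval T (\<lambda>t. (u t, A (u t)))"
  proof (rule L2_interval_limit[OF T])
    show "continuous_on {0..T} (\<lambda>t. (u t, An n (u t)))" for n by (intro continuous_intros u_cont An_u_cont)
    show "AE t in leb T. (\<lambda>n. (u t, An n (u t))) \<longlonglongrightarrow> (u t, A (u t))"
      using AE_D by eventually_elim (intro tendsto_intros An_tendsto)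
    show "(\<integral>\<^sup>+ t. ennreal ((norm (u t, A (u t)))\<^sup>2) \<partial>leb T) < \<infinity>"
    proof (rule nn_integral_bound[of _ "B\<^sup>2" 1])
      fix t assume t: "t \<in> {0<..<T}" "Mu t < \<infinity>"
      have "(norm (u t))\<^sup>2 \<le> B\<^sup>2" using t by (intro power_mono B) auto
      then show "(norm (u t, A (u t)))\<^sup>2 \<le> B\<^sup>2 + 1 * m t" using m(3)[OF t(2)] by (simp add: norm_Pair)
    qed auto
  qed
qed

text \<open>The derivative is set to zero where \<open>u t\<close> leaves the domain, which makes it a pointwise
  limit of measurable functions.\<close>

definition du :: "real \<Rightarrow> 'a" where "du t = (if Mu t < \<infinity> then g t - A (u t) else 0)"

text \<open>The truncated equation is classical and can be integrated by parts against a test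
  function; both sides pass to the limit, the right one dominated through \<open>m\<close>.\<close>

lemma W12_u: "W12_interval T u du"
  unfolding W12_interval_def
proof (intro conjI)
  obtain B C where C: "\<And>t. t \<in> {0..T} \<Longrightarrow> norm (g t) \<le> C" "0 \<le> C" and B: "\<And>t. t \<in> {0..T} \<Longrightarrow> norm (u t) \<le> B" "0 \<le> B"
    using bounds_exist by metis
  show "L2_interval T u"
  proof (rule L2_interval_limit[OF T u_cont])
    show "(\<integral>\<^sup>+ t. ennreal ((norm (u t))\<^sup>2) \<partial>leb T) < \<infinity>"
    proof (rule nn_integral_bound[of _ "B\<^sup>2" 0])
      fix t assume "t \<in> {0<..<T}"
      then have "(norm (u t))\<^sup>2 \<le> B\<^sup>2" by (intro power_mono B) auto
      then show "(norm (u t))\<^sup>2 \<le> B\<^sup>2 + 0 * m t" by simp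
    qed auto
  qed simp
  show "L2_interval T du"
  proof (rule L2_interval_limit[OF T])
    show "continuous_on {0..T} (\<lambda>t. g t - An n (u t))" for n by (intro continuous_intros g_cont An_u_cont)
    show "AE t in leb T. (\<lambda>n. g t - An n (u t)) \<longlonglongrightarrow> du t"
      using AE_Mu
    proof eventually_elim
      case (elim t)
      have "(\<lambda>n. g t - An n (u t)) \<longlonglongrightarrow> g t - A (u t)"
        by (intro tendsto_intros An_tendsto m(2)[OF elim])
      then show ?case using elim by (simp add: du_def)
    qed
    show "(\<integral>\<^sup>+ t. ennreal ((norm (du t))\<^sup>2) \<partial>leb T) < \<infinity>"
    proof (rule nn_integral_bound[of _ "2 * C\<^sup>2" 2])
      fix t assume t: "t \<in> {0<..<T}" "Mu t < \<infinity>"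
      have "(norm (g t - A (u t)))\<^sup>2 \<le> (norm (g t) + norm (A (u t)))\<^sup>2" by (intro power_mono norm_triangle_ineq4) simp
      also have "\<dots> \<le> 2 * (norm (g t))\<^sup>2 + 2 * (norm (A (u t)))\<^sup>2"
        using sum_squares_bound[of "norm (g t)" "norm (A (u t))"] by (simp add: power2_sum)
      also have "\<dots> \<le> 2 * C\<^sup>2 + 2 * m t"
        using t C(1)[of t] m(3)[OF t(2)] power_mono[of "norm (g t)" C 2] by simp
      finally show "(norm (du t))\<^sup>2 \<le> 2 * C\<^sup>2 + 2 * m t" using t(2) by (simp add: du_def)
    qed auto
  qed
  show "weak_derivative T u du"
    unfolding weak_derivative_def
  proof (intro allI impI)
    fix \<phi> v assume \<phi>: "test_function T \<phi>"
    interpret finite_measure "leb T" by (rule finite_leb)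
    note tf = test_function_continuous[OF \<phi>]
    have c: "continuous_on {0..T} \<phi>" "continuous_on {0..T} (deriv \<phi>)" using tf(1,2) continuous_on_subset by blast+
    have "compact (\<phi> ` {0..T})" "compact (deriv \<phi> ` {0..T})" by (intro compact_continuous_image c compact_Icc)+
    then obtain C\<phi> Cd where C\<phi>: "\<And>t. t \<in> {0..T} \<Longrightarrow> \<bar>\<phi> t\<bar> \<le> C\<phi>" and Cd: "\<And>t. t \<in> {0..T} \<Longrightarrow> \<bar>deriv \<phi> t\<bar> \<le> Cd"
      by (metis bounded_iff compact_imp_bounded image_eqI real_norm_def)
    have C\<phi>0: "0 \<le> C\<phi>" and Cd0: "0 \<le> Cd" using C\<phi>[of 0] Cd[of 0] T by auto
    have parts: "(LINT t|leb T. deriv \<phi> t * inner (P n (u t)) v) = - (LINT t|leb T. \<phi> t * inner (P n (g t) - An n (u t)) v)" for n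
    proof (rule integration_by_parts[OF T \<phi>])
      show "continuous_on {0..T} (\<lambda>t. inner (P n (u t)) v)"
        by (intro continuous_intros continuous_on_P u_cont)
      show "continuous_on {0..T} (\<lambda>t. inner (P n (g t) - An n (u t)) v)"
        by (intro continuous_intros continuous_on_P g_cont An_u_cont)
      show "((\<lambda>t. inner (P n (u t)) v) has_real_derivative inner (P n (g t) - An n (u t)) v) (at t)" if "t \<in> {0<..<T}" for t
        using bounded_linear.has_vector_derivative[OF bounded_linear_inner_left evol_u[OF evol that]]
        by (simp add: u_def has_real_derivative_iff_has_vector_derivative)
    qed
    have l1: "(\<lambda>n. LINT t|leb T. deriv \<phi> t * inner (P n (u t)) v) \<longlonglongrightarrow> (LINT t|leb T. deriv \<phi> t * inner (u t) v)"
    proof (rule integral_dominated_convergence[where w = "\<lambda>t. Cd * (B * norm v)"])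
      show "AE t in leb T. (\<lambda>n. deriv \<phi> t * inner (P n (u t)) v) \<longlonglongrightarrow> deriv \<phi> t * inner (u t) v"
        by (intro AE_I2 tendsto_intros P_tendsto)
      show "AE t in leb T. norm (deriv \<phi> t * inner (P n (u t)) v) \<le> Cd * (B * norm v)" for n
        using AE_leb_interior
      proof eventually_elim
        case (elim t)
        have "\<bar>inner (P n (u t)) v\<bar> \<le> norm (P n (u t)) * norm v" by (rule Cauchy_Schwarz_ineq2)
        also have "\<dots> \<le> B * norm v" using elim by (intro mult_right_mono order_trans[OF ops_norm(1) B(1)]) auto
        finally show ?case unfolding real_norm_def abs_mult using elim Cd0 by (intro mult_mono Cd) auto
      qed
      show "(\<lambda>t. deriv \<phi> t * inner (u t) v) \<in> borel_measurable (leb T)"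
        by (intro leb_measurable continuous_intros c u_cont)
      show "(\<lambda>t. deriv \<phi> t * inner (P n (u t)) v) \<in> borel_measurable (leb T)" for n
        by (intro leb_measurable continuous_intros c continuous_on_P u_cont)
    qed simp
    have meas_n: "(\<lambda>t. \<phi> t * inner (P n (g t) - An n (u t)) v) \<in> borel_measurable (leb T)" for n
      by (intro leb_measurable continuous_intros c continuous_on_P g_cont An_u_cont)
    have lim_du: "(\<lambda>n. inner (P n (g t) - An n (u t)) v) \<longlonglongrightarrow> inner (du t) v" if "Mu t < \<infinity>" for t
    proof -
      have "(\<lambda>n. inner (P n (g t) - An n (u t)) v) \<longlonglongrightarrow> inner (g t - A (u t)) v"
        by (intro tendsto_intros P_tendsto An_tendsto m(2)[OF that])
      then show ?thesis using that by (simp add: du_def)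
    qed
    have lim2: "AE t in leb T. (\<lambda>n. \<phi> t * inner (P n (g t) - An n (u t)) v) \<longlonglongrightarrow> \<phi> t * inner (du t) v"
      using AE_Mu by eventually_elim (intro tendsto_mult tendsto_const lim_du)
    \<comment> \<open>Cutting the approximants off where \<open>Mu\<close> is infinite gives
      convergence at every point, not just almost everywhere, so measurability follows
      directly.\<close>
    have "(\<lambda>t. \<phi> t * inner (du t) v) \<in> borel_measurable (leb T)"
    proof (rule borel_measurable_LIMSEQ_real)
      show "(\<lambda>t. if Mu t < \<infinity> then \<phi> t * inner (P n (g t) - An n (u t)) v else 0) \<in> borel_measurable (leb T)" for n
        using meas_n by measurable
      show "(\<lambda>n. if Mu t < \<infinity> then \<phi> t * inner (P n (g t) - An n (u t)) v else 0) \<longlonglongrightarrow> \<phi> t * inner (du t) v" for t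
        using tendsto_mult_left[OF lim_du, of t "\<phi> t"] by (cases "Mu t < \<infinity>") (simp_all add: du_def)
    qed
    then have l2: "(\<lambda>n. LINT t|leb T. \<phi> t * inner (P n (g t) - An n (u t)) v) \<longlonglongrightarrow> (LINT t|leb T. \<phi> t * inner (du t) v)"
    proof (rule integral_dominated_convergence[where w = "\<lambda>t. C\<phi> * ((C + (1 + m t)) * norm v)", OF _ meas_n _ lim2])
      show "integrable (leb T) (\<lambda>t. C\<phi> * ((C + (1 + m t)) * norm v))" using m_integrable by simp
      show "AE t in leb T. norm (\<phi> t * inner (P n (g t) - An n (u t)) v) \<le> C\<phi> * ((C + (1 + m t)) * norm v)" for n
        using AE_leb_interior AE_Mu
      proof eventually_elim
        case (elim t)
        have "x \<le> 1 + x\<^sup>2" for x :: real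
        proof -
          have "0 \<le> (x - 1)\<^sup>2 + x\<^sup>2 + 1" by simp
          then show ?thesis by (simp add: power2_eq_square algebra_simps)
        qed
        then have An1: "norm (An n (u t)) \<le> 1 + m t" using m(1)[of t n] elim by (smt (verit))
        have "\<bar>inner (P n (g t) - An n (u t)) v\<bar> \<le> norm (P n (g t) - An n (u t)) * norm v" by (rule Cauchy_Schwarz_ineq2)
        also have "\<dots> \<le> (C + (1 + m t)) * norm v"
          using elim An1 order_trans[OF ops_norm(1)[of n "g t"] C(1)[of t]]
          by (intro mult_right_mono order_trans[OF norm_triangle_ineq4] add_mono) auto
        finally show ?case unfolding real_norm_def abs_mult using elim C\<phi>0 by (intro mult_mono C\<phi>) auto
      qed
    qed
    show "(LINT t|leb T. deriv \<phi> t * inner (u t) v) = - (LINT t|leb T. \<phi> t * inner (du t) v)"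
      by (rule LIMSEQ_unique[OF l1]) (unfold parts, intro tendsto_minus l2)
  qed
qed

text \<open>\<open>K\<close> is an isometry onto the domain of the square root, so this is
  continuity of z in H.\<close>

lemma sqrt_continuous_u: "sqrt_continuous D A T u"
  unfolding sqrt_continuous_def
proof (intro conjI ballI)
  show "u t \<in> sqrt_domain D A" for t by (simp add: u_def sqrt_domain_eq)
  fix s assume s: "s \<in> {0..T}"
  have "(z \<longlongrightarrow> z s) (at s within {0..T})" using z_cont s by (simp add: continuous_on_def)
  then have "((\<lambda>t. norm (z t - z s)) \<longlongrightarrow> 0) (at s within {0..T})" by (simp add: tendsto_norm_zero LIM_zero)
  moreover have "sqrt_norm D A (u t - u s) = norm (z t - z s)" for t
    unfolding u_def by (metis ops_diff(4) sqrt_norm_K)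
  ultimately show "((\<lambda>t. sqrt_norm D A (u t - u s)) \<longlongrightarrow> 0) (at s within {0..T})" by simp
qed

end

context nonneg_self_adjoint
begin

lemma evolution_solution:
  assumes z: "continuous_on {0..} z" "z 0 = z0" "\<And>\<tau>. evol \<tau> z (\<lambda>t. f (K (z t)))"
    and R: "\<And>t. t \<ge> 0 \<Longrightarrow> norm (z t) < R" and f: "continuous_on {0..} (\<lambda>t. f (K (z t)))"
  shows "solution D A R f (K z0) \<infinity> (\<lambda>t. K (z t))"
  unfolding solution_def
proof (intro conjI allI impI)
  show "K (z t) \<in> sqrt_ball D A R" if "0 \<le> t \<and> ereal t < \<infinity>" for t using R that by (simp add: sqrt_ball_iff)
  fix T :: real assume "0 < T \<and> ereal T < \<infinity>"
  then interpret evolution D A z "\<lambda>t. f (K (z t))" T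
    by unfold_locales (auto intro: continuous_on_subset[OF z(1)] continuous_on_subset[OF f] z(3))
  have u: "u = (\<lambda>t. K (z t))" by (simp add: u_def[abs_def])
  show "sqrt_continuous D A T (\<lambda>t. K (z t))" "L2_domain D A T (\<lambda>t. K (z t))"
    using sqrt_continuous_u L2_domain_u by (simp_all add: u)
  show "absolutely_continuous_interval T (\<lambda>t. (norm (sqrt_operator D A (K (z t))))\<^sup>2)"
    using energy_abs_continuous by (simp add: sqrt_operator_K u_def)
  show "\<exists>u'. W12_interval T (\<lambda>t. K (z t)) u' \<and> (AE t in leb T. u' t + A (K (z t)) = f (K (z t)))"
  proof (intro exI conjI)
    show "W12_interval T (\<lambda>t. K (z t)) du" using W12_u by (simp add: u)
    show "AE t in leb T. du t + A (K (z t)) = f (K (z t))"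
      using AE_Mu by eventually_elim (simp add: du_def u)
  qed
qed (use z in auto)

end

section \<open>Smooth bump functions and the lemma of du Bois-Reymond\<close>

text \<open>A class closed under differentiation, which gives all iterated derivatives at once. The
  base functions carry an arbitrary polynomial in 1/x because differentiating exp(-1/x) produces
  such factors; the last rule admits the smooth step, known only through its derivative.\<close>

inductive smooth_class :: "(real \<Rightarrow> real) \<Rightarrow> bool" where
  base: "smooth_class (\<lambda>x. if x > 0 then poly q (1 / x) * exp (- (1 / x)) else 0)"
| const: "smooth_class (\<lambda>x. c)"
| add: "smooth_class f \<Longrightarrow> smooth_class g \<Longrightarrow> smooth_class (\<lambda>x. f x + g x)"
| mult: "smooth_class f \<Longrightarrow> smooth_class g \<Longrightarrow> smooth_class (\<lambda>x. f x * g x)"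
| affine: "smooth_class f \<Longrightarrow> smooth_class (\<lambda>x. f (c * x + d))"
| antiderivative: "smooth_class f \<Longrightarrow> (\<And>x. (F has_real_derivative f x) (at x)) \<Longrightarrow> smooth_class F"

lemma poly_div_exp_tendsto_0: "((\<lambda>y::real. poly q y / exp y) \<longlongrightarrow> 0) at_top"
proof -
  have "((\<lambda>y::real. \<Sum>i\<le>degree q. coeff q i * (y ^ i / exp y)) \<longlongrightarrow> (\<Sum>i\<le>degree q. coeff q i * 0)) at_top"
    by (intro tendsto_intros tendsto_power_div_exp_0)
  moreover have "(\<Sum>i\<le>degree q. coeff q i * (y ^ i / exp y)) = poly q y / exp y" for y :: real
    by (simp add: poly_altdef sum_divide_distrib)
  ultimately show ?thesis by simp
qed

text \<open>Away from 0 the chain rule yields the new polynomial X^2 (q - q'); at 0 exponential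
  decay beats every polynomial in 1/x.\<close>

lemma smooth_base_derivative:
  fixes q :: "real poly"
  defines "f \<equiv> \<lambda>q x. if x > 0 then poly q (1 / x) * exp (- (1 / x)) else 0"
  shows "(f q has_real_derivative f ([:0, 0, 1:] * (q - pderiv q)) x) (at x)"
proof -
  consider "x > 0" | "x < 0" | "x = 0" by linarith
  then show ?thesis
  proof cases
    case 1
    have "((\<lambda>x. poly q (1 / x) * exp (- (1 / x))) has_real_derivative
        poly q (1 / x) * (exp (- (1 / x)) * (1 / x\<^sup>2)) + poly (pderiv q) (1 / x) * (- (1 / x\<^sup>2)) * exp (- (1 / x))) (at x)"
      using 1 by (auto intro!: derivative_eq_intros DERIV_chain2[OF poly_DERIV] simp: power2_eq_square)
    also have "poly q (1 / x) * (exp (- (1 / x)) * (1 / x\<^sup>2)) + poly (pderiv q) (1 / x) * (- (1 / x\<^sup>2)) * exp (- (1 / x))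
        = f ([:0, 0, 1:] * (q - pderiv q)) x"
      using 1 by (simp add: f_def power2_eq_square algebra_simps)
    finally show ?thesis
      by (rule has_field_derivative_transform_within_open[where S = "{0<..}"]) (use 1 in \<open>auto simp: f_def\<close>)
  next
    case 2
    have "((\<lambda>x. 0) has_real_derivative f ([:0, 0, 1:] * (q - pderiv q)) x) (at x)"
      using 2 by (simp add: f_def)
    then show ?thesis
      by (rule has_field_derivative_transform_within_open[where S = "{..<0}"]) (use 2 in \<open>auto simp: f_def\<close>)
  next
    case 3
    have "((\<lambda>h. f q h / h) \<longlongrightarrow> 0) (at 0)"
    proof (rule filterlim_split_at)
      show "((\<lambda>h. f q h / h) \<longlongrightarrow> 0) (at_left 0)"
        by (rule tendsto_eventually) (auto simp: f_def eventually_at_filter)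
      \<comment> \<open>\<open>pCons 0 q\<close> is X q: the difference quotient contributes one
        more factor 1/h.\<close>
      have "((\<lambda>h. poly (pCons 0 q) (inverse h) / exp (inverse h)) \<longlongrightarrow> 0) (at_right 0)"
        by (rule filterlim_compose[OF poly_div_exp_tendsto_0 filterlim_inverse_at_top_right])
      moreover have "\<forall>\<^sub>F h in at_right 0. poly (pCons 0 q) (inverse h) / exp (inverse h) = f q h / h"
        by (auto simp: f_def eventually_at_filter exp_minus field_simps)
      ultimately show "((\<lambda>h. f q h / h) \<longlongrightarrow> 0) (at_right 0)" by (rule Lim_transform_eventually)
    qed
    moreover have "f r 0 = 0" for r by (simp add: f_def)
    ultimately show ?thesis unfolding 3 DERIV_def by simp
  qed
qed

lemma smooth_class_derivative:
  "smooth_class f \<Longrightarrow> \<exists>f'. smooth_class f' \<and> (\<forall>x. (f has_real_derivative f' x) (at x))"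
proof (induction rule: smooth_class.induct)
  case (base q)
  show ?case using smooth_base_derivative[of q] smooth_class.base by blast
next
  case (const c)
  show ?case using smooth_class.const[of 0] by (intro exI[of _ "\<lambda>x. 0"]) auto
next
  case (add f g)
  then obtain f' g' where "smooth_class f'" "smooth_class g'" "\<And>x. (f has_real_derivative f' x) (at x)"
    "\<And>x. (g has_real_derivative g' x) (at x)" by blast
  then show ?case by (intro exI[of _ "\<lambda>x. f' x + g' x"]) (auto intro!: smooth_class.add DERIV_add)
next
  case (mult f g)
  then obtain f' g' where "smooth_class f'" "smooth_class g'" "\<And>x. (f has_real_derivative f' x) (at x)"
    "\<And>x. (g has_real_derivative g' x) (at x)" by blast
  then show ?case using mult.hyps
    by (intro exI[of _ "\<lambda>x. f' x * g x + g' x * f x"]) (auto intro!: smooth_class.add smooth_class.mult DERIV_mult)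
next
  case (affine f c d)
  then obtain f' where f': "smooth_class f'" "\<And>x. (f has_real_derivative f' x) (at x)" by blast
  have "((\<lambda>x. f (c * x + d)) has_real_derivative f' (c * x + d) * c) (at x)" for x
    by (rule DERIV_chain2[OF f'(2)]) (auto intro!: derivative_eq_intros)
  then show ?case
    using smooth_class.mult[OF smooth_class.affine[OF f'(1), of c d] smooth_class.const[of c]] by blast
next
  case (antiderivative f F)
  then show ?case by blast
qed

lemma smooth_class_iterate: "smooth_class f \<Longrightarrow> smooth_class ((deriv ^^ k) f)"
proof (induction k)
  case (Suc k)
  then obtain f' where f': "smooth_class f'" "\<And>x. ((deriv ^^ k) f has_real_derivative f' x) (at x)"
    using smooth_class_derivative by blast
  then have "deriv ((deriv ^^ k) f) = f'" using DERIV_imp_deriv by blast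
  then show ?case using f' by simp
qed simp

lemma smooth_class_differentiable: "smooth_class f \<Longrightarrow> (deriv ^^ k) f differentiable (at t)"
  using smooth_class_derivative[OF smooth_class_iterate] by (meson real_differentiable_def)

lemma smooth_step_exists:
  obtains H \<eta> where "smooth_class H" "\<And>x. (H has_real_derivative \<eta> x) (at x)" "\<And>x::real. 0 \<le> \<eta> x"
    "\<And>x. \<eta> x \<noteq> 0 \<Longrightarrow> 0 < x \<and> x < 1" "0 < \<eta> (1 / 2)" "\<And>x. x \<le> 0 \<Longrightarrow> H x = H 0" "\<And>x. x \<ge> 1 \<Longrightarrow> H x = H 1"
proof -
  define e where "e x = (if x > 0 then exp (- (1 / x)) else 0)" for x :: real
  have e: "smooth_class e" using smooth_class.base[of 1] by (simp add: e_def[abs_def] cong: if_cong)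
  \<comment> \<open>A smooth bump, positive exactly on (0,1); its antiderivative \<open>H\<close> is
    a smooth step, constant on either side.\<close>
  define \<eta> where "\<eta> x = e x * e (-1 * x + 1)" for x
  have \<eta>: "smooth_class \<eta>"
    unfolding \<eta>_def[abs_def] by (rule smooth_class.mult[OF e smooth_class.affine[OF e]])
  have "isCont \<eta> x" for x using smooth_class_derivative[OF \<eta>] DERIV_isCont by blast
  then have "\<exists>H. \<forall>x::real. - \<infinity> < ereal x \<longrightarrow> ereal x < \<infinity> \<longrightarrow> (H has_vector_derivative \<eta> x) (at x)"
    by (intro einterval_antiderivative) auto
  then obtain H where H: "\<And>x. (H has_real_derivative \<eta> x) (at x)"
    by (auto simp: has_real_derivative_iff_has_vector_derivative)
  have z: "\<eta> x = 0" if "x \<le> 0 \<or> 1 \<le> x" for x using that by (auto simp: \<eta>_def e_def)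
  have hc: "\<exists>c. \<forall>x\<in>S. H x = c" if "convex S" "\<And>x. x \<in> S \<Longrightarrow> x \<le> 0 \<or> 1 \<le> x" for S
  proof (rule has_field_derivative_zero_constant[OF that(1)])
    show "(H has_real_derivative 0) (at x within S)" if "x \<in> S" for x
      using has_field_derivative_at_within[OF H, of x S] z[OF \<open>\<And>x. x \<in> S \<Longrightarrow> x \<le> 0 \<or> 1 \<le> x\<close>[OF that]] by simp
  qed
  have "\<exists>c. \<forall>x\<in>{..0}. H x = c" by (rule hc) auto
  moreover have "\<exists>c. \<forall>x\<in>{1..}. H x = c" by (rule hc) auto
  ultimately have "\<And>x. x \<le> 0 \<Longrightarrow> H x = H 0" "\<And>x. x \<ge> 1 \<Longrightarrow> H x = H 1" by force+
  moreover have "0 \<le> \<eta> x" for x by (simp add: \<eta>_def e_def)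
  moreover have "0 < x \<and> x < 1" if "\<eta> x \<noteq> 0" for x using that z[of x] by linarith
  moreover have "0 < \<eta> (1 / 2)" by (simp add: \<eta>_def e_def)
  ultimately show thesis using that[of H \<eta>] smooth_class.antiderivative[OF \<eta> H] H by blast
qed

text \<open>If m(a) < c < m(b), take a test function whose derivative is a bump just right of
  \<open>a\<close> minus a bump just right of \<open>b\<close>. Its derivative has integral 0 alone
  and against m, yet against c - m the integral is positive.\<close>

lemma du_Bois_Reymond_aux:
  fixes m :: "real \<Rightarrow> real"
  assumes m: "continuous_on {0..T} m" and ab: "0 < a" "a < b" "b < T"
    and test: "\<And>\<phi>. test_function T \<phi> \<Longrightarrow> (LINT t|leb T. deriv \<phi> t * m t) = 0"
  shows "m b \<le> m a"
proof (rule ccontr)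
  assume "\<not> m b \<le> m a"
  define c where "c = (m a + m b) / 2"
  have c: "m a < c" "c < m b" using \<open>\<not> m b \<le> m a\<close> by (auto simp: c_def)
  have T: "0 < T" using ab by simp
  have "(m \<longlongrightarrow> m a) (at a within {0..T})" "(m \<longlongrightarrow> m b) (at b within {0..T})"
    using m ab by (auto simp: continuous_on_def)
  then have "\<forall>\<^sub>F t in at a within {0..T}. m t < c" "\<forall>\<^sub>F t in at b within {0..T}. c < m t"
    using c by (auto intro: order_tendstoD)
  then obtain d1 d2 where d: "d1 > 0" "\<And>t. t \<in> {0..T} \<Longrightarrow> t \<noteq> a \<Longrightarrow> dist t a < d1 \<Longrightarrow> m t < c"
    "d2 > 0" "\<And>t. t \<in> {0..T} \<Longrightarrow> t \<noteq> b \<Longrightarrow> dist t b < d2 \<Longrightarrow> c < m t"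
    unfolding eventually_at by metis
  define \<delta> where "\<delta> = min (min (d1 / 2) (d2 / 2)) (min ((b - a) / 2) ((T - b) / 2))"
  have \<delta>: "0 < \<delta>" "\<delta> < d1" "\<delta> < d2" "a + \<delta> < b" "b + \<delta> < T"
    using d(1,3) ab by (auto simp: \<delta>_def min_def field_simps)
  obtain H \<eta> where H: "smooth_class H" "\<And>x. (H has_real_derivative \<eta> x) (at x)" "\<And>x::real. 0 \<le> \<eta> x"
    "\<And>x. \<eta> x \<noteq> 0 \<Longrightarrow> 0 < x \<and> x < 1" "0 < \<eta> (1 / 2)" "\<And>x. x \<le> 0 \<Longrightarrow> H x = H 0" "\<And>x. x \<ge> 1 \<Longrightarrow> H x = H 1"
    using smooth_step_exists by blast
  \<comment> \<open>Difference of two scaled steps: a plateau supported in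
    [a, b + \<delta>].\<close>
  define \<phi> where "\<phi> t = H (1 / \<delta> * t + - a / \<delta>) + (-1) * H (1 / \<delta> * t + - b / \<delta>)" for t
  have arg: "1 / \<delta> * t + - x / \<delta> = (t - x) / \<delta>" for t x by (simp add: diff_divide_distrib)
  have sm: "smooth_class \<phi>"
    unfolding \<phi>_def[abs_def]
    by (rule smooth_class.add[OF smooth_class.affine[OF H(1)] smooth_class.mult[OF smooth_class.const smooth_class.affine[OF H(1)]]])
  have "\<phi> t = 0" if "t \<notin> {a..b + \<delta>}" for t
  proof (cases "t < a")
    case True
    then have "(t - a) / \<delta> \<le> 0" "(t - b) / \<delta> \<le> 0" using ab \<delta> by (auto simp: divide_le_0_iff)
    from this[THEN H(6)] show ?thesis unfolding \<phi>_def arg by simp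
  next
    case False
    then have "1 \<le> (t - a) / \<delta>" "1 \<le> (t - b) / \<delta>" using that ab \<delta> by (auto simp: le_divide_eq_1)
    from this[THEN H(7)] show ?thesis unfolding \<phi>_def arg by simp
  qed
  then have tf: "test_function T \<phi>"
    unfolding test_function_def using smooth_class_differentiable[OF sm] ab \<delta> by (intro conjI allI exI[of _ a] exI[of _ "b + \<delta>"]) auto
  have d\<phi>: "deriv \<phi> t = (\<eta> ((t - a) / \<delta>) - \<eta> ((t - b) / \<delta>)) / \<delta>" for t
  proof (rule DERIV_imp_deriv)
    have "((\<lambda>t. H ((t - x) / \<delta>)) has_real_derivative \<eta> ((t - x) / \<delta>) * (1 / \<delta>)) (at t)" for x
      by (rule DERIV_chain2[OF H(2)]) (use \<delta> in \<open>auto intro!: derivative_eq_intros\<close>)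
    from DERIV_diff[OF this[of a] this[of b]]
    show "(\<phi> has_real_derivative (\<eta> ((t - a) / \<delta>) - \<eta> ((t - b) / \<delta>)) / \<delta>) (at t)"
      unfolding \<phi>_def[abs_def] arg by (simp add: diff_divide_distrib)
  qed
  note tfc = test_function_continuous[OF tf]
  have cd: "continuous_on {0..T} (deriv \<phi>)" using tfc(2) continuous_on_subset by blast
  \<comment> \<open>The integrand against c - m, nonnegative everywhere because m is below c on the
    first bump and above c on the second.\<close>
  define \<psi> where "\<psi> t = deriv \<phi> t * c - deriv \<phi> t * m t" for t
  have \<psi>c: "continuous_on {0..T} \<psi>" unfolding \<psi>_def by (intro continuous_intros cd m)
  have p1: "0 \<le> \<eta> ((t - a) / \<delta>) * (c - m t)" if "t \<in> {0..T}" for t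
  proof (cases "\<eta> ((t - a) / \<delta>) = 0")
    case False
    then have "0 < (t - a) / \<delta>" "(t - a) / \<delta> < 1" using H(4) by auto
    then have "m t < c" using \<delta> that by (intro d(2)) (auto simp: dist_real_def field_simps)
    then show ?thesis using H(3) by simp
  qed simp
  have p2: "0 \<le> \<eta> ((t - b) / \<delta>) * (m t - c)" if "t \<in> {0..T}" for t
  proof (cases "\<eta> ((t - b) / \<delta>) = 0")
    case False
    then have "0 < (t - b) / \<delta>" "(t - b) / \<delta> < 1" using H(4) by auto
    then have "c < m t" using \<delta> that by (intro d(4)) (auto simp: dist_real_def field_simps)
    then show ?thesis using H(3) by simp
  qed simp
  have \<psi>: "\<psi> t = (\<eta> ((t - a) / \<delta>) * (c - m t) + \<eta> ((t - b) / \<delta>) * (m t - c)) / \<delta>" for t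
    using \<delta> by (simp add: \<psi>_def d\<phi> field_simps)
  have "integral {0..T} (deriv \<phi>) = \<phi> T - \<phi> 0"
    by (rule integral_unique, rule fundamental_theorem_of_calculus)
      (use T tfc(3) in \<open>auto simp: has_real_derivative_iff_has_vector_derivative[symmetric] intro: has_field_derivative_at_within\<close>)
  then have "(LINT t|leb T. deriv \<phi> t * c) = 0"
    using tfc leb_integral[OF cd T] by simp
  then have "(LINT t|leb T. \<psi> t) = 0"
    unfolding \<psi>_def using test[OF tf]
    by (subst Bochner_Integration.integral_diff) (auto intro!: leb_integrable continuous_intros cd m)
  then have "integral {0..T} \<psi> = 0" using leb_integral[OF \<psi>c T] by simp
  then have "\<forall>t\<in>{0..T}. \<psi> t = 0"
    using integral_eq_0_iff[OF \<psi>c T] p1 p2 \<delta> by (simp add: \<psi>)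
  then have "\<psi> (a + \<delta> / 2) = 0" using ab \<delta> by auto
  moreover have "0 < \<psi> (a + \<delta> / 2)"
  proof -
    have t: "a + \<delta> / 2 \<in> {0..T}" using ab \<delta> by auto
    have "m (a + \<delta> / 2) < c" using t \<delta> by (intro d(2)) (auto simp: dist_real_def)
    then have "0 < \<eta> (1 / 2) * (c - m (a + \<delta> / 2))" using H(5) by simp
    moreover have "(a + \<delta> / 2 - a) / \<delta> = 1 / 2" using \<delta> by simp
    ultimately show ?thesis unfolding \<psi> using p2[OF t] \<delta> by (simp add: add_pos_nonneg)
  qed
  ultimately show False by simp
qed

lemma du_Bois_Reymond:
  fixes m :: "real \<Rightarrow> real"
  assumes m: "continuous_on {0..T} m" and ab: "a \<in> {0<..<T}" "b \<in> {0<..<T}"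
    and test: "\<And>\<phi>. test_function T \<phi> \<Longrightarrow> (LINT t|leb T. deriv \<phi> t * m t) = 0"
  shows "m a = m b"
proof -
  have *: "m a = m b" if "0 < a" "a < b" "b < T" for a b
  proof (rule antisym)
    have "(\<lambda>t. - m t) b \<le> (\<lambda>t. - m t) a"
      by (rule du_Bois_Reymond_aux[OF _ that]) (use m test in \<open>auto intro: continuous_intros\<close>)
    then show "m a \<le> m b" by simp
    show "m b \<le> m a" by (rule du_Bois_Reymond_aux[OF m that test])
  qed
  then show ?thesis using *[of a b] *[of b a] ab by (cases a b rule: linorder_cases) auto
qed

section \<open>Uniqueness of solutions\<close>

text \<open>Completeness of Lebesgue measure. It applies to the pairing of a weak derivative with a
  test vector, which is identified only almost everywhere.\<close>

lemma leb_measurable_cong_AE: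
  fixes f g :: "real \<Rightarrow> real"
  assumes f: "f \<in> borel_measurable (leb T)" and e: "AE t in leb T. f t = g t"
  shows "g \<in> borel_measurable (leb T)"
proof (rule measurableI)
  obtain N where N: "{t \<in> space (leb T). f t \<noteq> g t} \<subseteq> N" "N \<in> null_sets (leb T)"
    using e by (auto simp: eventually_ae_filter)
  have N0: "N \<in> null_sets lebesgue" using N(2) by (simp add: null_sets_restrict_space)
  fix S :: "real set" assume S: "S \<in> sets borel"
  have f1: "f -` S \<inter> space (leb T) \<in> sets lebesgue"
    using measurable_sets[OF f S] by (simp add: sets_restrict_space_iff)
  have X: "X \<in> sets lebesgue" if "X \<subseteq> N" for X using null_sets_completion_subset[OF that N0] by auto
  have "g -` S \<inter> space (leb T) = (f -` S \<inter> space (leb T) - (f -` S \<inter> N)) \<union> (g -` S \<inter> space (leb T) \<inter> N)"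
    using N(1) by auto
  also have "\<dots> \<in> sets lebesgue" using f1 X[of "f -` S \<inter> N"] X[of "g -` S \<inter> space (leb T) \<inter> N"] by auto
  finally show "g -` S \<inter> space (leb T) \<in> sets (leb T)" by (simp add: sets_restrict_space_iff)
qed simp

context nonneg_self_adjoint
begin

text \<open>At the maximum point of exp(-c t) |z - y|^2 the linear estimate bounds the maximum by a
  quarter of itself.\<close>

lemma evol_nonlinear_unique:
  assumes e: "evol T z g" "evol T y h" and init: "z 0 = y 0" and T: "0 \<le> T"
    and lip: "\<And>t. t \<in> {0<..<T} \<Longrightarrow> norm (g t - h t) \<le> L * norm (z t - y t)" and t: "t \<in> {0..T}"
  shows "z t = y t"
proof -
  define c where "c = 4 * L\<^sup>2 + 2"
  have "0 < 1 + 4 * L\<^sup>2" by (simp add: add_pos_nonneg)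
  then have c: "c > 1" "L\<^sup>2 / (c - 1) \<le> 1 / 4" by (auto simp: c_def field_simps)
  have zy: "continuous_on {0..T} z" "continuous_on {0..T} y" using e by (auto simp: evol_def)
  have "\<exists>s\<in>{0..T}. \<forall>t\<in>{0..T}. exp (- (c * t)) * (norm (z t - y t))\<^sup>2 \<le> exp (- (c * s)) * (norm (z s - y s))\<^sup>2"
    by (rule continuous_attains_sup) (use T in \<open>auto intro!: continuous_intros zy\<close>)
  then obtain s where s: "s \<in> {0..T}"
    "\<And>t. t \<in> {0..T} \<Longrightarrow> exp (- (c * t)) * (norm (z t - y t))\<^sup>2 \<le> exp (- (c * s)) * (norm (z s - y s))\<^sup>2" by blast
  define M where "M = exp (- (c * s)) * (norm (z s - y s))\<^sup>2"
  have M: "(norm (z t - y t))\<^sup>2 \<le> M * exp (c * t)" if "t \<in> {0..T}" for t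
  proof -
    have "exp (c * t) * (exp (- (c * t)) * (norm (z t - y t))\<^sup>2) \<le> exp (c * t) * M"
      unfolding M_def by (intro mult_left_mono s(2) that) simp
    then show ?thesis by (simp add: mult.assoc[symmetric] exp_minus mult.commute)
  qed
  have "(norm (z s - y s))\<^sup>2 \<le> exp s * (norm (z 0 - y 0))\<^sup>2 + (L\<^sup>2 * M) / (c - 1) * exp (c * s)"
  proof (rule evol_est[OF evol_diff[OF e] _ c(1) _ s(1)])
    fix t assume t: "t \<in> {0<..<T}"
    have "(norm (g t - h t))\<^sup>2 \<le> (L * norm (z t - y t))\<^sup>2" by (intro power_mono lip t) simp
    also have "\<dots> \<le> L\<^sup>2 * (M * exp (c * t))"
      unfolding power_mult_distrib using t by (intro mult_left_mono M) auto
    finally show "(norm (g t - h t))\<^sup>2 \<le> L\<^sup>2 * M * exp (c * t)" by (simp add: mult.assoc)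
  qed (simp add: M_def)
  also have "\<dots> = (L\<^sup>2 / (c - 1)) * (M * exp (c * s))" using init by simp
  also have "\<dots> \<le> 1 / 4 * (M * exp (c * s))" using c by (intro mult_right_mono) (auto simp: M_def)
  also have "M * exp (c * s) = (norm (z s - y s))\<^sup>2"
    by (simp add: M_def exp_minus)
  finally have "(norm (z s - y s))\<^sup>2 \<le> 0" by simp
  then have "M = 0" by (simp add: M_def)
  then show ?thesis using M[OF t] by simp
qed

text \<open>The bridge from weak to classical: the right-hand side of the truncated equation is
  continuous in t, so its antiderivative differs from the truncated solution by a function with weak
  derivative zero, that is, by a constant.\<close>

lemma solution_evol:
  assumes sol: "solution D A R f u0 Tm v" and T: "0 < T" "ereal T < Tm"
    and lip: "\<forall>u\<in>sqrt_ball D A R. \<forall>v\<in>sqrt_ball D A R. norm (f u - f v) \<le> L * sqrt_norm D A (u - v)"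
  obtains z where "\<And>t. t \<in> {0..T} \<Longrightarrow> v t = K (z t)" "evol T z (\<lambda>t. f (v t))"
proof -
  have ball: "v t \<in> sqrt_ball D A R" if "t \<in> {0..T}" for t
  proof -
    have "ereal t < Tm" using that T(2) by (meson atLeastAtMost_iff ereal_less_eq(3) le_less_trans)
    then show ?thesis using sol that by (auto simp: solution_def)
  qed
  have sc: "sqrt_continuous D A T v" and dom: "L2_domain D A T v"
    and "\<exists>u'. W12_interval T v u' \<and> (AE t in leb T. u' t + A (v t) = f (v t))"
    using sol T by (auto simp: solution_def)
  then obtain u' where wd: "weak_derivative T v u'" and eq: "AE t in leb T. u' t + A (v t) = f (v t)"
    by (auto simp: W12_interval_def)
  have AED: "AE t in leb T. v t \<in> D" using dom by (simp add: L2_domain_def)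
  define z where "z t = (SOME y. K y = v t)" for t
  have z: "K (z t) = v t" if "t \<in> {0..T}" for t
  proof -
    have "\<exists>y. K y = v t" using sc that sqrt_domain_eq unfolding sqrt_continuous_def by (metis imageE)
    then show ?thesis unfolding z_def by (rule someI_ex)
  qed
  have nz: "sqrt_norm D A (v t - v s) = norm (z t - z s)" if "t \<in> {0..T}" "s \<in> {0..T}" for t s
    using z[OF that(1)] z[OF that(2)] by (metis ops_diff(4) sqrt_norm_K)
  have lim: "((\<lambda>t. norm (z t - z s)) \<longlongrightarrow> 0) (at s within {0..T})" if s: "s \<in> {0..T}" for s
  proof (rule Lim_transform_within[where d = 1])
    show "((\<lambda>t. sqrt_norm D A (v t - v s)) \<longlongrightarrow> 0) (at s within {0..T})" using sc s by (simp add: sqrt_continuous_def)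
  qed (use nz s in auto)
  have cz: "continuous_on {0..T} z"
    unfolding continuous_on_def
    by (rule ballI, rule LIM_zero_cancel, rule tendsto_norm_zero_cancel, rule lim)
  have cf: "continuous_on {0..T} (\<lambda>t. f (v t))"
    unfolding continuous_on_def
  proof
    fix s assume s: "s \<in> {0..T}"
    have "((\<lambda>t. f (v t) - f (v s)) \<longlongrightarrow> 0) (at s within {0..T})"
    proof (rule Lim_null_comparison)
      show "\<forall>\<^sub>F t in at s within {0..T}. norm (f (v t) - f (v s)) \<le> L * norm (z t - z s)"
      proof -
        have "norm (f (v t) - f (v s)) \<le> L * norm (z t - z s)" if "t \<in> {0..T}" for t
          using lip[rule_format, OF ball[OF that] ball[OF s]] nz[OF that s] by simp
        then show ?thesis by (auto simp: eventually_at_filter)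
      qed
      show "((\<lambda>t. L * norm (z t - z s)) \<longlongrightarrow> 0) (at s within {0..T})"
        using tendsto_mult_left[OF lim[OF s], of L] by simp
    qed
    then show "((\<lambda>t. f (v t)) \<longlongrightarrow> f (v s)) (at s within {0..T})" by (rule LIM_zero_cancel)
  qed
  have "((\<lambda>s. P n (z s)) has_vector_derivative Bn n (f (v t)) - An n (z t)) (at t)" if t: "t \<in> {0<..<T}" for n t
  proof -
    define \<kappa> where "\<kappa> t = Bn n (f (v t)) - An n (z t)" for t
    have c\<kappa>: "continuous_on {0..T} \<kappa>"
      unfolding \<kappa>_def by (intro continuous_intros continuous_on_An cz bounded_linear.continuous_on[OF linear_ops(3)] cf)
    \<comment> \<open>Clamping time to [0,T] extends the continuous right-hand side to the whole
      line, where an antiderivative exists.\<close>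
    have "continuous_on UNIV (\<lambda>t. \<kappa> (max 0 (min T t)))"
      by (rule continuous_on_compose2[OF c\<kappa>]) (use T in \<open>auto intro!: continuous_intros\<close>)
    then obtain G where G: "\<And>t. t > -1 \<Longrightarrow> (G has_vector_derivative \<kappa> (max 0 (min T t))) (at t)"
      using antiderivative_exists by metis
    have dG: "(G has_vector_derivative \<kappa> t) (at t)" if "t \<in> {0<..<T}" for t using G[of t] that by simp
    have cG: "continuous_on {0..T} G"
      by (rule continuous_on_vector_derivative[of _ _ "\<lambda>t. \<kappa> (max 0 (min T t))"])
        (rule has_vector_derivative_at_within, rule G, simp)
    have test: "(LINT s|leb T. deriv \<phi> s * inner (P n (z s) - G s) x) = 0" if \<phi>: "test_function T \<phi>" for \<phi> x
    proof -
      have c: "continuous_on {0..T} \<phi>" "continuous_on {0..T} (deriv \<phi>)"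
        using test_function_continuous(1,2)[OF \<phi>] continuous_on_subset by blast+
      have c1: "continuous_on {0..T} (\<lambda>s. inner (P n (z s)) x)" "continuous_on {0..T} (\<lambda>s. inner (G s) x)"
        "continuous_on {0..T} (\<lambda>s. inner (\<kappa> s) x)"
        by (intro continuous_intros continuous_on_P cz cG c\<kappa>)+
      \<comment> \<open>\<open>Bn n\<close> is moved to the test vector, since the weak equation is
        one for v = K z and not for z.\<close>
      have Pz: "inner (P n (z s)) x = inner (v s) (Bn n x)" if "s \<in> {0..T}" for s
        unfolding z[OF that, symmetric] by (simp add: ops_inner(3)[symmetric] ops_mult)
      have "(LINT s|leb T. deriv \<phi> s * inner (P n (z s)) x) = (LINT s|leb T. deriv \<phi> s * inner (v s) (Bn n x))"
        by (rule Bochner_Integration.integral_cong) (auto simp: Pz)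
      also have "\<dots> = - (LINT s|leb T. \<phi> s * inner (u' s) (Bn n x))"
        using wd \<phi> by (simp add: weak_derivative_def)
      also have "(LINT s|leb T. \<phi> s * inner (u' s) (Bn n x)) = (LINT s|leb T. \<phi> s * inner (\<kappa> s) x)"
      proof -
        have AE: "AE s in leb T. \<phi> s * inner (\<kappa> s) x = \<phi> s * inner (u' s) (Bn n x)"
          using eq AED AE_leb_interior
        proof eventually_elim
          case (elim s)
          have s: "s \<in> {0..T}" using elim by simp
          have "inner (A (v s)) (Bn n x) = inner (P n (A (v s))) (Bn n x)"
            using ops_inner(1)[of n "A (v s)" "Bn n x"] by (simp add: ops_mult)
          also have "\<dots> = inner (Bn n (An n (K (z s)))) x"
            using P_A[OF elim(2)] z[OF s] by (simp add: ops_inner(3))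
          also have "Bn n (An n (K (z s))) = An n (z s)"
          proof -
            have "Bn n (An n (K (z s))) = Bn n (K (An n (z s)))" by (simp only: ops_mult(9))
            also have "\<dots> = P n (An n (z s))" by (rule ops_mult(7))
            also have "\<dots> = An n (z s)" by (simp add: ops_mult(3))
            finally show ?thesis .
          qed
          finally have a: "inner (A (v s)) (Bn n x) = inner (An n (z s)) x" .
          have "u' s = f (v s) - A (v s)" using elim(1) by (simp add: eq_diff_eq)
          then show ?case using a by (simp add: \<kappa>_def inner_diff_left ops_inner(3)[symmetric] ops_diff)
        qed
        have m1: "(\<lambda>s. \<phi> s * inner (\<kappa> s) x) \<in> borel_measurable (leb T)"
          by (intro leb_measurable continuous_intros c c1)
        show ?thesis
          by (rule integral_cong_AE[OF leb_measurable_cong_AE[OF m1 AE] m1])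
            (use AE in \<open>auto elim: eventually_mono\<close>)
      qed
      also have "- (LINT s|leb T. \<phi> s * inner (\<kappa> s) x) = (LINT s|leb T. deriv \<phi> s * inner (G s) x)"
      proof (rule integration_by_parts[OF T(1) \<phi> c1(2,3), symmetric])
        show "((\<lambda>s. inner (G s) x) has_real_derivative inner (\<kappa> t) x) (at t)" if "t \<in> {0<..<T}" for t
          using bounded_linear.has_vector_derivative[OF bounded_linear_inner_left dG[OF that]]
          by (simp add: has_real_derivative_iff_has_vector_derivative)
      qed
      finally have "(LINT s|leb T. deriv \<phi> s * inner (P n (z s)) x - deriv \<phi> s * inner (G s) x) = 0"
        by (subst Bochner_Integration.integral_diff) (auto intro!: leb_integrable continuous_intros c c1)
      then show ?thesis by (simp add: inner_diff_left right_diff_distrib)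
    qed
    have const: "P n (z s) - G s = P n (z t) - G t" if s: "s \<in> {0<..<T}" for s
    proof -
      have "inner (P n (z s) - G s) x = inner (P n (z t) - G t) x" for x
        by (rule du_Bois_Reymond[OF _ s t test]) (intro continuous_intros continuous_on_P cz cG)
      then show ?thesis by (metis vector_eq_rdot)
    qed
    have "((\<lambda>s. G s + (P n (z t) - G t)) has_vector_derivative \<kappa> t) (at t)"
      using has_vector_derivative_add[OF dG[OF t] has_vector_derivative_const[of "P n (z t) - G t"]] by simp
    then have "((\<lambda>s. P n (z s)) has_vector_derivative \<kappa> t) (at t)"
    proof (rule has_vector_derivative_transform_within_open[of _ _ _ "{0<..<T}"])
      show "G s + (P n (z t) - G t) = P n (z s)" if "s \<in> {0<..<T}" for s
        using const[OF that] by (metis add.commute diff_add_cancel)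
    qed (use t in auto)
    then show ?thesis by (simp add: \<kappa>_def)
  qed
  then have "evol T z (\<lambda>t. f (v t))" using cz by (simp add: evol_def)
  then show thesis using that z by metis
qed

lemma solution_unique:
  assumes sol: "solution D A R f u0 Tm v" "solution D A R f u0 Tm' v'"
    and lip: "\<forall>u\<in>sqrt_ball D A R. \<forall>v\<in>sqrt_ball D A R. norm (f u - f v) \<le> L * sqrt_norm D A (u - v)"
    and t: "0 \<le> t" "ereal t < Tm" "ereal t < Tm'"
  shows "v t = v' t"
proof (cases "t = 0")
  case True
  then show ?thesis using sol by (simp add: solution_def)
next
  case False
  then have t0: "0 < t" using t by simp
  obtain z where z: "\<And>s. s \<in> {0..t} \<Longrightarrow> v s = K (z s)" "evol t z (\<lambda>s. f (v s))"
    using solution_evol[OF sol(1) t0 t(2) lip] by metis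
  obtain y where y: "\<And>s. s \<in> {0..t} \<Longrightarrow> v' s = K (y s)" "evol t y (\<lambda>s. f (v' s))"
    using solution_evol[OF sol(2) t0 t(3) lip] by metis
  have "z t = y t"
  proof (rule evol_nonlinear_unique[OF z(2) y(2)])
    have "v 0 = v' 0" using sol by (simp add: solution_def)
    then show "z 0 = y 0" using z(1)[of 0] y(1)[of 0] t by (simp add: K_inject)
    fix s assume s: "s \<in> {0<..<t}"
    then have "ereal s < Tm" "ereal s < Tm'" using t by (auto intro: less_trans[of "ereal s" "ereal t"])
    then have "v s \<in> sqrt_ball D A R" "v' s \<in> sqrt_ball D A R" using sol s by (auto simp: solution_def)
    then have "norm (f (v s) - f (v' s)) \<le> L * sqrt_norm D A (v s - v' s)" using lip by blast
    also have "sqrt_norm D A (v s - v' s) = norm (z s - y s)"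
      using z(1)[of s] y(1)[of s] s by (simp add: ops_diff(4)[symmetric] sqrt_norm_K)
    finally show "norm (f (v s) - f (v' s)) \<le> L * norm (z s - y s)" .
  qed (use t in auto)
  then show ?thesis using z(1)[of t] y(1)[of t] t by simp
qed

end

theorem theorem2p6:
  fixes D :: "'a::{real_inner, complete_space} set"
    and A f :: "'a \<Rightarrow> 'a"
    and R p q K0 :: real
  assumes "self_adjoint D A" and "nonneg_operator D A"
    and "R > 0"
    and "operator_kernel D A \<noteq> {0}"
    and "\<exists>\<nu>>0. \<forall>u\<in>D. (norm (A u))\<^sup>2 \<ge> \<nu> * (norm (sqrt_operator D A u))\<^sup>2"
    and "\<exists>L. \<forall>u\<in>sqrt_ball D A R. \<forall>v\<in>sqrt_ball D A R.
           norm (f u - f v) \<le> L * sqrt_norm D A (u - v)"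
    and "p > 0" and "q > 0" and "K0 \<ge> 0"
    and "\<forall>u\<in>sqrt_ball D A R.
           norm (f u) \<le> K0 * (norm u powr (1 + p) + norm (sqrt_operator D A u) powr (1 + q))"
    and "\<forall>u\<in>sqrt_ball D A R. inner u (f u) \<le> 0"
  shows "\<exists>S. S \<noteq> {} \<and> S \<subseteq> sqrt_ball D A R \<and> sqrt_open D A S \<and>
           (\<forall>u0\<in>S. \<exists>u. maximal_solution D A R f u0 \<infinity> u
              \<and> (\<forall>T v. maximal_solution D A R f u0 T v \<longrightarrow> T = \<infinity> \<and> (\<forall>t\<ge>0. v t = u t))
              \<and> (\<exists>M1>0. \<forall>t\<ge>0. norm (u t) \<ge> M1 / (1 + t) powr (1 / p)))"
proof -
  interpret nonneg_self_adjoint D A by standard (fact assms)+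
  obtain \<nu> where \<nu>: "\<nu> > 0" "\<forall>u\<in>D. (norm (A u))\<^sup>2 \<ge> \<nu> * (norm (sqrt_operator D A u))\<^sup>2" using assms(5) by blast
  obtain L where lip: "\<forall>u\<in>sqrt_ball D A R. \<forall>v\<in>sqrt_ball D A R. norm (f u - f v) \<le> L * sqrt_norm D A (u - v)"
    using assms(6) by blast
  obtain \<epsilon> \<Gamma> where \<epsilon>: "0 < \<epsilon>" and \<Gamma>: "0 < \<Gamma>" and decay:
    "\<And>z0. 0 < norm (K z0) \<Longrightarrow> (norm (K z0))\<^sup>2 < \<epsilon> \<Longrightarrow>
       (norm z0)\<^sup>2 - (norm (K z0))\<^sup>2 < \<Gamma> * ((norm (K z0))\<^sup>2) powr (1 + p) \<Longrightarrow>
       \<exists>z. continuous_on {0..} z \<and> z 0 = z0 \<and> (\<forall>\<tau>. evol \<tau> z (\<lambda>t. f (K (z t)))) \<and>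
         (\<forall>t\<ge>0. norm (z t) < R) \<and> (\<exists>M>0. \<forall>t\<ge>0. M / (1 + t) powr (1 / p) \<le> norm (K (z t)))"
    using global_decay[OF assms(3) \<nu> lip assms(7-11)] by blast
  \<comment> \<open>The conditions of \<open>global_decay\<close> in the variable z. They are strict
    inequalities between continuous functions of z in H, and the isometry \<open>K\<close> turns
    openness in H into openness for the norm of the domain.\<close>
  define U where "U = {z. 0 < norm (K z) \<and> (norm (K z))\<^sup>2 < \<epsilon> \<and>
    (norm z)\<^sup>2 - (norm (K z))\<^sup>2 < \<Gamma> * ((norm (K z))\<^sup>2) powr (1 + p) \<and> norm z < R}"
  have cK: "continuous_on UNIV K" by (rule linear_continuous_on[OF linear_ops(4)])
  have "open U"
    unfolding U_def using assms(7)
    by (intro open_Collect_conj open_Collect_less continuous_intros continuous_on_powr' cK) auto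
  have ne: "U \<noteq> {}"
  proof -
    have "0 \<in> operator_kernel D A"
      using subspace_0[OF subspace_D] A_scale[of 0 0] by (simp add: operator_kernel_def)
    then obtain w where w: "w \<in> D" "A w = 0" "w \<noteq> 0" using assms(4) by (auto simp: operator_kernel_def)
    obtain \<zeta> where \<zeta>: "w = K \<zeta>" using D_subset w(1) by (auto simp: sqrt_domain_eq)
    \<comment> \<open>Coercivity with A w = 0 gives A^(1/2) w = 0, that is |\<zeta>| = |K \<zeta>|.
      The left side of the \<Gamma>-condition is then 0, for every multiple of \<zeta>.\<close>
    have "\<nu> * (norm (sqrt_operator D A w))\<^sup>2 \<le> 0" using \<nu>(2) w by force
    then have "(norm (sqrt_operator D A w))\<^sup>2 = 0" using \<nu>(1) by (simp add: mult_le_0_iff)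
    then have eq: "(norm \<zeta>)\<^sup>2 = (norm (K \<zeta>))\<^sup>2" using sqrt_operator_K[of \<zeta>] by (simp add: \<zeta>)
    then have n: "norm \<zeta> = norm (K \<zeta>)" by (simp add: power2_eq_iff_nonneg)
    have w0: "0 < norm (K \<zeta>)" using w \<zeta> by simp
    \<comment> \<open>The length to which the kernel vector is rescaled, half of what either
      smallness condition allows.\<close>
    define r where "r = min (sqrt \<epsilon>) R / 2"
    have r: "0 < r" "r < sqrt \<epsilon>" "r < R" using \<epsilon> assms(3) by (auto simp: r_def min_def)
    have "r\<^sup>2 < \<epsilon>" using r by (metis real_sqrt_less_iff real_sqrt_abs abs_of_pos)
    then have "(r / norm (K \<zeta>)) *\<^sub>R \<zeta> \<in> U"
      using r w0 \<Gamma> n by (simp add: U_def ops_scale)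
    then show ?thesis by blast
  qed
  show ?thesis
  proof (intro exI[of _ "K ` U"] conjI ballI)
    show "K ` U \<noteq> {}" using ne by simp
    show "K ` U \<subseteq> sqrt_ball D A R" by (auto simp: sqrt_ball_iff U_def)
    show "sqrt_open D A (K ` U)"
      unfolding sqrt_open_def
    proof (intro conjI ballI)
      show "K ` U \<subseteq> sqrt_domain D A" by (auto simp: sqrt_domain_eq)
      fix u assume "u \<in> K ` U"
      then obtain z where z: "u = K z" "z \<in> U" by blast
      then obtain e where e: "e > 0" "\<And>y. dist y z < e \<Longrightarrow> y \<in> U" using \<open>open U\<close> unfolding open_dist by blast
      have "v \<in> K ` U" if v: "v \<in> sqrt_domain D A" "sqrt_norm D A (v - u) < e" for v
      proof -
        obtain y where y: "v = K y" using v(1) by (auto simp: sqrt_domain_eq)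
        then have "dist y z < e" using v(2) by (simp add: z(1) dist_norm ops_diff(4)[symmetric] sqrt_norm_K)
        then show ?thesis using e(2) y by blast
      qed
      then show "\<exists>\<epsilon>>0. \<forall>v\<in>sqrt_domain D A. sqrt_norm D A (v - u) < \<epsilon> \<longrightarrow> v \<in> K ` U" using e(1) by blast
    qed
    fix u0 assume "u0 \<in> K ` U"
    then obtain z0 where z0: "u0 = K z0" "z0 \<in> U" by blast
    then obtain z where z: "continuous_on {0..} z" "z 0 = z0" "\<And>\<tau>. evol \<tau> z (\<lambda>t. f (K (z t)))"
      "\<And>t. t \<ge> 0 \<Longrightarrow> norm (z t) < R" "\<exists>M>0. \<forall>t\<ge>0. M / (1 + t) powr (1 / p) \<le> norm (K (z t))"
      using decay[of z0] by (auto simp: U_def)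
    have fc: "continuous_on {0..} (\<lambda>t. f (K (z t)))"
      unfolding continuous_on_def
    proof
      fix s :: real assume s: "s \<in> {0..}"
      have "((\<lambda>t. f (K (z t)) - f (K (z s))) \<longlongrightarrow> 0) (at s within {0..})"
      proof (rule Lim_null_comparison)
        have "norm (f (K (z t)) - f (K (z s))) \<le> L * norm (z t - z s)" if "t \<in> {0..}" for t
          using lip z(4)[of t] z(4)[of s] that s
          by (metis atLeast_iff ops_diff(4) sqrt_ball_iff sqrt_norm_K)
        then show "\<forall>\<^sub>F t in at s within {0..}. norm (f (K (z t)) - f (K (z s))) \<le> L * norm (z t - z s)"
          by (auto simp: eventually_at_filter)
        have "(z \<longlongrightarrow> z s) (at s within {0..})" using z(1) s by (simp add: continuous_on_def)
        then have "((\<lambda>t. L * norm (z t - z s)) \<longlongrightarrow> L * norm (z s - z s)) (at s within {0..})" by (intro tendsto_intros)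
        then show "((\<lambda>t. L * norm (z t - z s)) \<longlongrightarrow> 0) (at s within {0..})" by simp
      qed
      then show "((\<lambda>t. f (K (z t))) \<longlongrightarrow> f (K (z s))) (at s within {0..})" by (rule LIM_zero_cancel)
    qed
    have sol: "solution D A R f u0 \<infinity> (\<lambda>t. K (z t))"
      unfolding z0(1) by (rule evolution_solution[where f = f, OF z(1-4) fc])
    show "\<exists>u. maximal_solution D A R f u0 \<infinity> u
              \<and> (\<forall>T v. maximal_solution D A R f u0 T v \<longrightarrow> T = \<infinity> \<and> (\<forall>t\<ge>0. v t = u t))
              \<and> (\<exists>M1>0. \<forall>t\<ge>0. norm (u t) \<ge> M1 / (1 + t) powr (1 / p))"
    proof (intro exI[of _ "\<lambda>t. K (z t)"] conjI allI impI)
      show "maximal_solution D A R f u0 \<infinity> (\<lambda>t. K (z t))"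
        using sol by (auto simp: maximal_solution_def)
      fix T v assume max: "maximal_solution D A R f u0 T v"
      then have v: "solution D A R f u0 T v" by (simp add: maximal_solution_def)
      have eq: "v t = K (z t)" if "0 \<le> t" "ereal t < T" for t
        by (rule solution_unique[OF v sol lip that]) simp
      \<comment> \<open>By uniqueness the global solution extends v, so maximality of v leaves no
        other lifetime.\<close>
      show "T = \<infinity>"
        using max sol eq unfolding maximal_solution_def by (metis ereal_less_eq(1))
      then show "v t = K (z t)" if "0 \<le> t" for t using eq that by simp
    qed (rule z(5))
  qed
qed

end
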